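(* Let $[\sigma_1^{-}]$, $[\sigma_2^{-}]$ be the filtered Rouquier complexes of the negative elementary three-strand braids. Then there exists a homotopy equivalence $$f_{\mathrm{lr}}:\ [\sigma_1^{-}]\circ[\sigma_2^{-}]\circ[\sigma_1^{-}]\ \rightleftarrows\ [\sigma_2^{-}]\circ[\sigma_1^{-}]\circ[\sigma_2^{-}]\ : f_{\mathrm{rl}}$$ (of complexes with the filtration forgotten, $f_{\mathrm{lr}}$ and $f_{\mathrm{rl}}$ being mutually inverse up to homotopy) such that each of the morphisms $f_{\mathrm{lr}}$ and $f_{\mathrm{rl}}$ violates filtration by at most two units.
   Context: Categories. For $n\ge1$ let $\mathbf x=(x_1,\dots,x_n)$, $\mathbf y=(y_1,\dots,y_n)$; $\mathbb Q[\mathbf x,\mathbf y]$ is graded by $q$-degree with $\deg x_i=\deg y_i=2$. $\mathbf D_n$ is the derived category of $q$-graded $\mathbb Q[\mathbf x,\mathbf y]$-modules with a decreasing filtration $F^\bullet$: objects are represented by filtered $q$-graded complexes, filtered quasi-isomorphisms (those inducing quasi-isomorphisms on all associated graded pieces) are inverted, and morphisms preserve $q$-degree and filtration. Its homological degree is called $a$-degree; differentials lower it by $1$. Shift functors: $\mathbf q$ ($q$-degree), $\mathbf a$ ($a$-degree), $\mathbf s$ (filtration, $F^i(\mathbf sA)=F^{i-1}A$). $\mathrm{Ch}(\mathbf D_n)$ is the category of bounded chain complexes over the additive category $\mathbf D_n$ ("outer" complexes, in square brackets); the outer degree is the $t$-degree with shift $\mathbf t$, outer differentials lower $t$-degree by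 $1$, and $a$-degree records total homological degree, so passing to one higher outer position is the shift $\mathbf t_a=\mathbf t\mathbf a$. Half-integer $t$- and $s$-shifts are allowed. Put $\mathbf a_q=\mathbf a\mathbf q^2$, $\mathbf t_s=(\mathbf t\mathbf s)^{1/2}$. Violation of filtration: a morphism $f:A\to B$ between the underlying unfiltered objects of filtered objects $A,B$ violates filtration by (at most) $k$ units if $f$, regarded as a morphism $A\to\mathbf s^kB$, is filtered (i.e. comes from a morphism of the filtered category); a morphism of complexes violates filtration by at most $k$ units if its components do. Composition: $M\circ N=M(\mathbf z,\mathbf y)\otimes_{\mathbb Q[\mathbf y]}N(\mathbf y,\mathbf x)$ with the tensor product filtration (total outer complex in the case of complexes), regarded as a $\mathbb Q[\mathbf x,\mathbf z]$-module. Disjoint union of strands corresponds to $\otimes_{\mathbb Q}$. Two-strand bimodules ($n=2$). Put $x_\pm=x_2\pm x_1$, $y_\pm=y_2\pm y_1$. Let $I=\mathbb Q[\mathbf x,\mathbf y]/(y_1-x_1,y_2-x_2)$ with trivial filtration ($F^0$ everything, $F^1=0$). Let $M=\mathbb Q[\mathbf x,\mathbf y]/(y_+-x_+,(y_-+x_-)(y_--x_-))$. The black blob bimodule $B$ is $M$ with $F^0=M$, $F^1=(y_--x_-)M$, $F^2=0$, so $F^0/F^1\cong I$; let $\chi_-:B\to I$ be the projection onto $F^0/F^1$. The filtered Rouquier complex of the negative elementary two-strand braid is $$[\sigma^{-}]=(\mathbf t_s\mathbf a_q)^{-1}\bigl[\,\mathbf t_aB\xrightarrow{\chi_-}I\,\bigr].$$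 For three strands, let $J=\mathbb Q[x,y]/(y-x)$ be the bimodule of one vertical strand; $[\sigma_1^-]=[\sigma^-]\otimes_{\mathbb Q}J$ (crossing on strands $1,2$; $J$ in the variables $x_3,y_3$) and $[\sigma_2^-]=J\otimes_{\mathbb Q}[\sigma^-]$ (crossing on strands $2,3$; $J$ in the variables $x_1,y_1$). *)

theory Defs
  imports
    "HOL-Algebra.Free_Abelian_Groups"
    "HOL-Algebra.Generated_Groups"
    "HOL-Algebra.QuotRing"
    "HOL-Algebra.Module"
begin

text \<open>
  Conventions. The \<open>t\<close>-degree and the filtration index take values in the half-integers and are
  stored doubled, as integers: position \<open>p\<close> of an outer complex is \<open>t\<close>-degree \<open>p/2\<close>, and
  \<open>filt A j\<close> is \<open>F^(j/2) A\<close>. Thus outer differentials lower the position by \<open>2\<close>, and a filtration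
  indexed by the integers is extended to half-integers by \<open>F^(i - 1/2) = F^i\<close>.
  The \<open>a\<close>- and \<open>q\<close>-degrees are integers, not doubled.
\<close>


section \<open>Polynomial rings\<close>

datatype var = vX nat | vY nat

type_synonym mpol = "(var \<Rightarrow>\<^sub>0 nat) \<Rightarrow>\<^sub>0 rat"

definition Var :: "var \<Rightarrow> mpol" where
  "Var v = Poly_Mapping.single (Poly_Mapping.single v 1) 1"

definition Cst :: "rat \<Rightarrow> mpol" where
  "Cst c = Poly_Mapping.single 0 c"

definition pol :: "var set \<Rightarrow> mpol ring" where
  "pol V = \<lparr>carrier = {p. \<forall>e\<in>Poly_Mapping.keys p. Poly_Mapping.keys e \<subseteq> V},
            mult = (*), one = 1, zero = 0, add = (+)\<rparr>"

definition xyring :: "nat \<Rightarrow> mpol ring" where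
  "xyring n = pol (vX ` {1..n} \<union> vY ` {1..n})"

text \<open>Homogeneous polynomials of \<open>q\<close>-degree \<open>d\<close>; every variable has \<open>q\<close>-degree \<open>2\<close>.\<close>

definition qhom :: "int \<Rightarrow> mpol set" where
  "qhom d = {p. \<forall>e\<in>Poly_Mapping.keys p.
     2 * int (\<Sum>v\<in>Poly_Mapping.keys e. Poly_Mapping.lookup e v) = d}"

definition monom_subst :: "(var \<Rightarrow> mpol) \<Rightarrow> (var \<Rightarrow>\<^sub>0 nat) \<Rightarrow> mpol" where
  "monom_subst \<sigma> e = (\<Prod>v\<in>Poly_Mapping.keys e. \<sigma> v ^ Poly_Mapping.lookup e v)"

definition pol_subst :: "(var \<Rightarrow> mpol) \<Rightarrow> mpol \<Rightarrow> mpol" where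
  "pol_subst \<sigma> p = (\<Sum>e\<in>Poly_Mapping.keys p. Cst (Poly_Mapping.lookup p e) * monom_subst \<sigma> e)"


section \<open>Graded and filtered complexes\<close>

text \<open>
  A \<open>q\<close>-graded complex is stored as one module, the direct sum of its homogeneous components
  \<open>cmp A k q\<close> of \<open>a\<close>-degree \<open>k\<close> and \<open>q\<close>-degree \<open>q\<close>, with a differential \<open>bd\<close> of \<open>a\<close>-degree \<open>-1\<close>.
  The fields \<open>mult\<close> and \<open>one\<close> which \<^typ>\<open>('a, 'b) module\<close> inherits from rings are not used.
\<close>

record 'm gcx = "(mpol, 'm) module" +
  cmp :: "int \<Rightarrow> int \<Rightarrow> 'm set"
  bd :: "'m \<Rightarrow> 'm"

record 'm fcx = "'m gcx" +
  filt :: "int \<Rightarrow> 'm set"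

definition hom_dec :: "('m, 'e) gcx_scheme \<Rightarrow> 'm \<Rightarrow> (int \<times> int \<Rightarrow> 'm) \<Rightarrow> bool" where
  "hom_dec A m u \<longleftrightarrow> finite {i. u i \<noteq> \<zero>\<^bsub>A\<^esub>} \<and> (\<forall>k q. u (k, q) \<in> cmp A k q) \<and>
     m = (\<Oplus>\<^bsub>A\<^esub>i\<in>{i. u i \<noteq> \<zero>\<^bsub>A\<^esub>}. u i)"

definition lin_map :: "nat \<Rightarrow> ('m, 'e) gcx_scheme \<Rightarrow> ('k, 'f) gcx_scheme \<Rightarrow> ('m \<Rightarrow> 'k) \<Rightarrow> bool" where
  "lin_map n A B f \<longleftrightarrow> f \<in> hom (add_monoid A) (add_monoid B) \<and>
     (\<forall>r\<in>carrier (xyring n). \<forall>m\<in>carrier A. f (r \<odot>\<^bsub>A\<^esub> m) = r \<odot>\<^bsub>B\<^esub> f m)"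

definition gobj :: "nat \<Rightarrow> ('m, 'e) gcx_scheme \<Rightarrow> bool" where
  "gobj n A \<longleftrightarrow>
     module (xyring n) A \<and>
     (\<forall>k q. submodule (cmp A k q) (pol {}) A) \<and>
     (\<forall>m\<in>carrier A. \<exists>!u. hom_dec A m u) \<and>
     (\<forall>d k q. \<forall>r\<in>carrier (xyring n) \<inter> qhom d. \<forall>m\<in>cmp A k q. r \<odot>\<^bsub>A\<^esub> m \<in> cmp A k (q + d)) \<and>
     lin_map n A A (bd A) \<and>
     (\<forall>k q. \<forall>m\<in>cmp A k q. bd A m \<in> cmp A (k - 1) q) \<and>
     (\<forall>m\<in>carrier A. bd A (bd A m) = \<zero>\<^bsub>A\<^esub>)"

text \<open>
  Filtrations are by graded subcomplexes and are finite; finiteness is what makes filtered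
  quasi-isomorphisms quasi-isomorphisms of the underlying complexes, so that the filtration can be
  forgotten.
\<close>

definition fobj :: "nat \<Rightarrow> 'm fcx \<Rightarrow> bool" where
  "fobj n A \<longleftrightarrow>
     gobj n A \<and>
     (\<forall>j. submodule (filt A j) (xyring n) A) \<and>
     (\<forall>j. \<forall>m\<in>filt A j. bd A m \<in> filt A j) \<and>
     (\<forall>j. \<forall>m\<in>filt A j. \<exists>u. hom_dec A m u \<and> range u \<subseteq> filt A j) \<and>
     (\<forall>i j. i \<le> j \<longrightarrow> filt A j \<subseteq> filt A i) \<and>
     (\<exists>i. filt A i = carrier A) \<and> (\<exists>j. filt A j = {\<zero>\<^bsub>A\<^esub>})"

definition gmor :: "nat \<Rightarrow> ('m, 'e) gcx_scheme \<Rightarrow> ('m, 'e) gcx_scheme \<Rightarrow> ('m \<Rightarrow> 'm) \<Rightarrow> bool" where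
  "gmor n A B f \<longleftrightarrow> gobj n A \<and> gobj n B \<and> lin_map n A B f \<and>
     (\<forall>k q. f ` cmp A k q \<subseteq> cmp B k q) \<and>
     (\<forall>m\<in>carrier A. f (bd A m) = bd B (f m))"

definition fmor :: "nat \<Rightarrow> 'm fcx \<Rightarrow> 'm fcx \<Rightarrow> ('m \<Rightarrow> 'm) \<Rightarrow> bool" where
  "fmor n A B f \<longleftrightarrow> fobj n A \<and> fobj n B \<and> gmor n A B f \<and> (\<forall>j. f ` filt A j \<subseteq> filt B j)"

text \<open>
  For subcomplexes \<open>V \<subseteq> U\<close> of \<open>A\<close>, \<open>homology A U V\<close> is the homology of \<open>U/V\<close>, written as
  (elements of \<open>U\<close> with boundary in \<open>V\<close>) modulo \<open>bd U + V\<close>.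
\<close>

definition bnds :: "('m, 'e) gcx_scheme \<Rightarrow> 'm set \<Rightarrow> 'm set \<Rightarrow> 'm set" where
  "bnds A U V = bd A ` U <+>\<^bsub>A\<^esub> V"

definition homology :: "('m, 'e) gcx_scheme \<Rightarrow> 'm set \<Rightarrow> 'm set \<Rightarrow> 'm set monoid" where
  "homology A U V = (add_monoid A)\<lparr>carrier := {z \<in> U. bd A z \<in> V}\<rparr> Mod bnds A U V"

definition homology_map :: "('m, 'e) gcx_scheme \<Rightarrow> 'm set \<Rightarrow> 'm set \<Rightarrow> ('m \<Rightarrow> 'm) \<Rightarrow> 'm set \<Rightarrow> 'm set" where
  "homology_map B U V f C = bnds B U V <+>\<^bsub>B\<^esub> f ` C"

definition gqis :: "nat \<Rightarrow> ('m, 'e) gcx_scheme \<Rightarrow> ('m, 'e) gcx_scheme \<Rightarrow> ('m \<Rightarrow> 'm) \<Rightarrow> bool" where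
  "gqis n A B f \<longleftrightarrow> gmor n A B f \<and>
     homology_map B (carrier B) {\<zero>\<^bsub>B\<^esub>} f
       \<in> iso (homology A (carrier A) {\<zero>\<^bsub>A\<^esub>}) (homology B (carrier B) {\<zero>\<^bsub>B\<^esub>})"

definition fqis :: "nat \<Rightarrow> 'm fcx \<Rightarrow> 'm fcx \<Rightarrow> ('m \<Rightarrow> 'm) \<Rightarrow> bool" where
  "fqis n A B f \<longleftrightarrow> fmor n A B f \<and>
     (\<forall>j. homology_map B (filt B j) (filt B (j + 1)) f
       \<in> iso (homology A (filt A j) (filt A (j + 1))) (homology B (filt B j) (filt B (j + 1))))"


section \<open>Localization\<close>

record ('o, 'm) catdata =
  ob :: "'o \<Rightarrow> bool"
  mor :: "'o \<Rightarrow> 'o \<Rightarrow> ('m \<Rightarrow> 'm) \<Rightarrow> bool"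
  weq :: "'o \<Rightarrow> 'o \<Rightarrow> ('m \<Rightarrow> 'm) \<Rightarrow> bool"

text \<open>
  The additive category obtained by inverting the maps in \<open>weq\<close>, by generators and relations: a
  morphism is a term with \<open>loc_hom\<close>, and two terms denote the same morphism iff they are related by
  \<open>loc_eq\<close>. \<open>Gen A f B\<close> is the image of \<open>f : A \<rightarrow> B\<close>, and \<open>Inv A w B : B \<rightarrow> A\<close> is the inverse of
  \<open>w : A \<rightarrow> B\<close>. Since the original category has finite direct sums and \<open>weq\<close> is closed under them,
  this is the usual localization.
\<close>

datatype ('o, 'f) lterm =
    Gen 'o 'f 'o
  | Inv 'o 'f 'o
  | Cmp "('o, 'f) lterm" "('o, 'f) lterm"
  | Add "('o, 'f) lterm" "('o, 'f) lterm"
  | Neg "('o, 'f) lterm"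
  | Zero 'o 'o

inductive loc_hom ::
  "('o, 'm) catdata \<Rightarrow> 'o \<Rightarrow> 'o \<Rightarrow> ('o, 'm \<Rightarrow> 'm) lterm \<Rightarrow> bool" for \<C> where
  "mor \<C> A B f \<Longrightarrow> loc_hom \<C> A B (Gen A f B)"
| "weq \<C> A B w \<Longrightarrow> loc_hom \<C> B A (Inv A w B)"
| "loc_hom \<C> A B s \<Longrightarrow> loc_hom \<C> B C t \<Longrightarrow> loc_hom \<C> A C (Cmp t s)"
| "loc_hom \<C> A B s \<Longrightarrow> loc_hom \<C> A B t \<Longrightarrow> loc_hom \<C> A B (Add s t)"
| "loc_hom \<C> A B s \<Longrightarrow> loc_hom \<C> A B (Neg s)"
| "ob \<C> A \<Longrightarrow> ob \<C> B \<Longrightarrow> loc_hom \<C> A B (Zero A B)"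

inductive loc_eq ::
  "(('m, 'e) gcx_scheme, 'm) catdata \<Rightarrow> ('m, 'e) gcx_scheme \<Rightarrow> ('m, 'e) gcx_scheme \<Rightarrow>
   (('m, 'e) gcx_scheme, 'm \<Rightarrow> 'm) lterm \<Rightarrow> (('m, 'e) gcx_scheme, 'm \<Rightarrow> 'm) lterm \<Rightarrow> bool"
  for \<C> where
  le_refl: "loc_hom \<C> A B s \<Longrightarrow> loc_eq \<C> A B s s"
| le_sym: "loc_eq \<C> A B s t \<Longrightarrow> loc_eq \<C> A B t s"
| le_trans: "loc_eq \<C> A B s t \<Longrightarrow> loc_eq \<C> A B t u \<Longrightarrow> loc_eq \<C> A B s u"
| le_Cmp: "loc_eq \<C> A B s s' \<Longrightarrow> loc_eq \<C> B C t t' \<Longrightarrow> loc_eq \<C> A C (Cmp t s) (Cmp t' s')"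
| le_Add: "loc_eq \<C> A B s s' \<Longrightarrow> loc_eq \<C> A B t t' \<Longrightarrow> loc_eq \<C> A B (Add s t) (Add s' t')"
| le_Neg: "loc_eq \<C> A B s s' \<Longrightarrow> loc_eq \<C> A B (Neg s) (Neg s')"
| le_assoc: "loc_hom \<C> A B s \<Longrightarrow> loc_hom \<C> B C t \<Longrightarrow> loc_hom \<C> C D u \<Longrightarrow>
    loc_eq \<C> A D (Cmp u (Cmp t s)) (Cmp (Cmp u t) s)"
| le_idl: "ob \<C> B \<Longrightarrow> loc_hom \<C> A B s \<Longrightarrow> loc_eq \<C> A B (Cmp (Gen B (\<lambda>x. x) B) s) s"
| le_idr: "ob \<C> A \<Longrightarrow> loc_hom \<C> A B s \<Longrightarrow> loc_eq \<C> A B (Cmp s (Gen A (\<lambda>x. x) A)) s"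
| le_add_assoc: "loc_hom \<C> A B s \<Longrightarrow> loc_hom \<C> A B t \<Longrightarrow> loc_hom \<C> A B u \<Longrightarrow>
    loc_eq \<C> A B (Add s (Add t u)) (Add (Add s t) u)"
| le_add_comm: "loc_hom \<C> A B s \<Longrightarrow> loc_hom \<C> A B t \<Longrightarrow> loc_eq \<C> A B (Add s t) (Add t s)"
| le_zero: "ob \<C> A \<Longrightarrow> ob \<C> B \<Longrightarrow> loc_hom \<C> A B s \<Longrightarrow> loc_eq \<C> A B (Add s (Zero A B)) s"
| le_neg: "ob \<C> A \<Longrightarrow> ob \<C> B \<Longrightarrow> loc_hom \<C> A B s \<Longrightarrow> loc_eq \<C> A B (Add s (Neg s)) (Zero A B)"
| le_distl: "loc_hom \<C> A B s \<Longrightarrow> loc_hom \<C> A B t \<Longrightarrow> loc_hom \<C> B C u \<Longrightarrow>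
    loc_eq \<C> A C (Cmp u (Add s t)) (Add (Cmp u s) (Cmp u t))"
| le_distr: "loc_hom \<C> A B s \<Longrightarrow> loc_hom \<C> B C t \<Longrightarrow> loc_hom \<C> B C u \<Longrightarrow>
    loc_eq \<C> A C (Cmp (Add t u) s) (Add (Cmp t s) (Cmp u s))"
| le_gen_ext: "mor \<C> A B f \<Longrightarrow> mor \<C> A B g \<Longrightarrow> (\<forall>x\<in>carrier A. f x = g x) \<Longrightarrow>
    loc_eq \<C> A B (Gen A f B) (Gen A g B)"
| le_gen_comp: "mor \<C> A B f \<Longrightarrow> mor \<C> B C g \<Longrightarrow>
    loc_eq \<C> A C (Cmp (Gen B g C) (Gen A f B)) (Gen A (\<lambda>x. g (f x)) C)"
| le_gen_add: "mor \<C> A B f \<Longrightarrow> mor \<C> A B g \<Longrightarrow>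
    loc_eq \<C> A B (Add (Gen A f B) (Gen A g B)) (Gen A (\<lambda>x. f x \<oplus>\<^bsub>B\<^esub> g x) B)"
| le_invl: "weq \<C> A B w \<Longrightarrow> loc_eq \<C> A A (Cmp (Inv A w B) (Gen A w B)) (Gen A (\<lambda>x. x) A)"
| le_invr: "weq \<C> A B w \<Longrightarrow> loc_eq \<C> B B (Cmp (Gen A w B) (Inv A w B)) (Gen B (\<lambda>x. x) B)"

text \<open>The filtered derived category, and the derived category without filtrations.\<close>

definition D_filt :: "nat \<Rightarrow> ('m fcx, 'm) catdata" where
  "D_filt n = \<lparr>ob = fobj n, mor = fmor n, weq = fqis n\<rparr>"

definition D_unfilt :: "nat \<Rightarrow> ('m gcx, 'm) catdata" where
  "D_unfilt n = \<lparr>ob = gobj n, mor = gmor n, weq = gqis n\<rparr>"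

definition forget_mor :: "('m fcx, 'm \<Rightarrow> 'm) lterm \<Rightarrow> ('m gcx, 'm \<Rightarrow> 'm) lterm" where
  "forget_mor = map_lterm gcx.truncate id"


section \<open>Shifts\<close>

definition ashift :: "int \<Rightarrow> ('m, 'e) gcx_scheme \<Rightarrow> ('m, 'e) gcx_scheme" where
  "ashift k A = A\<lparr>cmp := \<lambda>i q. cmp A (i - k) q,
                  bd := \<lambda>m. if even k then bd A m else \<ominus>\<^bsub>A\<^esub> bd A m\<rparr>"

definition qshift :: "int \<Rightarrow> ('m, 'e) gcx_scheme \<Rightarrow> ('m, 'e) gcx_scheme" where
  "qshift d A = A\<lparr>cmp := \<lambda>k q. cmp A k (q - d)\<rparr>"

text \<open>\<open>shalf j\<close> is the filtration shift \<open>s^(j/2)\<close>.\<close>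

definition shalf :: "int \<Rightarrow> 'm fcx \<Rightarrow> 'm fcx" where
  "shalf j A = A\<lparr>filt := \<lambda>i. filt A (i - j)\<rparr>"

definition ashift_mor :: "(('m, 'e) gcx_scheme, 'm \<Rightarrow> 'm) lterm \<Rightarrow> (('m, 'e) gcx_scheme, 'm \<Rightarrow> 'm) lterm" where
  "ashift_mor = map_lterm (ashift 1) id"


section \<open>Chain complexes over the derived category\<close>

text \<open>
  The \<open>a\<close>-degree of an object at a given position is the total homological degree, so an outer
  differential lowers the \<open>a\<close>-degree by one as well: it is a morphism \<open>C\<^sub>t \<rightarrow> \<^bold>a C\<^sub>t\<^sub>-\<^sub>1\<close>.
\<close>

record ('o, 'm) dcx =
  dobj :: "int \<Rightarrow> 'o"
  ddiff :: "int \<Rightarrow> ('o, 'm \<Rightarrow> 'm) lterm"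

definition id_mor :: "'o \<Rightarrow> ('o, 'm \<Rightarrow> 'm) lterm" where
  "id_mor A = Gen A (\<lambda>x. x) A"

definition is_dcx ::
  "(('m, 'e) gcx_scheme, 'm) catdata \<Rightarrow> (('m, 'e) gcx_scheme, 'm) dcx \<Rightarrow> bool" where
  "is_dcx \<C> C \<longleftrightarrow>
     (\<forall>p. ob \<C> (dobj C p)) \<and>
     (\<forall>p. loc_hom \<C> (dobj C p) (ashift 1 (dobj C (p - 2))) (ddiff C p)) \<and>
     (\<forall>p. loc_eq \<C> (dobj C p) (ashift 1 (ashift 1 (dobj C (p - 4))))
        (Cmp (ashift_mor (ddiff C (p - 2))) (ddiff C p))
        (Zero (dobj C p) (ashift 1 (ashift 1 (dobj C (p - 4)))))) \<and>
     (\<exists>N. \<forall>p. \<bar>p\<bar> > N \<longrightarrow>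
        loc_eq \<C> (dobj C p) (dobj C p) (id_mor (dobj C p)) (Zero (dobj C p) (dobj C p)))"

definition chain_map ::
  "(('m, 'e) gcx_scheme, 'm) catdata \<Rightarrow> (('m, 'e) gcx_scheme, 'm) dcx \<Rightarrow> (('m, 'e) gcx_scheme, 'm) dcx \<Rightarrow>
   (int \<Rightarrow> (('m, 'e) gcx_scheme, 'm \<Rightarrow> 'm) lterm) \<Rightarrow> bool" where
  "chain_map \<C> C D f \<longleftrightarrow>
     (\<forall>p. loc_hom \<C> (dobj C p) (dobj D p) (f p)) \<and>
     (\<forall>p. loc_eq \<C> (dobj C p) (ashift 1 (dobj D (p - 2)))
        (Cmp (ddiff D p) (f p)) (Cmp (ashift_mor (f (p - 2))) (ddiff C p)))"

text \<open>
  A homotopy \<open>C\<^sub>t \<rightarrow> \<^bold>a\<^sup>-\<^sup>1 D\<^sub>t\<^sub>+\<^sub>1\<close> is given by its image under \<open>\<^bold>a\<close>, a morphism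
  \<open>\<^bold>a C\<^sub>t \<rightarrow> D\<^sub>t\<^sub>+\<^sub>1\<close>, and the homotopy relation is likewise stated after applying \<open>\<^bold>a\<close>.
  This avoids comparing \<open>\<^bold>a\<^sup>-\<^sup>1 \<^bold>a D\<close> with \<open>D\<close>.
\<close>

definition homotopic ::
  "(('m, 'e) gcx_scheme, 'm) catdata \<Rightarrow> (('m, 'e) gcx_scheme, 'm) dcx \<Rightarrow> (('m, 'e) gcx_scheme, 'm) dcx \<Rightarrow>
   (int \<Rightarrow> (('m, 'e) gcx_scheme, 'm \<Rightarrow> 'm) lterm) \<Rightarrow>
   (int \<Rightarrow> (('m, 'e) gcx_scheme, 'm \<Rightarrow> 'm) lterm) \<Rightarrow> bool" where
  "homotopic \<C> C D f g \<longleftrightarrow> (\<exists>h.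
     (\<forall>p. loc_hom \<C> (ashift 1 (dobj C p)) (dobj D (p + 2)) (h p)) \<and>
     (\<forall>p. loc_eq \<C> (ashift 1 (dobj C p)) (ashift 1 (dobj D p))
        (Add (ashift_mor (f p)) (Neg (ashift_mor (g p))))
        (Add (Cmp (ddiff D (p + 2)) (h p))
             (Cmp (ashift_mor (h (p - 2))) (ashift_mor (ddiff C p))))))"

definition homotopy_equiv ::
  "(('m, 'e) gcx_scheme, 'm) catdata \<Rightarrow> (('m, 'e) gcx_scheme, 'm) dcx \<Rightarrow> (('m, 'e) gcx_scheme, 'm) dcx \<Rightarrow>
   (int \<Rightarrow> (('m, 'e) gcx_scheme, 'm \<Rightarrow> 'm) lterm) \<Rightarrow>
   (int \<Rightarrow> (('m, 'e) gcx_scheme, 'm \<Rightarrow> 'm) lterm) \<Rightarrow> bool" where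
  "homotopy_equiv \<C> C D f g \<longleftrightarrow>
     is_dcx \<C> C \<and> is_dcx \<C> D \<and> chain_map \<C> C D f \<and> chain_map \<C> D C g \<and>
     homotopic \<C> C C (\<lambda>p. Cmp (g p) (f p)) (\<lambda>p. id_mor (dobj C p)) \<and>
     homotopic \<C> D D (\<lambda>p. Cmp (f p) (g p)) (\<lambda>p. id_mor (dobj D p))"

definition forget_dcx :: "('m fcx, 'm) dcx \<Rightarrow> ('m gcx, 'm) dcx" where
  "forget_dcx C = \<lparr>dobj = \<lambda>p. gcx.truncate (dobj C p), ddiff = \<lambda>p. forget_mor (ddiff C p)\<rparr>"

definition violates_filt_by ::
  "nat \<Rightarrow> int \<Rightarrow> 'm fcx \<Rightarrow> 'm fcx \<Rightarrow> ('m gcx, 'm \<Rightarrow> 'm) lterm \<Rightarrow> bool" where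
  "violates_filt_by n k A B f \<longleftrightarrow> (\<exists>\<phi>. loc_hom (D_filt n) A (shalf (2 * k) B) \<phi> \<and>
     loc_eq (D_unfilt n) (gcx.truncate A) (gcx.truncate B) (forget_mor \<phi>) f)"

definition chain_map_violates_filt_by ::
  "nat \<Rightarrow> int \<Rightarrow> ('m fcx, 'm) dcx \<Rightarrow> ('m fcx, 'm) dcx \<Rightarrow> (int \<Rightarrow> ('m gcx, 'm \<Rightarrow> 'm) lterm) \<Rightarrow> bool" where
  "chain_map_violates_filt_by n k C D f \<longleftrightarrow>
     (\<forall>p. violates_filt_by n k (dobj C p) (dobj D p) (f p))"


section \<open>Tensor products\<close>

text \<open>
  \<open>Mid\<close> is the set of pairs of images, in the two acting rings, of the elements of the ring over
  which the tensor product is taken. The tensor product is the free abelian group on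
  \<open>carrier M \<times> carrier N\<close> modulo the middle-linearity relations.
\<close>

definition tens_rels ::
  "(mpol \<times> mpol) set \<Rightarrow> ('a, 'c) gcx_scheme \<Rightarrow> ('b, 'd) gcx_scheme \<Rightarrow> ('a \<times> 'b \<Rightarrow>\<^sub>0 int) set" where
  "tens_rels Mid M N =
     {frag_of (m \<oplus>\<^bsub>M\<^esub> m', n) - frag_of (m, n) - frag_of (m', n) | m m' n.
        m \<in> carrier M \<and> m' \<in> carrier M \<and> n \<in> carrier N} \<union>
     {frag_of (m, n \<oplus>\<^bsub>N\<^esub> n') - frag_of (m, n) - frag_of (m, n') | m n n'.
        m \<in> carrier M \<and> n \<in> carrier N \<and> n' \<in> carrier N} \<union>
     {frag_of (a \<odot>\<^bsub>M\<^esub> m, n) - frag_of (m, b \<odot>\<^bsub>N\<^esub> n) | a b m n.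
        (a, b) \<in> Mid \<and> m \<in> carrier M \<and> n \<in> carrier N}"

definition tens_free ::
  "('a, 'c) gcx_scheme \<Rightarrow> ('b, 'd) gcx_scheme \<Rightarrow> ('a \<times> 'b \<Rightarrow>\<^sub>0 int) monoid" where
  "tens_free M N = free_Abelian_group (carrier M \<times> carrier N)"

definition tens_ker ::
  "(mpol \<times> mpol) set \<Rightarrow> ('a, 'c) gcx_scheme \<Rightarrow> ('b, 'd) gcx_scheme \<Rightarrow> ('a \<times> 'b \<Rightarrow>\<^sub>0 int) set" where
  "tens_ker Mid M N = generate (tens_free M N) (tens_rels Mid M N)"

definition tens_class ::
  "(mpol \<times> mpol) set \<Rightarrow> ('a, 'c) gcx_scheme \<Rightarrow> ('b, 'd) gcx_scheme \<Rightarrow>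
   ('a \<times> 'b \<Rightarrow>\<^sub>0 int) \<Rightarrow> ('a \<times> 'b \<Rightarrow>\<^sub>0 int) set" where
  "tens_class Mid M N u = tens_ker Mid M N #>\<^bsub>tens_free M N\<^esub> u"

text \<open>The additive subgroup generated by the pure tensors of pairs in \<open>S\<close>.\<close>

definition tens_span ::
  "(mpol \<times> mpol) set \<Rightarrow> ('a, 'c) gcx_scheme \<Rightarrow> ('b, 'd) gcx_scheme \<Rightarrow> ('a \<times> 'b) set \<Rightarrow>
   ('a \<times> 'b \<Rightarrow>\<^sub>0 int) set set" where
  "tens_span Mid M N S = tens_class Mid M N ` carrier (free_Abelian_group S)"

text \<open>
  The additive map to the tensor product of \<open>M\<close> and \<open>N\<close> which on pure tensors of its domain (another
  tensor product) is given by \<open>\<phi>\<close>.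
\<close>

definition tens_ind ::
  "(mpol \<times> mpol) set \<Rightarrow> ('a, 'c) gcx_scheme \<Rightarrow> ('b, 'd) gcx_scheme \<Rightarrow>
   ('x \<times> 'y \<Rightarrow> ('a \<times> 'b \<Rightarrow>\<^sub>0 int)) \<Rightarrow> ('x \<times> 'y \<Rightarrow>\<^sub>0 int) set \<Rightarrow> ('a \<times> 'b \<Rightarrow>\<^sub>0 int) set" where
  "tens_ind Mid M N \<phi> C = (\<Union>u\<in>C. tens_class Mid M N (frag_extend \<phi> u))"

text \<open>The Koszul sign, \<open>m \<mapsto> (-1)^k m\<close> in \<open>a\<close>-degree \<open>k\<close>.\<close>

definition asign :: "('m, 'e) gcx_scheme \<Rightarrow> 'm \<Rightarrow> 'm" where
  "asign A m = (let u = (THE u. hom_dec A m u) in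
     \<Oplus>\<^bsub>A\<^esub>i\<in>{i. u i \<noteq> \<zero>\<^bsub>A\<^esub>}. if even (fst i) then u i else \<ominus>\<^bsub>A\<^esub> u i)"

text \<open>
  A variable \<open>v\<close> acts by \<open>l v\<close> on the first factor and by \<open>r v\<close> on the second one.
\<close>

definition tens ::
  "(mpol \<times> mpol) set \<Rightarrow> (var \<Rightarrow> mpol) \<Rightarrow> (var \<Rightarrow> mpol) \<Rightarrow> 'a fcx \<Rightarrow> 'b fcx \<Rightarrow>
   ('a \<times> 'b \<Rightarrow>\<^sub>0 int) set fcx" where
  "tens Mid l r M N =
    \<lparr>carrier = carrier (tens_free M N Mod tens_ker Mid M N),
     mult = undefined, one = undefined,
     zero = one (tens_free M N Mod tens_ker Mid M N),
     add = mult (tens_free M N Mod tens_ker Mid M N),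
     smult = \<lambda>p. tens_ind Mid M N (\<lambda>(m, n). \<Sum>e\<in>Poly_Mapping.keys p.
       frag_of ((Cst (Poly_Mapping.lookup p e) * monom_subst l e) \<odot>\<^bsub>M\<^esub> m, monom_subst r e \<odot>\<^bsub>N\<^esub> n)),
     cmp = \<lambda>k q. tens_span Mid M N (\<Union>i d. cmp M i d \<times> cmp N (k - i) (q - d)),
     bd = tens_ind Mid M N (\<lambda>(m, n). frag_of (bd M m, n) + frag_of (asign M m, bd N n)),
     filt = \<lambda>j. tens_span Mid M N (\<Union>i. filt M i \<times> filt N (j - i))\<rparr>"

definition tens_map ::
  "(mpol \<times> mpol) set \<Rightarrow> ('a, 'c) gcx_scheme \<Rightarrow> ('b, 'd) gcx_scheme \<Rightarrow> ('x \<Rightarrow> 'a) \<Rightarrow> ('y \<Rightarrow> 'b) \<Rightarrow>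
   ('x \<times> 'y \<Rightarrow>\<^sub>0 int) set \<Rightarrow> ('a \<times> 'b \<Rightarrow>\<^sub>0 int) set" where
  "tens_map Mid M' N' f g = tens_ind Mid M' N' (\<lambda>(m, n). frag_of (f m, g n))"

text \<open>
  Composition of \<open>n\<close>-strand bimodules: the variables \<open>vX i\<close> acting on \<open>M\<close> are identified with the
  variables \<open>vY i\<close> acting on \<open>N\<close>; on the result \<open>vY i\<close> acts through \<open>M\<close> and \<open>vX i\<close> through \<open>N\<close>.
\<close>

definition comp_mid :: "nat \<Rightarrow> (mpol \<times> mpol) set" where
  "comp_mid n = {(p, pol_subst (\<lambda>v. case v of vX i \<Rightarrow> Var (vY i) | vY i \<Rightarrow> Var (vY i)) p) | p.
     p \<in> carrier (pol (vX ` {1..n}))}"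

definition bim_comp :: "nat \<Rightarrow> 'a fcx \<Rightarrow> 'b fcx \<Rightarrow> ('a \<times> 'b \<Rightarrow>\<^sub>0 int) set fcx" where
  "bim_comp n = tens (comp_mid n)
     (\<lambda>v. case v of vX i \<Rightarrow> 1 | vY i \<Rightarrow> Var (vY i))
     (\<lambda>v. case v of vX i \<Rightarrow> Var (vX i) | vY i \<Rightarrow> 1)"

text \<open>Disjoint union of \<open>n\<close> strands with further strands to their right.\<close>

definition union_mid :: "(mpol \<times> mpol) set" where
  "union_mid = {(Cst c, Cst c) | c. True}"

definition bim_union :: "nat \<Rightarrow> 'a fcx \<Rightarrow> 'b fcx \<Rightarrow> ('a \<times> 'b \<Rightarrow>\<^sub>0 int) set fcx" where
  "bim_union n = tens union_mid
     (\<lambda>v. case v of vX i \<Rightarrow> (if i \<le> n then Var (vX i) else 1)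
                  | vY i \<Rightarrow> (if i \<le> n then Var (vY i) else 1))
     (\<lambda>v. case v of vX i \<Rightarrow> (if i \<le> n then 1 else Var (vX (i - n)))
                  | vY i \<Rightarrow> (if i \<le> n then 1 else Var (vY (i - n))))"


section \<open>Outer complexes with strict differentials\<close>

text \<open>Here the differential at position \<open>p\<close> is an actual map to \<open>ashift 1 (opos C (p - 2))\<close>.\<close>

record 'm ocx =
  opos :: "int \<Rightarrow> 'm fcx"
  odiff :: "int \<Rightarrow> 'm \<Rightarrow> 'm"

definition dcx_of :: "'m ocx \<Rightarrow> ('m fcx, 'm) dcx" where
  "dcx_of C = \<lparr>dobj = opos C,
     ddiff = \<lambda>p. Gen (opos C p) (odiff C p) (ashift 1 (opos C (p - 2)))\<rparr>"

text \<open>\<open>thalf j\<close> is the shift \<open>t^(j/2)\<close>; it does not change the \<open>a\<close>-degree.\<close>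

definition thalf :: "int \<Rightarrow> 'm ocx \<Rightarrow> 'm ocx" where
  "thalf j C = \<lparr>opos = \<lambda>p. opos C (p - j), odiff = \<lambda>p. odiff C (p - j)\<rparr>"

definition oshift :: "('m fcx \<Rightarrow> 'm fcx) \<Rightarrow> 'm ocx \<Rightarrow> 'm ocx" where
  "oshift F C = C\<lparr>opos := \<lambda>p. F (opos C p)\<rparr>"

definition zero_fcx :: "'m fcx" where
  "zero_fcx = \<lparr>carrier = {undefined}, mult = undefined, one = undefined, zero = undefined,
     add = \<lambda>_ _. undefined, smult = \<lambda>_ _. undefined, cmp = \<lambda>_ _. {undefined}, bd = \<lambda>_. undefined,
     filt = \<lambda>_. {undefined}\<rparr>"

text \<open>The complex \<open>[\<^bold>t\<^sub>a A \<rightarrow> B]\<close> given by \<open>f : A \<rightarrow> B\<close>.\<close>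

definition two_term :: "'m fcx \<Rightarrow> ('m \<Rightarrow> 'm) \<Rightarrow> 'm fcx \<Rightarrow> 'm ocx" where
  "two_term A f B =
    (let P = (\<lambda>p. if p = 2 then ashift 1 A else if p = 0 then B else zero_fcx) in
     \<lparr>opos = P, odiff = \<lambda>p. if p = 2 then f else (\<lambda>_. \<zero>\<^bsub>P (p - 2)\<^esub>)\<rparr>)"

definition dir_sum :: "(int \<Rightarrow> 'm fcx) \<Rightarrow> (int \<Rightarrow> 'm) fcx" where
  "dir_sum A =
    (let U = {u. (\<forall>i. u i \<in> carrier (A i)) \<and> finite {i. u i \<noteq> \<zero>\<^bsub>A i\<^esub>}} in
     \<lparr>carrier = U, mult = undefined, one = undefined, zero = \<lambda>i. \<zero>\<^bsub>A i\<^esub>,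
      add = \<lambda>u v i. u i \<oplus>\<^bsub>A i\<^esub> v i,
      smult = \<lambda>r u i. r \<odot>\<^bsub>A i\<^esub> u i,
      cmp = \<lambda>k q. {u \<in> U. \<forall>i. u i \<in> cmp (A i) k q},
      bd = \<lambda>u i. bd (A i) (u i),
      filt = \<lambda>j. {u \<in> U. \<forall>i. u i \<in> filt (A i) j}\<rparr>)"

text \<open>
  The total complex of the composition. Component \<open>i\<close> of position \<open>p\<close> is \<open>C\<^sub>i \<circ> D\<^sub>p\<^sub>-\<^sub>i\<close>, and the
  differential is \<open>d(m \<otimes> n) = dm \<otimes> n + (-1)^k m \<otimes> dn\<close> for \<open>m\<close> of \<open>a\<close>-degree \<open>k\<close>.
\<close>

definition ocx_comp :: "nat \<Rightarrow> 'a ocx \<Rightarrow> 'b ocx \<Rightarrow> (int \<Rightarrow> ('a \<times> 'b \<Rightarrow>\<^sub>0 int) set) ocx" where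
  "ocx_comp n C D =
    \<lparr>opos = \<lambda>p. dir_sum (\<lambda>i. bim_comp n (opos C i) (opos D (p - i))),
     odiff = \<lambda>p u i.
       tens_map (comp_mid n) (opos C i) (opos D (p - 2 - i)) (odiff C (i + 2)) (\<lambda>y. y) (u (i + 2))
       \<oplus>\<^bsub>bim_comp n (opos C i) (opos D (p - 2 - i))\<^esub>
       tens_map (comp_mid n) (opos C i) (opos D (p - 2 - i)) (asign (opos C i)) (odiff D (p - i)) (u i)\<rparr>"

definition ocx_union_right :: "nat \<Rightarrow> 'a ocx \<Rightarrow> 'b fcx \<Rightarrow> ('a \<times> 'b \<Rightarrow>\<^sub>0 int) set ocx" where
  "ocx_union_right n C J =
    \<lparr>opos = \<lambda>p. bim_union n (opos C p) J,
     odiff = \<lambda>p. tens_map union_mid (opos C (p - 2)) J (odiff C p) (\<lambda>y. y)\<rparr>"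

text \<open>There is no sign in the differential if \<open>J\<close> is concentrated in \<open>a\<close>-degree \<open>0\<close>.\<close>

definition ocx_union_left :: "nat \<Rightarrow> 'a fcx \<Rightarrow> 'b ocx \<Rightarrow> ('a \<times> 'b \<Rightarrow>\<^sub>0 int) set ocx" where
  "ocx_union_left n J C =
    \<lparr>opos = \<lambda>p. bim_union n J (opos C p),
     odiff = \<lambda>p. tens_map union_mid J (opos C (p - 2)) (\<lambda>x. x) (odiff C p)\<rparr>"


section \<open>The Rouquier complexes\<close>

definition rel_ideal :: "nat \<Rightarrow> mpol set \<Rightarrow> mpol set" where
  "rel_ideal n S = Idl\<^bsub>xyring n\<^esub> S"

text \<open>
  The cyclic module \<open>\<rat>[x,y]/(S)\<close> in \<open>a\<close>-degree \<open>0\<close> with trivial filtration.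
\<close>

definition cyc_bim :: "nat \<Rightarrow> mpol set \<Rightarrow> mpol set fcx" where
  "cyc_bim n S = (let R = xyring n; I = rel_ideal n S in
    \<lparr>carrier = carrier (R Quot I), mult = mult (R Quot I), one = one (R Quot I),
     zero = zero (R Quot I), add = add (R Quot I),
     smult = \<lambda>r c. (I +>\<^bsub>R\<^esub> r) \<otimes>\<^bsub>R Quot I\<^esub> c,
     cmp = \<lambda>k q. if k = 0 then (\<lambda>p. I +>\<^bsub>R\<^esub> p) ` (carrier R \<inter> qhom q) else {zero (R Quot I)},
     bd = \<lambda>_. zero (R Quot I),
     filt = \<lambda>j. if j \<le> 0 then carrier (R Quot I) else {zero (R Quot I)}\<rparr>)"

definition xp :: mpol where "xp = Var (vX 2) + Var (vX 1)"
definition xm :: mpol where "xm = Var (vX 2) - Var (vX 1)"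
definition yp :: mpol where "yp = Var (vY 2) + Var (vY 1)"
definition ym :: mpol where "ym = Var (vY 2) - Var (vY 1)"

definition bim_J :: "mpol set fcx" where
  "bim_J = cyc_bim 1 {Var (vY 1) - Var (vX 1)}"

definition I_rels :: "mpol set" where
  "I_rels = {Var (vY 1) - Var (vX 1), Var (vY 2) - Var (vX 2)}"

definition bim_I :: "mpol set fcx" where
  "bim_I = cyc_bim 2 I_rels"

definition bim_M :: "mpol set fcx" where
  "bim_M = cyc_bim 2 {yp - xp, (ym + xm) * (ym - xm)}"

definition bim_B :: "mpol set fcx" where
  "bim_B = bim_M\<lparr>filt := \<lambda>j.
     if j \<le> 0 then carrier bim_M
     else if j \<le> 2 then (\<lambda>m. (ym - xm) \<odot>\<^bsub>bim_M\<^esub> m) ` carrier bim_M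
     else {\<zero>\<^bsub>bim_M\<^esub>}\<rparr>"

text \<open>The projection \<open>B \<rightarrow> F^0/F^1 = I\<close>, sending the class of a polynomial to its class.\<close>

definition chi_minus :: "mpol set \<Rightarrow> mpol set" where
  "chi_minus c = rel_ideal 2 I_rels <+>\<^bsub>xyring 2\<^esub> c"

text \<open>The shift \<open>(\<^bold>t\<^sub>s \<^bold>a\<^sub>q)\<^sup>-\<^sup>1\<close> is \<open>t^(-1/2) s^(-1/2) a^(-1) q^(-2)\<close>.\<close>

definition sigma_minus :: "mpol set ocx" where
  "sigma_minus = thalf (-1) (oshift (\<lambda>A. shalf (-1) (ashift (-1) (qshift (-2) A)))
     (two_term bim_B chi_minus bim_I))"

definition sigma1_minus :: "(mpol set \<times> mpol set \<Rightarrow>\<^sub>0 int) set ocx" where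
  "sigma1_minus = ocx_union_right 2 sigma_minus bim_J"

definition sigma2_minus :: "(mpol set \<times> mpol set \<Rightarrow>\<^sub>0 int) set ocx" where
  "sigma2_minus = ocx_union_left 1 bim_J sigma_minus"

end

(* All terms are free over the right polynomial ring on products of 1 and y, with zero inner
   differential, so the homotopy equivalence can be written in coordinates and no inverses of
   quasi-isomorphisms are needed. Each of the maps f_lr and f_rl extends the
   morphism which in the top position factors through the bimodule R (x)_(R^S) R, a direct summand of
   both sides.

   The filtration indices of a triple product range from -3/2 (everything) to 3/2 in the top position
   and to 1/2 in the other ones, where the next step is zero. Hence a violation by more than two units
   can only occur for the steps 1 and 3/2 in the top position, and it does not if they are sent to the step -1/2.
   The elements of such a step are annihilated by y_i - x_(s i), for the longest permutation s. So are
   their images, since the maps commute with the actions of all variables. But in the top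
   position such an element is divisible by y_1 - x_1 (or y_3 - x_3), and the differences y_i - x_i map
   everything into the step -1/2. *)

theory Submission
  imports Defs "HOL-Library.Function_Algebras"
begin


section \<open>Polynomials\<close>

text \<open>Coordinates are practicable because the basis is chosen uniformly: in either crossing
  the blob gets the basis 1, y with y the left variable of the outer strand (1 or 3), never of the
  common strand 2. Exchanging 1 and 3 exchanges the two words, so one formula with parameters
  \<open>a\<close>, \<open>c\<close> gives both maps, both homotopies and both filtration estimates.
  In a composite the right variables of one factor act as the left variables of the next. The
  operators of a crossing are therefore written for arbitrary commuting operators in place of the
  right variables, and products of crossings arise by nesting them. The permutation s comes from the
  deeper step of the blob. It is generated by y_- - x_-, which y_1 - x_2 and y_2 - x_1 annihilate,
  so it lives on the graph of a transposition. In the top position the steps 1 and 3/2 are spanned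
  by tensors with all three factors in that deeper step, and the three transpositions compose to s.
  The differences y_i - x_i, in turn, obey a Leibniz rule for tensor products and send each blob
  into its deeper step; hence they move a triple product up by one such step.\<close>

instantiation var :: linorder
begin

text \<open>A linear order of the variables induces a linear order of the monomials that is
  compatible with their multiplication. With it the type \<open>mpol\<close> is known to have no
  zero divisors, and the cancellation of differences of variables in \<open>cyc_M\<close> and
  \<open>wdiv\<close> rests on that.\<close>

fun var_code :: "var \<Rightarrow> nat" where
  "var_code (vX i) = 2 * i"
| "var_code (vY i) = 2 * i + 1"

definition "x \<le> y \<longleftrightarrow> var_code x \<le> var_code y"
definition "x < y \<longleftrightarrow> var_code x < var_code y" for x y :: var

lemma var_code_inject: "var_code x = var_code y \<longleftrightarrow> x = y"
  by (cases x; cases y) (auto, presburger+)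

instance
  by standard (auto simp: less_eq_var_def less_var_def var_code_inject)

end

abbreviation PR :: "var set \<Rightarrow> mpol set" where
  "PR V \<equiv> carrier (pol V)"

abbreviation xv :: "nat \<Rightarrow> mpol" where "xv i \<equiv> Var (vX i)"
abbreviation yv :: "nat \<Rightarrow> mpol" where "yv i \<equiv> Var (vY i)"

definition XV :: "nat \<Rightarrow> var set" where "XV n = vX ` {1..n}"
definition YV :: "nat \<Rightarrow> var set" where "YV n = vY ` {1..n}"

abbreviation RX :: "nat \<Rightarrow> mpol set" where "RX n \<equiv> PR (XV n)"
abbreviation XY :: "nat \<Rightarrow> var set" where "XY n \<equiv> XV n \<union> YV n"

lemma xyring_eq: "xyring n = pol (XY n)"
  by (simp add: xyring_def XV_def YV_def)

lemma vX_in_XV [simp]: "vX i \<in> XV n \<longleftrightarrow> i \<in> {1..n}" and vY_in_YV [simp]: "vY i \<in> YV n \<longleftrightarrow> i \<in> {1..n}"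
  and vX_notin_YV [simp]: "vX i \<notin> YV n" and vY_notin_XV [simp]: "vY i \<notin> XV n"
  by (auto simp: XV_def YV_def)

lemma pol_sel [simp]:
  "mult (pol V) = (*)" "one (pol V) = 1" "zero (pol V) = 0" "add (pol V) = (+)"
  by (simp_all add: pol_def)

lemma PR_iff: "p \<in> PR V \<longleftrightarrow> (\<forall>e\<in>Poly_Mapping.keys p. Poly_Mapping.keys e \<subseteq> V)"
  by (simp add: pol_def)

lemma keys_add_nat:
  "Poly_Mapping.keys ((e::'a \<Rightarrow>\<^sub>0 nat) + e') = Poly_Mapping.keys e \<union> Poly_Mapping.keys e'"
  by (auto simp: in_keys_iff lookup_add)

lemma PR_0 [simp]: "0 \<in> PR V" and PR_1 [simp]: "1 \<in> PR V"
  and PR_Cst [simp]: "Cst c \<in> PR V"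
  by (auto simp: PR_iff Cst_def)

lemma PR_Var [simp]: "v \<in> V \<Longrightarrow> Var v \<in> PR V"
  by (auto simp: PR_iff Var_def)

lemma PR_add [simp]: "p \<in> PR V \<Longrightarrow> q \<in> PR V \<Longrightarrow> p + q \<in> PR V"
  using Poly_Mapping.keys_add[of p q] by (fastforce simp: PR_iff)

lemma PR_uminus [simp]: "p \<in> PR V \<Longrightarrow> - p \<in> PR V"
  by (auto simp: PR_iff in_keys_iff)

lemma PR_diff [simp]: "p \<in> PR V \<Longrightarrow> q \<in> PR V \<Longrightarrow> p - q \<in> PR V"
  using PR_add[of p V "- q"] by simp

lemma PR_mult [simp]: "p \<in> PR V \<Longrightarrow> q \<in> PR V \<Longrightarrow> p * q \<in> PR V"
  using keys_mult[of p q] unfolding PR_iff by (fastforce simp: keys_add_nat)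

lemma PR_sum [simp]: "(\<And>i. i \<in> I \<Longrightarrow> f i \<in> PR V) \<Longrightarrow> sum f I \<in> PR V"
  by (induction I rule: infinite_finite_induct) auto

lemma PR_power [simp]: "p \<in> PR V \<Longrightarrow> p ^ k \<in> PR V"
  by (induction k) auto

lemma PR_prod [simp]: "(\<And>i. i \<in> I \<Longrightarrow> f i \<in> PR V) \<Longrightarrow> prod f I \<in> PR V"
  by (induction I rule: infinite_finite_induct) auto

lemma PR_mono: "V \<subseteq> W \<Longrightarrow> p \<in> PR V \<Longrightarrow> p \<in> PR W"
  by (fastforce simp: PR_iff)

lemma cring_pol [simp]: "cring (pol V)"
proof (rule cringI)
  show "abelian_group (pol V)"
  proof (rule abelian_groupI)
    fix x assume "x \<in> PR V"
    then show "\<exists>y\<in>PR V. y \<oplus>\<^bsub>pol V\<^esub> x = \<zero>\<^bsub>pol V\<^esub>"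
      by (intro bexI[of _ "- x"]) auto
  qed (auto simp: algebra_simps)
  show "comm_monoid (pol V)" by (rule comm_monoidI) (auto simp: algebra_simps)
qed (auto simp: algebra_simps)

lemma Cst_0 [simp]: "Cst 0 = 0" and Cst_1 [simp]: "Cst 1 = 1"
  by (simp_all add: Cst_def)

lemma Cst_add: "Cst (a + b) = Cst a + Cst b" and Cst_mult: "Cst (a * b) = Cst a * Cst b"
  by (simp_all add: Cst_def single_add mult_single)

text \<open>Induction on the total degree: the exponent is lowered by one at some variable that
  occurs in it.\<close>

lemma monom_induct [consumes 1, case_names 0 Suc]:
  assumes "Poly_Mapping.keys e \<subseteq> V" and "P 0"
    and "\<And>v e. v \<in> V \<Longrightarrow> Poly_Mapping.keys e \<subseteq> V \<Longrightarrow> P e \<Longrightarrow> P (Poly_Mapping.single v 1 + e)"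
  shows "P (e :: var \<Rightarrow>\<^sub>0 nat)"
  using assms(1)
proof (induction "sum (Poly_Mapping.lookup e) (Poly_Mapping.keys e)" arbitrary: e)
  case 0
  have "Poly_Mapping.keys e = {}"
    using 0(1) by (metis finite_keys in_keys_iff sum_eq_0_iff subsetI subset_empty)
  then have "e = 0" by simp
  then show ?case using assms(2) by simp
next
  case (Suc n)
  then obtain v where v: "v \<in> Poly_Mapping.keys e"
    by (metis Zero_not_Suc all_not_in_conv sum.empty)
  define e' where "e' = e - Poly_Mapping.single v 1"
  have e: "e = Poly_Mapping.single v 1 + e'"
    using v by (intro poly_mapping_eqI) (auto simp: e'_def lookup_add lookup_minus lookup_single in_keys_iff when_def)
  have sub: "Poly_Mapping.keys e' \<subseteq> Poly_Mapping.keys e"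
    by (subst e) (auto simp: keys_add_nat)
  have "sum (Poly_Mapping.lookup e) (Poly_Mapping.keys e) =
      sum (Poly_Mapping.lookup (Poly_Mapping.single v 1)) (Poly_Mapping.keys e) + sum (Poly_Mapping.lookup e') (Poly_Mapping.keys e)"
    by (subst e) (simp add: lookup_add sum.distrib)
  also have "sum (Poly_Mapping.lookup (Poly_Mapping.single v 1)) (Poly_Mapping.keys e) = 1"
    using v by (simp add: lookup_single when_def)
  also have "sum (Poly_Mapping.lookup e') (Poly_Mapping.keys e) = sum (Poly_Mapping.lookup e') (Poly_Mapping.keys e')"
    by (rule sum.mono_neutral_right) (use sub in \<open>auto simp: in_keys_iff\<close>)
  finally have "n = sum (Poly_Mapping.lookup e') (Poly_Mapping.keys e')" using Suc(2) by simp
  then have "P e'" using Suc(1)[of e'] sub Suc(3) by auto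
  then show ?case using assms(3)[of v e'] v sub Suc(3) e by auto
qed

lemma poly_sum_monom: "p = (\<Sum>e\<in>Poly_Mapping.keys p. Poly_Mapping.single e (Poly_Mapping.lookup p e))"
  by (intro poly_mapping_eqI) (auto simp: lookup_sum lookup_single when_def in_keys_iff)

lemma single_Suc_monom:
  "Poly_Mapping.single (Poly_Mapping.single v 1 + e) c = Var v * Poly_Mapping.single e c"
  by (simp add: Var_def mult_single)

text \<open>An additive map has to be tested only against constants and single variables to be seen
  linear over a polynomial ring. This is how \<open>d_smult\<close> and \<open>gmor_coord\<close>
  obtain linearity over all variables.\<close>

lemma PR_induct [consumes 1, case_names Cst add Var]:
  assumes "p \<in> PR V" and "\<And>c. P (Cst c)"
    and "\<And>p q. p \<in> PR V \<Longrightarrow> q \<in> PR V \<Longrightarrow> P p \<Longrightarrow> P q \<Longrightarrow> P (p + q)"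
    and "\<And>v p. v \<in> V \<Longrightarrow> p \<in> PR V \<Longrightarrow> P p \<Longrightarrow> P (Var v * p)"
  shows "P p"
proof -
  have mon: "P (Poly_Mapping.single e c) \<and> Poly_Mapping.single e c \<in> PR V" if "Poly_Mapping.keys e \<subseteq> V" for e c
    using that
  proof (induction e rule: monom_induct)
    case 0
    show ?case using assms(2)[of c] PR_Cst[of c] by (simp add: Cst_def)
  next
    case (Suc v e)
    then show ?case unfolding single_Suc_monom by (auto intro: assms(4))
  qed
  have "P (\<Sum>e\<in>A. Poly_Mapping.single e (Poly_Mapping.lookup p e)) \<and>
      (\<Sum>e\<in>A. Poly_Mapping.single e (Poly_Mapping.lookup p e)) \<in> PR V"
    if "finite A" "A \<subseteq> Poly_Mapping.keys p" for A
    using that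
  proof (induction A rule: finite_induct)
    case empty
    then show ?case using assms(2)[of 0] by simp
  next
    case (insert e A)
    then have "Poly_Mapping.keys e \<subseteq> V" using assms(1) by (auto simp: PR_iff)
    with insert mon[of e] show ?case by (simp add: assms(3))
  qed
  from this[OF _ subset_refl] show ?thesis using poly_sum_monom[of p] by simp
qed

subsection \<open>Substitution\<close>

text \<open>Products and sums over the support are awkward when two supports differ; extending both
  to a common finite set makes them comparable term by term.\<close>

lemma monom_subst_superset:
  assumes "finite A" "Poly_Mapping.keys e \<subseteq> A"
  shows "monom_subst \<sigma> e = (\<Prod>v\<in>A. \<sigma> v ^ Poly_Mapping.lookup e v)"
  unfolding monom_subst_def by (rule prod.mono_neutral_left) (use assms in \<open>auto simp: in_keys_iff\<close>)

lemma monom_subst_0 [simp]: "monom_subst \<sigma> 0 = 1"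
  by (simp add: monom_subst_def)

lemma monom_subst_add: "monom_subst \<sigma> (e + e') = monom_subst \<sigma> e * monom_subst \<sigma> e'"
proof -
  let ?A = "Poly_Mapping.keys e \<union> Poly_Mapping.keys e'"
  show ?thesis
    by (simp add: monom_subst_superset[of ?A] keys_add_nat lookup_add power_add prod.distrib)
qed

lemma monom_subst_single [simp]: "monom_subst \<sigma> (Poly_Mapping.single v (Suc 0)) = \<sigma> v"
  by (simp add: monom_subst_def)

lemma monom_subst_PR:
  assumes "\<And>v. v \<in> V \<Longrightarrow> \<sigma> v \<in> PR W" "Poly_Mapping.keys e \<subseteq> V"
  shows "monom_subst \<sigma> e \<in> PR W"
  unfolding monom_subst_def using assms by (intro PR_prod PR_power) auto

lemma monom_subst_1: "(\<And>v. v \<in> Poly_Mapping.keys e \<Longrightarrow> \<sigma> v = 1) \<Longrightarrow> monom_subst \<sigma> e = 1"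
  by (simp add: monom_subst_def)

lemma pol_subst_superset:
  assumes "finite A" "Poly_Mapping.keys p \<subseteq> A"
  shows "pol_subst \<sigma> p = (\<Sum>e\<in>A. Cst (Poly_Mapping.lookup p e) * monom_subst \<sigma> e)"
  unfolding pol_subst_def by (rule sum.mono_neutral_left) (use assms in \<open>auto simp: in_keys_iff\<close>)

lemma pol_subst_add: "pol_subst \<sigma> (p + q) = pol_subst \<sigma> p + pol_subst \<sigma> q"
proof -
  let ?A = "Poly_Mapping.keys p \<union> Poly_Mapping.keys q"
  show ?thesis
    using Poly_Mapping.keys_add[of p q]
    by (simp add: pol_subst_superset[of ?A] lookup_add Cst_add distrib_right sum.distrib)
qed

lemma pol_subst_0 [simp]: "pol_subst \<sigma> 0 = 0"
  by (simp add: pol_subst_def)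

lemma pol_subst_sum: "pol_subst \<sigma> (sum f I) = (\<Sum>i\<in>I. pol_subst \<sigma> (f i))"
  by (induction I rule: infinite_finite_induct) (auto simp: pol_subst_add)

lemma pol_subst_uminus: "pol_subst \<sigma> (- p) = - pol_subst \<sigma> p"
  using pol_subst_add[of \<sigma> p "- p"] by (simp add: eq_neg_iff_add_eq_0 add.commute)

lemma pol_subst_diff: "pol_subst \<sigma> (p - q) = pol_subst \<sigma> p - pol_subst \<sigma> q"
  using pol_subst_add[of \<sigma> p "- q"] by (simp add: pol_subst_uminus)

lemma pol_subst_single [simp]: "pol_subst \<sigma> (Poly_Mapping.single e c) = Cst c * monom_subst \<sigma> e"
  by (cases "c = 0") (simp_all add: pol_subst_def)

lemma pol_subst_Cst [simp]: "pol_subst \<sigma> (Cst c) = Cst c"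
  using pol_subst_single[of \<sigma> 0 c] unfolding Cst_def by (simp add: Cst_def[symmetric])

lemma pol_subst_1 [simp]: "pol_subst \<sigma> 1 = 1"
  using pol_subst_Cst[of \<sigma> 1] by simp

lemma pol_subst_Var [simp]: "pol_subst \<sigma> (Var v) = \<sigma> v"
  by (simp add: Var_def)

lemma pol_subst_mult_single:
  "pol_subst \<sigma> (Poly_Mapping.single e c * q) = Cst c * monom_subst \<sigma> e * pol_subst \<sigma> q"
proof -
  have "Poly_Mapping.single e c * q =
      (\<Sum>e'\<in>Poly_Mapping.keys q. Poly_Mapping.single (e + e') (c * Poly_Mapping.lookup q e'))"
    by (subst poly_sum_monom[of q]) (simp add: sum_distrib_left mult_single)
  then show ?thesis
    by (simp add: pol_subst_sum pol_subst_def[of \<sigma> q] sum_distrib_left Cst_mult monom_subst_add ac_simps)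
qed

lemma pol_subst_mult: "pol_subst \<sigma> (p * q) = pol_subst \<sigma> p * pol_subst \<sigma> q"
proof -
  have "pol_subst \<sigma> (p * q) = (\<Sum>e\<in>Poly_Mapping.keys p. pol_subst \<sigma> (Poly_Mapping.single e (Poly_Mapping.lookup p e) * q))"
    by (subst poly_sum_monom[of p]) (simp add: sum_distrib_right pol_subst_sum)
  also have "\<dots> = pol_subst \<sigma> p * pol_subst \<sigma> q"
    by (simp add: pol_subst_mult_single pol_subst_def[of \<sigma> p] sum_distrib_right)
  finally show ?thesis .
qed

lemma pol_subst_PR:
  assumes "\<And>v. v \<in> V \<Longrightarrow> \<sigma> v \<in> PR W" "p \<in> PR V"
  shows "pol_subst \<sigma> p \<in> PR W"
  using assms(2) unfolding pol_subst_def PR_iff[of p]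
  by (intro PR_sum PR_mult PR_Cst monom_subst_PR[of V] assms(1)) auto

lemma pol_subst_id:
  assumes "\<And>v. v \<in> V \<Longrightarrow> \<sigma> v = Var v" "p \<in> PR V"
  shows "pol_subst \<sigma> p = p"
  using assms(2) by (induction p rule: PR_induct) (auto simp: pol_subst_add pol_subst_mult assms(1))

lemma pol_subst_comp:
  assumes "\<And>v. v \<in> V \<Longrightarrow> pol_subst \<tau> (\<sigma> v) = \<rho> v" "p \<in> PR V"
  shows "pol_subst \<tau> (pol_subst \<sigma> p) = pol_subst \<rho> p"
  using assms(2) by (induction p rule: PR_induct) (auto simp: pol_subst_add pol_subst_mult assms(1))

subsection \<open>Homogeneous polynomials\<close>

definition mdeg :: "(var \<Rightarrow>\<^sub>0 nat) \<Rightarrow> int" where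
  "mdeg e = 2 * int (\<Sum>v\<in>Poly_Mapping.keys e. Poly_Mapping.lookup e v)"

lemma qhom_iff: "p \<in> qhom d \<longleftrightarrow> (\<forall>e\<in>Poly_Mapping.keys p. mdeg e = d)"
  by (simp add: qhom_def mdeg_def)

lemma mdeg_add: "mdeg (e + e') = mdeg e + mdeg e'"
proof -
  let ?A = "Poly_Mapping.keys e \<union> Poly_Mapping.keys e'"
  have s: "(\<Sum>v\<in>Poly_Mapping.keys f. Poly_Mapping.lookup f v) = (\<Sum>v\<in>?A. Poly_Mapping.lookup f v)"
    if "Poly_Mapping.keys f \<subseteq> ?A" for f
    by (rule sum.mono_neutral_left) (use that in \<open>auto simp: in_keys_iff\<close>)
  show ?thesis
    unfolding mdeg_def by (simp add: s keys_add_nat lookup_add sum.distrib)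
qed

lemma qhom_0 [simp]: "0 \<in> qhom d"
  by (simp add: qhom_iff)

lemma qhom_Cst [simp]: "Cst c \<in> qhom 0"
  by (simp add: qhom_iff Cst_def mdeg_def)

lemma qhom_1 [simp]: "1 \<in> qhom 0"
  using qhom_Cst[of 1] by simp

lemma qhom_Var [simp]: "Var v \<in> qhom 2"
  by (simp add: qhom_iff Var_def mdeg_def)

lemma qhom_add [simp]: "p \<in> qhom d \<Longrightarrow> q \<in> qhom d \<Longrightarrow> p + q \<in> qhom d"
  using Poly_Mapping.keys_add[of p q] by (auto simp: qhom_iff)

lemma qhom_uminus [simp]: "p \<in> qhom d \<Longrightarrow> - p \<in> qhom d"
  by (auto simp: qhom_iff in_keys_iff)

lemma qhom_uminus_iff [simp]: "- p \<in> qhom d \<longleftrightarrow> p \<in> qhom d"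
  using qhom_uminus[of "- p"] by fastforce

lemma qhom_diff [simp]: "p \<in> qhom d \<Longrightarrow> q \<in> qhom d \<Longrightarrow> p - q \<in> qhom d"
  using qhom_add[of p d "- q"] by simp

lemma qhom_sum: "(\<And>i. i \<in> I \<Longrightarrow> f i \<in> qhom d) \<Longrightarrow> sum f I \<in> qhom d"
  by (induction I rule: infinite_finite_induct) auto

lemma qhom_mult: "p \<in> qhom d \<Longrightarrow> q \<in> qhom d' \<Longrightarrow> d + d' = d'' \<Longrightarrow> p * q \<in> qhom d''"
  using keys_mult[of p q] by (fastforce simp: qhom_iff mdeg_add)

lemma qhom_Cst_mult [simp]: "p \<in> qhom d \<Longrightarrow> Cst c * p \<in> qhom d"
  by (rule qhom_mult[of _ 0 _ d]) auto

text \<open>The degree may depend on the variable: in a tensor product a variable acts by a variable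
  on one factor and by 1 on the other.\<close>

lemma monom_subst_qhom:
  assumes "\<And>v. v \<in> Poly_Mapping.keys e \<Longrightarrow> \<sigma> v \<in> qhom (d v)"
  shows "monom_subst \<sigma> e \<in> qhom (\<Sum>v\<in>Poly_Mapping.keys e. d v * int (Poly_Mapping.lookup e v))"
proof -
  have pow: "p ^ k \<in> qhom (d' * int k)" if "p \<in> qhom d'" for p d' k
    using that by (induction k) (auto intro: qhom_mult simp: algebra_simps)
  have "(\<Prod>v\<in>A. \<sigma> v ^ Poly_Mapping.lookup e v) \<in> qhom (\<Sum>v\<in>A. d v * int (Poly_Mapping.lookup e v))"
    if "finite A" "A \<subseteq> Poly_Mapping.keys e" for A
    using that by (induction A rule: finite_induct) (auto intro!: qhom_mult[OF pow] assms)
  from this[OF finite_keys subset_refl] show ?thesis unfolding monom_subst_def .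
qed

lemma pol_subst_qhom:
  assumes "\<And>v. v \<in> V \<Longrightarrow> \<sigma> v \<in> qhom 2" "p \<in> PR V" "p \<in> qhom d"
  shows "pol_subst \<sigma> p \<in> qhom d"
  unfolding pol_subst_def
proof (rule qhom_sum)
  fix e assume e: "e \<in> Poly_Mapping.keys p"
  then have "monom_subst \<sigma> e \<in> qhom (\<Sum>v\<in>Poly_Mapping.keys e. 2 * int (Poly_Mapping.lookup e v))"
    using assms(1,2) by (intro monom_subst_qhom) (auto simp: PR_iff)
  also have "(\<Sum>v\<in>Poly_Mapping.keys e. 2 * int (Poly_Mapping.lookup e v)) = d"
    using assms(3) e by (auto simp: qhom_iff mdeg_def sum_distrib_left)
  finally show "Cst (Poly_Mapping.lookup p e) * monom_subst \<sigma> e \<in> qhom d" by simp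
qed

definition hpart :: "int \<Rightarrow> mpol \<Rightarrow> mpol" where
  "hpart d p = (\<Sum>e\<in>{e\<in>Poly_Mapping.keys p. mdeg e = d}. Poly_Mapping.single e (Poly_Mapping.lookup p e))"

lemma lookup_hpart: "Poly_Mapping.lookup (hpart d p) e = (if mdeg e = d then Poly_Mapping.lookup p e else 0)"
  by (auto simp: hpart_def lookup_sum lookup_single when_def in_keys_iff)

lemma hpart_0 [simp]: "hpart d 0 = 0"
  by (simp add: hpart_def)

lemma hpart_add: "hpart d (p + q) = hpart d p + hpart d q"
  by (intro poly_mapping_eqI) (simp add: lookup_hpart lookup_add)

lemma hpart_sum: "hpart d (sum f I) = (\<Sum>i\<in>I. hpart d (f i))"
  by (induction I rule: infinite_finite_induct) (auto simp: hpart_add)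

lemma hpart_qhom [simp]: "hpart d p \<in> qhom d"
  by (auto simp: qhom_iff in_keys_iff lookup_hpart split: if_splits)

lemma hpart_PR [simp]: "p \<in> PR V \<Longrightarrow> hpart d p \<in> PR V"
  by (auto simp: PR_iff in_keys_iff[of _ "hpart d p"] in_keys_iff[of _ p] lookup_hpart split: if_splits)

lemma hpart_of_qhom: "p \<in> qhom d' \<Longrightarrow> hpart d p = (if d = d' then p else 0)"
  by (intro poly_mapping_eqI) (auto simp: lookup_hpart qhom_iff in_keys_iff)

lemma hpart_finite: "finite {d. hpart d p \<noteq> 0}"
proof (rule finite_subset)
  show "{d. hpart d p \<noteq> 0} \<subseteq> mdeg ` Poly_Mapping.keys p"
  proof
    fix d assume "d \<in> {d. hpart d p \<noteq> 0}"
    then obtain e where "Poly_Mapping.lookup (hpart d p) e \<noteq> 0"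
      by (auto simp: poly_mapping_eq_iff fun_eq_iff)
    then show "d \<in> mdeg ` Poly_Mapping.keys p"
      by (auto simp: lookup_hpart in_keys_iff split: if_splits)
  qed
qed simp

text \<open>The larger index set is wanted in \<open>hom_dec_hdec\<close>, where one set of degrees
  has to serve all coordinates at once.\<close>

lemma hpart_sum_all:
  assumes "finite A" "{d. hpart d p \<noteq> 0} \<subseteq> A"
  shows "(\<Sum>d\<in>A. hpart d p) = p"
proof (rule poly_mapping_eqI)
  fix e
  have "mdeg e \<in> A" if "Poly_Mapping.lookup p e \<noteq> 0"
  proof -
    have "Poly_Mapping.lookup (hpart (mdeg e) p) e \<noteq> 0" using that by (simp add: lookup_hpart)
    then show ?thesis using assms(2) by auto
  qed
  then show "Poly_Mapping.lookup (\<Sum>d\<in>A. hpart d p) e = Poly_Mapping.lookup p e"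
    using assms(1) by (cases "Poly_Mapping.lookup p e = 0") (auto simp: lookup_sum lookup_hpart)
qed


section \<open>Tensor products\<close>

text \<open>The action on a tensor product is defined one term of the polynomial at a time, so whole
  terms are the convenient generators there.\<close>

lemma PR_induct_single [consumes 1, case_names zero add single]:
  assumes "p \<in> PR V" and "P 0"
    and "\<And>p q. p \<in> PR V \<Longrightarrow> q \<in> PR V \<Longrightarrow> P p \<Longrightarrow> P q \<Longrightarrow> P (p + q)"
    and "\<And>e c. Poly_Mapping.keys e \<subseteq> V \<Longrightarrow> P (Poly_Mapping.single e c)"
  shows "P p"
proof -
  have "P (\<Sum>e\<in>A. Poly_Mapping.single e (Poly_Mapping.lookup p e)) \<and>
      (\<Sum>e\<in>A. Poly_Mapping.single e (Poly_Mapping.lookup p e)) \<in> PR V"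
    if "finite A" "A \<subseteq> Poly_Mapping.keys p" for A
    using that
  proof (induction A rule: finite_induct)
    case (insert e A)
    then have e: "Poly_Mapping.keys e \<subseteq> V" using assms(1) by (auto simp: PR_iff)
    then have "Poly_Mapping.single e (Poly_Mapping.lookup p e) \<in> PR V" by (simp add: PR_iff)
    with insert e show ?case by (simp add: assms(3,4))
  qed (simp add: assms(2))
  from this[OF _ subset_refl] show ?thesis using poly_sum_monom[of p] by simp
qed

lemma PR_single [simp]: "Poly_Mapping.keys e \<subseteq> V \<Longrightarrow> Poly_Mapping.single e c \<in> PR V"
  by (simp add: PR_iff)

text \<open>\<open>VM\<close> and \<open>VN\<close> are the variables that act on the two factors.
  Rational constants must be balanced because the action of a polynomial places each coefficient on
  the left factor, and \<open>smult_pt_right\<close> has to carry it over to the right one.\<close>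

locale bitensor =
  fixes Mid :: "(mpol \<times> mpol) set" and M :: "'a fcx" and N :: "'b fcx" and VM VN :: "var set"
  assumes M: "module (pol VM) M" and N: "module (pol VN) N"
    and Mid: "(a, b) \<in> Mid \<Longrightarrow> a \<in> PR VM \<and> b \<in> PR VN"
    and Mid_Cst: "(Cst c, Cst c) \<in> Mid"
begin

sublocale M: module "pol VM" M by (rule M)
sublocale N: module "pol VN" N by (rule N)

abbreviation K where "K \<equiv> tens_ker Mid M N"
abbreviation cl where "cl \<equiv> tens_class Mid M N"
abbreviation FG :: "('a \<times> 'b \<Rightarrow>\<^sub>0 int) \<Rightarrow> bool" where
  "FG u \<equiv> Poly_Mapping.keys u \<subseteq> carrier M \<times> carrier N"
definition pt :: "'a \<Rightarrow> 'b \<Rightarrow> ('a \<times> 'b \<Rightarrow>\<^sub>0 int) set" where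
  "pt m n = cl (frag_of (m, n))"

lemma FG_add: "FG u \<Longrightarrow> FG v \<Longrightarrow> FG (u + v)"
  using Poly_Mapping.keys_add[of u v] by blast

lemma FG_diff: "FG u \<Longrightarrow> FG v \<Longrightarrow> FG (u - v)"
  using keys_diff[of u v] by blast

lemma FG_frag_of: "m \<in> carrier M \<Longrightarrow> n \<in> carrier N \<Longrightarrow> FG (frag_of (m, n))"
  by (simp add: keys_frag_of)

lemma FG_sum: "(\<And>i. i \<in> I \<Longrightarrow> FG (f i)) \<Longrightarrow> FG (sum f I)"
  by (induction I rule: infinite_finite_induct) (simp_all add: FG_add)

lemma rels_FG: "u \<in> tens_rels Mid M N \<Longrightarrow> FG u"
  unfolding tens_rels_def
  by (elim UnE CollectE exE conjE; simp only:; intro FG_diff FG_frag_of) (auto dest: Mid)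

lemma subgroup_K: "subgroup K (tens_free M N)"
  unfolding tens_ker_def tens_free_def
  by (rule group.generate_is_subgroup) (auto dest: rels_FG)

lemma K_FG: "u \<in> K \<Longrightarrow> FG u"
  using subgroup.mem_carrier[OF subgroup_K] by (auto simp: tens_free_def)

lemma K_0: "0 \<in> K"
  using subgroup.one_closed[OF subgroup_K] by (simp add: tens_free_def)

lemma K_add: "u \<in> K \<Longrightarrow> v \<in> K \<Longrightarrow> u + v \<in> K"
  using subgroup.m_closed[OF subgroup_K, of u v] by (simp add: tens_free_def)

lemma K_uminus: "u \<in> K \<Longrightarrow> - u \<in> K"
  using subgroup.m_inv_closed[OF subgroup_K, of u] K_FG[of u] by (simp add: tens_free_def)

lemma K_rels: "u \<in> tens_rels Mid M N \<Longrightarrow> u \<in> K"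
  unfolding tens_ker_def by (rule generate.incl)

lemma K_induct [consumes 1, case_names zero rel uminus add]:
  assumes "u \<in> K" "P 0" "\<And>u. u \<in> tens_rels Mid M N \<Longrightarrow> P u"
    "\<And>u. u \<in> K \<Longrightarrow> P u \<Longrightarrow> P (- u)" "\<And>u v. u \<in> K \<Longrightarrow> v \<in> K \<Longrightarrow> P u \<Longrightarrow> P v \<Longrightarrow> P (u + v)"
  shows "P u"
proof -
  have "u \<in> generate (tens_free M N) (tens_rels Mid M N)" using assms(1) by (simp add: tens_ker_def)
  then show ?thesis
  proof (induction rule: generate.induct)
    case (inv h)
    then show ?case using assms(3,4)[of h] K_rels[of h] rels_FG[of h] by (simp add: tens_free_def)
  next
    case (eng h1 h2)
    then show ?case using assms(5) by (simp add: tens_free_def tens_ker_def)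
  qed (use assms(2,3) in \<open>simp_all add: tens_free_def\<close>)
qed

lemma cl_eq_image: "cl u = (\<lambda>k. k + u) ` K"
  by (auto simp: tens_class_def r_coset_def tens_free_def)

lemma cl_eq_iff: "cl u = cl v \<longleftrightarrow> u - v \<in> K"
proof
  assume "cl u = cl v"
  moreover have "u \<in> cl u" unfolding cl_eq_image using K_0 by force
  ultimately obtain k where "k \<in> K" "u = k + v" by (auto simp: cl_eq_image)
  then show "u - v \<in> K" by simp
next
  have *: "cl u \<subseteq> cl v" if "u - v \<in> K" for u v
  proof
    fix w assume "w \<in> cl u"
    then obtain k where "k \<in> K" "w = k + u" by (auto simp: cl_eq_image)
    then show "w \<in> cl v" unfolding cl_eq_image
      using K_add[OF \<open>k \<in> K\<close> that] by (intro image_eqI[of _ _ "k + (u - v)"]) auto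
  qed
  assume "u - v \<in> K"
  then show "cl u = cl v" using *[of u v] *[of v u] K_uminus[of "u - v"] by simp
qed

lemma cl_add_cong: "cl u = cl u' \<Longrightarrow> cl v = cl v' \<Longrightarrow> cl (u + v) = cl (u' + v')"
  unfolding cl_eq_iff by (drule (1) K_add) (simp add: algebra_simps)

lemma cl_uminus_cong: "cl u = cl u' \<Longrightarrow> cl (- u) = cl (- u')"
  unfolding cl_eq_iff by (drule K_uminus) (simp add: algebra_simps)

lemma cl_sum_cong: "(\<And>i. i \<in> I \<Longrightarrow> cl (f i) = cl (g i)) \<Longrightarrow> cl (sum f I) = cl (sum g I)"
  by (induction I rule: infinite_finite_induct) (auto intro!: cl_add_cong)

lemma pt_rel_add1:
  "m \<in> carrier M \<Longrightarrow> m' \<in> carrier M \<Longrightarrow> n \<in> carrier N \<Longrightarrow>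
   cl (frag_of (m \<oplus>\<^bsub>M\<^esub> m', n)) = cl (frag_of (m, n) + frag_of (m', n))"
  unfolding cl_eq_iff by (rule K_rels) (auto simp: tens_rels_def diff_diff_add)

lemma pt_rel_add2:
  "m \<in> carrier M \<Longrightarrow> n \<in> carrier N \<Longrightarrow> n' \<in> carrier N \<Longrightarrow>
   cl (frag_of (m, n \<oplus>\<^bsub>N\<^esub> n')) = cl (frag_of (m, n) + frag_of (m, n'))"
  unfolding cl_eq_iff by (rule K_rels) (auto simp: tens_rels_def diff_diff_add)

lemma pt_balanced:
  "(a, b) \<in> Mid \<Longrightarrow> m \<in> carrier M \<Longrightarrow> n \<in> carrier N \<Longrightarrow> pt (a \<odot>\<^bsub>M\<^esub> m) n = pt m (b \<odot>\<^bsub>N\<^esub> n)"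
  unfolding cl_eq_iff pt_def by (rule K_rels) (auto simp: tens_rels_def)

lemma tens_carrier: "carrier (tens Mid l r M N) = cl ` {u. FG u}"
  by (auto simp: tens_def FactGroup_def RCOSETS_def tens_free_def tens_class_def)

lemma tens_zero: "\<zero>\<^bsub>tens Mid l r M N\<^esub> = cl 0"
  by (simp add: tens_def FactGroup_def cl_eq_image)

lemma tens_add: "cl u \<oplus>\<^bsub>tens Mid l r M N\<^esub> cl v = cl (u + v)"
proof -
  have "cl u \<oplus>\<^bsub>tens Mid l r M N\<^esub> cl v = (\<Union>x\<in>cl u. \<Union>y\<in>cl v. {x + y})"
    by (simp add: tens_def FactGroup_def set_mult_def tens_free_def)
  also have "\<dots> = cl (u + v)"
  proof (intro equalityI subsetI)
    fix w assume "w \<in> (\<Union>x\<in>cl u. \<Union>y\<in>cl v. {x + y})"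
    then obtain k k' where "k \<in> K" "k' \<in> K" "w = (k + u) + (k' + v)" by (auto simp: cl_eq_image)
    then show "w \<in> cl (u + v)"
      unfolding cl_eq_image by (intro image_eqI[of _ _ "k + k'"]) (auto simp: K_add algebra_simps)
  next
    fix w assume "w \<in> cl (u + v)"
    then obtain k where "k \<in> K" "w = (k + u) + (0 + v)" by (auto simp: cl_eq_image algebra_simps)
    then show "w \<in> (\<Union>x\<in>cl u. \<Union>y\<in>cl v. {x + y})" unfolding cl_eq_image using K_0 by blast
  qed
  finally show ?thesis .
qed

lemma cl_closed: "FG u \<Longrightarrow> cl u \<in> carrier (tens Mid l r M N)"
  by (auto simp: tens_carrier)

lemma pt_closed: "m \<in> carrier M \<Longrightarrow> n \<in> carrier N \<Longrightarrow> pt m n \<in> carrier (tens Mid l r M N)"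
  unfolding pt_def by (intro cl_closed FG_frag_of)

lemma abelian_group_tens: "abelian_group (tens Mid l r M N)"
proof (rule abelian_groupI)
  fix x assume "x \<in> carrier (tens Mid l r M N)"
  then obtain u where u: "FG u" "x = cl u" by (auto simp: tens_carrier)
  then show "\<exists>y\<in>carrier (tens Mid l r M N). y \<oplus>\<^bsub>tens Mid l r M N\<^esub> x = \<zero>\<^bsub>tens Mid l r M N\<^esub>"
    by (intro bexI[of _ "cl (- u)"]) (auto simp: tens_zero tens_add intro!: cl_closed)
qed (auto simp: tens_carrier tens_add tens_zero algebra_simps intro!: imageI dest!: subsetD[OF Poly_Mapping.keys_add])

lemma pt_add1:
  "m \<in> carrier M \<Longrightarrow> m' \<in> carrier M \<Longrightarrow> n \<in> carrier N \<Longrightarrow>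
   pt (m \<oplus>\<^bsub>M\<^esub> m') n = pt m n \<oplus>\<^bsub>tens Mid l r M N\<^esub> pt m' n"
  by (simp add: pt_def tens_add pt_rel_add1)

lemma pt_add2:
  "m \<in> carrier M \<Longrightarrow> n \<in> carrier N \<Longrightarrow> n' \<in> carrier N \<Longrightarrow>
   pt m (n \<oplus>\<^bsub>N\<^esub> n') = pt m n \<oplus>\<^bsub>tens Mid l r M N\<^esub> pt m n'"
  by (simp add: pt_def tens_add pt_rel_add2)

lemma cl_frag_zero1: "n \<in> carrier N \<Longrightarrow> cl (frag_of (\<zero>\<^bsub>M\<^esub>, n)) = cl 0"
  using pt_rel_add1[of "\<zero>\<^bsub>M\<^esub>" "\<zero>\<^bsub>M\<^esub>" n] by (simp add: cl_eq_iff) (use K_uminus in fastforce)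

lemma cl_frag_zero2: "m \<in> carrier M \<Longrightarrow> cl (frag_of (m, \<zero>\<^bsub>N\<^esub>)) = cl 0"
  using pt_rel_add2[of m "\<zero>\<^bsub>N\<^esub>" "\<zero>\<^bsub>N\<^esub>"] by (simp add: cl_eq_iff) (use K_uminus in fastforce)

lemma pt_zero1: "n \<in> carrier N \<Longrightarrow> pt \<zero>\<^bsub>M\<^esub> n = \<zero>\<^bsub>tens Mid l r M N\<^esub>"
  by (simp add: pt_def cl_frag_zero1 tens_zero)

lemma pt_zero2: "m \<in> carrier M \<Longrightarrow> pt m \<zero>\<^bsub>N\<^esub> = \<zero>\<^bsub>tens Mid l r M N\<^esub>"
  by (simp add: pt_def cl_frag_zero2 tens_zero)

lemma cl_frag_neg1:
  assumes "m \<in> carrier M" "n \<in> carrier N"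
  shows "cl (- frag_of (m, n)) = cl (frag_of (\<ominus>\<^bsub>M\<^esub> m, n))"
proof -
  have "cl (frag_of (m, n) + frag_of (\<ominus>\<^bsub>M\<^esub> m, n)) = cl 0"
    using pt_rel_add1[of m "\<ominus>\<^bsub>M\<^esub> m" n] assms by (simp add: M.r_neg cl_frag_zero1)
  then show ?thesis unfolding cl_eq_iff by (drule_tac K_uminus) (simp add: algebra_simps)
qed

text \<open>A class is a difference of sums of pure tensors, and minus a pure tensor is the pure
  tensor with negated first factor. Hence closure under sums suffices.\<close>

lemma tens_induct [consumes 1, case_names pt add]:
  assumes "t \<in> carrier (tens Mid l r M N)"
    and pt: "\<And>m n. m \<in> carrier M \<Longrightarrow> n \<in> carrier N \<Longrightarrow> P (pt m n)"
    and add: "\<And>s t. s \<in> carrier (tens Mid l r M N) \<Longrightarrow> t \<in> carrier (tens Mid l r M N) \<Longrightarrow>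
      P s \<Longrightarrow> P t \<Longrightarrow> P (s \<oplus>\<^bsub>tens Mid l r M N\<^esub> t)"
  shows "P t"
proof -
  obtain u where u: "FG u" "t = cl u" using assms(1) by (auto simp: tens_carrier)
  \<comment> \<open>\<open>P\<close> is carried along for \<open>u\<close> and \<open>- u\<close>
    together, since \<open>frag_induction\<close> builds elements by differences.\<close>
  have "P (cl u) \<and> P (cl (- u)) \<and> FG u"
    using u(1)
  proof (induction u rule: frag_induction)
    case zero
    show ?case using pt[of "\<zero>\<^bsub>M\<^esub>" "\<zero>\<^bsub>N\<^esub>"] by (simp add: pt_def cl_frag_zero1)
  next
    case (one x)
    then obtain m n where [simp]: "x = (m, n)" "m \<in> carrier M" "n \<in> carrier N" by auto
    show ?case using pt[of m n] pt[of "\<ominus>\<^bsub>M\<^esub> m" n]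
      by (simp add: pt_def cl_frag_neg1 FG_frag_of)
  next
    case (diff a b)
    then have *: "P (cl a \<oplus>\<^bsub>tens Mid l r M N\<^esub> cl (- b))" "P (cl b \<oplus>\<^bsub>tens Mid l r M N\<^esub> cl (- a))"
      by (auto intro!: add cl_closed)
    with diff show ?case by (simp add: tens_add FG_diff)
  qed
  then show ?thesis using u by simp
qed

lemma tens_span_closed: "S \<subseteq> carrier M \<times> carrier N \<Longrightarrow> tens_span Mid M N S \<subseteq> carrier (tens Mid l r M N)"
  by (auto simp: tens_span_def tens_carrier)

text \<open>The closure of \<open>S\<close> under \<open>\<ominus>\<close> in the first factor makes additive closure sufficient.\<close>

lemma tens_span_induct [consumes 4, case_names pt add]:
  assumes t: "t \<in> tens_span Mid M N S" and S: "S \<subseteq> carrier M \<times> carrier N"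
    and neg: "\<forall>m n. (m, n) \<in> S \<longrightarrow> (\<ominus>\<^bsub>M\<^esub> m, n) \<in> S" and ne: "(\<zero>\<^bsub>M\<^esub>, \<zero>\<^bsub>N\<^esub>) \<in> S"
    and pt: "\<And>m n. (m, n) \<in> S \<Longrightarrow> P (pt m n)"
    and add: "\<And>s t. s \<in> tens_span Mid M N S \<Longrightarrow> t \<in> tens_span Mid M N S \<Longrightarrow>
      P s \<Longrightarrow> P t \<Longrightarrow> P (s \<oplus>\<^bsub>tens Mid l r M N\<^esub> t)"
  shows "P t"
proof -
  obtain u where u: "Poly_Mapping.keys u \<subseteq> S" "t = cl u" using t by (auto simp: tens_span_def)
  have "P (cl u) \<and> P (cl (- u)) \<and> Poly_Mapping.keys u \<subseteq> S"
    using u(1)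
  proof (induction u rule: frag_induction)
    case zero
    show ?case using pt[OF ne] by (simp add: pt_def cl_frag_zero1)
  next
    case (one x)
    then obtain m n where [simp]: "x = (m, n)" "(m, n) \<in> S" "m \<in> carrier M" "n \<in> carrier N"
      using S by (cases x) auto
    show ?case using pt[of m n] pt[OF neg[rule_format], of m n]
      by (simp add: pt_def cl_frag_neg1 keys_frag_of)
  next
    case (diff a b)
    have sp: "cl u \<in> tens_span Mid M N S" if "Poly_Mapping.keys u \<subseteq> S" for u
      using that by (auto simp: tens_span_def)
    have *: "P (cl a \<oplus>\<^bsub>tens Mid l r M N\<^esub> cl (- b))" "P (cl b \<oplus>\<^bsub>tens Mid l r M N\<^esub> cl (- a))"
      using diff by (auto intro!: add sp)
    with diff show ?case using keys_diff[of a b] by (auto simp add: tens_add)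
  qed
  then show ?thesis using u by simp
qed

lemma tens_span_pt: "(m, n) \<in> S \<Longrightarrow> pt m n \<in> tens_span Mid M N S"
  unfolding tens_span_def pt_def by (rule imageI) (simp add: keys_frag_of)

lemma tens_span_add:
  "s \<in> tens_span Mid M N S \<Longrightarrow> t \<in> tens_span Mid M N S \<Longrightarrow> s \<oplus>\<^bsub>tens Mid l r M N\<^esub> t \<in> tens_span Mid M N S"
  unfolding tens_span_def
proof (elim imageE)
  fix u v assume "s = cl u" "t = cl v" "u \<in> carrier (free_Abelian_group S)" "v \<in> carrier (free_Abelian_group S)"
  moreover from this have "Poly_Mapping.keys (u + v) \<subseteq> S"
    using Poly_Mapping.keys_add[of u v] by auto
  ultimately show "s \<oplus>\<^bsub>tens Mid l r M N\<^esub> t \<in> cl ` carrier (free_Abelian_group S)"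
    by (simp add: tens_add)
qed

lemma tens_span_zero: "\<zero>\<^bsub>tens Mid l r M N\<^esub> \<in> tens_span Mid M N S"
  unfolding tens_span_def tens_zero by (rule imageI) simp

lemma tens_span_mono: "S \<subseteq> S' \<Longrightarrow> tens_span Mid M N S \<subseteq> tens_span Mid M N S'"
  unfolding tens_span_def by auto

lemma tens_span_neg:
  assumes "t \<in> tens_span Mid M N S" and S: "S \<subseteq> carrier M \<times> carrier N"
  shows "\<ominus>\<^bsub>tens Mid l r M N\<^esub> t \<in> tens_span Mid M N S"
proof -
  interpret T: abelian_group "tens Mid l r M N" by (rule abelian_group_tens)
  obtain u where u: "Poly_Mapping.keys u \<subseteq> S" "t = cl u" using assms by (auto simp: tens_span_def)
  have "\<ominus>\<^bsub>tens Mid l r M N\<^esub> t = cl (- u)"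
    using u S by (intro T.minus_equality) (auto simp: tens_add tens_zero intro!: cl_closed)
  then show ?thesis using u by (auto simp: tens_span_def)
qed

end

text \<open>\<open>tens_ind\<close> is a union of classes over all representatives of a coset. If
  \<open>\<phi>\<close> respects the three kinds of relations up to classes, its additive extension
  maps kernel to kernel; then all these classes coincide and the union is a single class.\<close>

lemma tens_ind_cl:
  assumes A: "bitensor Mid M N VM VN" and B: "bitensor Mid' M' N' VM' VN'"
    and phi: "\<And>m n. m \<in> carrier M \<Longrightarrow> n \<in> carrier N \<Longrightarrow> Poly_Mapping.keys (\<phi> (m, n)) \<subseteq> carrier M' \<times> carrier N'"
    and add1: "\<And>m m' n. m \<in> carrier M \<Longrightarrow> m' \<in> carrier M \<Longrightarrow> n \<in> carrier N \<Longrightarrow>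
      tens_class Mid' M' N' (\<phi> (m \<oplus>\<^bsub>M\<^esub> m', n)) = tens_class Mid' M' N' (\<phi> (m, n) + \<phi> (m', n))"
    and add2: "\<And>m n n'. m \<in> carrier M \<Longrightarrow> n \<in> carrier N \<Longrightarrow> n' \<in> carrier N \<Longrightarrow>
      tens_class Mid' M' N' (\<phi> (m, n \<oplus>\<^bsub>N\<^esub> n')) = tens_class Mid' M' N' (\<phi> (m, n) + \<phi> (m, n'))"
    and bal: "\<And>a b m n. (a, b) \<in> Mid \<Longrightarrow> m \<in> carrier M \<Longrightarrow> n \<in> carrier N \<Longrightarrow>
      tens_class Mid' M' N' (\<phi> (a \<odot>\<^bsub>M\<^esub> m, n)) = tens_class Mid' M' N' (\<phi> (m, b \<odot>\<^bsub>N\<^esub> n))"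
  shows "tens_ind Mid' M' N' \<phi> (tens_class Mid M N u) = tens_class Mid' M' N' (frag_extend \<phi> u)"
proof -
  interpret A: bitensor Mid M N VM VN by (rule A)
  interpret B: bitensor Mid' M' N' VM' VN' by (rule B)
  have K: "frag_extend \<phi> k \<in> B.K" if "k \<in> A.K" for k
    using that
  proof (induction k rule: A.K_induct)
    case (rel u)
    then show ?case
      unfolding tens_rels_def
      using add1 add2 bal by (auto simp: frag_extend_diff frag_extend_add B.cl_eq_iff diff_diff_add)
  qed (auto simp: frag_extend_minus frag_extend_add B.K_0 B.K_uminus B.K_add)
  have "tens_class Mid' M' N' (frag_extend \<phi> w) = tens_class Mid' M' N' (frag_extend \<phi> u)"
    if "w \<in> A.cl u" for w
    using that K by (auto simp: A.cl_eq_image B.cl_eq_iff frag_extend_add)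
  moreover have "u \<in> A.cl u" unfolding A.cl_eq_image using A.K_0 by force
  ultimately show ?thesis unfolding tens_ind_def by (intro SUP_eq_const; blast)
qed

text \<open>The extension of \<open>g\<close> from pure tensors to the tensor product, evaluated on
  an arbitrarily chosen representative of the coset. The values are coordinate vectors, indexed by
  \<open>k\<close>.\<close>

definition tlift :: "('a \<Rightarrow> 'b \<Rightarrow> 'k \<Rightarrow> mpol) \<Rightarrow> ('a \<times> 'b \<Rightarrow>\<^sub>0 int) set \<Rightarrow> 'k \<Rightarrow> mpol" where
  "tlift g C k = (let u = (SOME u. u \<in> C) in
     \<Sum>x\<in>Poly_Mapping.keys u. of_int (Poly_Mapping.lookup u x) * g (fst x) (snd x) k)"

text \<open>The additive extension \<open>H\<close> of \<open>g\<close> to formal sums vanishes on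
  each relation, hence on the kernel, so the chosen representative does not matter.\<close>

lemma (in bitensor) tlift:
  assumes add1: "\<And>m m' n. m \<in> carrier M \<Longrightarrow> m' \<in> carrier M \<Longrightarrow> n \<in> carrier N \<Longrightarrow>
      g (m \<oplus>\<^bsub>M\<^esub> m') n = g m n + g m' n"
    and add2: "\<And>m n n'. m \<in> carrier M \<Longrightarrow> n \<in> carrier N \<Longrightarrow> n' \<in> carrier N \<Longrightarrow>
      g m (n \<oplus>\<^bsub>N\<^esub> n') = g m n + g m n'"
    and bal: "\<And>a b m n. (a, b) \<in> Mid \<Longrightarrow> m \<in> carrier M \<Longrightarrow> n \<in> carrier N \<Longrightarrow>
      g (a \<odot>\<^bsub>M\<^esub> m) n = g m (b \<odot>\<^bsub>N\<^esub> n)"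
  shows tlift_pt: "m \<in> carrier M \<Longrightarrow> n \<in> carrier N \<Longrightarrow> tlift g (pt m n) = g m n"
    and tlift_add: "s \<in> carrier (tens Mid l r M N) \<Longrightarrow> t \<in> carrier (tens Mid l r M N) \<Longrightarrow>
      tlift g (s \<oplus>\<^bsub>tens Mid l r M N\<^esub> t) = tlift g s + tlift g t"
proof -
  define H where "H u k = (\<Sum>x\<in>Poly_Mapping.keys u. of_int (Poly_Mapping.lookup u x) * g (fst x) (snd x) k)" for u k
  have Hsup: "H u k = (\<Sum>x\<in>A. of_int (Poly_Mapping.lookup u x) * g (fst x) (snd x) k)"
    if "finite A" "Poly_Mapping.keys u \<subseteq> A" for u k A
    unfolding H_def by (rule sum.mono_neutral_left) (use that in \<open>auto simp: in_keys_iff\<close>)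
  have Hadd: "H (u + v) = H u + H v" for u v
  proof
    fix k
    let ?A = "Poly_Mapping.keys u \<union> Poly_Mapping.keys v"
    show "H (u + v) k = (H u + H v) k"
      using Poly_Mapping.keys_add[of u v]
      by (simp add: Hsup[of ?A] lookup_add distrib_right sum.distrib)
  qed
  have H0: "H 0 = 0" by (rule ext) (simp add: H_def)
  have Hm: "H (- u) = - H u" for u
    using Hadd[of u "- u"] H0 by (simp add: eq_neg_iff_add_eq_0 add.commute)
  have Hd: "H (u - v) = H u - H v" for u v
    using Hadd[of u "- v"] by (simp add: Hm)
  have Hf: "H (frag_of (m, n)) = g m n" for m n
    by (rule ext) (simp add: H_def keys_frag_of)
  have HK: "H k = 0" if "k \<in> K" for k
    using that
  proof (induction k rule: K_induct)
    case (rel u)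
    then show ?case
      unfolding tens_rels_def by (auto simp: Hd Hf add1 add2 bal)
  qed (auto simp: H0 Hm Hadd)
  have cl: "tlift g (cl u) = H u" for u
  proof -
    have "u \<in> cl u" unfolding cl_eq_image using K_0 by force
    then have "(SOME w. w \<in> cl u) \<in> cl u" by (rule someI)
    then obtain k where "k \<in> K" "(SOME w. w \<in> cl u) = k + u" unfolding cl_eq_image by auto
    moreover have "tlift g (cl u) = H (SOME w. w \<in> cl u)"
      by (rule ext) (simp add: tlift_def H_def Let_def)
    ultimately show ?thesis by (simp add: Hadd HK)
  qed
  show "m \<in> carrier M \<Longrightarrow> n \<in> carrier N \<Longrightarrow> tlift g (pt m n) = g m n"
    by (simp add: pt_def cl Hf)
  show "s \<in> carrier (tens Mid l r M N) \<Longrightarrow> t \<in> carrier (tens Mid l r M N) \<Longrightarrow>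
      tlift g (s \<oplus>\<^bsub>tens Mid l r M N\<^esub> t) = tlift g s + tlift g t"
    by (auto simp: tens_carrier tens_add cl Hadd)
qed

section \<open>The polynomial ring acting on a tensor product\<close>

locale bitensor_act = bitensor Mid M N VM VN
  for Mid :: "(mpol \<times> mpol) set" and M :: "'a fcx" and N :: "'b fcx" and VM VN :: "var set" +
  fixes l r :: "var \<Rightarrow> mpol" and V :: "var set"
  assumes l: "v \<in> V \<Longrightarrow> l v \<in> PR VM" and r: "v \<in> V \<Longrightarrow> r v \<in> PR VN"
begin

abbreviation T where "T \<equiv> tens Mid l r M N"

sublocale T: abelian_group T by (rule abelian_group_tens)

text \<open>The effect of a single term of a polynomial on a pure tensor, as a formal sum; the
  coefficient goes to the left factor.\<close>

definition sact :: "(var \<Rightarrow>\<^sub>0 nat) \<Rightarrow> rat \<Rightarrow> 'a \<Rightarrow> 'b \<Rightarrow> ('a \<times> 'b \<Rightarrow>\<^sub>0 int)" where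
  "sact e c m n = frag_of ((Cst c * monom_subst l e) \<odot>\<^bsub>M\<^esub> m, monom_subst r e \<odot>\<^bsub>N\<^esub> n)"

lemma mon_l: "Poly_Mapping.keys e \<subseteq> V \<Longrightarrow> monom_subst l e \<in> PR VM"
  by (rule monom_subst_PR[OF l])
lemma mon_r: "Poly_Mapping.keys e \<subseteq> V \<Longrightarrow> monom_subst r e \<in> PR VN"
  by (rule monom_subst_PR[OF r])
lemma mon_cl: "Poly_Mapping.keys e \<subseteq> V \<Longrightarrow> Cst c * monom_subst l e \<in> PR VM"
  by (intro PR_mult PR_Cst mon_l)

lemma M_comm: "a \<in> PR VM \<Longrightarrow> b \<in> PR VM \<Longrightarrow> m \<in> carrier M \<Longrightarrow> a \<odot>\<^bsub>M\<^esub> (b \<odot>\<^bsub>M\<^esub> m) = b \<odot>\<^bsub>M\<^esub> (a \<odot>\<^bsub>M\<^esub> m)"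
  using M.smult_assoc1[of a b m] M.smult_assoc1[of b a m] by (simp add: mult.commute)
lemma N_comm: "a \<in> PR VN \<Longrightarrow> b \<in> PR VN \<Longrightarrow> n \<in> carrier N \<Longrightarrow> a \<odot>\<^bsub>N\<^esub> (b \<odot>\<^bsub>N\<^esub> n) = b \<odot>\<^bsub>N\<^esub> (a \<odot>\<^bsub>N\<^esub> n)"
  using N.smult_assoc1[of a b n] N.smult_assoc1[of b a n] by (simp add: mult.commute)

lemma sact_FG: "Poly_Mapping.keys e \<subseteq> V \<Longrightarrow> m \<in> carrier M \<Longrightarrow> n \<in> carrier N \<Longrightarrow> FG (sact e c m n)"
  unfolding sact_def using mon_cl[of e c] mon_r[of e] by (intro FG_frag_of) auto

lemma smult_def': "p \<odot>\<^bsub>T\<^esub> t = tens_ind Mid M N (\<lambda>(m, n). \<Sum>e\<in>Poly_Mapping.keys p. sact e (Poly_Mapping.lookup p e) m n) t"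
  by (simp add: tens_def sact_def)

lemma smult_cl:
  assumes "p \<in> PR V"
  shows "p \<odot>\<^bsub>T\<^esub> cl u = cl (frag_extend (\<lambda>(m, n). \<Sum>e\<in>Poly_Mapping.keys p. sact e (Poly_Mapping.lookup p e) m n) u)"
  unfolding smult_def'
proof (rule tens_ind_cl[OF bitensor_axioms bitensor_axioms])
  have k: "Poly_Mapping.keys e \<subseteq> V" if "e \<in> Poly_Mapping.keys p" for e
    using assms that by (auto simp: PR_iff)
  note cl_mon = mon_cl[OF k] mon_r[OF k]
  fix m n assume mn: "m \<in> carrier M" "n \<in> carrier N"
  show "FG (case (m, n) of (m, n) \<Rightarrow> \<Sum>e\<in>Poly_Mapping.keys p. sact e (Poly_Mapping.lookup p e) m n)"
    unfolding prod.case using mn k by (intro FG_sum sact_FG)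
  { fix m' assume "m' \<in> carrier M"
    then show "cl (case (m \<oplus>\<^bsub>M\<^esub> m', n) of (m, n) \<Rightarrow> \<Sum>e\<in>Poly_Mapping.keys p. sact e (Poly_Mapping.lookup p e) m n) =
       cl ((case (m, n) of (m, n) \<Rightarrow> \<Sum>e\<in>Poly_Mapping.keys p. sact e (Poly_Mapping.lookup p e) m n) +
          (case (m', n) of (m, n) \<Rightarrow> \<Sum>e\<in>Poly_Mapping.keys p. sact e (Poly_Mapping.lookup p e) m n))"
      unfolding prod.case sum.distrib[symmetric] sact_def using mn
      by (intro cl_sum_cong) (simp add: M.smult_r_distr cl_mon pt_rel_add1 del: PR_mult) }
  { fix n' assume "n' \<in> carrier N"
    then show "cl (case (m, n \<oplus>\<^bsub>N\<^esub> n') of (m, n) \<Rightarrow> \<Sum>e\<in>Poly_Mapping.keys p. sact e (Poly_Mapping.lookup p e) m n) =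
       cl ((case (m, n) of (m, n) \<Rightarrow> \<Sum>e\<in>Poly_Mapping.keys p. sact e (Poly_Mapping.lookup p e) m n) +
          (case (m, n') of (m, n) \<Rightarrow> \<Sum>e\<in>Poly_Mapping.keys p. sact e (Poly_Mapping.lookup p e) m n))"
      unfolding prod.case sum.distrib[symmetric] sact_def using mn
      by (intro cl_sum_cong) (simp add: N.smult_r_distr cl_mon pt_rel_add2 del: PR_mult) }
  { fix a b assume ab: "(a, b) \<in> Mid"
    then show "cl (case (a \<odot>\<^bsub>M\<^esub> m, n) of (m, n) \<Rightarrow> \<Sum>e\<in>Poly_Mapping.keys p. sact e (Poly_Mapping.lookup p e) m n) =
       cl (case (m, b \<odot>\<^bsub>N\<^esub> n) of (m, n) \<Rightarrow> \<Sum>e\<in>Poly_Mapping.keys p. sact e (Poly_Mapping.lookup p e) m n)"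
      unfolding prod.case sact_def using mn Mid[OF ab]
      by (intro cl_sum_cong)
        (simp add: M_comm[of _ a] N_comm[of _ b] cl_mon pt_balanced[unfolded pt_def] del: PR_mult) }
qed

lemma smult_add_t:
  assumes "p \<in> PR V" "s \<in> carrier T" "t \<in> carrier T"
  shows "p \<odot>\<^bsub>T\<^esub> (s \<oplus>\<^bsub>T\<^esub> t) = p \<odot>\<^bsub>T\<^esub> s \<oplus>\<^bsub>T\<^esub> p \<odot>\<^bsub>T\<^esub> t"
  using assms by (auto simp: tens_carrier tens_add smult_cl frag_extend_add)

lemma smult_pt:
  assumes "p \<in> PR V"
  shows "p \<odot>\<^bsub>T\<^esub> pt m n = cl (\<Sum>e\<in>Poly_Mapping.keys p. sact e (Poly_Mapping.lookup p e) m n)"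
  using assms by (simp add: pt_def smult_cl)

lemma smult_pt_closed:
  assumes "p \<in> PR V" "m \<in> carrier M" "n \<in> carrier N"
  shows "p \<odot>\<^bsub>T\<^esub> pt m n \<in> carrier T"
  unfolding smult_pt[OF assms(1)]
  by (intro cl_closed FG_sum sact_FG assms(2,3)) (use assms(1) in \<open>auto simp: PR_iff\<close>)

lemma smult_closed: "p \<in> PR V \<Longrightarrow> t \<in> carrier T \<Longrightarrow> p \<odot>\<^bsub>T\<^esub> t \<in> carrier T"
  by (rotate_tac 1, induction t rule: tens_induct) (auto simp: smult_pt_closed smult_add_t)

lemma sact_0: "Poly_Mapping.keys e \<subseteq> V \<Longrightarrow> m \<in> carrier M \<Longrightarrow> n \<in> carrier N \<Longrightarrow> cl (sact e 0 m n) = cl 0"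
  using M.smult_l_null[of m] mon_r[of e] by (simp add: sact_def cl_frag_zero1)

text \<open>A term with coefficient zero contributes the class of zero. Thus the actions of two
  polynomials and of their sum can be written over one set of exponents.\<close>

lemma smult_pt_superset:
  assumes "p \<in> PR V" "m \<in> carrier M" "n \<in> carrier N" "finite A" "Poly_Mapping.keys p \<subseteq> A"
    "\<And>e. e \<in> A \<Longrightarrow> Poly_Mapping.keys e \<subseteq> V"
  shows "p \<odot>\<^bsub>T\<^esub> pt m n = cl (\<Sum>e\<in>A. sact e (Poly_Mapping.lookup p e) m n)"
proof -
  have "cl (\<Sum>e\<in>A. sact e (Poly_Mapping.lookup p e) m n) =
     cl (\<Sum>e\<in>A. if e \<in> Poly_Mapping.keys p then sact e (Poly_Mapping.lookup p e) m n else 0)"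
    using assms by (intro cl_sum_cong) (auto simp: in_keys_iff sact_0)
  also have "(\<Sum>e\<in>A. if e \<in> Poly_Mapping.keys p then sact e (Poly_Mapping.lookup p e) m n else 0) =
     (\<Sum>e\<in>Poly_Mapping.keys p. sact e (Poly_Mapping.lookup p e) m n)"
    using assms(4,5) by (intro sum.mono_neutral_cong_right) auto
  finally show ?thesis using assms(1) by (simp add: smult_pt)
qed

lemma smult_pt_add:
  assumes "p \<in> PR V" "q \<in> PR V" "m \<in> carrier M" "n \<in> carrier N"
  shows "(p + q) \<odot>\<^bsub>T\<^esub> pt m n = p \<odot>\<^bsub>T\<^esub> pt m n \<oplus>\<^bsub>T\<^esub> q \<odot>\<^bsub>T\<^esub> pt m n"
proof -
  let ?A = "Poly_Mapping.keys p \<union> Poly_Mapping.keys q"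
  have A: "Poly_Mapping.keys e \<subseteq> V" if "e \<in> ?A" for e using assms that by (auto simp: PR_iff)
  have "cl (\<Sum>e\<in>?A. sact e (Poly_Mapping.lookup (p + q) e) m n) =
     cl (\<Sum>e\<in>?A. sact e (Poly_Mapping.lookup p e) m n + sact e (Poly_Mapping.lookup q e) m n)"
  proof (rule cl_sum_cong)
    fix e assume e: "e \<in> ?A"
    show "cl (sact e (Poly_Mapping.lookup (p + q) e) m n) =
       cl (sact e (Poly_Mapping.lookup p e) m n + sact e (Poly_Mapping.lookup q e) m n)"
      using M.smult_l_distr[OF mon_cl[OF A[OF e]] mon_cl[OF A[OF e]] assms(3)] mon_cl[OF A[OF e]] mon_r[OF A[OF e]] assms(3,4)
      by (simp add: sact_def lookup_add Cst_add distrib_right pt_rel_add1)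
  qed
  moreover have "s \<odot>\<^bsub>T\<^esub> pt m n = cl (\<Sum>e\<in>?A. sact e (Poly_Mapping.lookup s e) m n)"
    if "s \<in> PR V" "Poly_Mapping.keys s \<subseteq> ?A" for s
    using that assms A by (intro smult_pt_superset) auto
  ultimately show ?thesis
    using assms Poly_Mapping.keys_add[of p q] by (simp add: tens_add sum.distrib)
qed

lemma smult_l_distr:
  assumes "p \<in> PR V" "q \<in> PR V" "t \<in> carrier T"
  shows "(p + q) \<odot>\<^bsub>T\<^esub> t = p \<odot>\<^bsub>T\<^esub> t \<oplus>\<^bsub>T\<^esub> q \<odot>\<^bsub>T\<^esub> t"
  using assms(3)
proof (induction t rule: tens_induct)
  case (add s t)
  then show ?case using assms(1,2)
    by (simp add: smult_add_t smult_closed T.a_ac)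
qed (rule smult_pt_add[OF assms(1,2)])

lemma smult_single:
  assumes "Poly_Mapping.keys e \<subseteq> V" "m \<in> carrier M" "n \<in> carrier N"
  shows "Poly_Mapping.single e c \<odot>\<^bsub>T\<^esub> pt m n = pt ((Cst c * monom_subst l e) \<odot>\<^bsub>M\<^esub> m) (monom_subst r e \<odot>\<^bsub>N\<^esub> n)"
  using assms by (subst smult_pt_superset[of _ m n "{e}"]) (auto simp: pt_def sact_def)

lemma smult_single_single:
  assumes "Poly_Mapping.keys e \<subseteq> V" "Poly_Mapping.keys e' \<subseteq> V" "m \<in> carrier M" "n \<in> carrier N"
  shows "(Poly_Mapping.single e c * Poly_Mapping.single e' c') \<odot>\<^bsub>T\<^esub> pt m n =
     Poly_Mapping.single e c \<odot>\<^bsub>T\<^esub> (Poly_Mapping.single e' c' \<odot>\<^bsub>T\<^esub> pt m n)"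
  using assms M.smult_assoc1[OF mon_cl[OF assms(1), of c] mon_cl[OF assms(2), of c'] assms(3)]
    N.smult_assoc1[OF mon_r[OF assms(1)] mon_r[OF assms(2)] assms(4)]
    M.smult_closed[OF mon_cl[OF assms(2), of c'] assms(3)] N.smult_closed[OF mon_r[OF assms(2)] assms(4)]
  by (simp add: mult_single smult_single keys_add_nat monom_subst_add Cst_mult ac_simps)

text \<open>Both sides are additive in each polynomial, which reduces the claim to two terms; there
  it is multiplicativity of the substitutions \<open>l\<close> and \<open>r\<close>.\<close>

lemma smult_assoc_pt:
  assumes "p \<in> PR V" "q \<in> PR V" "m \<in> carrier M" "n \<in> carrier N"
  shows "(p * q) \<odot>\<^bsub>T\<^esub> pt m n = p \<odot>\<^bsub>T\<^esub> (q \<odot>\<^bsub>T\<^esub> pt m n)"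
proof -
  have pt: "pt m n \<in> carrier T" using assms by (simp add: pt_closed)
  have z: "0 \<odot>\<^bsub>T\<^esub> t = \<zero>\<^bsub>T\<^esub>" if "t \<in> carrier T" for t
    using smult_l_distr[of 0 0 t] smult_closed[of 0 t] that by simp
  have z': "p \<odot>\<^bsub>T\<^esub> \<zero>\<^bsub>T\<^esub> = \<zero>\<^bsub>T\<^esub>" if "p \<in> PR V" for p
    using smult_add_t[of p "\<zero>\<^bsub>T\<^esub>" "\<zero>\<^bsub>T\<^esub>"] smult_closed[of p "\<zero>\<^bsub>T\<^esub>"] that by simp
  show ?thesis
    using assms(1)
  proof (induction p rule: PR_induct_single)
    case zero
    then show ?case using pt z[OF smult_closed, OF assms(2) pt] by (simp add: z)
  next
    case (add p q')
    then show ?case using pt assms(2) by (simp add: distrib_right smult_l_distr smult_closed)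
  next
    case (single e c)
    show ?case using assms(2)
    proof (induction q rule: PR_induct_single)
      case zero
      then show ?case using pt single by (simp add: z z')
    next
      case (add p q)
      then show ?case using pt single by (simp add: distrib_left smult_l_distr smult_closed smult_add_t)
    qed (use single assms in \<open>simp add: smult_single_single\<close>)
  qed
qed

lemma module_T: "module (pol V) T"
proof (rule moduleI)
  fix p q t assume A: "p \<in> PR V" "q \<in> PR V" "t \<in> carrier T"
  from A(3) show "(p \<otimes>\<^bsub>pol V\<^esub> q) \<odot>\<^bsub>T\<^esub> t = p \<odot>\<^bsub>T\<^esub> (q \<odot>\<^bsub>T\<^esub> t)"
    by (induction t rule: tens_induct) (use A(1,2) in \<open>simp_all add: smult_assoc_pt smult_add_t smult_closed\<close>)
next
  fix t assume "t \<in> carrier T"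
  then show "\<one>\<^bsub>pol V\<^esub> \<odot>\<^bsub>T\<^esub> t = t"
  proof (induction t rule: tens_induct)
    case (pt m n)
    have "Poly_Mapping.single 0 1 \<odot>\<^bsub>T\<^esub> pt m n = pt m n"
      using pt M.smult_one[of m] N.smult_one[of n] by (subst smult_single) simp_all
    then show ?case by simp
  qed (simp add: smult_add_t)
qed (auto simp: T.abelian_group_axioms smult_closed smult_l_distr smult_add_t)

sublocale TM: module "pol V" T by (rule module_T)

lemma smult_pt_left:
  assumes "W \<subseteq> V" "p \<in> PR W" "\<And>v. v \<in> W \<Longrightarrow> r v = 1" "m \<in> carrier M" "n \<in> carrier N"
  shows "p \<odot>\<^bsub>T\<^esub> pt m n = pt (pol_subst l p \<odot>\<^bsub>M\<^esub> m) n"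
  using assms(2)
proof (induction p rule: PR_induct_single)
  case zero
  then show ?case using assms M.smult_l_null[of m] TM.smult_l_null[of "pt m n"] by (simp add: pt_zero1[where l=l and r=r] pt_closed)
next
  case (add p q)
  have *: "pol_subst l p \<in> PR VM" "pol_subst l q \<in> PR VM" "p \<in> PR V" "q \<in> PR V"
    using add assms(1) l by (auto intro!: pol_subst_PR[of W] intro: PR_mono)
  with add show ?case using assms M.smult_l_distr[of "pol_subst l p" "pol_subst l q" m]
    by (simp add: smult_pt_add pol_subst_add pt_add1[symmetric])
next
  case (single e c)
  then have "monom_subst r e = 1" "Poly_Mapping.keys e \<subseteq> V" using assms(1,3) by (auto intro!: monom_subst_1)
  then show ?case using assms N.smult_one[of n] by (simp add: smult_single)
qed

text \<open>The monomials act on the right factor alone, but the coefficients first land on the left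
  factor; \<open>Mid_Cst\<close> moves them across.\<close>

lemma smult_pt_right:
  assumes "W \<subseteq> V" "p \<in> PR W" "\<And>v. v \<in> W \<Longrightarrow> l v = 1" "m \<in> carrier M" "n \<in> carrier N"
  shows "p \<odot>\<^bsub>T\<^esub> pt m n = pt m (pol_subst r p \<odot>\<^bsub>N\<^esub> n)"
  using assms(2)
proof (induction p rule: PR_induct_single)
  case zero
  then show ?case using assms N.smult_l_null[of n] TM.smult_l_null[of "pt m n"] by (simp add: pt_zero2[where l=l and r=r] pt_closed)
next
  case (add p q)
  have *: "pol_subst r p \<in> PR VN" "pol_subst r q \<in> PR VN" "p \<in> PR V" "q \<in> PR V"
    using add assms(1) r by (auto intro!: pol_subst_PR[of W] intro: PR_mono)
  with add show ?case using assms N.smult_l_distr[of "pol_subst r p" "pol_subst r q" n]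
    by (simp add: smult_pt_add pol_subst_add pt_add2[symmetric])
next
  case (single e c)
  then have e: "monom_subst l e = 1" "Poly_Mapping.keys e \<subseteq> V" using assms(1,3) by (auto intro!: monom_subst_1)
  then show ?case using assms mon_r[OF e(2)] N.smult_assoc1[of "Cst c" "monom_subst r e" n]
    by (simp add: smult_single pt_balanced[OF Mid_Cst])
qed

lemma smult_pt_Var:
  assumes "v \<in> V" "m \<in> carrier M" "n \<in> carrier N"
  shows "Var v \<odot>\<^bsub>T\<^esub> pt m n = pt (l v \<odot>\<^bsub>M\<^esub> m) (r v \<odot>\<^bsub>N\<^esub> n)"
  using smult_single[of "Poly_Mapping.single v 1" m n 1] assms by (simp add: Var_def)

end

section \<open>Bimodules that are free over the right polynomial ring\<close>

text \<open>Vectors are total functions that vanish off \<open>K\<close>, so that modules with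
  different index sets can share one index type.\<close>

definition vecs :: "nat \<Rightarrow> 'k set \<Rightarrow> ('k \<Rightarrow> mpol) set" where
  "vecs n K = {v. (\<forall>k. v k \<in> RX n) \<and> (\<forall>k. k \<notin> K \<longrightarrow> v k = 0)}"

definition unitv :: "'k \<Rightarrow> 'k \<Rightarrow> mpol" where
  "unitv k j = (if j = k then 1 else 0)"

lemma RX_XY: "p \<in> RX n \<Longrightarrow> p \<in> PR (XY n)"
  by (rule PR_mono) auto

lemma unitv_vecs: "k \<in> K \<Longrightarrow> unitv k \<in> vecs n K"
  by (auto simp: vecs_def unitv_def)

lemma PR_empty_qhom: "p \<in> PR {} \<Longrightarrow> p \<in> qhom 0"
  by (auto simp: PR_iff qhom_iff mdeg_def)

lemma module_pol_mono:
  assumes "module (pol V) A" "W \<subseteq> V" shows "module (pol W) A"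
proof -
  interpret module "pol V" A by (rule assms(1))
  have W: "p \<in> PR V" if "p \<in> PR W" for p using PR_mono[OF assms(2) that] .
  show ?thesis
    using smult_l_distr smult_r_distr smult_assoc1 smult_one
    by (intro moduleI) (auto simp: abelian_group_axioms W)
qed

text \<open>A module without differential in the single \<open>a\<close>-degree \<open>a\<close>,
  free of finite rank over the right variables, with basis elements of \<open>q\<close>-degree
  \<open>qd k\<close>; \<open>\<Phi>\<close> takes coordinates. Since \<open>\<Phi>\<close> is only
  known to be linear over the right variables, homogeneity of the action of all variables is a
  separate condition, \<open>smult_hom\<close>.\<close>

locale xfree =
  fixes n :: nat and A :: "('m, 'e) gcx_scheme" and K :: "'k set" and \<Phi> :: "'m \<Rightarrow> 'k \<Rightarrow> mpol"
    and a :: int and qd :: "'k \<Rightarrow> int"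
  assumes module_A: "module (pol (XY n)) A" and finite_K: "finite K"
    and bij: "bij_betw \<Phi> (carrier A) (vecs n K)"
    and Phi_add: "x \<in> carrier A \<Longrightarrow> y \<in> carrier A \<Longrightarrow> \<Phi> (x \<oplus>\<^bsub>A\<^esub> y) = \<Phi> x + \<Phi> y"
    and Phi_smult: "p \<in> RX n \<Longrightarrow> x \<in> carrier A \<Longrightarrow> \<Phi> (p \<odot>\<^bsub>A\<^esub> x) = (\<lambda>k. p * \<Phi> x k)"
    and cmp_eq: "cmp A i q = (if i = a then {x\<in>carrier A. \<forall>k. \<Phi> x k \<in> qhom (q - qd k)} else {\<zero>\<^bsub>A\<^esub>})"
    and smult_hom: "p \<in> PR (XY n) \<Longrightarrow> p \<in> qhom d \<Longrightarrow> x \<in> cmp A a q \<Longrightarrow> p \<odot>\<^bsub>A\<^esub> x \<in> cmp A a (q + d)"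
    and bd_zero: "x \<in> carrier A \<Longrightarrow> bd A x = \<zero>\<^bsub>A\<^esub>"
begin

sublocale module "pol (XY n)" A by (rule module_A)

lemma Phi_zero [simp]: "\<Phi> \<zero>\<^bsub>A\<^esub> = 0"
  using Phi_add[of "\<zero>\<^bsub>A\<^esub>" "\<zero>\<^bsub>A\<^esub>"] by simp

lemma Phi_neg: "x \<in> carrier A \<Longrightarrow> \<Phi> (\<ominus>\<^bsub>A\<^esub> x) = - \<Phi> x"
  using Phi_add[of x "\<ominus>\<^bsub>A\<^esub> x"] by (simp add: M.r_neg eq_neg_iff_add_eq_0 add.commute)

lemma Phi_inject: "x \<in> carrier A \<Longrightarrow> y \<in> carrier A \<Longrightarrow> \<Phi> x = \<Phi> y \<Longrightarrow> x = y"
  using bij by (auto simp: bij_betw_def inj_on_def)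

lemma Phi_vecs: "x \<in> carrier A \<Longrightarrow> \<Phi> x \<in> vecs n K"
  using bij by (auto simp: bij_betw_def)

definition \<Psi> where "\<Psi> = inv_into (carrier A) \<Phi>"

lemma Psi_closed: "v \<in> vecs n K \<Longrightarrow> \<Psi> v \<in> carrier A"
  using bij unfolding \<Psi>_def bij_betw_def by (metis inv_into_into)

lemma Phi_Psi: "v \<in> vecs n K \<Longrightarrow> \<Phi> (\<Psi> v) = v"
  using bij unfolding \<Psi>_def bij_betw_def by (metis f_inv_into_f)

lemma Psi_Phi: "x \<in> carrier A \<Longrightarrow> \<Psi> (\<Phi> x) = x"
  using bij unfolding \<Psi>_def bij_betw_def by (metis inv_into_f_f)

lemma Phi_finsum:
  assumes "finite I" "\<And>i. i \<in> I \<Longrightarrow> f i \<in> carrier A"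
  shows "\<Phi> (\<Oplus>\<^bsub>A\<^esub>i\<in>I. f i) = (\<lambda>k. \<Sum>i\<in>I. \<Phi> (f i) k)"
  using assms
proof (induction I rule: finite_induct)
  case (insert i I)
  have "(\<Oplus>\<^bsub>A\<^esub>i\<in>insert i I. f i) = f i \<oplus>\<^bsub>A\<^esub> (\<Oplus>\<^bsub>A\<^esub>i\<in>I. f i)"
    using insert by (intro M.finsum_insert) auto
  moreover have "(\<Oplus>\<^bsub>A\<^esub>i\<in>I. f i) \<in> carrier A" using insert by (intro M.finsum_closed) auto
  ultimately show ?case using insert by (simp add: Phi_add plus_fun_def)
qed (simp add: zero_fun_def)

lemma cmp_carrier: "cmp A i q \<subseteq> carrier A"
  by (auto simp: cmp_eq)

lemma cmp_zero: "\<zero>\<^bsub>A\<^esub> \<in> cmp A i q"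
  by (auto simp: cmp_eq)

lemma cmp_add: "x \<in> cmp A i q \<Longrightarrow> y \<in> cmp A i q \<Longrightarrow> x \<oplus>\<^bsub>A\<^esub> y \<in> cmp A i q"
  by (auto simp: cmp_eq Phi_add split: if_splits)

lemma cmp_neg: "x \<in> cmp A i q \<Longrightarrow> \<ominus>\<^bsub>A\<^esub> x \<in> cmp A i q"
  by (auto simp: cmp_eq Phi_neg split: if_splits)

text \<open>The component of \<open>q\<close>-degree \<open>q\<close>: a coefficient of the basis
  element \<open>k\<close> must then have degree \<open>q - qd k\<close>.\<close>

definition hproj :: "int \<Rightarrow> 'm \<Rightarrow> 'm" where
  "hproj q x = \<Psi> (\<lambda>k. hpart (q - qd k) (\<Phi> x k))"

definition hdec :: "'m \<Rightarrow> int \<times> int \<Rightarrow> 'm" where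
  "hdec x = (\<lambda>(i, q). if i = a then hproj q x else \<zero>\<^bsub>A\<^esub>)"

lemma hpart_vecs: "v \<in> vecs n K \<Longrightarrow> (\<lambda>k. hpart (q - qd k) (v k)) \<in> vecs n K"
  by (auto simp: vecs_def)

lemma hproj_closed: "x \<in> carrier A \<Longrightarrow> hproj q x \<in> carrier A"
  unfolding hproj_def by (intro Psi_closed hpart_vecs Phi_vecs)

lemma Phi_hproj: "x \<in> carrier A \<Longrightarrow> \<Phi> (hproj q x) = (\<lambda>k. hpart (q - qd k) (\<Phi> x k))"
  unfolding hproj_def by (intro Phi_Psi hpart_vecs Phi_vecs)

lemma hproj_cmp: "x \<in> carrier A \<Longrightarrow> hproj q x \<in> cmp A a q"
  by (auto simp: cmp_eq hproj_closed Phi_hproj)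

lemma hproj_add: "x \<in> carrier A \<Longrightarrow> y \<in> carrier A \<Longrightarrow> hproj q (x \<oplus>\<^bsub>A\<^esub> y) = hproj q x \<oplus>\<^bsub>A\<^esub> hproj q y"
  by (rule Phi_inject) (auto simp: Phi_hproj hproj_closed Phi_add hpart_add)

lemma hproj_of_cmp: "x \<in> cmp A a q \<Longrightarrow> hproj q' x = (if q' = q then x else \<zero>\<^bsub>A\<^esub>)"
proof (rule Phi_inject)
  assume x: "x \<in> cmp A a q"
  then have xc: "x \<in> carrier A" using cmp_carrier by blast
  have "hpart (q' - qd k) (\<Phi> x k) = (if q' = q then \<Phi> x k else 0)" for k
    using x hpart_of_qhom[of "\<Phi> x k" "q - qd k" "q' - qd k"] by (simp add: cmp_eq)
  then show "\<Phi> (hproj q' x) = \<Phi> (if q' = q then x else \<zero>\<^bsub>A\<^esub>)"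
    using xc by (auto simp: Phi_hproj fun_eq_iff)
  show "hproj q' x \<in> carrier A" "(if q' = q then x else \<zero>\<^bsub>A\<^esub>) \<in> carrier A"
    using xc by (auto simp: hproj_closed)
qed

text \<open>Finitely many coordinates, each with finitely many homogeneous parts, leave finitely
  many nonzero components.\<close>

lemma hom_dec_hdec: assumes x: "x \<in> carrier A" shows "hom_dec A x (hdec x)"
proof -
  let ?S = "{i. hdec x i \<noteq> \<zero>\<^bsub>A\<^esub>}"
  let ?D = "\<Union>k\<in>K. (\<lambda>d. d + qd k) ` {d. hpart d (\<Phi> x k) \<noteq> 0}"
  have nz: "\<exists>k\<in>K. hpart (q - qd k) (\<Phi> x k) \<noteq> 0" if "hproj q x \<noteq> \<zero>\<^bsub>A\<^esub>" for q
  proof (rule ccontr)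
    assume "\<not> ?thesis"
    then have "hpart (q - qd k) (\<Phi> x k) = 0" for k
      using Phi_vecs[OF x] by (cases "k \<in> K") (auto simp: vecs_def)
    then have "\<Phi> (hproj q x) = \<Phi> \<zero>\<^bsub>A\<^esub>" using x by (simp add: Phi_hproj fun_eq_iff)
    then show False using that x by (meson Phi_inject M.zero_closed hproj_closed)
  qed
  have "?S \<subseteq> {a} \<times> ?D"
  proof
    fix i assume "i \<in> ?S"
    then obtain q where i: "i = (a, q)" "hproj q x \<noteq> \<zero>\<^bsub>A\<^esub>" by (cases i) (auto simp: hdec_def split: if_splits)
    then obtain k where "k \<in> K" "hpart (q - qd k) (\<Phi> x k) \<noteq> 0" using nz by blast
    then show "i \<in> {a} \<times> ?D" using i(1) by (auto intro!: bexI[of _ k] image_eqI[of _ _ "q - qd k"])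
  qed
  then have fin: "finite ?S" by (rule finite_subset) (auto intro!: finite_K hpart_finite)
  have cl: "hdec x i \<in> carrier A" for i using x by (auto simp: hdec_def hproj_closed split: prod.split)
  have "\<Phi> (\<Oplus>\<^bsub>A\<^esub>i\<in>?S. hdec x i) = \<Phi> x"
  proof
    fix k
    \<comment> \<open>All nonzero components have first index \<open>a\<close>, so they are told
      apart by the \<open>q\<close>-degree.\<close>
    have inj: "inj_on snd ?S" by (auto simp: inj_on_def hdec_def split: if_splits)
    have "\<Phi> (\<Oplus>\<^bsub>A\<^esub>i\<in>?S. hdec x i) k = (\<Sum>i\<in>?S. \<Phi> (hdec x i) k)"
      using fin cl by (subst Phi_finsum) auto
    also have "\<dots> = (\<Sum>i\<in>?S. hpart (snd i - qd k) (\<Phi> x k))"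
      using x by (intro sum.cong) (auto simp: hdec_def Phi_hproj split: if_splits)
    also have "\<dots> = (\<Sum>d\<in>(\<lambda>i. snd i - qd k) ` ?S. hpart d (\<Phi> x k))"
      using inj by (subst sum.reindex) (auto simp: inj_on_def)
    also have "\<dots> = \<Phi> x k"
    proof (rule hpart_sum_all)
      show "{d. hpart d (\<Phi> x k) \<noteq> 0} \<subseteq> (\<lambda>i. snd i - qd k) ` ?S"
      proof
        fix d assume "d \<in> {d. hpart d (\<Phi> x k) \<noteq> 0}"
        then have "\<Phi> (hproj (d + qd k) x) k \<noteq> 0" using x by (simp add: Phi_hproj)
        then have "hdec x (a, d + qd k) \<noteq> \<zero>\<^bsub>A\<^esub>" unfolding hdec_def by auto
        then show "d \<in> (\<lambda>i. snd i - qd k) ` ?S" by (intro image_eqI[of _ _ "(a, d + qd k)"]) auto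
      qed
    qed (use fin in auto)
    finally show "\<Phi> (\<Oplus>\<^bsub>A\<^esub>i\<in>?S. hdec x i) k = \<Phi> x k" .
  qed
  then have "(\<Oplus>\<^bsub>A\<^esub>i\<in>?S. hdec x i) = x" using x cl by (intro Phi_inject M.finsum_closed) auto
  then show ?thesis
    unfolding hom_dec_def using fin x by (auto simp: hdec_def hproj_cmp cmp_zero)
qed

text \<open>In each coordinate, taking the homogeneous part of the appropriate degree isolates one
  summand of any given decomposition.\<close>

lemma hom_dec_unique: assumes x: "x \<in> carrier A" and u: "hom_dec A x u" shows "u = hdec x"
proof
  fix j :: "int \<times> int"
  obtain i q where j: "j = (i, q)" by (cases j)
  have c: "u (i, q) \<in> cmp A i q" for i q using u by (auto simp: hom_dec_def)
  have cl: "u i \<in> carrier A" for i using c cmp_carrier by (cases i) blast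
  let ?S = "{i. u i \<noteq> \<zero>\<^bsub>A\<^esub>}"
  have fin: "finite ?S" and sum: "x = (\<Oplus>\<^bsub>A\<^esub>i\<in>?S. u i)" using u by (auto simp: hom_dec_def)
  have i0: "u (i, q) = \<zero>\<^bsub>A\<^esub>" if "i \<noteq> a" for i q using c[of i q] that by (simp add: cmp_eq)
  show "u j = hdec x j"
  proof (cases "i = a")
    case True
    have "\<Phi> (u (a, q)) = \<Phi> (hproj q x)"
    proof
      fix k
      have "\<Phi> (hproj q x) k = hpart (q - qd k) (\<Sum>i\<in>?S. \<Phi> (u i) k)"
        using x fin cl by (simp add: Phi_hproj) (subst sum, subst Phi_finsum, auto)
      also have "\<dots> = (\<Sum>i\<in>?S. hpart (q - qd k) (\<Phi> (u i) k))" by (simp add: hpart_sum)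
      also have "\<dots> = (\<Sum>i\<in>?S. if i = (a, q) then \<Phi> (u (a, q)) k else 0)"
      proof (rule sum.cong)
        fix i assume "i \<in> ?S"
        then obtain q' where i: "i = (a, q')" using i0 by (cases i) auto
        have "\<Phi> (u i) k \<in> qhom (q' - qd k)" using c[of a q'] by (simp add: cmp_eq i)
        then show "hpart (q - qd k) (\<Phi> (u i) k) = (if i = (a, q) then \<Phi> (u (a, q)) k else 0)"
          by (auto simp: hpart_of_qhom i)
      qed simp
      also have "\<dots> = \<Phi> (u (a, q)) k" using fin by (auto simp: sum.delta)
      finally show "\<Phi> (u (a, q)) k = \<Phi> (hproj q x) k" by simp
    qed
    then show ?thesis using x cl True by (auto simp: hdec_def j intro: Phi_inject hproj_closed)
  qed (simp add: j i0 hdec_def)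
qed

lemma gobj: "gobj n A"
  unfolding gobj_def
proof (intro conjI allI ballI impI)
  show "module (xyring n) A" using module_A by (simp add: xyring_eq)
  interpret C: module "pol {}" A by (rule module_pol_mono[OF module_A]) simp
  fix i q :: int
  show "submodule (cmp A i q) (pol {}) A"
  proof (rule C.submoduleI)
    fix p x assume p: "p \<in> PR {}" and x: "x \<in> cmp A i q"
    have "p \<odot>\<^bsub>A\<^esub> x \<in> cmp A a (q + 0)" if "i = a"
      using p x that by (intro smult_hom PR_empty_qhom) (auto intro: PR_mono[of "{}"])
    moreover have "p \<odot>\<^bsub>A\<^esub> x \<in> cmp A i q" if "i \<noteq> a"
      using p x that by (auto simp: cmp_eq)
    ultimately show "p \<odot>\<^bsub>A\<^esub> x \<in> cmp A i q" by (cases "i = a") auto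
  qed (use cmp_carrier in \<open>auto intro: cmp_zero cmp_add cmp_neg\<close>)
next
  fix x assume "x \<in> carrier A"
  then show "\<exists>!u. hom_dec A x u" using hom_dec_hdec hom_dec_unique by blast
next
  fix d i q p x assume "p \<in> carrier (xyring n) \<inter> qhom d" "x \<in> cmp A i q"
  then show "p \<odot>\<^bsub>A\<^esub> x \<in> cmp A i (q + d)"
    using smult_hom[of p d x q] by (cases "i = a") (auto simp: xyring_eq cmp_eq)
qed (use cmp_carrier in \<open>auto simp: lin_map_def hom_def bd_zero cmp_zero xyring_eq subset_eq\<close>)

text \<open>All components lie in the \<open>a\<close>-degree \<open>a\<close>, so the Koszul sign
  is one and the same for the whole module.\<close>

lemma asign: "x \<in> carrier A \<Longrightarrow> asign A x = (if even a then x else \<ominus>\<^bsub>A\<^esub> x)"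
proof -
  assume x: "x \<in> carrier A"
  let ?u = "hdec x" let ?S = "{i. hdec x i \<noteq> \<zero>\<^bsub>A\<^esub>}"
  have u: "(THE u. hom_dec A x u) = ?u"
    using x by (intro the_equality hom_dec_hdec hom_dec_unique)
  have cl: "hdec x i \<in> carrier A" for i using x by (auto simp: hdec_def hproj_closed split: prod.split)
  have fin: "finite ?S" and sum: "x = (\<Oplus>\<^bsub>A\<^esub>i\<in>?S. hdec x i)"
    using hom_dec_hdec[OF x] by (auto simp: hom_dec_def)
  have f: "fst i = a" if "hdec x i \<noteq> \<zero>\<^bsub>A\<^esub>" for i using that by (auto simp: hdec_def split: if_splits prod.splits)
  have e: "asign A x = (\<Oplus>\<^bsub>A\<^esub>i\<in>?S. if even a then hdec x i else \<ominus>\<^bsub>A\<^esub> hdec x i)"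
    unfolding asign_def u Let_def using cl f by (intro M.finsum_cong') auto
  show "asign A x = (if even a then x else \<ominus>\<^bsub>A\<^esub> x)"
  proof (rule Phi_inject)
    have "\<Phi> x = (\<lambda>k. \<Sum>i\<in>?S. \<Phi> (hdec x i) k)"
      by (subst sum) (use fin cl in \<open>simp add: Phi_finsum\<close>)
    then show "\<Phi> (asign A x) = \<Phi> (if even a then x else \<ominus>\<^bsub>A\<^esub> x)"
      unfolding e using fin cl x by (simp add: Phi_finsum Phi_neg sum_negf fun_eq_iff)
    show "asign A x \<in> carrier A" unfolding e using cl by (intro M.finsum_closed) auto
  qed (use x in auto)
qed

lemma basis_cmp: "k \<in> K \<Longrightarrow> \<Psi> (unitv k) \<in> cmp A a (qd k)"
  by (auto simp: cmp_eq Psi_closed Phi_Psi unitv_vecs) (simp add: unitv_def)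

lemma expand:
  assumes x: "x \<in> carrier A"
  shows "x = (\<Oplus>\<^bsub>A\<^esub>k\<in>K. \<Phi> x k \<odot>\<^bsub>A\<^esub> \<Psi> (unitv k))"
proof (rule Phi_inject[OF x])
  have p: "\<Phi> x k \<in> RX n" for k using Phi_vecs[OF x] by (simp add: vecs_def)
  have b: "\<Phi> x k \<odot>\<^bsub>A\<^esub> \<Psi> (unitv k) \<in> carrier A" if "k \<in> K" for k
    using p RX_XY that by (intro smult_closed Psi_closed unitv_vecs) auto
  show "(\<Oplus>\<^bsub>A\<^esub>k\<in>K. \<Phi> x k \<odot>\<^bsub>A\<^esub> \<Psi> (unitv k)) \<in> carrier A" using b by (intro M.finsum_closed) auto
  have "(\<Sum>k\<in>K. \<Phi> (\<Phi> x k \<odot>\<^bsub>A\<^esub> \<Psi> (unitv k)) j) = \<Phi> x j" for j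
  proof -
    have "(\<Sum>k\<in>K. \<Phi> (\<Phi> x k \<odot>\<^bsub>A\<^esub> \<Psi> (unitv k)) j) = (\<Sum>k\<in>K. if k = j then \<Phi> x j else 0)"
      by (intro sum.cong) (auto simp: Phi_smult p Psi_closed unitv_vecs Phi_Psi unitv_def)
    also have "\<dots> = \<Phi> x j" using finite_K Phi_vecs[OF x] by (auto simp: vecs_def)
    finally show ?thesis .
  qed
  then show "\<Phi> x = \<Phi> (\<Oplus>\<^bsub>A\<^esub>k\<in>K. \<Phi> x k \<odot>\<^bsub>A\<^esub> \<Psi> (unitv k))"
    using finite_K b by (simp add: Phi_finsum)
qed

end

text \<open>The common core of composition and disjoint union. \<open>g\<close> prescribes the
  coordinates of pure tensors with respect to the tensors of \<open>bM k\<close> and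
  \<open>bN k\<close>; \<open>gen\<close> says that a pure tensor is recovered from them, and
  \<open>unit\<close> that the basis tensors have unit vectors as coordinates.\<close>

lemma (in bitensor_act) xfree_tens:
  fixes g :: "'a \<Rightarrow> 'b \<Rightarrow> 'k \<Rightarrow> mpol"
  assumes xM: "xfree nM M KM \<Phi>M aM qdM" and xN: "xfree nN N KN \<Phi>N aN qdN"
    and VM: "VM = XY nM" and VN: "VN = XY nN" and V: "V = XY n"
    and add1: "\<And>m m' n. m \<in> carrier M \<Longrightarrow> m' \<in> carrier M \<Longrightarrow> n \<in> carrier N \<Longrightarrow> g (m \<oplus>\<^bsub>M\<^esub> m') n = g m n + g m' n"
    and add2: "\<And>m n n'. m \<in> carrier M \<Longrightarrow> n \<in> carrier N \<Longrightarrow> n' \<in> carrier N \<Longrightarrow> g m (n \<oplus>\<^bsub>N\<^esub> n') = g m n + g m n'"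
    and bal: "\<And>a b m n. (a, b) \<in> Mid \<Longrightarrow> m \<in> carrier M \<Longrightarrow> n \<in> carrier N \<Longrightarrow> g (a \<odot>\<^bsub>M\<^esub> m) n = g m (b \<odot>\<^bsub>N\<^esub> n)"
    and vec: "\<And>m n'. m \<in> carrier M \<Longrightarrow> n' \<in> carrier N \<Longrightarrow> g m n' \<in> vecs n J" and J: "finite J"
    and gCst: "\<And>c m n. m \<in> carrier M \<Longrightarrow> n \<in> carrier N \<Longrightarrow> g (Cst c \<odot>\<^bsub>M\<^esub> m) n = (\<lambda>k. Cst c * g m n k)"
    and gVar: "\<And>i m n'. i \<in> {1..n} \<Longrightarrow> m \<in> carrier M \<Longrightarrow> n' \<in> carrier N \<Longrightarrow>
      g (l (vX i) \<odot>\<^bsub>M\<^esub> m) (r (vX i) \<odot>\<^bsub>N\<^esub> n') = (\<lambda>k. Var (vX i) * g m n' k)"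
    and bM: "\<And>k. k \<in> J \<Longrightarrow> bM k \<in> cmp M aM (dM k)" and bN: "\<And>k. k \<in> J \<Longrightarrow> bN k \<in> cmp N aN (dN k)"
    and qd: "\<And>k. k \<in> J \<Longrightarrow> qd k = dM k + dN k" and unit: "\<And>k. k \<in> J \<Longrightarrow> g (bM k) (bN k) = unitv k"
    and gen: "\<And>m n. m \<in> carrier M \<Longrightarrow> n \<in> carrier N \<Longrightarrow> pt m n = (\<Oplus>\<^bsub>T\<^esub>k\<in>J. g m n k \<odot>\<^bsub>T\<^esub> pt (bM k) (bN k))"
    and hg: "\<And>m n d d' k. m \<in> cmp M aM d \<Longrightarrow> n \<in> cmp N aN d' \<Longrightarrow> g m n k \<in> qhom (d + d' - qd k)"
    and deg: "\<And>v. v \<in> V \<Longrightarrow> \<exists>dl dr. l v \<in> qhom dl \<and> r v \<in> qhom dr \<and> dl + dr = 2"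
  shows "xfree n T J (tlift g) (aM + aN) qd"
proof -
  interpret xM: xfree nM M KM \<Phi>M aM qdM by (rule xM)
  interpret xN: xfree nN N KN \<Phi>N aN qdN by (rule xN)
  let ?\<Phi> = "tlift g"
  have Phi_pt: "?\<Phi> (pt m n) = g m n" if "m \<in> carrier M" "n \<in> carrier N" for m n
    by (rule tlift_pt[of g]) (use that add1 add2 bal in simp_all)
  have Phi_add: "?\<Phi> (s \<oplus>\<^bsub>T\<^esub> t) = ?\<Phi> s + ?\<Phi> t" if "s \<in> carrier T" "t \<in> carrier T" for s t
    by (rule tlift_add[of g]) (use that add1 add2 bal in simp_all)
  have bMc: "bM k \<in> carrier M" if "k \<in> J" for k using bM[OF that] xM.cmp_carrier by blast
  have bNc: "bN k \<in> carrier N" if "k \<in> J" for k using bN[OF that] xN.cmp_carrier by blast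
  have Phi_vecs: "?\<Phi> t \<in> vecs n J" if "t \<in> carrier T" for t
    using that
  proof (induction t rule: tens_induct)
    case (add s t)
    then show ?case by (auto simp: Phi_add vecs_def)
  qed (simp add: Phi_pt vec)
  have Phi0: "?\<Phi> \<zero>\<^bsub>T\<^esub> = 0" using Phi_add[of "\<zero>\<^bsub>T\<^esub>" "\<zero>\<^bsub>T\<^esub>"] by simp
  have RXV: "p \<in> PR V" if "p \<in> RX n" for p using RX_XY[OF that] by (simp add: V)
  have Phi_smult: "?\<Phi> (p \<odot>\<^bsub>T\<^esub> t) = (\<lambda>k. p * ?\<Phi> t k)" if "p \<in> RX n" "t \<in> carrier T" for p t
    using that
  proof (induction p arbitrary: t rule: PR_induct)
    case (Cst c)
    then show ?case
    proof (induction t rule: tens_induct)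
      case (pt m n)
      have "Cst c \<in> PR VM" by simp
      then show ?case using pt
        by (subst smult_pt_left[of "{}"]) (auto simp: Phi_pt gCst)
    next
      case (add s t)
      then show ?case by (simp add: smult_add_t Phi_add smult_closed) (simp add: fun_eq_iff distrib_left)
    qed
  next
    case (add p q)
    then show ?case by (simp add: smult_l_distr RXV Phi_add smult_closed) (simp add: fun_eq_iff distrib_right)
  next
    case (Var v p)
    then obtain i where i: "v = vX i" "i \<in> {1..n}" by (auto simp: XV_def)
    have vV: "v \<in> V" using i by (auto simp: V)
    have V1: "?\<Phi> (Var v \<odot>\<^bsub>T\<^esub> t) = (\<lambda>k. Var v * ?\<Phi> t k)" if "t \<in> carrier T" for t
      using that
    proof (induction t rule: tens_induct)
      case (pt m n)
      then show ?case using i gVar l[OF vV] r[OF vV] vV by (simp add: smult_pt_Var Phi_pt)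
    next
      case (add s t)
      then show ?case using vV by (simp add: smult_add_t Phi_add smult_closed) (simp add: fun_eq_iff distrib_left)
    qed
    have "(Var v * p) \<odot>\<^bsub>T\<^esub> t = Var v \<odot>\<^bsub>T\<^esub> (p \<odot>\<^bsub>T\<^esub> t)"
      using TM.smult_assoc1[of "Var v" p t] vV Var RXV by simp
    then show ?case using Var V1 RXV by (simp add: smult_closed fun_eq_iff mult.assoc)
  qed
  \<comment> \<open>The linear combination with given coefficients; it will be the inverse of
    \<open>tlift g\<close>.\<close>
  define E where "E v = (\<Oplus>\<^bsub>T\<^esub>k\<in>J. v k \<odot>\<^bsub>T\<^esub> pt (bM k) (bN k))" for v
  have Ecl: "v k \<odot>\<^bsub>T\<^esub> pt (bM k) (bN k) \<in> carrier T" if "v \<in> vecs n J" "k \<in> J" for v k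
    using that bMc bNc RXV by (intro smult_pt_closed) (auto simp: vecs_def)
  have E_carrier: "E v \<in> carrier T" if "v \<in> vecs n J" for v
    unfolding E_def using Ecl that by (intro T.finsum_closed) auto
  have E_add: "E (v + w) = E v \<oplus>\<^bsub>T\<^esub> E w" if "v \<in> vecs n J" "w \<in> vecs n J" for v w
  proof -
    have "E (v + w) = (\<Oplus>\<^bsub>T\<^esub>k\<in>J. v k \<odot>\<^bsub>T\<^esub> pt (bM k) (bN k) \<oplus>\<^bsub>T\<^esub> w k \<odot>\<^bsub>T\<^esub> pt (bM k) (bN k))"
      unfolding E_def using that bMc bNc RXV Ecl
      by (intro T.finsum_cong') (auto simp: smult_pt_add vecs_def)
    then show ?thesis unfolding E_def using that Ecl by (subst (asm) T.finsum_addf) auto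
  qed
  have E_Phi: "E (?\<Phi> t) = t" if "t \<in> carrier T" for t
    using that
  proof (induction t rule: tens_induct)
    case (pt m n)
    then show ?case unfolding E_def Phi_pt[OF pt] by (rule gen[symmetric])
  next
    case (add s t)
    then show ?case using E_add[OF Phi_vecs Phi_vecs, of s t] by (simp only: Phi_add)
  qed
  have Phi_sum: "?\<Phi> (\<Oplus>\<^bsub>T\<^esub>k\<in>I. f k) = (\<lambda>j. \<Sum>k\<in>I. ?\<Phi> (f k) j)"
    if "finite I" "\<And>k. k \<in> I \<Longrightarrow> f k \<in> carrier T" for I and f :: "'k \<Rightarrow> _"
    using that
  proof (induction I rule: finite_induct)
    case (insert i I)
    have "(\<Oplus>\<^bsub>T\<^esub>i\<in>insert i I. f i) = f i \<oplus>\<^bsub>T\<^esub> (\<Oplus>\<^bsub>T\<^esub>i\<in>I. f i)"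
      using insert by (intro T.finsum_insert) auto
    moreover have "(\<Oplus>\<^bsub>T\<^esub>i\<in>I. f i) \<in> carrier T" using insert by (intro T.finsum_closed) auto
    ultimately show ?case using insert by (simp add: Phi_add plus_fun_def)
  qed (simp add: Phi0 zero_fun_def)
  have Phi_E: "?\<Phi> (E v) = v" if v: "v \<in> vecs n J" for v
  proof
    fix j
    have "?\<Phi> (E v) j = (\<Sum>k\<in>J. ?\<Phi> (v k \<odot>\<^bsub>T\<^esub> pt (bM k) (bN k)) j)"
      unfolding E_def using J Ecl[OF v] by (simp add: Phi_sum)
    also have "\<dots> = (\<Sum>k\<in>J. if k = j then v j else 0)"
      using v bMc bNc by (intro sum.cong) (auto simp: vecs_def Phi_smult pt_closed Phi_pt unit unitv_def)
    also have "\<dots> = v j" using v J by (auto simp: vecs_def)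
    finally show "?\<Phi> (E v) j = v j" .
  qed
  have bij: "bij_betw ?\<Phi> (carrier T) (vecs n J)"
    by (rule bij_betw_byWitness[of _ E]) (use E_Phi Phi_E Phi_vecs E_carrier in auto)
  define S where "S k q = (\<Union>i d. cmp M i d \<times> cmp N (k - i) (q - d))" for k q
  have cT: "cmp T k q = tens_span Mid M N (S k q)" for k q by (simp add: tens_def S_def)
  have Sc: "S k q \<subseteq> carrier M \<times> carrier N" for k q
    unfolding S_def using xM.cmp_carrier xN.cmp_carrier by blast
  have S0: "(\<zero>\<^bsub>M\<^esub>, \<zero>\<^bsub>N\<^esub>) \<in> S k q" for k q unfolding S_def using xM.cmp_zero xN.cmp_zero by blast
  have Sneg: "\<forall>m n. (m, n) \<in> S k q \<longrightarrow> (\<ominus>\<^bsub>M\<^esub> m, n) \<in> S k q" for k q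
    unfolding S_def by (auto intro: xM.cmp_neg)
  have Smem: "(m, n) \<in> S (aM + aN) q" if "m \<in> cmp M aM d" "n \<in> cmp N aN d'" "d + d' = q" for m n d d' q
    unfolding S_def by (rule UN_I[of aM], simp, rule UN_I[of d]) (use that in auto)
  \<comment> \<open>Unless the \<open>a\<close>-degrees of the factors are \<open>aM\<close> and
    \<open>aN\<close>, one of the factors is zero, and with it the tensor.\<close>
  have Sz: "pt m n = \<zero>\<^bsub>T\<^esub> \<or> (k = aM + aN \<and> (\<exists>d. m \<in> cmp M aM d \<and> n \<in> cmp N aN (q - d)))"
    if S: "(m, n) \<in> S k q" for k q m n
  proof -
    obtain i d where i: "m \<in> cmp M i d" "n \<in> cmp N (k - i) (q - d)" using S by (auto simp: S_def)
    have mn: "m \<in> carrier M" "n \<in> carrier N" using i xM.cmp_carrier xN.cmp_carrier by blast+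
    show ?thesis
    proof (cases "i = aM \<and> k - i = aN")
      case True
      then show ?thesis using i by auto
    next
      case False
      then have "m = \<zero>\<^bsub>M\<^esub> \<or> n = \<zero>\<^bsub>N\<^esub>" using i by (auto simp: xM.cmp_eq xN.cmp_eq split: if_splits)
      then show ?thesis using mn by (auto simp: pt_zero1[where l=l and r=r] pt_zero2[where l=l and r=r])
    qed
  qed
  have span_closed: "t \<in> tens_span Mid M N (S k q) \<Longrightarrow> t \<in> carrier T" for t k q
    using tens_span_closed[OF Sc] by blast
  have hom_act: "p \<odot>\<^bsub>T\<^esub> pt m n \<in> cmp T (aM + aN) (d + d' + d'')"
    if p: "p \<in> PR V" "p \<in> qhom d''" and m: "m \<in> cmp M aM d" and n: "n \<in> cmp N aN d'" for p m n d d' d''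
  proof -
    have mn: "m \<in> carrier M" "n \<in> carrier N" using m n xM.cmp_carrier xN.cmp_carrier by blast+
    have "Poly_Mapping.keys (\<Sum>e\<in>Poly_Mapping.keys p. sact e (Poly_Mapping.lookup p e) m n) \<subseteq> S (aM + aN) (d + d' + d'')"
    proof (rule order_trans[OF keys_sum] UN_least)+
      fix e assume e: "e \<in> Poly_Mapping.keys p"
      have eV: "Poly_Mapping.keys e \<subseteq> V" using e p by (auto simp: PR_iff)
      \<comment> \<open>The degree 2 of a variable is split between its actions on the two factors,
        in a way that depends on the variable. A splitting is fixed for each, so that what a
        monomial adds on one side is missing on the other.\<close>
      define dl where "dl v = (SOME d. l v \<in> qhom d \<and> r v \<in> qhom (2 - d))" for v
      have dl: "l v \<in> qhom (dl v) \<and> r v \<in> qhom (2 - dl v)" if "v \<in> V" for v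
      proof -
        from deg[OF that] obtain d1 d2 where "l v \<in> qhom d1" "r v \<in> qhom d2" "d1 + d2 = 2" by blast
        moreover from this have "d2 = 2 - d1" by simp
        ultimately have "\<exists>d. l v \<in> qhom d \<and> r v \<in> qhom (2 - d)" by blast
        then show ?thesis unfolding dl_def by (rule someI_ex)
      qed
      let ?s = "\<Sum>v\<in>Poly_Mapping.keys e. dl v * int (Poly_Mapping.lookup e v)"
      have L: "monom_subst l e \<in> qhom ?s" using dl eV by (intro monom_subst_qhom) auto
      have "monom_subst r e \<in> qhom (\<Sum>v\<in>Poly_Mapping.keys e. (2 - dl v) * int (Poly_Mapping.lookup e v))"
        using dl eV by (intro monom_subst_qhom) auto
      also have "(\<Sum>v\<in>Poly_Mapping.keys e. (2 - dl v) * int (Poly_Mapping.lookup e v)) = mdeg e - ?s"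
        by (simp add: mdeg_def sum_distrib_left left_diff_distrib sum_subtractf)
      also have "mdeg e = d''" using p e by (auto simp: qhom_iff)
      finally have R: "monom_subst r e \<in> qhom (d'' - ?s)" .
      have "(Cst (Poly_Mapping.lookup p e) * monom_subst l e) \<odot>\<^bsub>M\<^esub> m \<in> cmp M aM (d + ?s)"
        using mon_cl[OF eV] L m by (intro xM.smult_hom) (auto simp: VM)
      moreover have "monom_subst r e \<odot>\<^bsub>N\<^esub> n \<in> cmp N aN (d' + (d'' - ?s))"
        using mon_r[OF eV] R n by (intro xN.smult_hom) (auto simp: VN)
      ultimately show "Poly_Mapping.keys (sact e (Poly_Mapping.lookup p e) m n) \<subseteq> S (aM + aN) (d + d' + d'')"
        unfolding sact_def keys_frag_of by (auto intro: Smem)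
    qed
    then show ?thesis unfolding smult_pt[OF p(1)] cT tens_span_def by (intro imageI) simp
  qed
  have c0: "cmp T k q = {\<zero>\<^bsub>T\<^esub>}" if "k \<noteq> aM + aN" for k q
  proof -
    have "t = \<zero>\<^bsub>T\<^esub>" if "t \<in> tens_span Mid M N (S k q)" for t
      using that Sc Sneg S0
    proof (induction t rule: tens_span_induct[where l=l and r=r])
      case (pt m n)
      then show ?case using Sz[OF pt] \<open>k \<noteq> aM + aN\<close> by auto
    qed auto
    then show ?thesis unfolding cT using tens_span_zero by auto
  qed
  have c1: "cmp T (aM + aN) q = {t\<in>carrier T. \<forall>k. ?\<Phi> t k \<in> qhom (q - qd k)}" for q
  proof (intro equalityI subsetI CollectI conjI)
    fix t assume "t \<in> cmp T (aM + aN) q"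
    then have t: "t \<in> tens_span Mid M N (S (aM + aN) q)" by (simp add: cT)
    then show "t \<in> carrier T" by (rule span_closed)
    show "\<forall>k. ?\<Phi> t k \<in> qhom (q - qd k)"
      using t Sc Sneg S0
    proof (induction t rule: tens_span_induct[where l=l and r=r])
      case (pt m n)
      then have mn: "m \<in> carrier M" "n \<in> carrier N" using Sc by blast+
      from Sz[OF pt] show ?case
      proof
        assume "pt m n = \<zero>\<^bsub>T\<^esub>" then show ?thesis by (simp add: Phi0)
      next
        assume "aM + aN = aM + aN \<and> (\<exists>d. m \<in> cmp M aM d \<and> n \<in> cmp N aN (q - d))"
        then obtain d where "m \<in> cmp M aM d" "n \<in> cmp N aN (q - d)" by blast
        from hg[OF this] show ?thesis using mn by (simp add: Phi_pt)
      qed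
    next
      case (add s t)
      then show ?case by (simp add: Phi_add span_closed)
    qed
  next
    fix t assume "t \<in> {t\<in>carrier T. \<forall>k. ?\<Phi> t k \<in> qhom (q - qd k)}"
    then have t: "t \<in> carrier T" "\<And>k. ?\<Phi> t k \<in> qhom (q - qd k)" by auto
    have mem: "?\<Phi> t k \<odot>\<^bsub>T\<^esub> pt (bM k) (bN k) \<in> tens_span Mid M N (S (aM + aN) q)" if k: "k \<in> J" for k
      using hom_act[OF _ t(2)[of k] bM[OF k] bN[OF k]] qd[OF k] RXV Phi_vecs[OF t(1)] by (simp add: cT vecs_def)
    have "(\<Oplus>\<^bsub>T\<^esub>k\<in>I. ?\<Phi> t k \<odot>\<^bsub>T\<^esub> pt (bM k) (bN k)) \<in> tens_span Mid M N (S (aM + aN) q)"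
      if "finite I" "I \<subseteq> J" for I
      using that
    proof (induction I rule: finite_induct)
      case (insert i I)
      have "(\<Oplus>\<^bsub>T\<^esub>k\<in>insert i I. ?\<Phi> t k \<odot>\<^bsub>T\<^esub> pt (bM k) (bN k)) =
          ?\<Phi> t i \<odot>\<^bsub>T\<^esub> pt (bM i) (bN i) \<oplus>\<^bsub>T\<^esub> (\<Oplus>\<^bsub>T\<^esub>k\<in>I. ?\<Phi> t k \<odot>\<^bsub>T\<^esub> pt (bM k) (bN k))"
        using insert Ecl[OF Phi_vecs[OF t(1)]] by (intro T.finsum_insert) auto
      then show ?case using insert mem[of i] by (simp add: tens_span_add)
    qed (simp add: tens_span_zero)
    from this[OF J subset_refl] have "E (?\<Phi> t) \<in> cmp T (aM + aN) q" by (simp add: E_def cT)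
    then show "t \<in> cmp T (aM + aN) q" by (simp add: E_Phi t(1))
  qed
  show ?thesis
  proof (rule xfree.intro)
    show "module (pol (XY n)) T" using module_T by (simp add: V)
    show "cmp T i q = (if i = aM + aN then {x\<in>carrier T. \<forall>k. ?\<Phi> x k \<in> qhom (q - qd k)} else {\<zero>\<^bsub>T\<^esub>})" for i q
      using c0 c1 by simp
    show "p \<odot>\<^bsub>T\<^esub> x \<in> cmp T (aM + aN) (q + d)"
      if p: "p \<in> PR (XY n)" "p \<in> qhom d" and x: "x \<in> cmp T (aM + aN) q" for p d x q
    proof -
      have pV: "p \<in> PR V" using p by (simp add: V)
      have "x \<in> tens_span Mid M N (S (aM + aN) q)" using x by (simp add: cT)
      then show ?thesis
        using Sc Sneg S0
      proof (induction x rule: tens_span_induct[where l=l and r=r])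
        case (pt m n)
        from Sz[OF pt] show ?case
        proof (elim disjE conjE exE)
          fix d' assume "m \<in> cmp M aM d'" "n \<in> cmp N aN (q - d')"
          from hom_act[OF pV p(2) this] show ?thesis by simp
        next
          assume "pt m n = \<zero>\<^bsub>T\<^esub>"
          then show ?thesis using TM.smult_r_null[of p] pV by (simp add: cT tens_span_zero)
        qed
      next
        case (add s t)
        then show ?case using pV by (simp add: smult_add_t span_closed cT tens_span_add)
      qed
    qed
    show "bd T x = \<zero>\<^bsub>T\<^esub>" if "x \<in> carrier T" for x
    proof -
      from that obtain u where u: "FG u" "x = cl u" by (auto simp: tens_carrier)
      let ?\<phi> = "\<lambda>(m, n). frag_of (bd M m, n) + frag_of (asign M m, bd N n)"
      \<comment> \<open>Both inner differentials vanish, so a pure tensor goes to a sum of two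
        tensors with a zero factor.\<close>
      have z: "cl (?\<phi> (m, n)) = cl 0" if "m \<in> carrier M" "n \<in> carrier N" for m n
      proof -
        have "cl (frag_of (\<zero>\<^bsub>M\<^esub>, n) + frag_of (asign M m, \<zero>\<^bsub>N\<^esub>)) = cl (0 + 0)"
          using that by (intro cl_add_cong cl_frag_zero1 cl_frag_zero2) (auto simp: xM.asign)
        then show ?thesis using that by (simp add: xM.bd_zero xN.bd_zero)
      qed
      have z2: "cl (?\<phi> (m, n) + ?\<phi> (m', n')) = cl 0"
        if "m \<in> carrier M" "n \<in> carrier N" "m' \<in> carrier M" "n' \<in> carrier N" for m n m' n'
        using cl_add_cong[OF z z] that by simp
      have "bd T x = cl (frag_extend ?\<phi> u)"
        unfolding u(2) tens_def gcx.select_convs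
      proof (rule tens_ind_cl[OF bitensor_axioms bitensor_axioms])
        fix m n assume mn: "m \<in> carrier M" "n \<in> carrier N"
        then show "FG (?\<phi> (m, n))"
          by (simp add: xM.bd_zero xN.bd_zero xM.asign FG_add FG_frag_of)
        show "cl (?\<phi> (m \<oplus>\<^bsub>M\<^esub> m', n)) = cl (?\<phi> (m, n) + ?\<phi> (m', n))" if "m' \<in> carrier M" for m'
          using mn that by (simp only: z z2 M.a_closed)
        show "cl (?\<phi> (m, n \<oplus>\<^bsub>N\<^esub> n')) = cl (?\<phi> (m, n) + ?\<phi> (m, n'))" if "n' \<in> carrier N" for n'
          using mn that by (simp only: z z2 N.a_closed)
        show "cl (?\<phi> (a \<odot>\<^bsub>M\<^esub> m, n)) = cl (?\<phi> (m, b \<odot>\<^bsub>N\<^esub> n))" if "(a, b) \<in> Mid" for a b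
          using mn Mid[OF that] by (simp only: z M.smult_closed N.smult_closed)
      qed
      also have "\<dots> = cl 0"
        using u(1)
      proof (induction u rule: frag_induction)
        case (one x)
        then show ?case using z by (cases x) simp
      next
        case (diff a b)
        then show ?case using cl_add_cong[OF diff(1) cl_uminus_cong[OF diff(2)]] by (simp add: frag_extend_diff)
      qed simp
      finally show ?thesis by (simp add: tens_zero)
    qed
  qed (use J bij Phi_add Phi_smult in auto)
qed

lemma (in abelian_group) finsum_product:
  assumes "finite A" "finite B" and f: "\<And>x y. x \<in> A \<Longrightarrow> y \<in> B \<Longrightarrow> f (x, y) \<in> carrier G"
  shows "(\<Oplus>z\<in>A \<times> B. f z) = (\<Oplus>x\<in>A. \<Oplus>y\<in>B. f (x, y))"
  using assms(1) f
proof (induction A rule: finite_induct)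
  case (insert x A)
  have s: "(\<Oplus>z\<in>{x} \<times> B. f z) = (\<Oplus>y\<in>B. f (x, y))"
  proof -
    have "(\<Oplus>z\<in>(\<lambda>y. (x, y)) ` B. f z) = (\<Oplus>y\<in>B. f (x, y))"
      using insert(4) by (intro finsum_reindex) (auto simp: inj_on_def)
    moreover have "(\<lambda>y. (x, y)) ` B = {x} \<times> B" by auto
    ultimately show ?thesis by simp
  qed
  have "insert x A \<times> B = {x} \<times> B \<union> A \<times> B" by auto
  then have "(\<Oplus>z\<in>insert x A \<times> B. f z) = (\<Oplus>z\<in>{x} \<times> B. f z) \<oplus> (\<Oplus>z\<in>A \<times> B. f z)"
    using insert assms(2) by (simp only:) (rule finsum_Un_disjoint, auto)
  also have "\<dots> = (\<Oplus>y\<in>B. f (x, y)) \<oplus> (\<Oplus>x\<in>A. \<Oplus>y\<in>B. f (x, y))"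
    using insert s by simp
  also have "\<dots> = (\<Oplus>x\<in>insert x A. \<Oplus>y\<in>B. f (x, y))"
    using insert by (intro finsum_insert[symmetric]) (auto intro!: finsum_closed)
  finally show ?case .
qed simp

context bitensor_act
begin

lemma pt_finsum1:
  assumes "finite I" "\<And>i. i \<in> I \<Longrightarrow> f i \<in> carrier M" "x \<in> carrier N"
  shows "pt (\<Oplus>\<^bsub>M\<^esub>i\<in>I. f i) x = (\<Oplus>\<^bsub>T\<^esub>i\<in>I. pt (f i) x)"
  using assms(1,2)
proof (induction I rule: finite_induct)
  case (insert i I)
  have "(\<Oplus>\<^bsub>M\<^esub>i\<in>insert i I. f i) = f i \<oplus>\<^bsub>M\<^esub> (\<Oplus>\<^bsub>M\<^esub>i\<in>I. f i)"
    using insert by (intro M.M.finsum_insert) auto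
  moreover have "(\<Oplus>\<^bsub>T\<^esub>i\<in>insert i I. pt (f i) x) = pt (f i) x \<oplus>\<^bsub>T\<^esub> (\<Oplus>\<^bsub>T\<^esub>i\<in>I. pt (f i) x)"
    using insert assms(3) by (intro T.finsum_insert) (auto intro: pt_closed)
  moreover have "(\<Oplus>\<^bsub>M\<^esub>i\<in>I. f i) \<in> carrier M" using insert by (intro M.M.finsum_closed) auto
  ultimately show ?case using insert assms(3) by (simp add: pt_add1[where l=l and r=r])
qed (simp add: pt_zero1[where l=l and r=r] assms(3))

lemma pt_finsum2:
  assumes "finite I" "\<And>i. i \<in> I \<Longrightarrow> f i \<in> carrier N" "x \<in> carrier M"
  shows "pt x (\<Oplus>\<^bsub>N\<^esub>i\<in>I. f i) = (\<Oplus>\<^bsub>T\<^esub>i\<in>I. pt x (f i))"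
  using assms(1,2)
proof (induction I rule: finite_induct)
  case (insert i I)
  have "(\<Oplus>\<^bsub>N\<^esub>i\<in>insert i I. f i) = f i \<oplus>\<^bsub>N\<^esub> (\<Oplus>\<^bsub>N\<^esub>i\<in>I. f i)"
    using insert by (intro N.M.finsum_insert) auto
  moreover have "(\<Oplus>\<^bsub>T\<^esub>i\<in>insert i I. pt x (f i)) = pt x (f i) \<oplus>\<^bsub>T\<^esub> (\<Oplus>\<^bsub>T\<^esub>i\<in>I. pt x (f i))"
    using insert assms(3) by (intro T.finsum_insert) (auto intro: pt_closed)
  moreover have "(\<Oplus>\<^bsub>N\<^esub>i\<in>I. f i) \<in> carrier N" using insert by (intro N.M.finsum_closed) auto
  ultimately show ?case using insert assms(3) by (simp add: pt_add2[where l=l and r=r])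
qed (simp add: pt_zero2[where l=l and r=r] assms(3))

end

subsection \<open>Composition\<close>

definition comp_l :: "var \<Rightarrow> mpol" where "comp_l v = (case v of vX i \<Rightarrow> 1 | vY i \<Rightarrow> Var (vY i))"
definition comp_r :: "var \<Rightarrow> mpol" where "comp_r v = (case v of vX i \<Rightarrow> Var (vX i) | vY i \<Rightarrow> 1)"

lemma bim_comp_eq: "bim_comp n = tens (comp_mid n) comp_l comp_r"
  by (rule ext)+ (simp add: bim_comp_def comp_l_def[abs_def] comp_r_def[abs_def])

text \<open>Variables outside \<open>RX n\<close> are sent to 0, which makes the substitution \<open>vX i \<mapsto> vY i\<close> a total ring
  homomorphism into the ring acting on an \<open>n\<close>-strand bimodule.\<close>

definition xtoy :: "nat \<Rightarrow> mpol \<Rightarrow> mpol" where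
  "xtoy n = pol_subst (\<lambda>v. case v of vX i \<Rightarrow> if i \<in> {1..n} then Var (vY i) else 0 | vY i \<Rightarrow> 0)"

lemma xtoy_add: "xtoy n (p + q) = xtoy n p + xtoy n q" and xtoy_mult: "xtoy n (p * q) = xtoy n p * xtoy n q"
  and xtoy_0 [simp]: "xtoy n 0 = 0" and xtoy_1 [simp]: "xtoy n 1 = 1" and xtoy_Cst [simp]: "xtoy n (Cst c) = Cst c"
  and xtoy_xv: "i \<in> {1..n} \<Longrightarrow> xtoy n (xv i) = yv i"
  by (auto simp: xtoy_def pol_subst_add pol_subst_mult)

lemma xtoy_RX: "p \<in> RX n \<Longrightarrow> xtoy n p = pol_subst (\<lambda>v. case v of vX i \<Rightarrow> Var (vY i) | vY i \<Rightarrow> Var (vY i)) p"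
  unfolding xtoy_def
  by (induction p rule: PR_induct) (auto simp: pol_subst_add pol_subst_mult XV_def)

lemma xtoy_closed: "xtoy n p \<in> PR (YV n)"
  unfolding xtoy_def by (rule pol_subst_PR[of UNIV]) (auto split: var.split simp: PR_iff[of p])

lemma xtoy_XY: "xtoy n p \<in> PR (XY n)"
  by (rule PR_mono[OF _ xtoy_closed]) auto

lemma xtoy_qhom: "p \<in> qhom d \<Longrightarrow> xtoy n p \<in> qhom d"
  unfolding xtoy_def by (rule pol_subst_qhom[of UNIV]) (auto split: var.split simp: PR_iff[of p])

lemma comp_mid_eq: "comp_mid n = {(p, xtoy n p) | p. p \<in> RX n}"
  unfolding comp_mid_def XV_def[symmetric] by (auto simp: xtoy_RX)

text \<open>\<open>m\<close> is expanded over the right variables; its coefficients cross the tensor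
  sign and become polynomials in the left variables acting on \<open>x\<close>, whose coordinates
  are then taken.\<close>

definition comp_coord ::
  "nat \<Rightarrow> ('a \<Rightarrow> 'k \<Rightarrow> mpol) \<Rightarrow> 'b fcx \<Rightarrow> ('b \<Rightarrow> 'l \<Rightarrow> mpol) \<Rightarrow> 'a \<Rightarrow> 'b \<Rightarrow> 'k \<times> 'l \<Rightarrow> mpol" where
  "comp_coord n \<Phi>M N \<Phi>N m x = (\<lambda>(i, j). \<Phi>N (xtoy n (\<Phi>M m i) \<odot>\<^bsub>N\<^esub> x) j)"

locale xcomp = xM: xfree n M KM \<Phi>M aM qdM + xN: xfree n N KN \<Phi>N aN qdN
  for n and M :: "'a fcx" and KM :: "'k set" and \<Phi>M aM qdM and N :: "'b fcx" and KN :: "'l set" and \<Phi>N aN qdN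
begin

sublocale bt: bitensor_act "comp_mid n" M N "XY n" "XY n" comp_l comp_r "XY n"
proof (intro bitensor_act.intro bitensor.intro bitensor_act_axioms.intro)
  show "module (pol (XY n)) M" "module (pol (XY n)) N" by (rule xM.module_A xN.module_A)+
qed (auto simp: comp_mid_eq xtoy_XY RX_XY comp_l_def comp_r_def split: var.split)

abbreviation g where "g \<equiv> comp_coord n \<Phi>M N \<Phi>N"

lemma Phi_M_RX: "m \<in> carrier M \<Longrightarrow> \<Phi>M m k \<in> RX n"
  using xM.Phi_vecs by (auto simp: vecs_def)

lemma Phi_N_RX: "m \<in> carrier N \<Longrightarrow> \<Phi>N m k \<in> RX n"
  using xN.Phi_vecs by (auto simp: vecs_def)

lemma xtoy_act: "x \<in> carrier N \<Longrightarrow> xtoy n p \<odot>\<^bsub>N\<^esub> x \<in> carrier N"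
  using xN.smult_closed[OF xtoy_XY] by simp

lemma g_add1: "m \<in> carrier M \<Longrightarrow> m' \<in> carrier M \<Longrightarrow> x \<in> carrier N \<Longrightarrow> g (m \<oplus>\<^bsub>M\<^esub> m') x = g m x + g m' x"
  using xN.smult_l_distr[OF xtoy_XY xtoy_XY]
  by (auto simp: comp_coord_def xM.Phi_add xtoy_add xN.Phi_add xtoy_act fun_eq_iff)

lemma g_add2: "m \<in> carrier M \<Longrightarrow> x \<in> carrier N \<Longrightarrow> x' \<in> carrier N \<Longrightarrow> g m (x \<oplus>\<^bsub>N\<^esub> x') = g m x + g m x'"
  using xN.smult_r_distr[OF xtoy_XY]
  by (auto simp: comp_coord_def xN.Phi_add xtoy_act fun_eq_iff)

lemma g_bal: "(a, b) \<in> comp_mid n \<Longrightarrow> m \<in> carrier M \<Longrightarrow> x \<in> carrier N \<Longrightarrow> g (a \<odot>\<^bsub>M\<^esub> m) x = g m (b \<odot>\<^bsub>N\<^esub> x)"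
  using xN.smult_assoc1[OF xtoy_XY xtoy_XY] bt.N_comm[OF xtoy_XY xtoy_XY]
  by (auto simp: comp_coord_def comp_mid_eq xM.Phi_smult xtoy_mult fun_eq_iff)

lemma tlift_g_pt: "m \<in> carrier M \<Longrightarrow> x \<in> carrier N \<Longrightarrow> tlift g (bt.pt m x) = g m x"
  by (rule bt.tlift_pt[of g]) (auto intro: g_add1 g_add2 g_bal)

text \<open>\<open>M\<close> is free over the ring over which the tensor product is formed. The
  composite is therefore a direct sum of copies of \<open>N\<close>, one for each basis element of
  \<open>M\<close>, and each copy is free over the right variables.\<close>

lemma xfree_comp: "xfree n (bim_comp n M N) (KM \<times> KN) (tlift g) (aM + aN) (\<lambda>(i, j). qdM i + qdN j)"
  unfolding bim_comp_eq
proof (rule bt.xfree_tens[OF xM.xfree_axioms xN.xfree_axioms refl refl refl,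
      where bM="\<lambda>(i, j). xM.\<Psi> (unitv i)" and bN="\<lambda>(i, j). xN.\<Psi> (unitv j)"
      and dM="\<lambda>(i, j). qdM i" and dN="\<lambda>(i, j). qdN j"])
  fix m x assume mx: "m \<in> carrier M" "x \<in> carrier N"
  have "\<Phi>N (\<zero>\<^bsub>N\<^esub>) = 0" by simp
  then show vec: "g m x \<in> vecs n (KM \<times> KN)"
    using mx xM.Phi_vecs[of m] xN.Phi_vecs[OF xtoy_act[OF mx(2)]] xN.smult_l_null[of x]
    by (auto simp: vecs_def comp_coord_def)
  show "g (Cst c \<odot>\<^bsub>M\<^esub> m) x = (\<lambda>k. Cst c * g m x k)" for c
    using mx xN.smult_assoc1[of "Cst c" "xtoy n _" x] by (auto simp: comp_coord_def xM.Phi_smult xtoy_mult xtoy_XY xN.Phi_smult xtoy_act)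
  show "g (comp_l (vX i) \<odot>\<^bsub>M\<^esub> m) (comp_r (vX i) \<odot>\<^bsub>N\<^esub> x) = (\<lambda>k. xv i * g m x k)" if "i \<in> {1..n}" for i
  proof -
    have i: "xv i \<in> PR (XY n)" "xv i \<in> RX n" using that by simp_all
    have "xtoy n p \<odot>\<^bsub>N\<^esub> (xv i \<odot>\<^bsub>N\<^esub> x) = xv i \<odot>\<^bsub>N\<^esub> (xtoy n p \<odot>\<^bsub>N\<^esub> x)" for p
      using bt.N_comm[OF xtoy_XY i(1) mx(2)] .
    then show ?thesis using mx i xM.smult_one[of m]
      by (auto simp: comp_coord_def comp_l_def comp_r_def xN.Phi_smult xtoy_act)
  qed
  have gR: "g m x k \<in> RX n" for k using vec unfolding vecs_def by blast
  have bM: "xM.\<Psi> (unitv i) \<in> carrier M" if "i \<in> KM" for i using that by (intro xM.Psi_closed unitv_vecs)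
  have bN: "xN.\<Psi> (unitv i) \<in> carrier N" if "i \<in> KN" for i using that by (intro xN.Psi_closed unitv_vecs)
  have sl: "p \<odot>\<^bsub>bt.T\<^esub> bt.pt m' x' = bt.pt m' (p \<odot>\<^bsub>N\<^esub> x')" if "p \<in> RX n" "m' \<in> carrier M" "x' \<in> carrier N" for p m' x'
  proof -
    have "pol_subst comp_r p = p" using that(1) by (intro pol_subst_id[of "XV n"]) (auto simp: comp_r_def XV_def)
    moreover have "comp_l v = 1" if "v \<in> XV n" for v using that by (auto simp: comp_l_def XV_def)
    ultimately show ?thesis
      using bt.smult_pt_right[OF _ that(1) _ that(2,3)] by simp
  qed
  have "bt.pt m x = bt.pt (\<Oplus>\<^bsub>M\<^esub>i\<in>KM. \<Phi>M m i \<odot>\<^bsub>M\<^esub> xM.\<Psi> (unitv i)) x"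
    using xM.expand[OF mx(1)] by simp
  also have "\<dots> = (\<Oplus>\<^bsub>bt.T\<^esub>i\<in>KM. bt.pt (\<Phi>M m i \<odot>\<^bsub>M\<^esub> xM.\<Psi> (unitv i)) x)"
    using xM.finite_K mx bM Phi_M_RX by (intro bt.pt_finsum1) (auto intro!: xM.smult_closed RX_XY)
  also have "\<dots> = (\<Oplus>\<^bsub>bt.T\<^esub>i\<in>KM. \<Oplus>\<^bsub>bt.T\<^esub>j\<in>KN. g m x (i, j) \<odot>\<^bsub>bt.T\<^esub> bt.pt (xM.\<Psi> (unitv i)) (xN.\<Psi> (unitv j)))"
  proof (rule bt.T.finsum_cong')
    fix i assume i: "i \<in> KM"
    let ?x = "xtoy n (\<Phi>M m i) \<odot>\<^bsub>N\<^esub> x"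
    have "bt.pt (\<Phi>M m i \<odot>\<^bsub>M\<^esub> xM.\<Psi> (unitv i)) x = bt.pt (xM.\<Psi> (unitv i)) ?x"
      using i mx bM Phi_M_RX by (intro bt.pt_balanced) (auto simp: comp_mid_eq)
    also have "\<dots> = bt.pt (xM.\<Psi> (unitv i)) (\<Oplus>\<^bsub>N\<^esub>j\<in>KN. \<Phi>N ?x j \<odot>\<^bsub>N\<^esub> xN.\<Psi> (unitv j))"
      using xN.expand[OF xtoy_act[OF mx(2)]] by simp
    also have "\<dots> = (\<Oplus>\<^bsub>bt.T\<^esub>j\<in>KN. bt.pt (xM.\<Psi> (unitv i)) (\<Phi>N ?x j \<odot>\<^bsub>N\<^esub> xN.\<Psi> (unitv j)))"
      using xN.finite_K i bM bN Phi_N_RX[OF xtoy_act[OF mx(2)]] by (intro bt.pt_finsum2) (auto intro!: xN.smult_closed RX_XY)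
    also have "\<dots> = (\<Oplus>\<^bsub>bt.T\<^esub>j\<in>KN. g m x (i, j) \<odot>\<^bsub>bt.T\<^esub> bt.pt (xM.\<Psi> (unitv i)) (xN.\<Psi> (unitv j)))"
      using i bM bN gR
      by (intro bt.T.finsum_cong') (auto intro!: bt.smult_pt_closed RX_XY simp: sl, auto simp: comp_coord_def)
    finally show "bt.pt (\<Phi>M m i \<odot>\<^bsub>M\<^esub> xM.\<Psi> (unitv i)) x =
      (\<Oplus>\<^bsub>bt.T\<^esub>j\<in>KN. g m x (i, j) \<odot>\<^bsub>bt.T\<^esub> bt.pt (xM.\<Psi> (unitv i)) (xN.\<Psi> (unitv j)))" .
  qed (use bM bN gR in \<open>auto intro!: bt.T.finsum_closed bt.smult_pt_closed RX_XY\<close>)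
  also have "\<dots> = (\<Oplus>\<^bsub>bt.T\<^esub>k\<in>KM \<times> KN. g m x k \<odot>\<^bsub>bt.T\<^esub> bt.pt (case k of (i, j) \<Rightarrow> xM.\<Psi> (unitv i)) (case k of (i, j) \<Rightarrow> xN.\<Psi> (unitv j)))"
    using bM bN gR xM.finite_K xN.finite_K
    by (subst bt.T.finsum_product) (auto intro!: bt.smult_pt_closed RX_XY)
  finally show "bt.pt m x = (\<Oplus>\<^bsub>bt.T\<^esub>k\<in>KM \<times> KN. g m x k \<odot>\<^bsub>bt.T\<^esub> bt.pt (case k of (i, j) \<Rightarrow> xM.\<Psi> (unitv i)) (case k of (i, j) \<Rightarrow> xN.\<Psi> (unitv j)))" .
next
  fix k assume "k \<in> KM \<times> KN"
  then obtain i j where k: "k = (i, j)" "i \<in> KM" "j \<in> KN" by auto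
  show "(case k of (i, j) \<Rightarrow> xM.\<Psi> (unitv i)) \<in> cmp M aM (case k of (i, j) \<Rightarrow> qdM i)"
    "(case k of (i, j) \<Rightarrow> xN.\<Psi> (unitv j)) \<in> cmp N aN (case k of (i, j) \<Rightarrow> qdN j)"
    using k xM.basis_cmp xN.basis_cmp by auto
  have bN: "xN.\<Psi> (unitv j) \<in> carrier N" using k by (intro xN.Psi_closed unitv_vecs)
  have "g (xM.\<Psi> (unitv i)) (xN.\<Psi> (unitv j)) (i', j') = unitv (i, j) (i', j')" for i' j'
    using xN.smult_l_null[OF bN] xN.smult_one[OF bN] k
    by (auto simp: comp_coord_def xM.Phi_Psi xN.Phi_Psi unitv_vecs unitv_def)
  then show "g (case k of (i, j) \<Rightarrow> xM.\<Psi> (unitv i)) (case k of (i, j) \<Rightarrow> xN.\<Psi> (unitv j)) = unitv k"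
    by (auto simp: k)
next
  fix m x d d' and k :: "'k \<times> 'l" assume m: "m \<in> cmp M aM d" and x: "x \<in> cmp N aN d'"
  obtain i j where k: "k = (i, j)" by (cases k)
  have "xtoy n (\<Phi>M m i) \<in> qhom (d - qdM i)" using m by (auto simp: xM.cmp_eq intro: xtoy_qhom)
  from xN.smult_hom[OF xtoy_XY this x] have "xtoy n (\<Phi>M m i) \<odot>\<^bsub>N\<^esub> x \<in> cmp N aN (d' + (d - qdM i))" .
  then have "\<Phi>N (xtoy n (\<Phi>M m i) \<odot>\<^bsub>N\<^esub> x) j \<in> qhom (d' + (d - qdM i) - qdN j)" by (simp add: xN.cmp_eq)
  then show "g m x k \<in> qhom (d + d' - (case k of (i, j) \<Rightarrow> qdM i + qdN j))"
    by (simp add: comp_coord_def k algebra_simps)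
next
  fix v assume "v \<in> XY n"
  then show "\<exists>dl dr. comp_l v \<in> qhom dl \<and> comp_r v \<in> qhom dr \<and> dl + dr = 2"
  proof (cases v)
    case (vX i)
    then show ?thesis by (intro exI[of _ 0] exI[of _ 2]) (simp add: comp_l_def comp_r_def)
  next
    case (vY i)
    then show ?thesis by (intro exI[of _ 2] exI[of _ 0]) (simp add: comp_l_def comp_r_def)
  qed
qed (use xM.finite_K xN.finite_K in \<open>auto intro: g_add1 g_add2 g_bal\<close>)

end

subsection \<open>Disjoint union\<close>

definition union_l :: "nat \<Rightarrow> var \<Rightarrow> mpol" where
  "union_l n v = (case v of vX i \<Rightarrow> (if i \<le> n then Var (vX i) else 1) | vY i \<Rightarrow> (if i \<le> n then Var (vY i) else 1))"
definition union_r :: "nat \<Rightarrow> var \<Rightarrow> mpol" where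
  "union_r n v = (case v of vX i \<Rightarrow> (if i \<le> n then 1 else Var (vX (i - n))) | vY i \<Rightarrow> (if i \<le> n then 1 else Var (vY (i - n))))"

lemma bim_union_eq: "bim_union n = tens union_mid (union_l n) (union_r n)"
  by (rule ext)+ (simp add: bim_union_def union_l_def[abs_def] union_r_def[abs_def])

definition shv :: "nat \<Rightarrow> mpol \<Rightarrow> mpol" where
  "shv k = pol_subst (\<lambda>v. case v of vX i \<Rightarrow> Var (vX (i + k)) | vY i \<Rightarrow> Var (vY (i + k)))"

lemma shv_add: "shv k (p + q) = shv k p + shv k q" and shv_mult: "shv k (p * q) = shv k p * shv k q"
  and shv_uminus: "shv k (- p) = - shv k p" and shv_diff: "shv k (p - q) = shv k p - shv k q"
  and shv_0 [simp]: "shv k 0 = 0" and shv_1 [simp]: "shv k 1 = 1" and shv_Cst [simp]: "shv k (Cst c) = Cst c"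
  and shv_xv [simp]: "shv k (xv i) = xv (i + k)"
  by (auto simp: shv_def pol_subst_add pol_subst_mult pol_subst_uminus pol_subst_diff)

lemma shv_RX: "p \<in> RX n \<Longrightarrow> shv k p \<in> PR (vX ` {k+1..k+n})"
  unfolding shv_def by (rule pol_subst_PR[of "XV n"]) (auto simp: XV_def)

lemma shv_qhom: "p \<in> qhom d \<Longrightarrow> shv k p \<in> qhom d"
  unfolding shv_def by (rule pol_subst_qhom[of UNIV]) (auto split: var.split simp: PR_iff[of p])

definition union_coord ::
  "nat \<Rightarrow> ('a \<Rightarrow> 'k \<Rightarrow> mpol) \<Rightarrow> ('b \<Rightarrow> 'l \<Rightarrow> mpol) \<Rightarrow> 'a \<Rightarrow> 'b \<Rightarrow> 'k \<times> 'l \<Rightarrow> mpol" where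
  "union_coord k \<Phi>M \<Phi>N m x = (\<lambda>(i, j). \<Phi>M m i * shv k (\<Phi>N x j))"

locale xunion = xM: xfree nM M KM \<Phi>M aM qdM + xN: xfree nN N KN \<Phi>N aN qdN
  for nM and M :: "'a fcx" and KM :: "'k set" and \<Phi>M aM qdM and nN and N :: "'b fcx" and KN :: "'l set" and \<Phi>N aN qdN
begin

sublocale bt: bitensor_act union_mid M N "XY nM" "XY nN" "union_l nM" "union_r nM" "XY (nM + nN)"
proof (intro bitensor_act.intro bitensor.intro bitensor_act_axioms.intro)
  show "module (pol (XY nM)) M" "module (pol (XY nN)) N" by (rule xM.module_A xN.module_A)+
qed (auto simp: union_mid_def union_l_def union_r_def le_diff_conv split: var.split)

abbreviation g where "g \<equiv> union_coord nM \<Phi>M \<Phi>N"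

lemma Phi_M_RX: "m \<in> carrier M \<Longrightarrow> \<Phi>M m k \<in> RX nM"
  using xM.Phi_vecs by (auto simp: vecs_def)

lemma Phi_N_RX: "m \<in> carrier N \<Longrightarrow> \<Phi>N m k \<in> RX nN"
  using xN.Phi_vecs by (auto simp: vecs_def)

lemma g_add1: "m \<in> carrier M \<Longrightarrow> m' \<in> carrier M \<Longrightarrow> x \<in> carrier N \<Longrightarrow> g (m \<oplus>\<^bsub>M\<^esub> m') x = g m x + g m' x"
  by (auto simp: union_coord_def xM.Phi_add fun_eq_iff distrib_right)

lemma g_add2: "m \<in> carrier M \<Longrightarrow> x \<in> carrier N \<Longrightarrow> x' \<in> carrier N \<Longrightarrow> g m (x \<oplus>\<^bsub>N\<^esub> x') = g m x + g m x'"
  by (auto simp: union_coord_def xN.Phi_add shv_add fun_eq_iff distrib_left)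

lemma g_bal: "(a, b) \<in> union_mid \<Longrightarrow> m \<in> carrier M \<Longrightarrow> x \<in> carrier N \<Longrightarrow> g (a \<odot>\<^bsub>M\<^esub> m) x = g m (b \<odot>\<^bsub>N\<^esub> x)"
  by (auto simp: union_coord_def union_mid_def xM.Phi_smult xN.Phi_smult shv_mult fun_eq_iff)

lemma tlift_g_pt: "m \<in> carrier M \<Longrightarrow> x \<in> carrier N \<Longrightarrow> tlift g (bt.pt m x) = g m x"
  by (rule bt.tlift_pt[of g]) (auto intro: g_add1 g_add2 g_bal)

lemma shv_XV: "p \<in> RX nN \<Longrightarrow> shv nM p \<in> RX (nM + nN)"
  by (rule PR_mono[OF _ shv_RX]) (auto simp: XV_def)

lemma RX_le: "p \<in> RX nM \<Longrightarrow> p \<in> RX (nM + nN)"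
  by (rule PR_mono) (auto simp: XV_def)

lemma xfree_union: "xfree (nM + nN) (bim_union nM M N) (KM \<times> KN) (tlift g) (aM + aN) (\<lambda>(i, j). qdM i + qdN j)"
  unfolding bim_union_eq
proof (rule bt.xfree_tens[OF xM.xfree_axioms xN.xfree_axioms refl refl refl,
      where bM="\<lambda>(i, j). xM.\<Psi> (unitv i)" and bN="\<lambda>(i, j). xN.\<Psi> (unitv j)"
      and dM="\<lambda>(i, j). qdM i" and dN="\<lambda>(i, j). qdN j"])
  fix m x assume mx: "m \<in> carrier M" "x \<in> carrier N"
  show vec: "g m x \<in> vecs (nM + nN) (KM \<times> KN)"
    using mx xM.Phi_vecs[of m] xN.Phi_vecs[of x] RX_le[OF Phi_M_RX[OF mx(1)]] shv_XV[OF Phi_N_RX[OF mx(2)]]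
    by (auto simp: vecs_def union_coord_def)
  show "g (Cst c \<odot>\<^bsub>M\<^esub> m) x = (\<lambda>k. Cst c * g m x k)" for c
    using mx by (auto simp: union_coord_def xM.Phi_smult mult.assoc)
  show "g (union_l nM (vX i) \<odot>\<^bsub>M\<^esub> m) (union_r nM (vX i) \<odot>\<^bsub>N\<^esub> x) = (\<lambda>k. xv i * g m x k)" if "i \<in> {1..nM + nN}" for i
    using mx that xM.smult_one[of m] xN.smult_one[of x]
    by (cases "i \<le> nM") (auto simp: union_coord_def union_l_def union_r_def xM.Phi_smult xN.Phi_smult shv_mult le_diff_conv algebra_simps)
  have gR: "g m x k \<in> RX (nM + nN)" for k using vec unfolding vecs_def by blast
  have bM: "xM.\<Psi> (unitv i) \<in> carrier M" if "i \<in> KM" for i using that by (intro xM.Psi_closed unitv_vecs)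
  have bN: "xN.\<Psi> (unitv i) \<in> carrier N" if "i \<in> KN" for i using that by (intro xN.Psi_closed unitv_vecs)
  \<comment> \<open>The variables of the first \<open>nM\<close> strands touch only the left factor,
    the shifted ones only the right factor, so such a product acts factorwise.\<close>
  have sl: "(p * shv nM q) \<odot>\<^bsub>bt.T\<^esub> bt.pt m' x' = bt.pt (p \<odot>\<^bsub>M\<^esub> m') (q \<odot>\<^bsub>N\<^esub> x')"
    if pq: "p \<in> RX nM" "q \<in> RX nN" and m': "m' \<in> carrier M" "x' \<in> carrier N" for p q m' x'
  proof -
    let ?W = "vX ` {nM+1..nM+nN}"
    have p: "pol_subst (union_l nM) p = p" using pq(1) by (intro pol_subst_id[of "XV nM"]) (auto simp: union_l_def XV_def)
    have "pol_subst (union_r nM) (shv nM q) = pol_subst Var q"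
      unfolding shv_def using pq(2) by (rule pol_subst_comp[of "XV nN", rotated]) (auto simp: union_r_def XV_def)
    also have "\<dots> = q" using pq(2) by (rule pol_subst_id[rotated]) simp
    finally have q: "pol_subst (union_r nM) (shv nM q) = q" .
    have P: "p \<in> PR (XY (nM + nN))" "shv nM q \<in> PR (XY (nM + nN))" "q \<in> PR (XY nN)"
      using RX_le[OF pq(1)] shv_XV[OF pq(2)] pq(2) by (auto intro: RX_XY)
    have "(p * shv nM q) \<odot>\<^bsub>bt.T\<^esub> bt.pt m' x' = p \<odot>\<^bsub>bt.T\<^esub> (shv nM q \<odot>\<^bsub>bt.T\<^esub> bt.pt m' x')"
      using P m' bt.smult_assoc_pt by simp
    also have "shv nM q \<odot>\<^bsub>bt.T\<^esub> bt.pt m' x' = bt.pt m' (q \<odot>\<^bsub>N\<^esub> x')"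
    proof -
      have "?W \<subseteq> XY (nM + nN)" "\<And>v. v \<in> ?W \<Longrightarrow> union_l nM v = 1" by (auto simp: union_l_def)
      then show ?thesis
        using bt.smult_pt_right[of ?W "shv nM q" m' x'] shv_RX[OF pq(2), of nM] m' q by simp
    qed
    also have "p \<odot>\<^bsub>bt.T\<^esub> bt.pt m' (q \<odot>\<^bsub>N\<^esub> x') = bt.pt (p \<odot>\<^bsub>M\<^esub> m') (q \<odot>\<^bsub>N\<^esub> x')"
    proof -
      have "XV nM \<subseteq> XY (nM + nN)" "\<And>v. v \<in> XV nM \<Longrightarrow> union_r nM v = 1" by (auto simp: union_r_def XV_def)
      then show ?thesis
        using bt.smult_pt_left[of "XV nM" p m' "q \<odot>\<^bsub>N\<^esub> x'"] pq m' P p xN.smult_closed[of q x'] by simp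
    qed
    finally show ?thesis .
  qed
  have "bt.pt m x = bt.pt (\<Oplus>\<^bsub>M\<^esub>i\<in>KM. \<Phi>M m i \<odot>\<^bsub>M\<^esub> xM.\<Psi> (unitv i)) (\<Oplus>\<^bsub>N\<^esub>j\<in>KN. \<Phi>N x j \<odot>\<^bsub>N\<^esub> xN.\<Psi> (unitv j))"
    using xM.expand[OF mx(1)] xN.expand[OF mx(2)] by simp
  also have "\<dots> = (\<Oplus>\<^bsub>bt.T\<^esub>i\<in>KM. bt.pt (\<Phi>M m i \<odot>\<^bsub>M\<^esub> xM.\<Psi> (unitv i)) (\<Oplus>\<^bsub>N\<^esub>j\<in>KN. \<Phi>N x j \<odot>\<^bsub>N\<^esub> xN.\<Psi> (unitv j)))"
    using xM.finite_K mx bM bN Phi_M_RX Phi_N_RX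
    by (intro bt.pt_finsum1) (auto intro!: xM.smult_closed xN.smult_closed xN.finsum_closed RX_XY)
  also have "\<dots> = (\<Oplus>\<^bsub>bt.T\<^esub>i\<in>KM. \<Oplus>\<^bsub>bt.T\<^esub>j\<in>KN. g m x (i, j) \<odot>\<^bsub>bt.T\<^esub> bt.pt (xM.\<Psi> (unitv i)) (xN.\<Psi> (unitv j)))"
  proof (rule bt.T.finsum_cong')
    fix i assume i: "i \<in> KM"
    have "bt.pt (\<Phi>M m i \<odot>\<^bsub>M\<^esub> xM.\<Psi> (unitv i)) (\<Oplus>\<^bsub>N\<^esub>j\<in>KN. \<Phi>N x j \<odot>\<^bsub>N\<^esub> xN.\<Psi> (unitv j)) =
       (\<Oplus>\<^bsub>bt.T\<^esub>j\<in>KN. bt.pt (\<Phi>M m i \<odot>\<^bsub>M\<^esub> xM.\<Psi> (unitv i)) (\<Phi>N x j \<odot>\<^bsub>N\<^esub> xN.\<Psi> (unitv j)))"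
      using xN.finite_K i bM bN Phi_N_RX[OF mx(2)] Phi_M_RX[OF mx(1)]
      by (intro bt.pt_finsum2) (auto intro!: xN.smult_closed xM.smult_closed RX_XY)
    also have "\<dots> = (\<Oplus>\<^bsub>bt.T\<^esub>j\<in>KN. g m x (i, j) \<odot>\<^bsub>bt.T\<^esub> bt.pt (xM.\<Psi> (unitv i)) (xN.\<Psi> (unitv j)))"
      using i bM bN gR Phi_N_RX[OF mx(2)] Phi_M_RX[OF mx(1)]
      by (intro bt.T.finsum_cong') (auto intro!: bt.smult_pt_closed RX_XY, auto simp: union_coord_def sl)
    finally show "bt.pt (\<Phi>M m i \<odot>\<^bsub>M\<^esub> xM.\<Psi> (unitv i)) (\<Oplus>\<^bsub>N\<^esub>j\<in>KN. \<Phi>N x j \<odot>\<^bsub>N\<^esub> xN.\<Psi> (unitv j)) =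
      (\<Oplus>\<^bsub>bt.T\<^esub>j\<in>KN. g m x (i, j) \<odot>\<^bsub>bt.T\<^esub> bt.pt (xM.\<Psi> (unitv i)) (xN.\<Psi> (unitv j)))" .
  qed (use bM bN gR in \<open>auto intro!: bt.T.finsum_closed bt.smult_pt_closed RX_XY\<close>)
  also have "\<dots> = (\<Oplus>\<^bsub>bt.T\<^esub>k\<in>KM \<times> KN. g m x k \<odot>\<^bsub>bt.T\<^esub> bt.pt (case k of (i, j) \<Rightarrow> xM.\<Psi> (unitv i)) (case k of (i, j) \<Rightarrow> xN.\<Psi> (unitv j)))"
    using bM bN gR xM.finite_K xN.finite_K
    by (subst bt.T.finsum_product) (auto intro!: bt.smult_pt_closed RX_XY)
  finally show "bt.pt m x = (\<Oplus>\<^bsub>bt.T\<^esub>k\<in>KM \<times> KN. g m x k \<odot>\<^bsub>bt.T\<^esub> bt.pt (case k of (i, j) \<Rightarrow> xM.\<Psi> (unitv i)) (case k of (i, j) \<Rightarrow> xN.\<Psi> (unitv j)))" .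
next
  fix k assume "k \<in> KM \<times> KN"
  then obtain i j where k: "k = (i, j)" "i \<in> KM" "j \<in> KN" by auto
  show "(case k of (i, j) \<Rightarrow> xM.\<Psi> (unitv i)) \<in> cmp M aM (case k of (i, j) \<Rightarrow> qdM i)"
    "(case k of (i, j) \<Rightarrow> xN.\<Psi> (unitv j)) \<in> cmp N aN (case k of (i, j) \<Rightarrow> qdN j)"
    using k xM.basis_cmp xN.basis_cmp by auto
  have "g (xM.\<Psi> (unitv i)) (xN.\<Psi> (unitv j)) (i', j') = unitv (i, j) (i', j')" for i' j'
    using k by (auto simp: union_coord_def xM.Phi_Psi xN.Phi_Psi unitv_vecs unitv_def)
  then show "g (case k of (i, j) \<Rightarrow> xM.\<Psi> (unitv i)) (case k of (i, j) \<Rightarrow> xN.\<Psi> (unitv j)) = unitv k"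
    by (auto simp: k)
next
  fix m x d d' and k :: "'k \<times> 'l" assume m: "m \<in> cmp M aM d" and x: "x \<in> cmp N aN d'"
  obtain i j where k: "k = (i, j)" by (cases k)
  have "\<Phi>M m i \<in> qhom (d - qdM i)" "shv nM (\<Phi>N x j) \<in> qhom (d' - qdN j)"
    using m x by (auto simp: xM.cmp_eq xN.cmp_eq intro: shv_qhom)
  then show "g m x k \<in> qhom (d + d' - (case k of (i, j) \<Rightarrow> qdM i + qdN j))"
    by (auto simp: union_coord_def k intro: qhom_mult)
next
  fix v assume "v \<in> XY (nM + nN)"
  show "\<exists>dl dr. union_l nM v \<in> qhom dl \<and> union_r nM v \<in> qhom dr \<and> dl + dr = 2"
  proof (cases "(case v of vX i \<Rightarrow> i | vY i \<Rightarrow> i) \<le> nM")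
    case True
    then show ?thesis by (intro exI[of _ 2] exI[of _ 0]) (cases v; simp add: union_l_def union_r_def)
  next
    case False
    then show ?thesis by (intro exI[of _ 0] exI[of _ 2]) (cases v; simp add: union_l_def union_r_def)
  qed
qed (use xM.finite_K xN.finite_K in \<open>auto intro: g_add1 g_add2 g_bal\<close>)

end

subsection \<open>Shifts and zero objects\<close>

text \<open>Shifting, refiltering and truncating relabel the grading at most and leave the module
  operations and coordinates alone; the lemmas that follow for these operations are derived from
  this one.\<close>

lemma xfree_transfer:
  fixes A :: "('m, 'e) gcx_scheme" and A' :: "('m, 'f) gcx_scheme"
  assumes A: "xfree n A K \<Phi> a qd"
    and eq: "carrier A' = carrier A" "zero A' = zero A" "add A' = add A" "smult A' = smult A"
    and cmp: "\<And>i q. cmp A' i q = cmp A (i - k) (q - d)"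
    and bd: "\<And>x. x \<in> carrier A \<Longrightarrow> bd A' x = \<zero>\<^bsub>A\<^esub>"
  shows "xfree n A' K \<Phi> (a + k) (\<lambda>j. qd j + d)"
proof -
  interpret A: xfree n A K \<Phi> a qd by (rule A)
  show ?thesis
  proof (rule xfree.intro)
    have "abelian_group A'"
    proof (rule abelian_groupI)
      fix x assume "x \<in> carrier A'"
      then show "\<exists>y\<in>carrier A'. y \<oplus>\<^bsub>A'\<^esub> x = \<zero>\<^bsub>A'\<^esub>"
        using A.l_neg[of x] A.a_inv_closed[of x] by (auto simp: eq)
    qed (auto simp: eq A.a_ac)
    then show "module (pol (XY n)) A'"
      using A.smult_l_distr A.smult_r_distr A.smult_assoc1 A.smult_one
      by (intro moduleI) (auto simp: eq)
    show "cmp A' i q = (if i = a + k then {x\<in>carrier A'. \<forall>j. \<Phi> x j \<in> qhom (q - (qd j + d))} else {\<zero>\<^bsub>A'\<^esub>})" for i q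
      by (auto simp: cmp A.cmp_eq eq algebra_simps)
    show "p \<odot>\<^bsub>A'\<^esub> x \<in> cmp A' (a + k) (q + d')"
      if "p \<in> PR (XY n)" "p \<in> qhom d'" "x \<in> cmp A' (a + k) q" for p d' x q
      using A.smult_hom[OF that(1,2), of x "q - d"] that(3) by (simp add: cmp eq algebra_simps)
  qed (use A.finite_K A.bij A.Phi_add A.Phi_smult bd in \<open>auto simp: eq\<close>)
qed

lemma xfree_ashift: "xfree n A K \<Phi> a qd \<Longrightarrow> xfree n (ashift k A) K \<Phi> (a + k) qd"
proof -
  assume A: "xfree n A K \<Phi> a qd"
  then interpret A: xfree n A K \<Phi> a qd .
  show ?thesis
    using xfree_transfer[OF A, of "ashift k A" k 0] by (simp add: ashift_def A.bd_zero)
qed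

lemma xfree_qshift: "xfree n A K \<Phi> a qd \<Longrightarrow> xfree n (qshift d A) K \<Phi> a (\<lambda>j. qd j + d)"
  using xfree_transfer[of n A K \<Phi> a qd "qshift d A" 0 d] by (simp add: qshift_def xfree.bd_zero)

lemma xfree_filt: "xfree n A K \<Phi> a qd \<Longrightarrow> xfree n (A\<lparr>filt := f\<rparr>) K \<Phi> a qd"
  using xfree_transfer[of n A K \<Phi> a qd "A\<lparr>filt := f\<rparr>" 0 0] by (simp add: xfree.bd_zero)

lemma xfree_shalf: "xfree n A K \<Phi> a qd \<Longrightarrow> xfree n (shalf j A) K \<Phi> a qd"
  unfolding shalf_def by (rule xfree_filt)

lemma xfree_truncate: "xfree n A K \<Phi> a qd \<Longrightarrow> xfree n (gcx.truncate A) K \<Phi> a qd"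
  using xfree_transfer[of n A K \<Phi> a qd "gcx.truncate A" 0 0] by (simp add: gcx.truncate_def xfree.bd_zero)

lemma xfree_zero:
  assumes c: "carrier A = {\<zero>\<^bsub>A\<^esub>}" and ops: "\<zero>\<^bsub>A\<^esub> \<oplus>\<^bsub>A\<^esub> \<zero>\<^bsub>A\<^esub> = \<zero>\<^bsub>A\<^esub>" "\<And>p. p \<odot>\<^bsub>A\<^esub> \<zero>\<^bsub>A\<^esub> = \<zero>\<^bsub>A\<^esub>"
    and cmp: "\<And>i q. cmp A i q = {\<zero>\<^bsub>A\<^esub>}" and bd: "bd A \<zero>\<^bsub>A\<^esub> = \<zero>\<^bsub>A\<^esub>"
  shows "xfree n A {} (\<lambda>_ _. 0) a qd"
proof (rule xfree.intro)
  have "abelian_group A" by (rule abelian_groupI) (auto simp: c ops)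
  then show "module (pol (XY n)) A" by (intro moduleI) (auto simp: c ops)
  have "vecs n {} = {\<lambda>_. 0}" by (auto simp: vecs_def fun_eq_iff)
  then show "bij_betw (\<lambda>_ _. 0) (carrier A) (vecs n {})" by (auto simp: bij_betw_def c)
qed (auto simp: c ops cmp bd fun_eq_iff)

text \<open>On a zero module any degrees are consistent. This takes care of positions of the wrong
  parity, at which \<open>a\<close>-degrees computed by \<open>div\<close> need not add up.\<close>

lemma xfree_empty:
  assumes "xfree n A {} \<Phi> a qd" shows "carrier A = {\<zero>\<^bsub>A\<^esub>}" "xfree n A {} \<Phi> a' qd'"
proof -
  interpret A: xfree n A "{}" \<Phi> a qd by (rule assms)
  have z: "\<Phi> x = 0" if "x \<in> carrier A" for x using A.Phi_vecs[OF that] by (auto simp: vecs_def fun_eq_iff)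
  have "x = \<zero>\<^bsub>A\<^esub>" if "x \<in> carrier A" for x
    by (rule A.Phi_inject) (use that z in auto)
  then show c: "carrier A = {\<zero>\<^bsub>A\<^esub>}" by auto
  have cmp: "cmp A i q = {\<zero>\<^bsub>A\<^esub>}" for i q using A.cmp_zero[of i q] A.cmp_carrier[of i q] c by auto
  show "xfree n A {} \<Phi> a' qd'"
  proof (rule xfree.intro)
    show "cmp A i q = (if i = a' then {x\<in>carrier A. \<forall>k. \<Phi> x k \<in> qhom (q - qd' k)} else {\<zero>\<^bsub>A\<^esub>})" for i q
      by (auto simp: cmp c)
    show "p \<odot>\<^bsub>A\<^esub> x \<in> cmp A a' (q + d)" if "p \<in> PR (XY n)" "x \<in> cmp A a' q" for p d x q
      using that by (simp add: cmp)
  qed (use A.bij A.Phi_add A.Phi_smult A.bd_zero A.module_A in auto)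
qed

subsection \<open>Cyclic modules\<close>

lemma ideal_rel_ideal: "S \<subseteq> PR (XY n) \<Longrightarrow> ideal (rel_ideal n S) (pol (XY n))"
  using ring.genideal_ideal[of "pol (XY n)" S] cring_pol[of "XY n"]
  unfolding rel_ideal_def xyring_eq by (simp add: cring_def)

lemma rel_ideal_ops:
  assumes "S \<subseteq> PR (XY n)"
  shows "0 \<in> rel_ideal n S" "p \<in> rel_ideal n S \<Longrightarrow> q \<in> rel_ideal n S \<Longrightarrow> p + q \<in> rel_ideal n S"
    "p \<in> rel_ideal n S \<Longrightarrow> r \<in> PR (XY n) \<Longrightarrow> r * p \<in> rel_ideal n S"
proof -
  have "additive_subgroup (rel_ideal n S) (pol (XY n))" using ideal_rel_ideal[OF assms] by (rule ideal.axioms)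
  from additive_subgroup.zero_closed[OF this] additive_subgroup.a_closed[OF this, of p q]
    ideal.I_l_closed[OF ideal_rel_ideal[OF assms], of p r]
  show "0 \<in> rel_ideal n S" "p \<in> rel_ideal n S \<Longrightarrow> q \<in> rel_ideal n S \<Longrightarrow> p + q \<in> rel_ideal n S"
    "p \<in> rel_ideal n S \<Longrightarrow> r \<in> PR (XY n) \<Longrightarrow> r * p \<in> rel_ideal n S"
    by simp_all
qed

text \<open>A normal form criterion for a cyclic module. By \<open>one\<close> and
  \<open>step\<close> the span of the \<open>e k\<close> over the right variables contains 1 and is
  stable under the left variables modulo the ideal, hence is everything; \<open>uniq\<close> is
  linear independence modulo the ideal.\<close>

locale cyc =
  fixes n :: nat and S :: "mpol set" and K :: "'k set" and e :: "'k \<Rightarrow> mpol" and qd :: "'k \<Rightarrow> int"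
  assumes K: "finite K" and S: "S \<subseteq> PR (XY n)" and e: "e k \<in> PR (XY n)" and eq: "e k \<in> qhom (qd k)"
    and one: "\<exists>v\<in>vecs n K. (\<forall>k. v k \<in> qhom (- qd k)) \<and> 1 - (\<Sum>k\<in>K. v k * e k) \<in> rel_ideal n S"
    and step: "i \<in> {1..n} \<Longrightarrow> k \<in> K \<Longrightarrow>
      \<exists>v\<in>vecs n K. (\<forall>j. v j \<in> qhom (qd k + 2 - qd j)) \<and> yv i * e k - (\<Sum>k\<in>K. v k * e k) \<in> rel_ideal n S"
    and uniq: "v \<in> vecs n K \<Longrightarrow> (\<Sum>k\<in>K. v k * e k) \<in> rel_ideal n S \<Longrightarrow> v = 0"
begin

abbreviation I where "I \<equiv> rel_ideal n S"
definition comb where "comb v = (\<Sum>k\<in>K. v k * e k)"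
abbreviation co where "co p \<equiv> I +>\<^bsub>pol (XY n)\<^esub> p"
abbreviation A where "A \<equiv> cyc_bim n S"

lemma ideal_I: "ideal I (pol (XY n))"
  by (rule ideal_rel_ideal[OF S])

sublocale I: ideal I "pol (XY n)" by (rule ideal_I)

lemma I_0: "0 \<in> I" by (rule rel_ideal_ops[OF S])
lemma I_add: "p \<in> I \<Longrightarrow> q \<in> I \<Longrightarrow> p + q \<in> I" by (rule rel_ideal_ops[OF S])
lemma I_mult: "p \<in> I \<Longrightarrow> q \<in> PR (XY n) \<Longrightarrow> q * p \<in> I" by (rule rel_ideal_ops[OF S])
lemma I_neg: "p \<in> I \<Longrightarrow> - p \<in> I" using I_mult[of p "- 1"] by simp
lemma I_diff: "p \<in> I \<Longrightarrow> q \<in> I \<Longrightarrow> p - q \<in> I" using I_add[of p "- q"] I_neg by simp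
lemma I_sum: "(\<And>i. i \<in> J \<Longrightarrow> f i \<in> I) \<Longrightarrow> sum f J \<in> I"
  by (induction J rule: infinite_finite_induct) (auto intro: I_0 I_add)

lemma co_eq_image: "co p = (\<lambda>h. h + p) ` I"
  by (auto simp: a_r_coset_def')

lemma co_eq_iff: "co p = co q \<longleftrightarrow> p - q \<in> I"
proof
  assume "co p = co q"
  moreover have "p \<in> co p" unfolding co_eq_image using I_0 by force
  ultimately obtain k where "k \<in> I" "p = k + q" by (auto simp: co_eq_image)
  then show "p - q \<in> I" by simp
next
  have *: "co u \<subseteq> co v" if "u - v \<in> I" for u v
  proof
    fix w assume "w \<in> co u"
    then obtain k where "k \<in> I" "w = k + u" by (auto simp: co_eq_image)
    then show "w \<in> co v" unfolding co_eq_image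
      using I_add[OF \<open>k \<in> I\<close> that] by (intro image_eqI[of _ _ "k + (u - v)"]) auto
  qed
  assume "p - q \<in> I"
  then show "co p = co q" using *[of p q] *[of q p] I_neg[of "p - q"] by simp
qed

lemma A_carrier: "carrier A = co ` PR (XY n)"
  by (auto simp: cyc_bim_def Let_def xyring_eq FactRing_def A_RCOSETS_def')

lemma A_zero: "\<zero>\<^bsub>A\<^esub> = co 0"
  by (simp add: cyc_bim_def Let_def xyring_eq FactRing_def co_eq_image)

lemma A_add: "p \<in> PR (XY n) \<Longrightarrow> q \<in> PR (XY n) \<Longrightarrow> co p \<oplus>\<^bsub>A\<^esub> co q = co (p + q)"
  using I.a_rcos_sum[of p q] by (simp add: cyc_bim_def Let_def xyring_eq FactRing_def)

lemma A_smult: "p \<in> PR (XY n) \<Longrightarrow> q \<in> PR (XY n) \<Longrightarrow> p \<odot>\<^bsub>A\<^esub> co q = co (p * q)"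
  using I.rcoset_mult_add[of p q] by (simp add: cyc_bim_def Let_def xyring_eq FactRing_def)

lemma A_cmp: "cmp A i q = (if i = 0 then co ` (PR (XY n) \<inter> qhom q) else {\<zero>\<^bsub>A\<^esub>})"
  by (simp add: cyc_bim_def Let_def xyring_eq)

lemma A_bd: "bd A x = \<zero>\<^bsub>A\<^esub>"
  by (simp add: cyc_bim_def Let_def)

lemma module_cyc: "module (pol (XY n)) A"
proof (rule moduleI)
  show "abelian_group A"
  proof (rule abelian_groupI)
    fix x assume "x \<in> carrier A"
    then obtain p where "p \<in> PR (XY n)" "x = co p" by (auto simp: A_carrier)
    then show "\<exists>y\<in>carrier A. y \<oplus>\<^bsub>A\<^esub> x = \<zero>\<^bsub>A\<^esub>"
      by (intro bexI[of _ "co (- p)"]) (auto simp: A_carrier A_add A_zero)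
  qed (auto simp: A_carrier A_add A_zero algebra_simps)
qed (auto simp: A_carrier A_add A_smult algebra_simps)

lemma comb_add: "comb (v + w) = comb v + comb w"
  by (simp add: comb_def distrib_right sum.distrib)
lemma comb_diff: "comb (v - w) = comb v - comb w"
  by (simp add: comb_def left_diff_distrib sum_subtractf)
lemma comb_scale: "comb (\<lambda>k. p * v k) = p * comb v"
  by (simp add: comb_def sum_distrib_left mult.assoc)
lemma comb_0: "comb 0 = 0" "comb (\<lambda>_. 0) = 0" by (simp_all add: comb_def)

lemma vecs_add: "v \<in> vecs n K \<Longrightarrow> w \<in> vecs n K \<Longrightarrow> v + w \<in> vecs n K"
  and vecs_diff: "v \<in> vecs n K \<Longrightarrow> w \<in> vecs n K \<Longrightarrow> v - w \<in> vecs n K"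
  and vecs_scale: "p \<in> RX n \<Longrightarrow> v \<in> vecs n K \<Longrightarrow> (\<lambda>k. p * v k) \<in> vecs n K"
  by (auto simp: vecs_def)

lemma comb_PR: "v \<in> vecs n K \<Longrightarrow> comb v \<in> PR (XY n)"
  unfolding comb_def by (intro PR_sum PR_mult e RX_XY) (auto simp: vecs_def)

text \<open>Reduction to the span with control of degrees. The bound on the coefficients is what
  identifies the graded components of the quotient in \<open>xfree_cyc\<close>.\<close>

definition NF :: "mpol \<Rightarrow> int \<Rightarrow> bool" where
  "NF p d \<longleftrightarrow> (\<exists>v\<in>vecs n K. (\<forall>k. v k \<in> qhom (d - qd k)) \<and> p - comb v \<in> I)"

lemma NF_add: assumes "NF p d" "NF q d" shows "NF (p + q) d"
proof -
  obtain v w where v: "v \<in> vecs n K" "\<forall>k. v k \<in> qhom (d - qd k)" "p - comb v \<in> I"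
    and w: "w \<in> vecs n K" "\<forall>k. w k \<in> qhom (d - qd k)" "q - comb w \<in> I" using assms by (auto simp: NF_def)
  have "p + q - comb (v + w) \<in> I" using I_add[OF v(3) w(3)] by (simp add: comb_add algebra_simps)
  then show ?thesis unfolding NF_def using v w by (intro bexI[of _ "v + w"]) (auto intro: vecs_add)
qed

lemma NF_scale: assumes "NF p d" "r \<in> RX n" "r \<in> qhom d'" "d'' = d + d'" shows "NF (r * p) d''"
proof -
  obtain v where v: "v \<in> vecs n K" "\<forall>k. v k \<in> qhom (d - qd k)" "p - comb v \<in> I" using assms by (auto simp: NF_def)
  have "r * p - comb (\<lambda>k. r * v k) \<in> I"
    using I_mult[OF v(3) RX_XY[OF assms(2)]] by (simp add: comb_scale algebra_simps)
  then show ?thesis unfolding NF_def using v assms(2-4)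
    by (intro bexI[of _ "\<lambda>k. r * v k"]) (auto intro: vecs_scale qhom_mult)
qed

lemma NF_0: "NF 0 d"
  unfolding NF_def by (intro bexI[of _ 0]) (auto simp: comb_0 I_0 vecs_def)

lemma NF_sum: "(\<And>i. i \<in> J \<Longrightarrow> NF (f i) d) \<Longrightarrow> NF (sum f J) d"
  by (induction J rule: infinite_finite_induct) (auto intro: NF_0 NF_add)

lemma NF_cong: "NF p d \<Longrightarrow> q - p \<in> I \<Longrightarrow> NF q d"
  unfolding NF_def using I_add by fastforce

lemma NF_yv: assumes "NF p d" "i \<in> {1..n}" shows "NF (yv i * p) (d + 2)"
proof -
  obtain v where v: "v \<in> vecs n K" "\<forall>k. v k \<in> qhom (d - qd k)" "p - comb v \<in> I" using assms by (auto simp: NF_def)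
  have "NF (yv i * comb v) (d + 2)"
    unfolding comb_def sum_distrib_left
  proof (rule NF_sum)
    fix k assume k: "k \<in> K"
    have "NF (yv i * e k) (qd k + 2)" using step[OF assms(2) k] by (simp add: NF_def comb_def)
    then have "NF (v k * (yv i * e k)) (d + 2)"
      by (rule NF_scale[where d'="d - qd k"]) (use v in \<open>auto simp: vecs_def\<close>)
    then show "NF (yv i * (v k * e k)) (d + 2)" by (simp add: ac_simps)
  qed
  moreover have "yv i * p - yv i * comb v \<in> I"
    using I_mult[OF v(3), of "yv i"] assms(2) by (simp add: algebra_simps)
  ultimately show ?thesis by (rule NF_cong)
qed

lemma NF_qhom: assumes "p \<in> PR (XY n)" "p \<in> qhom d" shows "NF p d"
proof -
  have s: "NF (Poly_Mapping.single e c) (mdeg e)" if "Poly_Mapping.keys e \<subseteq> XY n" for e c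
    using that
  proof (induction e rule: monom_induct)
    case 0
    have "NF 1 0" using one by (simp add: NF_def comb_def)
    then have "NF (Cst c * 1) 0" by (rule NF_scale[where d'=0]) auto
    then show ?case by (simp add: Cst_def mdeg_def)
  next
    case (Suc v e)
    have d: "mdeg (Poly_Mapping.single v 1 + e) = mdeg e + 2"
      by (simp add: mdeg_add) (simp add: mdeg_def)
    show ?case
    proof (cases v)
      case (vX i)
      then show ?thesis unfolding single_Suc_monom d using Suc by (intro NF_scale[OF Suc(3), where d'=2]) auto
    next
      case (vY i)
      then show ?thesis unfolding single_Suc_monom d using Suc by (auto intro!: NF_yv simp del: single_Suc_monom)
    qed
  qed
  have "NF (\<Sum>e\<in>Poly_Mapping.keys p. Poly_Mapping.single e (Poly_Mapping.lookup p e)) d"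
    using s assms by (intro NF_sum) (fastforce simp: PR_iff qhom_iff)
  then show ?thesis by (simp add: poly_sum_monom[symmetric])
qed

lemma normal_form: assumes "p \<in> PR (XY n)" shows "\<exists>v\<in>vecs n K. p - comb v \<in> I"
proof -
  have "\<exists>v\<in>vecs n K. (\<Sum>d\<in>D. hpart d p) - comb v \<in> I" if "finite D" for D
    using that
  proof (induction D rule: finite_induct)
    case empty
    then show ?case by (intro bexI[of _ 0]) (auto simp: comb_0 I_0 vecs_def)
  next
    case (insert d D)
    then obtain v where v: "v \<in> vecs n K" "(\<Sum>d\<in>D. hpart d p) - comb v \<in> I" by auto
    obtain w where w: "w \<in> vecs n K" "hpart d p - comb w \<in> I"
      using NF_qhom[of "hpart d p" d] assms by (auto simp: NF_def)
    have "(hpart d p + (\<Sum>d\<in>D. hpart d p)) - comb (w + v) \<in> I"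
      using I_add[OF w(2) v(2)] by (simp add: comb_add algebra_simps)
    then show ?case unfolding sum.insert[OF insert(1,2)] using vecs_add[OF w(1) v(1)] by blast
  qed
  from this[OF hpart_finite[of p]] show ?thesis by (simp add: hpart_sum_all[OF hpart_finite])
qed

definition nf :: "mpol set \<Rightarrow> 'k \<Rightarrow> mpol" where
  "nf c = (THE v. v \<in> vecs n K \<and> c = co (comb v))"

lemma nf_eq: assumes "v \<in> vecs n K" "p - comb v \<in> I" shows "nf (co p) = v"
  unfolding nf_def
proof (rule the_equality)
  fix w assume w: "w \<in> vecs n K \<and> co p = co (comb w)"
  have "comb (w - v) \<in> I"
    using I_diff[OF assms(2), of "p - comb w"] w by (simp add: co_eq_iff comb_diff)
  then have "w - v = 0" using w assms(1) by (intro uniq vecs_diff) (auto simp: comb_def)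
  then show "w = v" by simp
qed (use assms co_eq_iff in auto)

lemma xfree_cyc: "xfree n A K nf 0 qd"
proof (rule xfree.intro)
  have ex: "\<exists>v. x = co (comb v) \<and> nf x = v \<and> v \<in> vecs n K" if "x \<in> carrier A" for x
  proof -
    from that obtain p where p: "p \<in> PR (XY n)" "x = co p" by (auto simp: A_carrier)
    from normal_form[OF p(1)] obtain v where "v \<in> vecs n K" "p - comb v \<in> I" by blast
    then show ?thesis using nf_eq[of v p] co_eq_iff p by auto
  qed
  have nfc: "nf (co (comb v)) = v" if "v \<in> vecs n K" for v using that by (intro nf_eq) (auto simp: I_0)
  show "module (pol (XY n)) A" by (rule module_cyc)
  show "finite K" by (rule K)
  show "bij_betw nf (carrier A) (vecs n K)"
    by (rule bij_betw_byWitness[of _ "\<lambda>v. co (comb v)"]) (use ex nfc comb_PR in \<open>auto simp: A_carrier\<close>)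
  show "nf (x \<oplus>\<^bsub>A\<^esub> y) = nf x + nf y" if xy: "x \<in> carrier A" "y \<in> carrier A" for x y
  proof -
    obtain v w where "x = co (comb v)" "v \<in> vecs n K" "y = co (comb w)" "w \<in> vecs n K" using ex[OF xy(1)] ex[OF xy(2)] by blast
    then show ?thesis by (simp add: A_add comb_PR comb_add[symmetric] nfc vecs_add)
  qed
  show "nf (p \<odot>\<^bsub>A\<^esub> x) = (\<lambda>k. p * nf x k)" if px: "p \<in> RX n" "x \<in> carrier A" for p x
  proof -
    obtain v where "x = co (comb v)" "v \<in> vecs n K" using ex[OF px(2)] by blast
    then show ?thesis using px(1) by (simp add: A_smult comb_PR RX_XY comb_scale[symmetric] nfc vecs_scale)
  qed
  show "cmp A i q = (if i = 0 then {x\<in>carrier A. \<forall>k. nf x k \<in> qhom (q - qd k)} else {\<zero>\<^bsub>A\<^esub>})" for i q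
  proof (cases "i = 0")
    case True
    have "co p \<in> carrier A \<and> (\<forall>k. nf (co p) k \<in> qhom (q - qd k))" if p: "p \<in> PR (XY n)" "p \<in> qhom q" for p
      using NF_qhom[OF p] p(1) by (auto simp: NF_def nf_eq A_carrier)
    moreover have "x \<in> co ` (PR (XY n) \<inter> qhom q)"
      if x: "x \<in> carrier A" "\<And>k. nf x k \<in> qhom (q - qd k)" for x
    proof -
      obtain v where v: "x = co (comb v)" "nf x = v" "v \<in> vecs n K" using ex[OF x(1)] by blast
      have "comb v \<in> qhom q" unfolding comb_def using x(2) v(2) eq by (intro qhom_sum qhom_mult[of _ "q - qd _"]) auto
      then show ?thesis using v comb_PR by auto
    qed
    ultimately show ?thesis unfolding A_cmp using True by auto
  qed (simp add: A_cmp)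
  show "p \<odot>\<^bsub>A\<^esub> x \<in> cmp A 0 (q + d)" if "p \<in> PR (XY n)" "p \<in> qhom d" "x \<in> cmp A 0 q" for p d x q
    using that by (auto simp: A_cmp A_smult qhom_mult[of p d _ q] add.commute)
qed (simp add: A_bd)

end

text \<open>The polynomials killed by a substitution form an ideal. Evaluation on graphs of
  permutations, where the relations vanish, is the means to prove linear independence modulo the
  relations.\<close>

lemma rel_ideal_subst:
  assumes S: "S \<subseteq> PR (XY n)" and k: "\<And>p. p \<in> S \<Longrightarrow> pol_subst \<sigma> p = 0" and p: "p \<in> rel_ideal n S"
  shows "pol_subst \<sigma> p = 0"
proof -
  let ?J = "{p \<in> PR (XY n). pol_subst \<sigma> p = 0}"
  interpret R: cring "pol (XY n)" by simp
  have "ideal ?J (pol (XY n))"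
  proof (rule idealI)
    have "\<ominus>\<^bsub>pol (XY n)\<^esub> x = - x" if "x \<in> PR (XY n)" for x
      using that by (intro R.minus_equality) auto
    note inv = this[unfolded a_inv_def, simplified]
    show "subgroup ?J (add_monoid (pol (XY n)))"
      by (rule group.subgroupI[OF R.a_group])
        (auto simp: pol_subst_add pol_subst_uminus inv intro!: exI[of _ 0])
  qed (auto simp: pol_subst_mult R.ring_axioms)
  then have "rel_ideal n S \<subseteq> ?J"
    unfolding rel_ideal_def xyring_eq using S k by (intro R.genideal_minimal) auto
  then show ?thesis using p by auto
qed

lemma rel_ideal_incl: "S \<subseteq> PR (XY n) \<Longrightarrow> p \<in> S \<Longrightarrow> p \<in> rel_ideal n S"
  unfolding rel_ideal_def xyring_eq
  using ring.genideal_self[of "pol (XY n)" S] cring_pol[of "XY n"] by (auto simp: cring_def)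

section \<open>Bases of the elementary bimodules\<close>

lemma Var_inject: "Var v = Var w \<longleftrightarrow> v = w"
proof
  assume "Var v = Var w"
  then have "Poly_Mapping.keys (Var v) = Poly_Mapping.keys (Var w)" by simp
  then have "Poly_Mapping.single v (1::nat) = Poly_Mapping.single w 1" by (simp add: Var_def)
  then have "Poly_Mapping.keys (Poly_Mapping.single v (1::nat)) = Poly_Mapping.keys (Poly_Mapping.single w (1::nat))" by (rule arg_cong)
  then show "v = w" by simp
qed simp

lemma Cst_numeral: "Cst (numeral w) = numeral w"
  by (simp add: Cst_def)

lemma cyc_J: "cyc 1 {yv 1 - xv 1} {()} (\<lambda>_. 1) (\<lambda>_. 0)"
proof
  let ?S = "{yv 1 - xv 1}"
  have S: "?S \<subseteq> PR (XY 1)" by auto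
  then show "?S \<subseteq> PR (XY 1)" .
  show "\<exists>v\<in>vecs 1 {()}. (\<forall>k. v k \<in> qhom (- 0)) \<and> 1 - (\<Sum>k\<in>{()}. v k * 1) \<in> rel_ideal 1 ?S"
    by (rule bexI[of _ "\<lambda>_. 1"]) (use rel_ideal_ops(1)[OF S] in \<open>auto simp: vecs_def\<close>)
  fix i k assume i: "i \<in> {1..1::nat}"
  show "\<exists>v\<in>vecs 1 {()}. (\<forall>j. v j \<in> qhom (0 + 2 - 0)) \<and> yv i * 1 - (\<Sum>k\<in>{()}. v k * 1) \<in> rel_ideal 1 ?S"
    using rel_ideal_incl[OF S, of "yv 1 - xv 1"] i
    by (intro bexI[of _ "\<lambda>_. xv 1"]) (auto simp: vecs_def)
next
  fix v :: "unit \<Rightarrow> mpol" assume v: "v \<in> vecs 1 {()}" and I: "(\<Sum>k\<in>{()}. v k * 1) \<in> rel_ideal 1 {yv 1 - xv 1}"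
  let ?\<sigma> = "\<lambda>v. case v of vX i \<Rightarrow> xv i | vY i \<Rightarrow> xv i"
  have "pol_subst ?\<sigma> (v ()) = 0"
    by (rule rel_ideal_subst[of "{yv 1 - xv 1}" 1]) (use I in \<open>auto simp: pol_subst_diff\<close>)
  moreover have "pol_subst ?\<sigma> (v ()) = v ()"
    using v by (intro pol_subst_id[of "XV 1"]) (auto simp: vecs_def XV_def)
  ultimately show "v = 0" by (auto simp: fun_eq_iff)
qed auto

text \<open>Basis indices of a crossing: \<open>B0\<close> and \<open>B1\<close> belong to the basis
  1, y of the blob, \<open>TI\<close> to the generator of the identity bimodule.\<close>

datatype trit = B0 | B1 | TI

lemma trit_UNIV: "(UNIV :: trit set) = {B0, B1, TI}"
  using trit.exhaust by blast

instance trit :: finite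
  by standard (simp add: trit_UNIV)

lemma I_rels_PR: "I_rels \<subseteq> PR (XY 2)"
  by (auto simp: I_rels_def)

lemma cyc_I: "cyc 2 I_rels {TI} (\<lambda>_. 1) (\<lambda>_. 0)"
proof
  show "I_rels \<subseteq> PR (XY 2)" by (rule I_rels_PR)
  show "\<exists>v\<in>vecs 2 {TI}. (\<forall>k. v k \<in> qhom (- 0)) \<and> 1 - (\<Sum>k\<in>{TI}. v k * 1) \<in> rel_ideal 2 I_rels"
    by (rule bexI[of _ "\<lambda>t. if t = TI then 1 else 0"]) (auto simp: rel_ideal_ops[OF I_rels_PR] vecs_def)
  fix i k assume i: "i \<in> {1..2::nat}"
  then have "i = 1 \<or> i = 2" by auto
  then show "\<exists>v\<in>vecs 2 {TI}. (\<forall>j. v j \<in> qhom (0 + 2 - 0)) \<and> yv i * 1 - (\<Sum>k\<in>{TI}. v k * 1) \<in> rel_ideal 2 I_rels"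
    using rel_ideal_incl[OF I_rels_PR, of "yv i - xv i"]
    by (intro bexI[of _ "\<lambda>t. if t = TI then xv i else 0"]) (auto simp: vecs_def I_rels_def)
next
  fix v :: "trit \<Rightarrow> mpol" assume v: "v \<in> vecs 2 {TI}" and I: "(\<Sum>k\<in>{TI}. v k * 1) \<in> rel_ideal 2 I_rels"
  let ?\<sigma> = "\<lambda>v. case v of vX i \<Rightarrow> xv i | vY i \<Rightarrow> xv i"
  have "pol_subst ?\<sigma> (v TI) = 0"
    by (rule rel_ideal_subst[OF I_rels_PR]) (use I in \<open>auto simp: I_rels_def pol_subst_diff\<close>)
  moreover have "pol_subst ?\<sigma> (v TI) = v TI"
    using v by (intro pol_subst_id[of "XV 2"]) (auto simp: vecs_def XV_def)
  ultimately have "v TI = 0" by simp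
  then show "v = 0" using v by (auto simp: fun_eq_iff vecs_def) (metis singletonD)
qed auto

definition M_rels :: "mpol set" where "M_rels = {yp - xp, (ym + xm) * (ym - xm)}"

lemma M_rels_PR: "M_rels \<subseteq> PR (XY 2)"
  by (auto simp: M_rels_def yp_def xp_def ym_def xm_def)

text \<open>\<open>c\<close> is the strand whose left variable serves as second basis element. It
  remains a parameter because the two crossings on three strands use different ones.\<close>

definition Mbasis :: "nat \<Rightarrow> trit \<Rightarrow> mpol" where "Mbasis c t = (if t = B1 then yv c else 1)"
definition Mdeg :: "trit \<Rightarrow> int" where "Mdeg t = (if t = B1 then 2 else 0)"

text \<open>The defining relations say that the elementary symmetric functions of the left and of
  the right variables agree. It follows that y_c is a root of the quadratic polynomial with roots
  x_1 and x_2, which is the third relation and reduces the square of y_c.\<close>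

lemma M_rels_ideal:
  assumes "(c, c') \<in> {(1, 2), (2, 1)}"
  shows "yv c + yv c' - xv c - xv c' \<in> rel_ideal 2 M_rels" "yv c * yv c' - xv c * xv c' \<in> rel_ideal 2 M_rels"
    "yv c * yv c + xv c * xv c' - (xv c + xv c') * yv c \<in> rel_ideal 2 M_rels"
proof -
  note ops = rel_ideal_ops[OF M_rels_PR]
  have A: "yp - xp \<in> rel_ideal 2 M_rels" "(ym + xm) * (ym - xm) \<in> rel_ideal 2 M_rels"
    using rel_ideal_incl[OF M_rels_PR] by (simp_all add: M_rels_def)
  then show 1: "yv c + yv c' - xv c - xv c' \<in> rel_ideal 2 M_rels" using assms by (auto simp: yp_def xp_def algebra_simps)
  \<comment> \<open>From (y_+)^2 - (y_-)^2 = 4 y_1 y_2, and likewise for x. The factor x_+ + y_+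
    turns the linear relation into (y_+)^2 - (x_+)^2.\<close>
  let ?h = "Cst (1 / 4) * (xp + yp)"
  have q: "Cst (1 / 4) * 4 = (1 :: mpol)"
    using Cst_mult[of "1/4" 4] by (simp add: Cst_numeral)
  have "?h * (yp - xp) + (- Cst (1 / 4)) * ((ym + xm) * (ym - xm)) = (Cst (1 / 4) * 4) * (yv 1 * yv 2 - xv 1 * xv 2)"
    by (simp add: yp_def xp_def ym_def xm_def algebra_simps)
  moreover have "?h * (yp - xp) + (- Cst (1 / 4)) * ((ym + xm) * (ym - xm)) \<in> rel_ideal 2 M_rels"
    by (rule ops(2)[OF ops(3)[OF A(1)] ops(3)[OF A(2)]]) (auto simp: xp_def yp_def)
  ultimately have "yv 1 * yv 2 - xv 1 * xv 2 \<in> rel_ideal 2 M_rels" by (simp add: q)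
  then show 2: "yv c * yv c' - xv c * xv c' \<in> rel_ideal 2 M_rels" using assms by (auto simp: mult.commute)
  have "yv c \<in> PR (XY 2)" using assms by auto
  then have "yv c * (yv c + yv c' - xv c - xv c') + (- 1) * (yv c * yv c' - xv c * xv c') \<in> rel_ideal 2 M_rels"
    using 1 2 by (intro ops) auto
  then show "yv c * yv c + xv c * xv c' - (xv c + xv c') * yv c \<in> rel_ideal 2 M_rels" by (simp add: algebra_simps)
qed

text \<open>For independence, the left variables are set to the right ones in either order, and both
  substitutions kill the relations. A combination v_0 + v_1 y_c in the ideal then gives v_0 + v_1
  x_1 = 0 = v_0 + v_1 x_2, so v_1 (x_1 - x_2) = 0.\<close>

lemma cyc_M: fixes c c' :: nat assumes c: "(c, c') \<in> {(1, 2), (2, 1)}" shows "cyc 2 M_rels {B0, B1} (Mbasis c) Mdeg"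
proof
  note ops = rel_ideal_ops[OF M_rels_PR]
  have cc: "c \<in> {1..2}" "c' \<in> {1..2}" "c \<noteq> c'" using c by auto
  show "M_rels \<subseteq> PR (XY 2)" by (rule M_rels_PR)
  show "Mbasis c k \<in> PR (XY 2)" for k using cc by (auto simp: Mbasis_def)
  show "\<exists>v\<in>vecs 2 {B0, B1}. (\<forall>k. v k \<in> qhom (- Mdeg k)) \<and> 1 - (\<Sum>k\<in>{B0, B1}. v k * Mbasis c k) \<in> rel_ideal 2 M_rels"
    by (rule bexI[of _ "\<lambda>t. if t = B0 then 1 else 0"]) (auto simp: ops vecs_def Mbasis_def Mdeg_def)
  fix i k assume i: "i \<in> {1..2::nat}" and k: "k \<in> {B0, B1}"
  let ?v = "\<lambda>p q t. case t of B0 \<Rightarrow> p | B1 \<Rightarrow> q | TI \<Rightarrow> (0::mpol)"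
  have ex: "\<exists>v\<in>vecs 2 {B0, B1}. (\<forall>j. v j \<in> qhom (Mdeg k + 2 - Mdeg j)) \<and> z - (\<Sum>k\<in>{B0, B1}. v k * Mbasis c k) \<in> rel_ideal 2 M_rels"
    if "p \<in> RX 2" "q \<in> RX 2" "p \<in> qhom (Mdeg k + 2)" "q \<in> qhom (Mdeg k)" "z - (p + q * yv c) \<in> rel_ideal 2 M_rels" for p q z
    using that by (intro bexI[of _ "?v p q"]) (auto simp: vecs_def Mbasis_def Mdeg_def split: trit.split)
  from i c have "i = c \<or> i = c'" by auto
  then show "\<exists>v\<in>vecs 2 {B0, B1}. (\<forall>j. v j \<in> qhom (Mdeg k + 2 - Mdeg j)) \<and>
      yv i * Mbasis c k - (\<Sum>k\<in>{B0, B1}. v k * Mbasis c k) \<in> rel_ideal 2 M_rels"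
  proof
    assume i: "i = c"
    show ?thesis
    proof (cases "k = B0")
      case True
      show ?thesis by (rule ex[of 0 1]) (use True i in \<open>auto simp: Mbasis_def Mdeg_def ops\<close>)
    next
      case False
      then have "k = B1" using k by simp
      then show ?thesis
        using M_rels_ideal(3)[OF c] cc i
        by (intro ex[of "- (xv c * xv c')" "xv c + xv c'"])
          (auto simp: Mbasis_def Mdeg_def algebra_simps intro!: qhom_mult[of _ 2 _ 2])
    qed
  next
    assume i: "i = c'"
    show ?thesis
    proof (cases "k = B0")
      case True
      show ?thesis using M_rels_ideal(1)[OF c] cc True i
        by (intro ex[of "xv c + xv c'" "- 1"]) (auto simp: Mbasis_def Mdeg_def algebra_simps)
    next
      case False
      then have "k = B1" using k by simp
      then show ?thesis
        using M_rels_ideal(2)[OF c] cc i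
        by (intro ex[of "xv c * xv c'" 0])
          (auto simp: Mbasis_def Mdeg_def algebra_simps intro!: qhom_mult[of _ 2 _ 2])
    qed
  qed
next
  have cc: "c \<in> {1..2}" "c' \<in> {1..2}" "c \<noteq> c'" using c by auto
  fix v :: "trit \<Rightarrow> mpol" assume v: "v \<in> vecs 2 {B0, B1}" and "(\<Sum>k\<in>{B0, B1}. v k * Mbasis c k) \<in> rel_ideal 2 M_rels"
  then have I: "v B0 + v B1 * yv c \<in> rel_ideal 2 M_rels" by (simp add: Mbasis_def)
  have ev: "v B0 + v B1 * xv (f c) = 0" if f: "f = id \<or> f = (\<lambda>i. 3 - i)" for f :: "nat \<Rightarrow> nat"
  proof -
    let ?\<sigma> = "\<lambda>v. case v of vX i \<Rightarrow> xv i | vY i \<Rightarrow> xv (f i)"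
    have "pol_subst ?\<sigma> (v B0 + v B1 * yv c) = 0"
      by (rule rel_ideal_subst[OF M_rels_PR _ I])
        (use f in \<open>auto simp: M_rels_def yp_def xp_def ym_def xm_def pol_subst_diff pol_subst_add pol_subst_mult\<close>)
    moreover have "pol_subst ?\<sigma> (v k) = v k" for k
      using v by (intro pol_subst_id[of "XV 2"]) (auto simp: vecs_def XV_def)
    ultimately show ?thesis by (simp add: pol_subst_add pol_subst_mult)
  qed
  have e1: "v B0 + v B1 * xv c = 0" and e2: "v B0 + v B1 * xv c' = 0"
    using ev[of id] ev[of "\<lambda>i. 3 - i"] c by auto
  have "v B1 * (xv c - xv c') = (v B0 + v B1 * xv c) - (v B0 + v B1 * xv c')" by (simp add: algebra_simps)
  then have "v B1 * (xv c - xv c') = 0" by (simp only: e1 e2 diff_self)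
  then have "v B1 = 0" using cc by (auto simp: Var_inject)
  then have "v B0 = 0 \<and> v B1 = 0" using e1 by simp
  then show "v = 0" using v by (auto simp: fun_eq_iff vecs_def) (metis insertE singletonD)
qed (auto simp: Mbasis_def Mdeg_def)

subsection \<open>Direct sums\<close>

lemma xfree_dir_sum:
  fixes f :: "'k \<Rightarrow> int"
  assumes A: "\<And>i. xfree n (A i) {k\<in>K. f k = i} (\<Phi> i) a qd" and K: "finite K"
  shows "xfree n (dir_sum A) K (\<lambda>u k. \<Phi> (f k) (u (f k)) k) a qd"
proof -
  interpret A: xfree n "A i" "{k\<in>K. f k = i}" "\<Phi> i" a qd for i by (rule A)
  let ?S = "dir_sum A" let ?\<Phi> = "\<lambda>u k. \<Phi> (f k) (u (f k)) k"
  have c0: "carrier (A i) = {\<zero>\<^bsub>A i\<^esub>}" if "i \<notin> f ` K" for i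
  proof -
    have e: "{k\<in>K. f k = i} = {}" using that by auto
    from A[of i] show ?thesis unfolding e by (rule xfree_empty(1))
  qed
  have c: "carrier ?S = {u. \<forall>i. u i \<in> carrier (A i)}"
  proof -
    \<comment> \<open>Summands without an index are zero, so finiteness of the support is
      automatic.\<close>
    have "finite {i. u i \<noteq> \<zero>\<^bsub>A i\<^esub>}" if "\<forall>i. u i \<in> carrier (A i)" for u
    proof (rule finite_subset[of _ "f ` K"])
      show "{i. u i \<noteq> \<zero>\<^bsub>A i\<^esub>} \<subseteq> f ` K"
      proof
        fix i assume i: "i \<in> {i. u i \<noteq> \<zero>\<^bsub>A i\<^esub>}"
        have "u i \<in> carrier (A i)" using that by blast
        then show "i \<in> f ` K" using c0[of i] i by (cases "i \<in> f ` K") auto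
      qed
    qed (use K in auto)
    then show ?thesis by (auto simp: dir_sum_def Let_def)
  qed
  have S: "zero ?S = (\<lambda>i. \<zero>\<^bsub>A i\<^esub>)" "add ?S = (\<lambda>u v i. u i \<oplus>\<^bsub>A i\<^esub> v i)" "smult ?S = (\<lambda>r u i. r \<odot>\<^bsub>A i\<^esub> u i)"
    "bd ?S = (\<lambda>u i. bd (A i) (u i))" "cmp ?S = (\<lambda>k q. {u\<in>carrier ?S. \<forall>i. u i \<in> cmp (A i) k q})"
    by (simp_all add: dir_sum_def Let_def)
  have inK: "\<Phi> i x k = 0" if "x \<in> carrier (A i)" "\<not> (k \<in> K \<and> f k = i)" for i x k
    using A.Phi_vecs[OF that(1)] that(2) by (auto simp: vecs_def)
  have RX: "\<Phi> i x k \<in> RX n" if "x \<in> carrier (A i)" for i x k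
    using A.Phi_vecs[OF that] by (auto simp: vecs_def)
  define G where "G v i = (\<lambda>k. if f k = i then v k else (0::mpol))" for v i
  have Gv: "G v i \<in> vecs n {k\<in>K. f k = i}" if "v \<in> vecs n K" for v i
    using that by (auto simp: vecs_def G_def)
  have PhiG: "\<Phi> i (A.\<Psi> i (G v i)) = G v i" if "v \<in> vecs n K" for v i
    using Gv[OF that] by (rule A.Phi_Psi)
  have ab: "abelian_group ?S"
  proof (rule abelian_groupI)
    fix x assume x: "x \<in> carrier ?S"
    then show "\<exists>y\<in>carrier ?S. y \<oplus>\<^bsub>?S\<^esub> x = \<zero>\<^bsub>?S\<^esub>"
      by (intro bexI[of _ "\<lambda>i. \<ominus>\<^bsub>A i\<^esub> x i"]) (auto simp: c S A.l_neg)
  qed (auto simp: c S A.a_ac)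
  show ?thesis
  proof (rule xfree.intro)
    show "module (pol (XY n)) ?S"
      using ab A.smult_l_distr A.smult_r_distr A.smult_assoc1 A.smult_one by (intro moduleI) (auto simp: c S)
    show "bij_betw ?\<Phi> (carrier ?S) (vecs n K)"
    proof (rule bij_betw_byWitness[of _ "\<lambda>v i. A.\<Psi> i (G v i)"])
      show "\<forall>u\<in>carrier ?S. (\<lambda>i. A.\<Psi> i (G (?\<Phi> u) i)) = u"
      proof (intro ballI ext)
        fix u i assume "u \<in> carrier ?S"
        then have u: "\<And>i. u i \<in> carrier (A i)" by (auto simp: c)
        have "G (?\<Phi> u) i = \<Phi> i (u i)" using inK u by (auto simp: G_def fun_eq_iff)
        then show "A.\<Psi> i (G (?\<Phi> u) i) = u i" using A.Psi_Phi u by simp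
      qed
      show "\<forall>v\<in>vecs n K. ?\<Phi> (\<lambda>i. A.\<Psi> i (G v i)) = v" using PhiG by (auto simp: G_def)
      show "?\<Phi> ` carrier ?S \<subseteq> vecs n K" using inK RX by (auto simp: vecs_def c)
      show "(\<lambda>v i. A.\<Psi> i (G v i)) ` vecs n K \<subseteq> carrier ?S" using Gv A.Psi_closed by (auto simp: c)
    qed
    show "cmp ?S i q = (if i = a then {x\<in>carrier ?S. \<forall>k. ?\<Phi> x k \<in> qhom (q - qd k)} else {\<zero>\<^bsub>?S\<^esub>})" for i q
    proof (cases "i = a")
      case True
      have "u j \<in> cmp (A j) a q" if u: "u \<in> carrier ?S" "\<forall>k. ?\<Phi> u k \<in> qhom (q - qd k)" for u j
      proof -
        have "\<Phi> j (u j) k \<in> qhom (q - qd k)" for k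
          using u inK[of "u j" j k] by (cases "k \<in> K \<and> f k = j") (auto simp: c)
        then show ?thesis using u by (simp add: A.cmp_eq c)
      qed
      then show ?thesis using True by (auto simp: S A.cmp_eq)
    next
      case False
      then show ?thesis by (auto simp: S A.cmp_eq c)
    qed
  qed (use K A.Phi_add A.Phi_smult A.smult_hom A.bd_zero in \<open>auto simp: c S fun_eq_iff\<close>)
qed

subsection \<open>Models of complexes\<close>

text \<open>\<open>Y i\<close> and \<open>D\<close> are the actions of the variable \<open>vY i\<close> and of the differential in coordinates. All
  positions share the index type \<open>'k\<close>; \<open>pos\<close> gives the position of a basis element.\<close>

locale omodel =
  fixes n :: nat and C :: "'a ocx" and pos :: "'k::finite \<Rightarrow> int" and m :: int and qd :: "'k \<Rightarrow> int"
    and \<Phi> :: "int \<Rightarrow> 'a \<Rightarrow> 'k \<Rightarrow> mpol" and Y :: "nat \<Rightarrow> ('k \<Rightarrow> mpol) \<Rightarrow> 'k \<Rightarrow> mpol" and D :: "('k \<Rightarrow> mpol) \<Rightarrow> 'k \<Rightarrow> mpol"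
  assumes xfree: "xfree n (opos C p) {k. pos k = p} (\<Phi> p) ((p - m) div 2) qd"
    and Phi_Y: "i \<in> {1..n} \<Longrightarrow> x \<in> carrier (opos C p) \<Longrightarrow> \<Phi> p (yv i \<odot>\<^bsub>opos C p\<^esub> x) = Y i (\<Phi> p x)"
    and d_closed: "x \<in> carrier (opos C p) \<Longrightarrow> odiff C p x \<in> carrier (opos C (p - 2))"
    and Phi_d: "x \<in> carrier (opos C p) \<Longrightarrow> \<Phi> (p - 2) (odiff C p x) = D (\<Phi> p x)"
    and parity: "even (pos k - m)"
    and D_add: "D (v + w) = D v + D w" and D_scale: "D (\<lambda>k. r * v k) = (\<lambda>k. r * D v k)"
    and D_Y: "i \<in> {1..n} \<Longrightarrow> D (Y i v) = Y i (D v)"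
begin

sublocale X: xfree n "opos C p" "{k. pos k = p}" "\<Phi> p" "(p - m) div 2" qd for p by (rule xfree)

lemma d_add: "x \<in> carrier (opos C p) \<Longrightarrow> y \<in> carrier (opos C p) \<Longrightarrow>
    odiff C p (x \<oplus>\<^bsub>opos C p\<^esub> y) = odiff C p x \<oplus>\<^bsub>opos C (p - 2)\<^esub> odiff C p y"
  by (rule X.Phi_inject[where p="p - 2"]) (simp_all add: d_closed Phi_d X.Phi_add D_add)

text \<open>Constants and right variables act on coordinates by scaling, left variables by
  \<open>Y i\<close>; \<open>D\<close> commutes with both, and \<open>PR_induct\<close> combines
  them.\<close>

lemma d_smult:
  assumes "q \<in> PR (XY n)" "x \<in> carrier (opos C p)"
  shows "odiff C p (q \<odot>\<^bsub>opos C p\<^esub> x) = q \<odot>\<^bsub>opos C (p - 2)\<^esub> odiff C p x"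
  using assms
proof (induction q arbitrary: x rule: PR_induct)
  case (Cst c)
  have "Cst c \<in> PR (XY n)" "Cst c \<in> RX n" by simp_all
  then show ?case using Cst by (intro X.Phi_inject[where p="p - 2"]) (auto simp: d_closed Phi_d X.Phi_smult D_scale)
next
  case (add p q)
  then show ?case by (simp add: X.smult_l_distr[simplified] d_add d_closed X.smult_closed[simplified])
next
  case (Var v q)
  have V: "odiff C p (Var v \<odot>\<^bsub>opos C p\<^esub> x) = Var v \<odot>\<^bsub>opos C (p - 2)\<^esub> odiff C p x" if x: "x \<in> carrier (opos C p)" for x
  proof (rule X.Phi_inject[where p="p - 2"])
    have v: "Var v \<in> PR (XY n)" using Var(1) by simp
    then show "odiff C p (Var v \<odot>\<^bsub>opos C p\<^esub> x) \<in> carrier (opos C (p - 2))" "Var v \<odot>\<^bsub>opos C (p - 2)\<^esub> odiff C p x \<in> carrier (opos C (p - 2))"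
      using x X.smult_closed by (auto intro!: d_closed)
    show "\<Phi> (p - 2) (odiff C p (Var v \<odot>\<^bsub>opos C p\<^esub> x)) = \<Phi> (p - 2) (Var v \<odot>\<^bsub>opos C (p - 2)\<^esub> odiff C p x)"
    proof (cases v)
      case (vX i)
      then have "Var v \<in> RX n" using Var(1) by simp
      then show ?thesis using x v X.smult_closed[of "Var v" x p] by (simp add: d_closed Phi_d X.Phi_smult D_scale)
    next
      case (vY i)
      then have "i \<in> {1..n}" using Var(1) by simp
      then show ?thesis using x v vY X.smult_closed[of "Var v" x p] by (simp add: d_closed Phi_d Phi_Y D_Y del: atLeastAtMost_iff)
    qed
  qed
  have "(Var v * q) \<odot>\<^bsub>opos C p\<^esub> x = Var v \<odot>\<^bsub>opos C p\<^esub> (q \<odot>\<^bsub>opos C p\<^esub> x)"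
    using X.smult_assoc1[of "Var v" q x p] Var by simp
  moreover have "(Var v * q) \<odot>\<^bsub>opos C (p - 2)\<^esub> odiff C p x = Var v \<odot>\<^bsub>opos C (p - 2)\<^esub> (q \<odot>\<^bsub>opos C (p - 2)\<^esub> odiff C p x)"
    using X.smult_assoc1[of "Var v" q "odiff C p x" "p - 2"] Var d_closed by simp
  moreover have "q \<odot>\<^bsub>opos C p\<^esub> x \<in> carrier (opos C p)" using X.smult_closed[of q x p] Var by simp
  ultimately show ?case using Var V by simp
qed

end

text \<open>An index pair belongs to the summand given by the position of its first entry; its
  coordinate is read off from that summand alone.\<close>

definition comp_Phi :: "'a ocx \<Rightarrow> ('k \<Rightarrow> int) \<Rightarrow> (int \<Rightarrow> 'a \<Rightarrow> 'k \<Rightarrow> mpol) \<Rightarrow> 'b ocx \<Rightarrow> ('l \<Rightarrow> int) \<Rightarrow> (int \<Rightarrow> 'b \<Rightarrow> 'l \<Rightarrow> mpol) \<Rightarrow>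
    int \<Rightarrow> (int \<Rightarrow> ('a \<times> 'b \<Rightarrow>\<^sub>0 int) set) \<Rightarrow> 'k \<times> 'l \<Rightarrow> mpol" where
  "comp_Phi C posC \<Phi>C E posE \<Phi>E p u k = tlift (comp_coord 3 (\<Phi>C (posC (fst k))) (opos E (p - posC (fst k))) (\<Phi>E (p - posC (fst k)))) (u (posC (fst k))) k"

text \<open>\<open>YC'\<close> and \<open>DC'\<close> are the operators \<open>YC\<close> and \<open>DC\<close> with multiplication by \<open>xv j\<close> replaced by the operator
  \<open>YE j\<close>; this is expressed by naturality along additive maps \<open>\<Theta>\<close> that intertwine the two.\<close>

locale ocomp = C: omodel 3 C posC mC qdC \<Phi>C YC DC + E: omodel 3 E posE mE qdE \<Phi>E YE DE
  for C :: "'a ocx" and posC :: "'k::finite \<Rightarrow> int" and mC qdC \<Phi>C YC DC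
    and E :: "'b ocx" and posE :: "'l::finite \<Rightarrow> int" and mE qdE \<Phi>E YE DE +
  fixes YC' :: "nat \<Rightarrow> ('k \<Rightarrow> 'l \<Rightarrow> mpol) \<Rightarrow> 'k \<Rightarrow> 'l \<Rightarrow> mpol" and DC' :: "('k \<Rightarrow> 'l \<Rightarrow> mpol) \<Rightarrow> 'k \<Rightarrow> 'l \<Rightarrow> mpol"
  assumes YC_nat: "\<And>\<Theta> i w k. (\<And>p q. \<Theta> (p + q) = \<Theta> p + \<Theta> q) \<Longrightarrow> (\<And>p j. j \<in> {1..3} \<Longrightarrow> \<Theta> (xv j * p) = YE j (\<Theta> p)) \<Longrightarrow>
      i \<in> {1..3} \<Longrightarrow> \<Theta> (YC i w k) = YC' i (\<lambda>k. \<Theta> (w k)) k"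
    and DC_nat: "\<And>\<Theta> w k. (\<And>p q. \<Theta> (p + q) = \<Theta> p + \<Theta> q) \<Longrightarrow> (\<And>p j. j \<in> {1..3} \<Longrightarrow> \<Theta> (xv j * p) = YE j (\<Theta> p)) \<Longrightarrow>
      \<Theta> (DC w k) = DC' (\<lambda>k. \<Theta> (w k)) k"
    and YC'_add: "i \<in> {1..3} \<Longrightarrow> YC' i (\<lambda>k. v k + w k) k = YC' i v k + YC' i w k"
    and DC'_add: "DC' (\<lambda>k. v k + w k) k = DC' v k + DC' w k"
    and YC'_local: "(\<And>k'. posC k' = posC k \<Longrightarrow> v k' = w k') \<Longrightarrow> i \<in> {1..3} \<Longrightarrow> YC' i v k = YC' i w k"
    and DC'_local: "(\<And>k'. posC k' = posC k + 2 \<Longrightarrow> v k' = w k') \<Longrightarrow> DC' v k = DC' w k"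
begin

abbreviation CE where "CE \<equiv> ocx_comp 3 C E"
abbreviation \<Phi>CE where "\<Phi>CE \<equiv> comp_Phi C posC \<Phi>C E posE \<Phi>E"
definition posCE :: "'k \<times> 'l \<Rightarrow> int" where "posCE k = posC (fst k) + posE (snd k)"
definition qdCE :: "'k \<times> 'l \<Rightarrow> int" where "qdCE k = qdC (fst k) + qdE (snd k)"
definition YCE :: "nat \<Rightarrow> ('k \<times> 'l \<Rightarrow> mpol) \<Rightarrow> 'k \<times> 'l \<Rightarrow> mpol" where
  "YCE i w k = YC' i (\<lambda>k l. w (k, l)) (fst k) (snd k)"
definition DCE :: "('k \<times> 'l \<Rightarrow> mpol) \<Rightarrow> 'k \<times> 'l \<Rightarrow> mpol" where
  "DCE w k = DC' (\<lambda>k l. w (k, l)) (fst k) (snd k) +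
    (if even ((posC (fst k) - mC) div 2) then DE (\<lambda>l. w (fst k, l)) (snd k) else - DE (\<lambda>l. w (fst k, l)) (snd k))"

sublocale T: xcomp 3 "opos C i" "{k. posC k = i}" "\<Phi>C i" "(i - mC) div 2" qdC
    "opos E j" "{k. posE k = j}" "\<Phi>E j" "(j - mE) div 2" qdE for i j
  by (rule xcomp.intro[OF C.xfree E.xfree])

abbreviation TT where "TT i j \<equiv> bim_comp 3 (opos C i) (opos E j)"
abbreviation gg where "gg i j \<equiv> comp_coord 3 (\<Phi>C i) (opos E j) (\<Phi>E j)"

lemma opos_CE: "opos CE p = dir_sum (\<lambda>i. TT i (p - i))"
  by (simp add: ocx_comp_def)

lemma xfree_TT:
  "xfree 3 (TT i (p - i)) {k. posCE k = p \<and> posC (fst k) = i} (tlift (gg i (p - i))) ((p - (mC + mE)) div 2) qdCE"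
proof -
  have q: "(\<lambda>(i, j). qdC i + qdE j) = qdCE" by (auto simp: qdCE_def fun_eq_iff)
  have K: "{k. posC k = i} \<times> {k. posE k = p - i} = {k. posCE k = p \<and> posC (fst k) = i}"
    by (auto simp: posCE_def)
  have x: "xfree 3 (TT i (p - i)) {k. posCE k = p \<and> posC (fst k) = i} (tlift (gg i (p - i))) ((i - mC) div 2 + (p - i - mE) div 2) qdCE"
    using T.xfree_comp[of i "p - i"] unfolding q K .
  show ?thesis
  \<comment> \<open>If the summand has a basis element, both differences are even and the two halves
    add up. Otherwise the summand is zero and fits every degree.\<close>
  proof (cases "{k. posCE k = p \<and> posC (fst k) = i} = {}")
    case True
    from x show ?thesis unfolding True by (rule xfree_empty(2))
  next
    case False
    then obtain k where k: "posC (fst k) = i" "posE (snd k) = p - i" by (auto simp: posCE_def)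
    then have "even (i - mC)" "even (p - i - mE)" using C.parity[of "fst k"] E.parity[of "snd k"] by simp_all
    then have "(i - mC) div 2 + (p - i - mE) div 2 = (p - (mC + mE)) div 2" by presburger
    then show ?thesis using x by simp
  qed
qed

lemma xfree_CE: "xfree 3 (opos CE p) {k. posCE k = p} (\<Phi>CE p) ((p - (mC + mE)) div 2) qdCE"
proof -
  have *: "xfree 3 (TT i (p - i)) {k\<in>{k. posCE k = p}. posC (fst k) = i} (tlift (gg i (p - i))) ((p - (mC + mE)) div 2) qdCE" for i
    using xfree_TT[of i p] by simp
  have "xfree 3 (dir_sum (\<lambda>i. TT i (p - i))) {k. posCE k = p}
      (\<lambda>u k. tlift (gg (posC (fst k)) (p - posC (fst k))) (u (posC (fst k))) k) ((p - (mC + mE)) div 2) qdCE"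
    by (rule xfree_dir_sum[OF *]) simp
  then show ?thesis unfolding opos_CE comp_Phi_def .
qed

lemma CE_carrier: "u \<in> carrier (opos CE p) \<longleftrightarrow> (\<forall>i. u i \<in> carrier (TT i (p - i)))"
proof
  show "u \<in> carrier (opos CE p) \<Longrightarrow> \<forall>i. u i \<in> carrier (TT i (p - i))"
    unfolding opos_CE by (simp add: dir_sum_def Let_def)
  assume u: "\<forall>i. u i \<in> carrier (TT i (p - i))"
  have "finite {i. u i \<noteq> \<zero>\<^bsub>TT i (p - i)\<^esub>}"
  proof (rule finite_subset[of _ "range posC"])
    show "{i. u i \<noteq> \<zero>\<^bsub>TT i (p - i)\<^esub>} \<subseteq> range posC"
    proof
      fix i assume i: "i \<in> {i. u i \<noteq> \<zero>\<^bsub>TT i (p - i)\<^esub>}"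
      show "i \<in> range posC"
      proof (rule ccontr)
        assume "i \<notin> range posC"
        then have e: "{k. posCE k = p \<and> posC (fst k) = i} = {}" by auto
        from xfree_TT[of i p] have "carrier (TT i (p - i)) = {\<zero>\<^bsub>TT i (p - i)\<^esub>}"
          unfolding e by (rule xfree_empty(1))
        moreover have "u i \<in> carrier (TT i (p - i))" using u by blast
        ultimately show False using i by simp
      qed
    qed
  qed simp
  then show "u \<in> carrier (opos CE p)" using u unfolding opos_CE by (simp add: dir_sum_def Let_def)
qed

text \<open>For fixed \<open>x\<close>, sending p to the coordinates of p(y) x is additive and turns
  multiplication by x_i into \<open>YE i\<close>. It is the map \<open>\<Theta>\<close> to which the
  naturality assumptions on \<open>YC\<close> and \<open>DC\<close> are applied.\<close>

lemma Theta:
  assumes "x \<in> carrier (opos E j)"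
  shows "\<Phi>E j (xtoy 3 (p + q) \<odot>\<^bsub>opos E j\<^esub> x) = \<Phi>E j (xtoy 3 p \<odot>\<^bsub>opos E j\<^esub> x) + \<Phi>E j (xtoy 3 q \<odot>\<^bsub>opos E j\<^esub> x)"
    and "i \<in> {1..3} \<Longrightarrow> \<Phi>E j (xtoy 3 (xv i * p) \<odot>\<^bsub>opos E j\<^esub> x) = YE i (\<Phi>E j (xtoy 3 p \<odot>\<^bsub>opos E j\<^esub> x))"
proof -
  show "\<Phi>E j (xtoy 3 (p + q) \<odot>\<^bsub>opos E j\<^esub> x) = \<Phi>E j (xtoy 3 p \<odot>\<^bsub>opos E j\<^esub> x) + \<Phi>E j (xtoy 3 q \<odot>\<^bsub>opos E j\<^esub> x)"
    using E.X.smult_l_distr[OF _ _ assms, of "xtoy 3 p" "xtoy 3 q"] assms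
    by (simp add: xtoy_add xtoy_XY E.X.Phi_add T.xtoy_act)
  assume i: "i \<in> {1..3}"
  have "xtoy 3 (xv i * p) \<odot>\<^bsub>opos E j\<^esub> x = yv i \<odot>\<^bsub>opos E j\<^esub> (xtoy 3 p \<odot>\<^bsub>opos E j\<^esub> x)"
    using E.X.smult_assoc1[OF _ _ assms, of "yv i" "xtoy 3 p"] i by (simp add: xtoy_mult xtoy_xv xtoy_XY)
  then show "\<Phi>E j (xtoy 3 (xv i * p) \<odot>\<^bsub>opos E j\<^esub> x) = YE i (\<Phi>E j (xtoy 3 p \<odot>\<^bsub>opos E j\<^esub> x))"
    using E.Phi_Y[OF i T.xtoy_act[OF assms]] by simp
qed

lemma YC'_add2: "i \<in> {1..3} \<Longrightarrow> YC' i (\<lambda>k l. v k l + w k l) k l = YC' i v k l + YC' i w k l"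
  using YC'_add[of i v w k] by (simp add: plus_fun_def)

lemma DC'_add2: "DC' (\<lambda>k l. v k l + w k l) k l = DC' v k l + DC' w k l"
  using DC'_add[of v w k] by (simp add: plus_fun_def)

text \<open>On a pure tensor the left variable acts on the first factor, by \<open>YC i\<close> in
  coordinates. The coordinates of the tensor are the images of those under the map of
  \<open>Theta\<close>, so naturality replaces \<open>YC i\<close> by \<open>YC' i\<close>.\<close>

lemma TT_Y:
  assumes i: "i \<in> {1..3}" and t: "t \<in> carrier (TT a b)"
  shows "yv i \<odot>\<^bsub>TT a b\<^esub> t \<in> carrier (TT a b) \<and> (\<forall>k l. tlift (gg a b) (yv i \<odot>\<^bsub>TT a b\<^esub> t) (k, l) = YC' i (\<lambda>k l. tlift (gg a b) t (k, l)) k l)"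
proof -
  have iV: "yv i \<in> PR (XY 3)" "vY i \<in> XY 3" using i by auto
  have X: "xfree 3 (TT a b) ({k. posC k = a} \<times> {k. posE k = b}) (tlift (gg a b)) ((a - mC) div 2 + (b - mE) div 2) (\<lambda>(i, j). qdC i + qdE j)"
    by (rule T.xfree_comp)
  interpret X: xfree 3 "TT a b" "{k. posC k = a} \<times> {k. posE k = b}" "tlift (gg a b)" "(a - mC) div 2 + (b - mE) div 2" "\<lambda>(i, j). qdC i + qdE j"
    by (rule X)
  have cl: "yv i \<odot>\<^bsub>TT a b\<^esub> t \<in> carrier (TT a b)" if "t \<in> carrier (TT a b)" for t
    using X.smult_closed iV that by simp
  have "\<forall>k l. tlift (gg a b) (yv i \<odot>\<^bsub>TT a b\<^esub> t) (k, l) = YC' i (\<lambda>k l. tlift (gg a b) t (k, l)) k l"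
    using t[unfolded bim_comp_eq]
  proof (induction t rule: T.bt.tens_induct)
    case (pt m x)
    have y: "yv i \<odot>\<^bsub>TT a b\<^esub> T.bt.pt a b m x = T.bt.pt a b (yv i \<odot>\<^bsub>opos C a\<^esub> m) x"
      using T.bt.smult_pt_Var[OF iV(2) pt] E.X.smult_one[OF pt(2)] by (simp add: comp_l_def comp_r_def bim_comp_eq)
    have ym: "yv i \<odot>\<^bsub>opos C a\<^esub> m \<in> carrier (opos C a)" using C.X.smult_closed[of "yv i" m a] iV pt by simp
    have "gg a b (yv i \<odot>\<^bsub>opos C a\<^esub> m) x (k, l) = YC' i (\<lambda>k l. gg a b m x (k, l)) k l" for k l
      unfolding comp_coord_def prod.case C.Phi_Y[OF i pt(1)]
      by (subst YC_nat[OF Theta[OF pt(2)] i]) simp_all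
    then show ?case unfolding y T.tlift_g_pt[OF pt] T.tlift_g_pt[OF ym pt(2)] by blast
  next
    case (add s t)
    then have st: "s \<in> carrier (TT a b)" "t \<in> carrier (TT a b)" by (simp_all add: bim_comp_eq)
    have "yv i \<odot>\<^bsub>TT a b\<^esub> (s \<oplus>\<^bsub>TT a b\<^esub> t) = yv i \<odot>\<^bsub>TT a b\<^esub> s \<oplus>\<^bsub>TT a b\<^esub> yv i \<odot>\<^bsub>TT a b\<^esub> t"
      using X.smult_r_distr iV st by simp
    then show ?case using add(3,4) st cl
      by (simp add: bim_comp_eq[symmetric] X.Phi_add YC'_add2[OF i])
  qed
  then show ?thesis using cl t by blast
qed

lemma TT_d1:
  assumes t: "t \<in> carrier (TT (a + 2) b)"
  shows "tens_map (comp_mid 3) (opos C a) (opos E b) (odiff C (a + 2)) (\<lambda>y. y) t \<in> carrier (TT a b) \<and>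
    (\<forall>k l. tlift (gg a b) (tens_map (comp_mid 3) (opos C a) (opos E b) (odiff C (a + 2)) (\<lambda>y. y) t) (k, l) =
      DC' (\<lambda>k l. tlift (gg (a + 2) b) t (k, l)) k l)"
proof -
  let ?h = "tens_map (comp_mid 3) (opos C a) (opos E b) (odiff C (a + 2)) (\<lambda>y. y)"
  have d: "odiff C (a + 2) m \<in> carrier (opos C a)" if "m \<in> carrier (opos C (a + 2))" for m
    using C.d_closed[OF that] by simp
  have pd: "\<Phi>C a (odiff C (a + 2) m) = DC (\<Phi>C (a + 2) m)" if "m \<in> carrier (opos C (a + 2))" for m
    using C.Phi_d[OF that] by simp
  have hcl: "?h (T.bt.cl (a + 2) b u) = T.bt.cl a b (frag_extend (\<lambda>(m, n). frag_of (odiff C (a + 2) m, n)) u)" for u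
    unfolding tens_map_def
  proof (rule tens_ind_cl[OF T.bt.bitensor_axioms T.bt.bitensor_axioms], unfold prod.case)
    fix m n assume mn: "m \<in> carrier (opos C (a + 2))" "n \<in> carrier (opos E b)"
    show "T.bt.FG a b (frag_of (odiff C (a + 2) m, n))" using mn d by (intro T.bt.FG_frag_of)
    show "T.bt.cl a b (frag_of (odiff C (a + 2) (m \<oplus>\<^bsub>opos C (a + 2)\<^esub> m'), n)) =
        T.bt.cl a b (frag_of (odiff C (a + 2) m, n) + frag_of (odiff C (a + 2) m', n))"
      if "m' \<in> carrier (opos C (a + 2))" for m'
      using T.bt.pt_rel_add1[OF d d mn(2)] C.d_add[of m "a + 2" m'] mn that by simp
    show "T.bt.cl a b (frag_of (odiff C (a + 2) m, n \<oplus>\<^bsub>opos E b\<^esub> n')) =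
        T.bt.cl a b (frag_of (odiff C (a + 2) m, n) + frag_of (odiff C (a + 2) m, n'))"
      if "n' \<in> carrier (opos E b)" for n'
      using T.bt.pt_rel_add2[OF d mn(2) that] mn by simp
    show "T.bt.cl a b (frag_of (odiff C (a + 2) (r \<odot>\<^bsub>opos C (a + 2)\<^esub> m), n)) = T.bt.cl a b (frag_of (odiff C (a + 2) m, s \<odot>\<^bsub>opos E b\<^esub> n))"
      if "(r, s) \<in> comp_mid 3" for r s
    proof -
      have "r \<in> PR (XY 3)" using that by (auto simp: comp_mid_eq RX_XY)
      then show ?thesis using T.bt.pt_balanced[OF that d mn(2), of m] C.d_smult[of r m "a + 2"] mn
        by (simp add: T.bt.pt_def)
    qed
  qed
  have hpt: "?h (T.bt.pt (a + 2) b m x) = T.bt.pt a b (odiff C (a + 2) m) x" for m x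
    by (simp add: T.bt.pt_def hcl)
  have hadd: "?h (s \<oplus>\<^bsub>TT (a + 2) b\<^esub> t) = ?h s \<oplus>\<^bsub>TT a b\<^esub> ?h t" if "s \<in> carrier (TT (a + 2) b)" "t \<in> carrier (TT (a + 2) b)" for s t
    using that by (auto simp: bim_comp_eq T.bt.tens_carrier T.bt.tens_add hcl frag_extend_add)
  interpret X: xfree 3 "TT a' b'" "{k. posC k = a'} \<times> {k. posE k = b'}" "tlift (gg a' b')" "(a' - mC) div 2 + (b' - mE) div 2" "\<lambda>(i, j). qdC i + qdE j" for a' b'
    by (rule T.xfree_comp)
  show ?thesis
    using t[unfolded bim_comp_eq]
  proof (induction t rule: T.bt.tens_induct)
    case (pt m x)
    have "gg a b (odiff C (a + 2) m) x (k, l) = DC' (\<lambda>k l. gg (a + 2) b m x (k, l)) k l" for k l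
      unfolding comp_coord_def prod.case pd[OF pt(1)]
      by (subst DC_nat[OF Theta[OF pt(2)]]) simp_all
    then show ?case unfolding hpt T.tlift_g_pt[OF pt] T.tlift_g_pt[OF d[OF pt(1)] pt(2)]
      using T.bt.pt_closed[OF d[OF pt(1)] pt(2)] by (simp add: bim_comp_eq)
  next
    case (add s t)
    then have st: "s \<in> carrier (TT (a + 2) b)" "t \<in> carrier (TT (a + 2) b)" by (simp_all add: bim_comp_eq)
    then show ?case using add(3,4) unfolding bim_comp_eq[symmetric] hadd[OF st]
      by (simp add: X.Phi_add DC'_add2)
  qed
qed

text \<open>The first factor keeps its coordinates up to the Koszul sign. The transferred
  coefficients act on the second factor through its left variables, with which its differential
  commutes; so \<open>DE\<close> is applied separately for each index of the first factor.\<close>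

lemma TT_d2:
  assumes t: "t \<in> carrier (TT a b)"
  shows "tens_map (comp_mid 3) (opos C a) (opos E (b - 2)) (asign (opos C a)) (odiff E b) t \<in> carrier (TT a (b - 2)) \<and>
    (\<forall>k l. tlift (gg a (b - 2)) (tens_map (comp_mid 3) (opos C a) (opos E (b - 2)) (asign (opos C a)) (odiff E b) t) (k, l) =
      (if even ((a - mC) div 2) then DE (\<lambda>l. tlift (gg a b) t (k, l)) l else - DE (\<lambda>l. tlift (gg a b) t (k, l)) l))"
proof -
  let ?h = "tens_map (comp_mid 3) (opos C a) (opos E (b - 2)) (asign (opos C a)) (odiff E b)"
  let ?s = "asign (opos C a)"
  have s: "?s m = (if even ((a - mC) div 2) then m else \<ominus>\<^bsub>opos C a\<^esub> m)" if "m \<in> carrier (opos C a)" for m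
    using C.X.asign[OF that] .
  have scl: "?s m \<in> carrier (opos C a)" if "m \<in> carrier (opos C a)" for m using that by (simp add: s)
  have sadd: "?s (m \<oplus>\<^bsub>opos C a\<^esub> m') = ?s m \<oplus>\<^bsub>opos C a\<^esub> ?s m'" if "m \<in> carrier (opos C a)" "m' \<in> carrier (opos C a)" for m m'
    using that by (simp add: s C.X.minus_add)
  have ssm: "?s (r \<odot>\<^bsub>opos C a\<^esub> m) = r \<odot>\<^bsub>opos C a\<^esub> ?s m" if "r \<in> PR (XY 3)" "m \<in> carrier (opos C a)" for r m
    using that C.X.smult_closed[of r m a] C.X.smult_r_minus[of r m a] by (simp add: s)
  note d = E.d_closed[of _ b]
  have hcl: "?h (T.bt.cl a b u) = T.bt.cl a (b - 2) (frag_extend (\<lambda>(m, n). frag_of (?s m, odiff E b n)) u)" for u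
    unfolding tens_map_def
  proof (rule tens_ind_cl[OF T.bt.bitensor_axioms T.bt.bitensor_axioms], unfold prod.case)
    fix m n assume mn: "m \<in> carrier (opos C a)" "n \<in> carrier (opos E b)"
    show "T.bt.FG a (b - 2) (frag_of (?s m, odiff E b n))" using mn d scl by (intro T.bt.FG_frag_of)
    show "T.bt.cl a (b - 2) (frag_of (?s (m \<oplus>\<^bsub>opos C a\<^esub> m'), odiff E b n)) =
        T.bt.cl a (b - 2) (frag_of (?s m, odiff E b n) + frag_of (?s m', odiff E b n))"
      if "m' \<in> carrier (opos C a)" for m'
      using T.bt.pt_rel_add1[OF scl scl d] mn that by (simp add: sadd)
    show "T.bt.cl a (b - 2) (frag_of (?s m, odiff E b (n \<oplus>\<^bsub>opos E b\<^esub> n'))) =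
        T.bt.cl a (b - 2) (frag_of (?s m, odiff E b n) + frag_of (?s m, odiff E b n'))"
      if "n' \<in> carrier (opos E b)" for n'
      using T.bt.pt_rel_add2[OF scl d d] mn that by (simp add: E.d_add)
    show "T.bt.cl a (b - 2) (frag_of (?s (r \<odot>\<^bsub>opos C a\<^esub> m), odiff E b n)) = T.bt.cl a (b - 2) (frag_of (?s m, odiff E b (r' \<odot>\<^bsub>opos E b\<^esub> n)))"
      if "(r, r') \<in> comp_mid 3" for r r'
    proof -
      have r: "r \<in> PR (XY 3)" "r' \<in> PR (XY 3)" using that by (auto simp: comp_mid_eq RX_XY xtoy_XY)
      show ?thesis using T.bt.pt_balanced[OF that scl d, of m n] r mn
        by (simp add: ssm E.d_smult T.bt.pt_def)
    qed
  qed
  have hpt: "?h (T.bt.pt a b m x) = T.bt.pt a (b - 2) (?s m) (odiff E b x)" for m x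
    by (simp add: T.bt.pt_def hcl)
  have hadd: "?h (s \<oplus>\<^bsub>TT a b\<^esub> t) = ?h s \<oplus>\<^bsub>TT a (b - 2)\<^esub> ?h t" if "s \<in> carrier (TT a b)" "t \<in> carrier (TT a b)" for s t
    using that by (auto simp: bim_comp_eq T.bt.tens_carrier T.bt.tens_add hcl frag_extend_add)
  interpret X: xfree 3 "TT a' b'" "{k. posC k = a'} \<times> {k. posE k = b'}" "tlift (gg a' b')" "(a' - mC) div 2 + (b' - mE) div 2" "\<lambda>(i, j). qdC i + qdE j" for a' b'
    by (rule T.xfree_comp)
  have DEm: "DE (\<lambda>l. v l + w l) l = DE v l + DE w l" for v w l
    using E.D_add[of v w] by (simp add: plus_fun_def)
  have DEn: "DE (- v) = - DE v" for v
    using E.D_scale[of "- 1" v] by (simp add: fun_Compl_def)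
  show ?thesis
    using t[unfolded bim_comp_eq]
  proof (induction t rule: T.bt.tens_induct)
    case (pt m x)
    have neg: "xtoy 3 (- p) = - xtoy 3 p" for p using xtoy_add[of 3 p "- p"] by (simp add: eq_neg_iff_add_eq_0 add.commute)
    have negs: "- q \<odot>\<^bsub>opos E b'\<^esub> y = \<ominus>\<^bsub>opos E b'\<^esub> (q \<odot>\<^bsub>opos E b'\<^esub> y)" if "q \<in> PR (XY 3)" "y \<in> carrier (opos E b')" for q y b'
    proof (rule E.X.minus_equality[symmetric])
      show "- q \<odot>\<^bsub>opos E b'\<^esub> y \<oplus>\<^bsub>opos E b'\<^esub> q \<odot>\<^bsub>opos E b'\<^esub> y = \<zero>\<^bsub>opos E b'\<^esub>"
        using E.X.smult_l_distr[of "- q" q y b'] E.X.smult_l_null[of y b'] that by simp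
    qed (use E.X.smult_closed[of _ y b'] that in auto)
    have "gg a (b - 2) (?s m) (odiff E b x) (k, l) = (if even ((a - mC) div 2) then DE (\<lambda>l. gg a b m x (k, l)) l else - DE (\<lambda>l. gg a b m x (k, l)) l)" for k l
    proof -
      have dq: "\<Phi>E (b - 2) (q \<odot>\<^bsub>opos E (b - 2)\<^esub> odiff E b x) = DE (\<Phi>E b (q \<odot>\<^bsub>opos E b\<^esub> x))" if "q \<in> PR (XY 3)" for q
        using E.d_smult[OF that pt(2)] E.Phi_d[of "q \<odot>\<^bsub>opos E b\<^esub> x" b] E.X.smult_closed[of q x b] that pt(2) by simp
      show ?thesis
        using pt xtoy_XY[of 3] E.X.smult_closed[of "xtoy 3 _" "odiff E b x" "b - 2"] d[OF pt(2)]
        by (simp add: comp_coord_def s C.X.Phi_neg neg negs E.X.Phi_neg dq DEn)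
    qed
    then show ?case unfolding hpt T.tlift_g_pt[OF pt] T.tlift_g_pt[OF scl[OF pt(1)] d[OF pt(2)]]
      using T.bt.pt_closed[OF scl[OF pt(1)] d[OF pt(2)]] by (simp add: bim_comp_eq)
  next
    case (add s t)
    then have st: "s \<in> carrier (TT a b)" "t \<in> carrier (TT a b)" by (simp_all add: bim_comp_eq)
    then show ?case using add(3,4) unfolding bim_comp_eq[symmetric] hadd[OF st]
      by (simp add: X.Phi_add DEm)
  qed
qed

lemma Phi_CE_eq:
  assumes u: "u \<in> carrier (opos CE p)" and k: "posC k = i"
  shows "tlift (gg i (p - i)) (u i) (k, l) = \<Phi>CE p u (k, l)"
  using k by (simp add: comp_Phi_def)

text \<open>Locality of \<open>YC'\<close> and \<open>DC'\<close> allows the coordinates of all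
  summands to be treated as one vector: at an index of the summand \<open>i\<close> the action
  involves the summand \<open>i\<close> only, and the first part of the differential only the
  summand \<open>i + 2\<close>.\<close>

lemma omodel_CE:
  assumes D_Y: "\<And>i v. i \<in> {1..3} \<Longrightarrow> DCE (YCE i v) = YCE i (DCE v)"
    and D_scale: "\<And>r v k. DC' (\<lambda>k l. r * v k l) k = (\<lambda>l. r * DC' v k l)"
  shows "omodel 3 CE posCE (mC + mE) qdCE \<Phi>CE YCE DCE"
proof (rule omodel.intro)
  fix p
  show "xfree 3 (opos CE p) {k. posCE k = p} (\<Phi>CE p) ((p - (mC + mE)) div 2) qdCE" by (rule xfree_CE)
  interpret XC: xfree 3 "opos CE p" "{k. posCE k = p}" "\<Phi>CE p" "(p - (mC + mE)) div 2" qdCE for p by (rule xfree_CE)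
  fix u assume u: "u \<in> carrier (opos CE p)"
  have ui: "u i \<in> carrier (TT i (p - i))" for i using u by (simp add: CE_carrier)
  show "\<Phi>CE p (yv i \<odot>\<^bsub>opos CE p\<^esub> u) = YCE i (\<Phi>CE p u)" if i: "i \<in> {1..3}" for i
  proof
    fix kl :: "'k \<times> 'l" obtain k l where kl: "kl = (k, l)" by (cases kl)
    have "(yv i \<odot>\<^bsub>opos CE p\<^esub> u) j = yv i \<odot>\<^bsub>TT j (p - j)\<^esub> u j" for j by (simp add: opos_CE dir_sum_def Let_def)
    then have "\<Phi>CE p (yv i \<odot>\<^bsub>opos CE p\<^esub> u) kl = YC' i (\<lambda>k' l'. tlift (gg (posC k) (p - posC k)) (u (posC k)) (k', l')) k l"
      using TT_Y[OF i ui[of "posC k"]] by (simp add: comp_Phi_def kl)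
    also have "\<dots> = YC' i (\<lambda>k' l'. \<Phi>CE p u (k', l')) k l"
      by (rule fun_cong[OF YC'_local[OF _ i]]) (use Phi_CE_eq[OF u] in auto)
    finally show "\<Phi>CE p (yv i \<odot>\<^bsub>opos CE p\<^esub> u) kl = YCE i (\<Phi>CE p u) kl" by (simp add: YCE_def kl)
  qed
  interpret X: xfree 3 "TT a' b'" "{k. posC k = a'} \<times> {k. posE k = b'}" "tlift (gg a' b')" "(a' - mC) div 2 + (b' - mE) div 2" "\<lambda>(i, j). qdC i + qdE j" for a' b'
    by (rule T.xfree_comp)
  have du: "odiff CE p u i =
      tens_map (comp_mid 3) (opos C i) (opos E (p - 2 - i)) (odiff C (i + 2)) (\<lambda>y. y) (u (i + 2)) \<oplus>\<^bsub>TT i (p - 2 - i)\<^esub>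
      tens_map (comp_mid 3) (opos C i) (opos E (p - 2 - i)) (asign (opos C i)) (odiff E (p - i)) (u i)" for i
    by (simp add: ocx_comp_def)
  have eqs: "p - (i + 2) = p - 2 - i" "p - i - 2 = p - 2 - i" for i by simp_all
  note d1 = TT_d1[OF ui[of "_ + 2"], unfolded eqs] and d2 = TT_d2[OF ui, unfolded eqs]
  show "odiff CE p u \<in> carrier (opos CE (p - 2))"
    unfolding CE_carrier du using d1 d2 by (auto intro!: X.a_closed)
  show "\<Phi>CE (p - 2) (odiff CE p u) = DCE (\<Phi>CE p u)"
  proof
    fix kl :: "'k \<times> 'l" obtain k l where kl: "kl = (k, l)" by (cases kl)
    define i where "i = posC k"
    have "\<Phi>CE (p - 2) (odiff CE p u) kl = tlift (gg i (p - 2 - i)) (odiff CE p u i) (k, l)"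
      by (simp add: comp_Phi_def kl i_def)
    also have "\<dots> = DC' (\<lambda>k' l'. tlift (gg (i + 2) (p - 2 - i)) (u (i + 2)) (k', l')) k l +
       (if even ((i - mC) div 2) then DE (\<lambda>l. tlift (gg i (p - i)) (u i) (k, l)) l else - DE (\<lambda>l. tlift (gg i (p - i)) (u i) (k, l)) l)"
      unfolding du using d1[of i] d2[of i] by (simp add: X.Phi_add)
    also have "DC' (\<lambda>k' l'. tlift (gg (i + 2) (p - 2 - i)) (u (i + 2)) (k', l')) k l = DC' (\<lambda>k' l'. \<Phi>CE p u (k', l')) k l"
      by (rule fun_cong[OF DC'_local]) (use Phi_CE_eq[OF u, of _ "i + 2"] in \<open>auto simp: i_def eqs\<close>)
    also have "(\<lambda>l. tlift (gg i (p - i)) (u i) (k, l)) = (\<lambda>l. \<Phi>CE p u (k, l))"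
      using Phi_CE_eq[OF u, of k i] by (simp add: i_def)
    finally show "\<Phi>CE (p - 2) (odiff CE p u) kl = DCE (\<Phi>CE p u) kl"
      by (simp add: DCE_def kl i_def)
  qed
next
  fix kl :: "'k \<times> 'l"
  show "even (posCE kl - (mC + mE))" using C.parity[of "fst kl"] E.parity[of "snd kl"] by (simp add: posCE_def)
next
  fix v w :: "'k \<times> 'l \<Rightarrow> mpol"
  show "DCE (v + w) = DCE v + DCE w"
  proof
    fix kl :: "'k \<times> 'l"
    have "DE (\<lambda>l. v (k, l) + w (k, l)) l = DE (\<lambda>l. v (k, l)) l + DE (\<lambda>l. w (k, l)) l" for k l
      using E.D_add[of "\<lambda>l. v (k, l)" "\<lambda>l. w (k, l)"] by (simp add: plus_fun_def)
    then show "DCE (v + w) kl = (DCE v + DCE w) kl"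
      by (simp add: DCE_def DC'_add2)
  qed
next
  fix r v
  show "DCE (\<lambda>k. r * v k) = (\<lambda>k. r * DCE v k)"
    by (rule ext) (simp add: DCE_def D_scale E.D_scale distrib_left)
qed (rule D_Y)

end

section \<open>The crossings\<close>

lemma I_rel_mem: "i = 1 \<or> i = 2 \<Longrightarrow> yv i - xv i \<in> rel_ideal 2 I_rels"
  by (rule rel_ideal_incl[OF I_rels_PR]) (auto simp: I_rels_def)

text \<open>Adding the strand \<open>J\<close> multiplies the index set by a one-element set; this
  removes the extra factor again.\<close>

lemma xfree_relabel:
  assumes A: "xfree n A K \<Phi> a qd" and f: "bij f"
  shows "xfree n A {k. f k \<in> K} (\<lambda>x k. \<Phi> x (f k)) a (\<lambda>k. qd (f k))"
proof -
  interpret A: xfree n A K \<Phi> a qd by (rule A)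
  have ff: "f (inv_into UNIV f k) = k" "inv_into UNIV f (f j) = j" for k j
    using f by (simp_all add: bij_is_surj surj_f_inv_f bij_is_inj)
  have all: "(\<forall>k. P (f k)) \<longleftrightarrow> (\<forall>k. P k)" for P using ff(1) by metis
  show ?thesis
  proof (rule xfree.intro)
    show "module (pol (XY n)) A" by (rule A.module_A)
    have "{k. f k \<in> K} = inv_into UNIV f ` K" using ff by (auto simp: image_iff) metis
    then show "finite {k. f k \<in> K}" using A.finite_K by simp
    show "bij_betw (\<lambda>x k. \<Phi> x (f k)) (carrier A) (vecs n {k. f k \<in> K})"
    proof (rule bij_betw_byWitness[of _ "\<lambda>v. A.\<Psi> (\<lambda>k. v (inv_into UNIV f k))"])
      have v: "(\<lambda>k. v (inv_into UNIV f k)) \<in> vecs n K" if "v \<in> vecs n {k. f k \<in> K}" for v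
        using that ff by (auto simp: vecs_def)
      then show "(\<lambda>v. A.\<Psi> (\<lambda>k. v (inv_into UNIV f k))) ` vecs n {k. f k \<in> K} \<subseteq> carrier A" by (auto intro: A.Psi_closed)
      show "\<forall>v\<in>vecs n {k. f k \<in> K}. (\<lambda>k. \<Phi> (A.\<Psi> (\<lambda>k. v (inv_into UNIV f k))) (f k)) = v"
        using A.Phi_Psi[OF v] ff by auto
      show "\<forall>x\<in>carrier A. A.\<Psi> (\<lambda>k. \<Phi> x (f (inv_into UNIV f k))) = x" using A.Psi_Phi ff by simp
      show "(\<lambda>x k. \<Phi> x (f k)) ` carrier A \<subseteq> vecs n {k. f k \<in> K}" using A.Phi_vecs by (auto simp: vecs_def)
    qed
    show "cmp A i q = (if i = a then {x\<in>carrier A. \<forall>k. \<Phi> x (f k) \<in> qhom (q - qd (f k))} else {\<zero>\<^bsub>A\<^esub>})" for i q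
      using all[of "\<lambda>k. \<Phi> _ k \<in> qhom (q - qd k)"] by (simp add: A.cmp_eq)
  qed (use A.Phi_add A.Phi_smult A.smult_hom A.bd_zero in \<open>auto simp: fun_eq_iff\<close>)
qed

lemma xfree_qd_cong:
  assumes A: "xfree n A K \<Phi> a qd" and eq: "\<And>k. k \<in> K \<Longrightarrow> qd k = qd' k"
  shows "xfree n A K \<Phi> a qd'"
proof -
  interpret A: xfree n A K \<Phi> a qd by (rule A)
  have *: "\<Phi> x k \<in> qhom (q - qd k) \<longleftrightarrow> \<Phi> x k \<in> qhom (q - qd' k)" if "x \<in> carrier A" for x k q
    using A.Phi_vecs[OF that] eq[of k] by (cases "k \<in> K") (auto simp: vecs_def)
  show ?thesis
  proof (rule xfree.intro)
    show "cmp A i q = (if i = a then {x\<in>carrier A. \<forall>k. \<Phi> x k \<in> qhom (q - qd' k)} else {\<zero>\<^bsub>A\<^esub>})" for i q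
      using * by (auto simp: A.cmp_eq)
  qed (use A.module_A A.finite_K A.bij A.Phi_add A.Phi_smult A.smult_hom A.bd_zero in auto)
qed

definition tpos :: "trit \<Rightarrow> int" where "tpos t = (if t = TI then - 1 else 1)"
definition tqd :: "trit \<Rightarrow> int" where "tqd t = (if t = B1 then 0 else - 2)"

text \<open>The action of \<open>vY i\<close> and the differential for the crossing of two strands \<open>a\<close> and \<open>b\<close>, composed with
  a bimodule on which \<open>vY j\<close> acts by \<open>U j\<close>. The basis of the blob bimodule is \<open>1, vY a\<close>, indexed by \<open>B0, B1\<close>.\<close>

definition Ysig :: "nat \<Rightarrow> nat \<Rightarrow> (nat \<Rightarrow> 'n \<Rightarrow> 'n) \<Rightarrow> nat \<Rightarrow> (trit \<Rightarrow> 'n) \<Rightarrow> trit \<Rightarrow> 'n::ab_group_add" where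
  "Ysig a b U i w t = (case t of
     TI \<Rightarrow> U i (w TI)
   | B0 \<Rightarrow> if i = a then - U a (U b (w B1)) else if i = b then U a (w B0) + U b (w B0) + U a (U b (w B1)) else U i (w B0)
   | B1 \<Rightarrow> if i = a then w B0 + U a (w B1) + U b (w B1) else if i = b then - w B0 else U i (w B1))"

definition Dsig :: "nat \<Rightarrow> (nat \<Rightarrow> 'n \<Rightarrow> 'n) \<Rightarrow> (trit \<Rightarrow> 'n) \<Rightarrow> trit \<Rightarrow> 'n::ab_group_add" where
  "Dsig a U w t = (case t of TI \<Rightarrow> w B0 + U a (w B1) | _ \<Rightarrow> 0)"

abbreviation xmul :: "nat \<Rightarrow> mpol \<Rightarrow> mpol" where "xmul j p \<equiv> xv j * p"

text \<open>\<open>W k\<close> is the normal form of y_i times the basis element \<open>k\<close>.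
  The coefficients of a normal form are polynomials, which commute with y_i, so the action on all
  elements is given by this matrix.\<close>

lemma (in cyc) nf_yv:
  assumes x: "x \<in> carrier A" and i: "i \<in> {1..n}" and W: "\<And>k. k \<in> K \<Longrightarrow> W k \<in> vecs n K"
    "\<And>k. k \<in> K \<Longrightarrow> yv i * e k - comb (W k) \<in> I"
  shows "nf (yv i \<odot>\<^bsub>A\<^esub> x) = (\<lambda>j. \<Sum>k\<in>K. nf x k * W k j)"
proof -
  from x obtain p where p: "p \<in> PR (XY n)" "x = co p" by (auto simp: A_carrier)
  from normal_form[OF p(1)] obtain v where v: "v \<in> vecs n K" "p - comb v \<in> I" by blast
  have nfx: "nf x = v" using nf_eq[OF v] p by simp
  let ?w = "\<lambda>j. \<Sum>k\<in>K. v k * W k j"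
  have w: "?w \<in> vecs n K" using v(1) W(1) by (auto simp: vecs_def)
  have "comb ?w = (\<Sum>j\<in>K. \<Sum>k\<in>K. v k * W k j * e j)"
    unfolding comb_def by (simp add: sum_distrib_right)
  also have "\<dots> = (\<Sum>k\<in>K. \<Sum>j\<in>K. v k * W k j * e j)" by (rule sum.swap)
  also have "\<dots> = (\<Sum>k\<in>K. v k * comb (W k))"
    unfolding comb_def by (simp add: sum_distrib_left mult.assoc)
  finally have "yv i * comb v - comb ?w = (\<Sum>k\<in>K. v k * (yv i * e k - comb (W k)))"
    by (simp add: comb_def[of v] sum_distrib_left sum_subtractf algebra_simps)
  also have "\<dots> \<in> I" using v(1) W(2) RX_XY by (intro I_sum I_mult) (auto simp: vecs_def)
  finally have "yv i * (p - comb v) + (yv i * comb v - comb ?w) \<in> I"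
    using I_mult[OF v(2), of "yv i"] i by (intro I_add) auto
  then have "yv i * p - comb ?w \<in> I" by (simp add: algebra_simps)
  then have "nf (co (yv i * p)) = ?w" by (rule nf_eq[OF w])
  moreover have "yv i \<odot>\<^bsub>A\<^esub> x = co (yv i * p)" using p i by (simp add: A_smult)
  ultimately show ?thesis by (simp only: nfx)
qed

definition Phi2 :: "nat \<Rightarrow> int \<Rightarrow> mpol set \<Rightarrow> trit \<Rightarrow> mpol" where
  "Phi2 c p = (if p = 1 then cyc.nf 2 M_rels {B0, B1} (Mbasis c)
     else if p = - 1 then cyc.nf 2 I_rels {TI} (\<lambda>_. 1) else (\<lambda>_ _. 0))"

text \<open>The shift t^(-1/2) moves the two terms from positions 2 and 0 to positions 1 and
  -1.\<close>

lemma opos_sigma: "opos sigma_minus p = shalf (- 1) (ashift (- 1) (qshift (- 2)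
    (if p = 1 then ashift 1 bim_B else if p = - 1 then bim_I else zero_fcx)))"
  by (simp add: sigma_minus_def thalf_def oshift_def two_term_def Let_def)

lemma odiff_sigma: "odiff sigma_minus p = (if p = 1 then chi_minus else (\<lambda>_. \<zero>\<^bsub>opos sigma_minus (p - 2)\<^esub>))"
  by (auto simp: sigma_minus_def thalf_def oshift_def two_term_def Let_def shalf_def ashift_def qshift_def)

lemma sigma_sel [simp]:
  "carrier (opos sigma_minus 1) = carrier bim_M" "zero (opos sigma_minus 1) = zero bim_M"
  "add (opos sigma_minus 1) = add bim_M" "smult (opos sigma_minus 1) = smult bim_M"
  "carrier (opos sigma_minus (- 1)) = carrier bim_I" "zero (opos sigma_minus (- 1)) = zero bim_I"
  "add (opos sigma_minus (- 1)) = add bim_I" "smult (opos sigma_minus (- 1)) = smult bim_I"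
  by (simp_all add: opos_sigma shalf_def ashift_def qshift_def bim_B_def)

lemma xfree_sigma:
  fixes c c' :: nat assumes c: "(c, c') \<in> {(1, 2), (2, 1)}"
  shows "xfree 2 (opos sigma_minus p) {t. tpos t = p} (Phi2 c p) ((p - 1) div 2) tqd"
proof -
  note sh = xfree_shalf xfree_ashift xfree_qshift
  consider "p = 1" | "p = - 1" | "p \<noteq> 1" "p \<noteq> - 1" by blast
  then show ?thesis
  proof cases
    case 1
    have K: "{t. tpos t = p} = {B0, B1}" using trit_UNIV by (auto simp: tpos_def 1)
    have q: "(\<lambda>j. Mdeg j + - 2) = tqd" by (auto simp: Mdeg_def tqd_def fun_eq_iff)
    have "xfree 2 bim_B {B0, B1} (Phi2 c p) 0 Mdeg"
      unfolding bim_B_def bim_M_def M_rels_def[symmetric] using 1 by (simp add: Phi2_def xfree_filt cyc.xfree_cyc[OF cyc_M[OF c]])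
    from xfree_shalf[OF xfree_ashift[OF xfree_qshift[OF xfree_ashift[OF this]]], of "- 1" "- 1" "- 2" 1]
    show ?thesis unfolding K q by (simp add: opos_sigma 1)
  next
    case 2
    have K: "{t. tpos t = p} = {TI}" using trit_UNIV by (auto simp: tpos_def 2)
    have "xfree 2 bim_I {TI} (Phi2 c p) 0 (\<lambda>_. 0)"
      unfolding bim_I_def using 2 by (simp add: Phi2_def cyc.xfree_cyc[OF cyc_I])
    from xfree_shalf[OF xfree_ashift[OF xfree_qshift[OF this]], of "- 1" "- 1" "- 2"]
    have "xfree 2 (opos sigma_minus p) {TI} (Phi2 c p) ((p - 1) div 2) (\<lambda>_. - 2)" by (simp add: opos_sigma 2)
    then show ?thesis unfolding K by (rule xfree_qd_cong) (simp add: tqd_def)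
  next
    case 3
    have K: "{t. tpos t = p} = {}" using 3 by (auto simp: tpos_def)
    have "xfree 2 zero_fcx {} (Phi2 c p) 0 tqd"
      using 3 xfree_zero[of zero_fcx 2 0 tqd] by (simp add: Phi2_def zero_fcx_def)
    from xfree_empty(2)[OF xfree_shalf[OF xfree_ashift[OF xfree_qshift[OF this]]], of "- 1" "- 1" "- 2"]
    show ?thesis unfolding K using 3 by (simp add: opos_sigma)
  qed
qed

text \<open>The relations of the blob vanish on the diagonal, so their ideal lies in that of the
  identity bimodule. Adding the larger ideal to a coset of the smaller one gives the coset of the
  same polynomial.\<close>

lemma chi_minus_co:
  "chi_minus (rel_ideal 2 M_rels +>\<^bsub>pol (XY 2)\<^esub> p) = rel_ideal 2 I_rels +>\<^bsub>pol (XY 2)\<^esub> p"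
proof -
  have sub: "rel_ideal 2 M_rels \<subseteq> rel_ideal 2 I_rels"
    unfolding rel_ideal_def[of 2 M_rels] xyring_eq
  proof (rule ring.genideal_minimal)
    show "ring (pol (XY 2))" using cring_pol[of "XY 2"] by (simp add: cring_def)
    show "ideal (rel_ideal 2 I_rels) (pol (XY 2))" by (rule ideal_rel_ideal[OF I_rels_PR])
    have i: "yv 1 - xv 1 \<in> rel_ideal 2 I_rels" "yv 2 - xv 2 \<in> rel_ideal 2 I_rels"
      by (simp_all add: I_rel_mem del: One_nat_def)
    note ops = rel_ideal_ops[OF I_rels_PR]
    have a: "yp - xp \<in> rel_ideal 2 I_rels" using ops(2)[OF i] by (simp add: yp_def xp_def algebra_simps)
    have "(- 1) * (yv 1 - xv 1) + (yv 2 - xv 2) \<in> rel_ideal 2 I_rels" by (rule ops(2)[OF ops(3)[OF i(1)] i(2)]) auto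
    then have "ym - xm \<in> rel_ideal 2 I_rels" by (simp add: ym_def xm_def algebra_simps)
    then have "(ym + xm) * (ym - xm) \<in> rel_ideal 2 I_rels" by (rule ops(3)) (auto simp: ym_def xm_def)
    with a show "M_rels \<subseteq> rel_ideal 2 I_rels" by (simp add: M_rels_def)
  qed
  have 0: "0 \<in> rel_ideal 2 M_rels" by (rule rel_ideal_ops[OF M_rels_PR])
  show ?thesis
    unfolding chi_minus_def set_add_def' a_r_coset_def' xyring_eq pol_sel
  proof (intro equalityI subsetI)
    fix z assume "z \<in> (\<Union>h\<in>rel_ideal 2 I_rels. \<Union>k\<in>\<Union>h\<in>rel_ideal 2 M_rels. {h + p}. {h + k})"
    then obtain h k where hk: "h \<in> rel_ideal 2 I_rels" "k \<in> rel_ideal 2 M_rels" "z = h + (k + p)" by auto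
    then have "h + k \<in> rel_ideal 2 I_rels" using sub by (intro rel_ideal_ops[OF I_rels_PR]) auto
    then show "z \<in> (\<Union>h\<in>rel_ideal 2 I_rels. {h + p})" using hk by (auto simp: add.assoc intro!: bexI[of _ "h + k"])
  next
    fix z assume "z \<in> (\<Union>h\<in>rel_ideal 2 I_rels. {h + p})"
    then obtain h where "h \<in> rel_ideal 2 I_rels" "z = h + (0 + p)" by auto
    then show "z \<in> (\<Union>h\<in>rel_ideal 2 I_rels. \<Union>k\<in>\<Union>h\<in>rel_ideal 2 M_rels. {h + p}. {h + k})"
      using 0 by blast
  qed
qed

lemma omodel_sigma:
  fixes c c' :: nat assumes c: "(c, c') \<in> {(1, 2), (2, 1)}"
  shows "omodel 2 sigma_minus tpos 1 tqd (Phi2 c) (Ysig c c' xmul) (Dsig c xmul)"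
proof (rule omodel.intro)
  have cc: "c \<in> {1..2}" "c' \<in> {1..2}" "c \<noteq> c'" using c by auto
  show xf: "xfree 2 (opos sigma_minus p) {t. tpos t = p} (Phi2 c p) ((p - 1) div 2) tqd" for p
    by (rule xfree_sigma[OF c])
  interpret X: xfree 2 "opos sigma_minus p" "{t. tpos t = p}" "Phi2 c p" "(p - 1) div 2" tqd for p by (rule xf)
  interpret CM: cyc 2 M_rels "{B0, B1}" "Mbasis c" Mdeg by (rule cyc_M[OF c])
  interpret CI: cyc 2 I_rels "{TI}" "\<lambda>_. 1" "\<lambda>_. 0" by (rule cyc_I)
  have M: "bim_M = CM.A" by (simp add: bim_M_def M_rels_def)
  have I: "bim_I = CI.A" by (simp add: bim_I_def)
  have P1: "Phi2 c 1 = CM.nf" and P2: "Phi2 c (- 1) = CI.nf" by (simp_all add: Phi2_def)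
  have van: "Phi2 c p x t = 0" if "x \<in> carrier (opos sigma_minus p)" "tpos t \<noteq> p" for p x t
    using X.Phi_vecs[OF that(1)] that(2) by (auto simp: vecs_def)
  fix p x assume x: "x \<in> carrier (opos sigma_minus p)"
  show "Phi2 c p (yv i \<odot>\<^bsub>opos sigma_minus p\<^esub> x) = Ysig c c' xmul i (Phi2 c p x)" if i: "i \<in> {1..2}" for i
  proof -
    consider "p = 1" | "p = - 1" | "p \<noteq> 1" "p \<noteq> - 1" by blast
    then show ?thesis
    proof cases
      case 1
      have xM: "x \<in> carrier CM.A" using x 1 by (simp add: M)
      let ?v = "\<lambda>p q t. case t of B0 \<Rightarrow> p | B1 \<Rightarrow> q | TI \<Rightarrow> (0::mpol)"
      have vv: "?v p q \<in> vecs 2 {B0, B1}" if "p \<in> RX 2" "q \<in> RX 2" for p q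
        using that by (auto simp: vecs_def split: trit.split)
      have cv: "CM.comb (?v p q) = p + q * yv c" for p q by (simp add: CM.comb_def Mbasis_def)
      have z: "CM.nf x TI = 0" using van[OF x, of TI] 1 by (simp add: P1 tpos_def)
      \<comment> \<open>The matrices of the left variables. Multiplication by y_c sends 1 to y_c and
        y_c to (x_c + x_c') y_c - x_c x_c'; multiplication by y_c' sends 1 to x_c + x_c' - y_c and
        y_c to x_c x_c'.\<close>
      define W where "W k = (if i = c then (if k = B0 then ?v 0 1 else ?v (- (xv c * xv c')) (xv c + xv c'))
         else (if k = B0 then ?v (xv c + xv c') (- 1) else ?v (xv c * xv c') 0))" for k
      have "i = c \<or> i = c'" using i c by auto
      then have "yv i * Mbasis c k - CM.comb (W k) \<in> CM.I" if "k \<in> {B0, B1}" for k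
        using that M_rels_ideal[OF c] CM.I_0 cc(3) by (auto simp: W_def cv Mbasis_def algebra_simps)
      moreover have "W k \<in> vecs 2 {B0, B1}" for k using cc unfolding W_def by (auto intro!: vv)
      ultimately have "CM.nf (yv i \<odot>\<^bsub>CM.A\<^esub> x) = (\<lambda>j. \<Sum>k\<in>{B0, B1}. CM.nf x k * W k j)"
        using xM i by (intro CM.nf_yv) auto
      then show ?thesis unfolding 1 using \<open>i = c \<or> i = c'\<close> cc(3) z
        by (auto simp: P1 M Ysig_def W_def fun_eq_iff algebra_simps split: trit.split)
    next
      case 2
      have xI: "x \<in> carrier CI.A" using x 2 by (simp add: I)
      have z: "CI.nf x B0 = 0" "CI.nf x B1 = 0" using van[OF x] 2 by (simp_all add: P2 tpos_def)
      have "i = 1 \<or> i = 2" using i by auto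
      then have "yv i - xv i \<in> CI.I" by (rule I_rel_mem)
      then have "CI.nf (yv i \<odot>\<^bsub>CI.A\<^esub> x) = (\<lambda>j. \<Sum>k\<in>{TI}. CI.nf x k * (if j = TI then xv i else 0))"
        using xI i by (intro CI.nf_yv) (auto simp: vecs_def CI.comb_def)
      then show ?thesis unfolding 2 using z
        by (auto simp: P2 I Ysig_def fun_eq_iff algebra_simps split: trit.split)
    next
      case 3
      then show ?thesis by (auto simp: Phi2_def Ysig_def fun_eq_iff split: trit.split)
    qed
  qed
  have d: "odiff sigma_minus p x \<in> carrier (opos sigma_minus (p - 2)) \<and> Phi2 c (p - 2) (odiff sigma_minus p x) = Dsig c xmul (Phi2 c p x)"
  proof (cases "p = 1")
    case True
    from x True have "x \<in> carrier CM.A" by (simp add: M)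
    then obtain p' where p: "p' \<in> PR (XY 2)" "x = CM.co p'" by (auto simp: CM.A_carrier)
    from CM.normal_form[OF p(1)] obtain v where v: "v \<in> vecs 2 {B0, B1}" "p' - CM.comb v \<in> CM.I" by blast
    have nv: "CM.nf x = v" using CM.nf_eq[OF v] p by simp
    have xv: "x = CM.co (CM.comb v)" using v p by (simp add: CM.co_eq_iff)
    have cv: "CM.comb v = v B0 + v B1 * yv c" by (simp add: CM.comb_def Mbasis_def)
    have cI: "odiff sigma_minus p x = CI.co (CM.comb v)" by (simp add: odiff_sigma True xv chi_minus_co)
    have "c = 1 \<or> c = 2" using c by auto
    then have "yv c - xv c \<in> CI.I" by (rule I_rel_mem)
    then have "v B1 * (yv c - xv c) \<in> CI.I" using v(1) RX_XY by (intro CI.I_mult) (auto simp: vecs_def)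
    then have "CM.comb v - CI.comb (\<lambda>t. if t = TI then v B0 + v B1 * xv c else 0) \<in> CI.I"
      by (simp add: cv CI.comb_def algebra_simps)
    then have "CI.nf (CI.co (CM.comb v)) = (\<lambda>t. if t = TI then v B0 + v B1 * xv c else 0)"
      using v(1) cc by (intro CI.nf_eq) (auto simp: vecs_def)
    moreover have "CI.co (CM.comb v) \<in> carrier CI.A" using CM.comb_PR[OF v(1)] by (auto simp: CI.A_carrier)
    ultimately show ?thesis
      unfolding cI using True by (auto simp: P1 P2 I nv Dsig_def fun_eq_iff mult.commute split: trit.split)
  next
    case False
    then have "Phi2 c p x B0 = 0 \<and> Phi2 c p x B1 = 0" using van[OF x] by (auto simp: tpos_def)
    then have "Dsig c xmul (Phi2 c p x) = 0" by (auto simp: Dsig_def fun_eq_iff split: trit.split)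
    then show ?thesis using False by (simp add: odiff_sigma)
  qed
  then show "odiff sigma_minus p x \<in> carrier (opos sigma_minus (p - 2))"
    "Phi2 c (p - 2) (odiff sigma_minus p x) = Dsig c xmul (Phi2 c p x)" by auto
next
  have cc: "c \<noteq> c'" using c by auto
  fix i and v w :: "trit \<Rightarrow> mpol" and r
  show "Dsig c xmul (v + w) = Dsig c xmul v + Dsig c xmul w" "Dsig c xmul (\<lambda>k. r * v k) = (\<lambda>k. r * Dsig c xmul v k)"
    by (auto simp: Dsig_def fun_eq_iff algebra_simps split: trit.split)
  show "Dsig c xmul (Ysig c c' xmul i v) = Ysig c c' xmul i (Dsig c xmul v)"
    using cc by (auto simp: Dsig_def Ysig_def fun_eq_iff algebra_simps split: trit.split)
qed (auto simp: tpos_def)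

section \<open>The elementary crossings on three strands\<close>

definition PhiJ :: "mpol set \<Rightarrow> unit \<Rightarrow> mpol" where
  "PhiJ = cyc.nf 1 {yv 1 - xv 1} {()} (\<lambda>_. 1)"

lemma xfree_J: "xfree 1 bim_J {()} PhiJ 0 (\<lambda>_. 0)"
  unfolding bim_J_def PhiJ_def by (rule cyc.xfree_cyc[OF cyc_J])

lemma PhiJ_yv: assumes "x \<in> carrier bim_J" shows "PhiJ (yv 1 \<odot>\<^bsub>bim_J\<^esub> x) = (\<lambda>j. xv 1 * PhiJ x j)"
proof -
  interpret J: cyc 1 "{yv 1 - xv 1}" "{()}" "\<lambda>_. 1" "\<lambda>_. 0" by (rule cyc_J)
  have "yv 1 - xv 1 \<in> J.I" using rel_ideal_incl[OF J.S] by simp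
  then have "J.nf (yv 1 \<odot>\<^bsub>J.A\<^esub> x) = (\<lambda>j. \<Sum>k\<in>{()}. J.nf x k * xv 1)"
    using assms by (intro J.nf_yv) (auto simp: vecs_def J.comb_def bim_J_def)
  then show ?thesis by (simp add: PhiJ_def bim_J_def fun_eq_iff mult.commute)
qed

text \<open>To the right of the strand \<open>J\<close> the second strand of the crossing becomes
  strand 3. Hence \<open>Phi2 2\<close> is used there and \<open>Phi2 1\<close> in the other case:
  each time the basis contains the left variable of the outer strand.\<close>

definition Phi_right :: "int \<Rightarrow> (mpol set \<times> mpol set \<Rightarrow>\<^sub>0 int) set \<Rightarrow> trit \<Rightarrow> mpol" where
  "Phi_right p t k = tlift (union_coord 2 (Phi2 1 p) PhiJ) t (k, ())"
definition Phi_left :: "int \<Rightarrow> (mpol set \<times> mpol set \<Rightarrow>\<^sub>0 int) set \<Rightarrow> trit \<Rightarrow> mpol" where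
  "Phi_left p t k = tlift (union_coord 1 PhiJ (Phi2 2 p)) t ((), k)"

lemma Dsig_laws:
  "Dsig a xmul (v + w) = Dsig a xmul v + Dsig a xmul w" "Dsig a xmul (\<lambda>k. r * v k) = (\<lambda>k. r * Dsig a xmul v k)"
  "a \<noteq> b \<Longrightarrow> Dsig a xmul (Ysig a b xmul i v) = Ysig a b xmul i (Dsig a xmul v)"
  by (auto simp: Dsig_def Ysig_def fun_eq_iff algebra_simps split: trit.split)

lemma Ysig_add: "Ysig a b xmul i (\<lambda>k. v k + w k) k = Ysig a b xmul i v k + Ysig a b xmul i w k"
  and Dsig_add: "Dsig a xmul (\<lambda>k. v k + w k) k = Dsig a xmul v k + Dsig a xmul w k"
  by (auto simp: Dsig_def Ysig_def algebra_simps split: trit.split)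

text \<open>\<open>J\<close> has rank one and its left variable equals its right one. So the
  coordinate operators are those of the crossing, and \<open>yv 3\<close> multiplies by
  \<open>xv 3\<close>.\<close>

lemma omodel_right: "omodel 3 sigma1_minus tpos 1 tqd Phi_right (Ysig 1 2 xmul) (Dsig 1 xmul)"
proof (rule omodel.intro)
  interpret S: omodel 2 sigma_minus tpos 1 tqd "Phi2 1" "Ysig 1 2 xmul" "Dsig 1 xmul" by (rule omodel_sigma) simp
  interpret J: xfree 1 bim_J "{()}" PhiJ 0 "\<lambda>_. 0" by (rule xfree_J)
  interpret U: xunion 2 "opos sigma_minus p" "{t. tpos t = p}" "Phi2 1 p" "(p - 1) div 2" tqd 1 bim_J "{()}" PhiJ 0 "\<lambda>_. 0" for p
    by (rule xunion.intro[OF S.xfree xfree_J])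
  let ?T = "\<lambda>p. opos sigma1_minus p"
  have three: "2 + 1 = (3::nat)" by simp
  have op: "?T p = bim_union 2 (opos sigma_minus p) bim_J" for p by (simp add: sigma1_minus_def ocx_union_right_def)
  have tn: "?T p = tens union_mid (union_l 2) (union_r 2) (opos sigma_minus p) bim_J" for p by (simp add: op bim_union_eq)
  have Phi_pt: "Phi_right p (U.bt.pt p m x) k = Phi2 1 p m k * shv 2 (PhiJ x ())"
    if "m \<in> carrier (opos sigma_minus p)" "x \<in> carrier bim_J" for p m x k
    using U.tlift_g_pt[OF that] by (simp add: Phi_right_def union_coord_def)
  show xf: "xfree 3 (?T p) {t. tpos t = p} (Phi_right p) ((p - 1) div 2) tqd" for p
  proof -
    have b: "bij (\<lambda>k::trit. (k, ()))" by (auto simp: bij_def inj_on_def surj_def)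
    have K: "{k. (k, ()) \<in> {t. tpos t = p} \<times> {()}} = {t. tpos t = p}" by auto
    show ?thesis
      using xfree_relabel[OF U.xfree_union[of p, unfolded three] b] unfolding K op Phi_right_def[abs_def] by simp
  qed
  interpret X: xfree 3 "?T p" "{t. tpos t = p}" "Phi_right p" "(p - 1) div 2" tqd for p by (rule xf)
  fix p t assume t: "t \<in> carrier (?T p)"
  show "Phi_right p (yv i \<odot>\<^bsub>?T p\<^esub> t) = Ysig 1 2 xmul i (Phi_right p t)" if i: "i \<in> {1..3}" for i
    using t[unfolded tn]
  proof (induction t rule: U.bt.tens_induct)
    case (pt m x)
    have iV: "vY i \<in> XY (2 + 1)" using i by simp
    have "yv i \<odot>\<^bsub>?T p\<^esub> U.bt.pt p m x = U.bt.pt p (union_l 2 (vY i) \<odot>\<^bsub>opos sigma_minus p\<^esub> m) (union_r 2 (vY i) \<odot>\<^bsub>bim_J\<^esub> x)"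
      using U.bt.smult_pt_Var[OF iV pt] by (simp add: tn)
    moreover have cl: "union_l 2 (vY i) \<odot>\<^bsub>opos sigma_minus p\<^esub> m \<in> carrier (opos sigma_minus p)" "union_r 2 (vY i) \<odot>\<^bsub>bim_J\<^esub> x \<in> carrier bim_J"
      using S.X.smult_closed[OF U.bt.l[OF iV] pt(1)] J.smult_closed[OF U.bt.r[OF iV] pt(2)] .
    moreover have "i = 1 \<or> i = 2 \<or> i = 3" using i by auto
    ultimately show ?case
      using PhiJ_yv[OF pt(2)] S.Phi_Y[OF _ pt(1), of i] S.X.smult_one[OF pt(1)] J.smult_one[OF pt(2)] pt
      by (auto simp: Phi_pt union_l_def union_r_def Ysig_def shv_mult numeral_2_eq_2[symmetric] fun_eq_iff algebra_simps split: trit.split)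
  next
    case (add s t)
    then have st: "s \<in> carrier (?T p)" "t \<in> carrier (?T p)" by (simp_all add: tn)
    have y: "yv i \<in> PR (XY 3)" using i by simp
    show ?case unfolding tn[symmetric]
      using add(3,4) X.smult_r_distr[OF _ st, of "yv i"] X.smult_closed[OF _ st(1), of "yv i"] X.smult_closed[OF _ st(2), of "yv i"] y st
      by (simp add: X.Phi_add fun_eq_iff plus_fun_def Ysig_add)
  qed
  let ?h = "odiff sigma1_minus p"
  have he: "?h = tens_map union_mid (opos sigma_minus (p - 2)) bim_J (odiff sigma_minus p) (\<lambda>y. y)"
    by (simp add: sigma1_minus_def ocx_union_right_def)
  have hcl: "?h (U.bt.cl p u) = U.bt.cl (p - 2) (frag_extend (\<lambda>(m, n). frag_of (odiff sigma_minus p m, n)) u)" for u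
    unfolding tens_map_def he
  proof (rule tens_ind_cl[OF U.bt.bitensor_axioms U.bt.bitensor_axioms], unfold prod.case)
    fix m n assume mn: "m \<in> carrier (opos sigma_minus p)" "n \<in> carrier bim_J"
    show "U.bt.FG (p - 2) (frag_of (odiff sigma_minus p m, n))" using mn S.d_closed by (intro U.bt.FG_frag_of)
    show "U.bt.cl (p - 2) (frag_of (odiff sigma_minus p (m \<oplus>\<^bsub>opos sigma_minus p\<^esub> m'), n)) =
        U.bt.cl (p - 2) (frag_of (odiff sigma_minus p m, n) + frag_of (odiff sigma_minus p m', n))"
      if "m' \<in> carrier (opos sigma_minus p)" for m'
      using U.bt.pt_rel_add1[OF S.d_closed S.d_closed mn(2)] S.d_add[of m p m'] mn that by simp
    show "U.bt.cl (p - 2) (frag_of (odiff sigma_minus p m, n \<oplus>\<^bsub>bim_J\<^esub> n')) =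
        U.bt.cl (p - 2) (frag_of (odiff sigma_minus p m, n) + frag_of (odiff sigma_minus p m, n'))"
      if "n' \<in> carrier bim_J" for n'
      using U.bt.pt_rel_add2[OF S.d_closed mn(2) that] mn by simp
    show "U.bt.cl (p - 2) (frag_of (odiff sigma_minus p (r \<odot>\<^bsub>opos sigma_minus p\<^esub> m), n)) =
        U.bt.cl (p - 2) (frag_of (odiff sigma_minus p m, s \<odot>\<^bsub>bim_J\<^esub> n))"
      if "(r, s) \<in> union_mid" for r s
    proof -
      have "r \<in> PR (XY 2)" using that by (auto simp: union_mid_def)
      then show ?thesis using U.bt.pt_balanced[OF that S.d_closed mn(2), of m] S.d_smult[of r m p] mn
        by (simp add: U.bt.pt_def)
    qed
  qed
  have hpt: "?h (U.bt.pt p m x) = U.bt.pt (p - 2) (odiff sigma_minus p m) x" for m x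
    by (simp add: U.bt.pt_def hcl)
  have hadd: "?h (s \<oplus>\<^bsub>?T p\<^esub> t) = ?h s \<oplus>\<^bsub>?T (p - 2)\<^esub> ?h t" if "s \<in> carrier (?T p)" "t \<in> carrier (?T p)" for s t
    using that by (auto simp: tn U.bt.tens_carrier U.bt.tens_add hcl frag_extend_add)
  have "?h t \<in> carrier (?T (p - 2)) \<and> Phi_right (p - 2) (?h t) = Dsig 1 xmul (Phi_right p t)"
    using t[unfolded tn]
  proof (induction t rule: U.bt.tens_induct)
    case (pt m x)
    have "?h (U.bt.pt p m x) \<in> carrier (?T (p - 2))"
      unfolding hpt tn using pt by (intro U.bt.pt_closed S.d_closed)
    moreover have "Phi_right (p - 2) (?h (U.bt.pt p m x)) k = Dsig 1 xmul (Phi_right p (U.bt.pt p m x)) k" for k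
      unfolding hpt using pt S.Phi_d[OF pt(1)] S.d_closed[OF pt(1)]
      by (auto simp: Phi_pt
          Dsig_def algebra_simps split: trit.split)
    ultimately show ?case by blast
  next
    case (add s t)
    then have st: "s \<in> carrier (?T p)" "t \<in> carrier (?T p)" by (simp_all add: tn)
    then show ?case using add(3,4) unfolding tn[symmetric] hadd[OF st]
      by (simp add: X.Phi_add fun_eq_iff plus_fun_def Dsig_add)
  qed
  then show "?h t \<in> carrier (?T (p - 2))" "Phi_right (p - 2) (?h t) = Dsig 1 xmul (Phi_right p t)" by auto
qed (auto simp: tpos_def Dsig_laws)

lemma omodel_left: "omodel 3 sigma2_minus tpos 1 tqd Phi_left (Ysig 3 2 xmul) (Dsig 3 xmul)"
proof (rule omodel.intro)
  interpret S: omodel 2 sigma_minus tpos 1 tqd "Phi2 2" "Ysig 2 1 xmul" "Dsig 2 xmul" by (rule omodel_sigma) simp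
  interpret J: xfree 1 bim_J "{()}" PhiJ 0 "\<lambda>_. 0" by (rule xfree_J)
  interpret U: xunion 1 bim_J "{()}" PhiJ 0 "\<lambda>_. 0" 2 "opos sigma_minus p" "{t. tpos t = p}" "Phi2 2 p" "(p - 1) div 2" tqd for p
    by (rule xunion.intro[OF xfree_J S.xfree])
  let ?T = "\<lambda>p. opos sigma2_minus p"
  have three: "1 + 2 = (3::nat)" by simp
  have op: "?T p = bim_union 1 bim_J (opos sigma_minus p)" for p by (simp add: sigma2_minus_def ocx_union_left_def)
  have tn: "?T p = tens union_mid (union_l 1) (union_r 1) bim_J (opos sigma_minus p)" for p by (simp add: op bim_union_eq)
  have Phi_pt: "Phi_left p (U.bt.pt p x m) k = PhiJ x () * shv 1 (Phi2 2 p m k)"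
    if "x \<in> carrier bim_J" "m \<in> carrier (opos sigma_minus p)" for p m x k
    using U.tlift_g_pt[OF that] by (simp add: Phi_left_def union_coord_def)
  show xf: "xfree 3 (?T p) {t. tpos t = p} (Phi_left p) ((p - 1) div 2) tqd" for p
  proof -
    have b: "bij (\<lambda>k::trit. ((), k))" by (auto simp: bij_def inj_on_def surj_def)
    have K: "{k. ((), k) \<in> {()} \<times> {t. tpos t = p}} = {t. tpos t = p}" by auto
    show ?thesis
      using xfree_relabel[OF U.xfree_union[of p, unfolded three] b] unfolding K op Phi_left_def[abs_def] by simp
  qed
  interpret X: xfree 3 "?T p" "{t. tpos t = p}" "Phi_left p" "(p - 1) div 2" tqd for p by (rule xf)
  fix p t assume t: "t \<in> carrier (?T p)"
  show "Phi_left p (yv i \<odot>\<^bsub>?T p\<^esub> t) = Ysig 3 2 xmul i (Phi_left p t)" if i: "i \<in> {1..3}" for i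
    using t[unfolded tn]
  proof (induction t rule: U.bt.tens_induct)
    case (pt x m)
    have iV: "vY i \<in> XY (1 + 2)" using i by simp
    have "yv i \<odot>\<^bsub>?T p\<^esub> U.bt.pt p x m = U.bt.pt p (union_l 1 (vY i) \<odot>\<^bsub>bim_J\<^esub> x) (union_r 1 (vY i) \<odot>\<^bsub>opos sigma_minus p\<^esub> m)"
      using U.bt.smult_pt_Var[OF iV pt] by (simp add: tn)
    moreover have "union_r 1 (vY i) \<odot>\<^bsub>opos sigma_minus p\<^esub> m \<in> carrier (opos sigma_minus p)" "union_l 1 (vY i) \<odot>\<^bsub>bim_J\<^esub> x \<in> carrier bim_J"
      using S.X.smult_closed[OF U.bt.r[OF iV] pt(2)] J.smult_closed[OF U.bt.l[OF iV] pt(1)] .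
    moreover have "i = 1 \<or> i = 2 \<or> i = 3" using i by auto
    ultimately show ?case
      using PhiJ_yv[OF pt(1)] S.Phi_Y[OF _ pt(2), of "i - 1"] S.X.smult_one[OF pt(2)] J.smult_one[OF pt(1)] pt
      by (auto simp: Phi_pt union_l_def union_r_def Ysig_def shv_mult shv_add shv_uminus numeral_2_eq_2[symmetric] fun_eq_iff algebra_simps split: trit.split)
  next
    case (add s t)
    then have st: "s \<in> carrier (?T p)" "t \<in> carrier (?T p)" by (simp_all add: tn)
    have y: "yv i \<in> PR (XY 3)" using i by simp
    show ?case unfolding tn[symmetric]
      using add(3,4) X.smult_r_distr[OF _ st, of "yv i"] X.smult_closed[OF _ st(1), of "yv i"] X.smult_closed[OF _ st(2), of "yv i"] y st
      by (simp add: X.Phi_add fun_eq_iff plus_fun_def Ysig_add)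
  qed
  let ?h = "odiff sigma2_minus p"
  have he: "?h = tens_map union_mid bim_J (opos sigma_minus (p - 2)) (\<lambda>y. y) (odiff sigma_minus p)"
    by (simp add: sigma2_minus_def ocx_union_left_def)
  have hcl: "?h (U.bt.cl p u) = U.bt.cl (p - 2) (frag_extend (\<lambda>(n, m). frag_of (n, odiff sigma_minus p m)) u)" for u
    unfolding tens_map_def he
  proof (rule tens_ind_cl[OF U.bt.bitensor_axioms U.bt.bitensor_axioms], unfold prod.case)
    fix n m assume mn: "n \<in> carrier bim_J" "m \<in> carrier (opos sigma_minus p)"
    show "U.bt.FG (p - 2) (frag_of (n, odiff sigma_minus p m))" using mn S.d_closed by (intro U.bt.FG_frag_of)
    show "U.bt.cl (p - 2) (frag_of (n, odiff sigma_minus p (m \<oplus>\<^bsub>opos sigma_minus p\<^esub> m'))) =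
        U.bt.cl (p - 2) (frag_of (n, odiff sigma_minus p m) + frag_of (n, odiff sigma_minus p m'))"
      if "m' \<in> carrier (opos sigma_minus p)" for m'
      using U.bt.pt_rel_add2[OF mn(1) S.d_closed S.d_closed] S.d_add[of m p m'] mn that by simp
    show "U.bt.cl (p - 2) (frag_of (n \<oplus>\<^bsub>bim_J\<^esub> n', odiff sigma_minus p m)) =
        U.bt.cl (p - 2) (frag_of (n, odiff sigma_minus p m) + frag_of (n', odiff sigma_minus p m))"
      if "n' \<in> carrier bim_J" for n'
      using U.bt.pt_rel_add1[OF mn(1) that S.d_closed] mn by simp
    show "U.bt.cl (p - 2) (frag_of (r \<odot>\<^bsub>bim_J\<^esub> n, odiff sigma_minus p m)) =
        U.bt.cl (p - 2) (frag_of (n, odiff sigma_minus p (s \<odot>\<^bsub>opos sigma_minus p\<^esub> m)))"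
      if "(r, s) \<in> union_mid" for r s
    proof -
      have "s \<in> PR (XY 2)" using that by (auto simp: union_mid_def)
      then show ?thesis using U.bt.pt_balanced[OF that mn(1) S.d_closed, of m] S.d_smult[of s m p] mn
        by (simp add: U.bt.pt_def)
    qed
  qed
  have hpt: "?h (U.bt.pt p x m) = U.bt.pt (p - 2) x (odiff sigma_minus p m)" for m x
    by (simp add: U.bt.pt_def hcl)
  have hadd: "?h (s \<oplus>\<^bsub>?T p\<^esub> t) = ?h s \<oplus>\<^bsub>?T (p - 2)\<^esub> ?h t" if "s \<in> carrier (?T p)" "t \<in> carrier (?T p)" for s t
    using that by (auto simp: tn U.bt.tens_carrier U.bt.tens_add hcl frag_extend_add)
  have "?h t \<in> carrier (?T (p - 2)) \<and> Phi_left (p - 2) (?h t) = Dsig 3 xmul (Phi_left p t)"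
    using t[unfolded tn]
  proof (induction t rule: U.bt.tens_induct)
    case (pt x m)
    have "?h (U.bt.pt p x m) \<in> carrier (?T (p - 2))"
      unfolding hpt tn using pt by (intro U.bt.pt_closed S.d_closed)
    moreover have "Phi_left (p - 2) (?h (U.bt.pt p x m)) k = Dsig 3 xmul (Phi_left p (U.bt.pt p x m)) k" for k
      unfolding hpt using pt S.Phi_d[OF pt(2)] S.d_closed[OF pt(2)]
      by (auto simp: Phi_pt Dsig_def shv_mult shv_add numeral_2_eq_2[symmetric] algebra_simps split: trit.split)
    ultimately show ?case by blast
  next
    case (add s t)
    then have st: "s \<in> carrier (?T p)" "t \<in> carrier (?T p)" by (simp_all add: tn)
    then show ?case using add(3,4) unfolding tn[symmetric] hadd[OF st]
      by (simp add: X.Phi_add fun_eq_iff plus_fun_def Dsig_add)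
  qed
  then show "?h t \<in> carrier (?T (p - 2))" "Phi_left (p - 2) (?h t) = Dsig 3 xmul (Phi_left p t)" by auto
qed (auto simp: tpos_def Dsig_laws)

text \<open>A crossing is named by its outer strand, 1 or 3; its other strand is 2 in both cases.
  The two crossings thereby become one family with a parameter.\<close>

definition sgm where "sgm a = (if a = 1 then sigma1_minus else sigma2_minus)" for a :: nat
definition Phi3 where "Phi3 a = (if a = 1 then Phi_right else Phi_left)" for a :: nat

lemma omodel_sgm: "a = 1 \<or> a = 3 \<Longrightarrow> omodel 3 (sgm a) tpos 1 tqd (Phi3 a) (Ysig a 2 xmul) (Dsig a xmul)"
  using omodel_right omodel_left by (auto simp: sgm_def Phi3_def simp del: One_nat_def)

subsection \<open>Products of crossings\<close>

text \<open>The right variables of the first crossing act as left variables of the second. The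
  operators \<open>U\<close> for the first crossing are therefore the operators
  \<open>Ysig c 2 U\<close> on vectors of the second.\<close>

definition YSS :: "nat \<Rightarrow> nat \<Rightarrow> (nat \<Rightarrow> 'n \<Rightarrow> 'n) \<Rightarrow> nat \<Rightarrow> (trit \<times> trit \<Rightarrow> 'n) \<Rightarrow> trit \<times> trit \<Rightarrow> 'n::ab_group_add" where
  "YSS a c U i w k = Ysig a 2 (Ysig c 2 U) i (\<lambda>s t. w (s, t)) (fst k) (snd k)"

text \<open>The sign is the Koszul sign: the blob has \<open>a\<close>-degree 0 and the identity
  term \<open>a\<close>-degree -1. In \<open>DSSS\<close> it is negative if exactly one of the first
  two entries is \<open>TI\<close>.\<close>

definition DSS :: "nat \<Rightarrow> nat \<Rightarrow> (nat \<Rightarrow> 'n \<Rightarrow> 'n) \<Rightarrow> (trit \<times> trit \<Rightarrow> 'n) \<Rightarrow> trit \<times> trit \<Rightarrow> 'n::ab_group_add" where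
  "DSS a c U w k = Dsig a (Ysig c 2 U) (\<lambda>s t. w (s, t)) (fst k) (snd k) +
     (if fst k = TI then - Dsig c U (\<lambda>t. w (fst k, t)) (snd k) else Dsig c U (\<lambda>t. w (fst k, t)) (snd k))"

definition YSSS :: "nat \<Rightarrow> nat \<Rightarrow> nat \<Rightarrow> ((trit \<times> trit) \<times> trit \<Rightarrow> mpol) \<Rightarrow> (trit \<times> trit) \<times> trit \<Rightarrow> mpol" where
  "YSSS a c i w k = YSS a c (Ysig a 2 xmul) i (\<lambda>s t. w (s, t)) (fst k) (snd k)"

definition DSSS :: "nat \<Rightarrow> nat \<Rightarrow> ((trit \<times> trit) \<times> trit \<Rightarrow> mpol) \<Rightarrow> (trit \<times> trit) \<times> trit \<Rightarrow> mpol" where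
  "DSSS a c w k = DSS a c (Ysig a 2 xmul) (\<lambda>s t. w (s, t)) (fst k) (snd k) +
     (if (fst (fst k) = TI) \<noteq> (snd (fst k) = TI) then - Dsig a xmul (\<lambda>t. w (fst k, t)) (snd k) else Dsig a xmul (\<lambda>t. w (fst k, t)) (snd k))"

definition pos2 :: "trit \<times> trit \<Rightarrow> int" where "pos2 k = tpos (fst k) + tpos (snd k)"
definition pos3 :: "(trit \<times> trit) \<times> trit \<Rightarrow> int" where "pos3 k = pos2 (fst k) + tpos (snd k)"
definition qd2 :: "trit \<times> trit \<Rightarrow> int" where "qd2 k = tqd (fst k) + tqd (snd k)"
definition qd3 :: "(trit \<times> trit) \<times> trit \<Rightarrow> int" where "qd3 k = qd2 (fst k) + tqd (snd k)"
definition Phi4 where "Phi4 a c = comp_Phi (sgm a) tpos (Phi3 a) (sgm c) tpos (Phi3 c)"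
definition Phi5 where "Phi5 a c = comp_Phi (ocx_comp 3 (sgm a) (sgm c)) pos2 (Phi4 a c) (sgm a) tpos (Phi3 a)"

section \<open>Naturality, locality and commutation of the coordinate operators\<close>

lemma additive_minus:
  assumes "\<And>p q. \<Theta> (p + q) = \<Theta> p + \<Theta> (q :: 'x::ab_group_add) + (0 :: 'y::ab_group_add)"
  shows "\<Theta> (- p) = - \<Theta> p" "\<Theta> 0 = 0"
proof -
  show 0: "\<Theta> 0 = 0" using assms[of 0 0] by simp
  show "\<Theta> (- p) = - \<Theta> p" using assms[of p "- p"] 0 by (simp add: eq_neg_iff_add_eq_0 add.commute)
qed

text \<open>\<open>Ysig\<close> is composed of sums, negatives and the operators \<open>U j\<close>,
  all of which are respected by an additive map that intertwines \<open>U\<close> and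
  \<open>U'\<close>.\<close>

lemma Ysig_nat:
  assumes add: "\<And>p q. \<Theta> (p + q) = \<Theta> p + \<Theta> q" and U: "\<And>p j. j \<in> {1..3} \<Longrightarrow> \<Theta> (U j p) = U' j (\<Theta> p)"
    and i: "i \<in> {1..3}" and a: "a \<in> {1..3}" and b: "b \<in> {1..3}"
  shows "\<Theta> (Ysig a b U i w k) = Ysig a b U' i (\<lambda>k. \<Theta> (w k)) k"
proof -
  have m: "\<Theta> (- p) = - \<Theta> p" for p using additive_minus(1)[of \<Theta> p] add by simp
  show ?thesis using U[OF i] U[OF a] U[OF b] by (auto simp: Ysig_def add m split: trit.split)
qed

lemma Dsig_nat:
  assumes add: "\<And>p q. \<Theta> (p + q) = \<Theta> p + \<Theta> q" and U: "\<And>p j. j \<in> {1..3} \<Longrightarrow> \<Theta> (U j p) = U' j (\<Theta> p)"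
    and a: "a \<in> {1..3}"
  shows "\<Theta> (Dsig a U w k) = Dsig a U' (\<lambda>k. \<Theta> (w k)) k"
  using U[OF a] additive_minus(2)[of \<Theta>] add by (auto simp: Dsig_def split: trit.split)

text \<open>Naturality of the outer \<open>Ysig\<close> is applied to \<open>\<Theta>\<close> acting
  entrywise on vectors; naturality of the inner one shows that this entrywise map
  intertwines.\<close>

lemma YSS_nat:
  assumes add: "\<And>p q. \<Theta> (p + q) = \<Theta> p + \<Theta> q" and U: "\<And>p j. j \<in> {1..3} \<Longrightarrow> \<Theta> (U j p) = U' j (\<Theta> p)"
    and i: "i \<in> {1..3}" and a: "a \<in> {1..3}" and c: "c \<in> {1..3}"
  shows "\<Theta> (YSS a c U i w k) = YSS a c U' i (\<lambda>k. \<Theta> (w k)) k"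
proof -
  have 2: "2 \<in> {1..3::nat}" by simp
  have "(\<lambda>t. \<Theta> (Ysig a 2 (Ysig c 2 U) i (\<lambda>s t. w (s, t)) (fst k) t)) = Ysig a 2 (Ysig c 2 U') i (\<lambda>s t. \<Theta> (w (s, t))) (fst k)"
  proof (rule Ysig_nat[where \<Theta>="\<lambda>f t. \<Theta> (f t)", OF _ _ i a 2])
    fix p :: "trit \<Rightarrow> 'a" and j :: nat assume j: "j \<in> {1..3}"
    show "(\<lambda>t. \<Theta> (Ysig c 2 U j p t)) = Ysig c 2 U' j (\<lambda>t. \<Theta> (p t))"
      by (rule ext) (rule Ysig_nat[where \<Theta>=\<Theta> and U=U and U'=U', OF add U j c 2])
  qed (simp add: add fun_eq_iff)
  from fun_cong[OF this, of "snd k"] show ?thesis by (simp add: YSS_def)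
qed

lemma DSS_nat:
  assumes add: "\<And>p q. \<Theta> (p + q) = \<Theta> p + \<Theta> q" and U: "\<And>p j. j \<in> {1..3} \<Longrightarrow> \<Theta> (U j p) = U' j (\<Theta> p)"
    and a: "a \<in> {1..3}" and c: "c \<in> {1..3}"
  shows "\<Theta> (DSS a c U w k) = DSS a c U' (\<lambda>k. \<Theta> (w k)) k"
proof -
  have 2: "2 \<in> {1..3::nat}" by simp
  have m: "\<Theta> (- p) = - \<Theta> p" for p using additive_minus(1)[of \<Theta> p] add by simp
  have "(\<lambda>t. \<Theta> (Dsig a (Ysig c 2 U) (\<lambda>s t. w (s, t)) (fst k) t)) = Dsig a (Ysig c 2 U') (\<lambda>s t. \<Theta> (w (s, t))) (fst k)"
  proof (rule Dsig_nat[where \<Theta>="\<lambda>f t. \<Theta> (f t)", OF _ _ a])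
    fix p :: "trit \<Rightarrow> 'a" and j :: nat assume j: "j \<in> {1..3}"
    show "(\<lambda>t. \<Theta> (Ysig c 2 U j p t)) = Ysig c 2 U' j (\<lambda>t. \<Theta> (p t))"
      by (rule ext) (rule Ysig_nat[where \<Theta>=\<Theta> and U=U and U'=U', OF add U j c 2])
  qed (simp add: add fun_eq_iff)
  from fun_cong[OF this, of "snd k"] show ?thesis
    using Dsig_nat[where \<Theta>=\<Theta> and U=U and U'=U' and a=c, OF add U c] by (simp add: DSS_def add m del: atLeastAtMost_iff)
qed

lemma Ysig_local: "(\<And>t'. tpos t' = tpos t \<Longrightarrow> v t' = w t') \<Longrightarrow> Ysig a b U i v t = Ysig a b U i w t"
  by (cases t) (auto simp: Ysig_def tpos_def)

lemma Dsig_local: "(\<And>t'. tpos t' = tpos t + 2 \<Longrightarrow> v t' = w t') \<Longrightarrow> Dsig a U v t = Dsig a U w t"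
  by (cases t) (auto simp: Dsig_def tpos_def)

lemma YSS_local:
  assumes "\<And>k'. pos2 k' = pos2 k \<Longrightarrow> v k' = w k'" and "a \<noteq> 2" "c \<noteq> 2"
  shows "YSS a c U i v k = YSS a c U i w k"
proof -
  obtain s t where k: "k = (s, t)" by (cases k)
  show ?thesis
    using assms unfolding k by (cases s; cases t) (simp_all add: YSS_def Ysig_def pos2_def tpos_def)
qed

lemma DSS_local:
  assumes "\<And>k'. pos2 k' = pos2 k + 2 \<Longrightarrow> v k' = w k'"
  shows "DSS a c U v k = DSS a c U w k"
proof -
  obtain s t where k: "k = (s, t)" by (cases k)
  show ?thesis
    using assms unfolding k by (cases s; cases t) (simp_all add: DSS_def Dsig_def Ysig_def pos2_def tpos_def)
qed

text \<open>The properties of multiplication by the right variables that \<open>Ysig\<close> needs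
  and, by \<open>comm_ops_Ysig\<close>, passes on; this is what permits nesting.\<close>

definition comm_ops :: "(nat \<Rightarrow> 'n \<Rightarrow> 'n::ab_group_add) \<Rightarrow> bool" where
  "comm_ops U \<longleftrightarrow> (\<forall>j p q. U j (p + q) = U j p + U j q) \<and> (\<forall>i j p. U i (U j p) = U j (U i p))"

lemma comm_ops_xmul: "comm_ops xmul"
  by (simp add: comm_ops_def algebra_simps)

lemma comm_opsD:
  assumes "comm_ops U"
  shows "U j (p + q) = U j p + U j q" "U i (U j p) = U j (U i p)" "U j (- p) = - U j p" "U j (p - q) = U j p - U j q" "U j 0 = 0"
proof -
  show a: "U j (p + q) = U j p + U j q" for p q using assms by (simp add: comm_ops_def)
  show "U i (U j p) = U j (U i p)" using assms by (simp add: comm_ops_def)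
  show m: "U j (- p) = - U j p" for p using additive_minus(1)[of "U j" p] a by simp
  show "U j 0 = 0" using additive_minus(2)[of "U j"] a by simp
  show "U j (p - q) = U j p - U j q" using a[of p "- q"] m by simp
qed

lemma comm_ops_Ysig:
  assumes U: "comm_ops U" and ab: "a \<noteq> b" shows "comm_ops (Ysig a b U)"
proof -
  note D = comm_opsD[OF U]
  have "Ysig a b U j (p + q) = Ysig a b U j p + Ysig a b U j q" for j p q
    by (auto simp: Ysig_def fun_eq_iff D algebra_simps split: trit.split)
  moreover have "Ysig a b U i (Ysig a b U j p) = Ysig a b U j (Ysig a b U i p)" for i j p
  proof
    fix t
    show "Ysig a b U i (Ysig a b U j p) t = Ysig a b U j (Ysig a b U i p) t"
      using D(2)[of i a] D(2)[of i b] D(2)[of j a] D(2)[of j b] D(2)[of a b] D(2)[of i j] ab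
      by (cases t; cases "i = a"; cases "i = b"; cases "j = a"; cases "j = b")
        (simp_all add: Ysig_def D(1,3,4,5) algebra_simps)
  qed
  ultimately show ?thesis unfolding comm_ops_def by blast
qed

lemma Dsig_Ysig:
  assumes U: "comm_ops U" and ab: "a \<noteq> b" shows "Dsig a U (Ysig a b U i w) = Ysig a b U i (Dsig a U w)"
proof
  fix t
  note D = comm_opsD[OF U]
  show "Dsig a U (Ysig a b U i w) t = Ysig a b U i (Dsig a U w) t"
    using D(2)[of i a] D(2)[of b a] ab
    by (cases t; cases "i = a"; cases "i = b") (simp_all add: Ysig_def Dsig_def D(1,3,4,5) algebra_simps)
qed

lemma Dsig_additive: "comm_ops U \<Longrightarrow> Dsig a U (v + w) = Dsig a U v + Dsig a U w"
  by (auto simp: Dsig_def fun_eq_iff comm_opsD algebra_simps split: trit.split)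

text \<open>The first part of the differential is handled by \<open>Dsig_Ysig\<close>. For the
  second part, the left variables act by a matrix over the first index whose entries are operators
  of the second crossing, and these commute with its differential. The sign is harmless, as the
  matrix does not mix \<open>TI\<close> with the blob.\<close>

lemma DSS_YSS:
  assumes U: "comm_ops U" and ac: "a \<in> {1, 3}" "c \<in> {1, 3}" and i: "i \<in> {1..3}"
  shows "DSS a c U (YSS a c U i w) = YSS a c U i (DSS a c U w)"
proof
  fix k :: "trit \<times> trit" obtain s t where k: "k = (s, t)" by (cases k)
  have ac': "a \<noteq> 2" "c \<noteq> 2" "a \<in> {1..3}" "2 \<in> {1..3::nat}" using ac by auto
  have V: "comm_ops (Ysig c 2 U)" using U ac' by (intro comm_ops_Ysig)
  define w' where "w' = (\<lambda>s t. w (s, t))"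
  let ?D = "\<lambda>f. Dsig c U f" and ?V = "Ysig c 2 U"
  define e where "e = (\<lambda>s. if s = TI then - ?D (w' s) else ?D (w' s))"
  have Dm: "?D (- f) = - ?D f" for f using additive_minus(1)[of ?D f] Dsig_additive[OF U] by simp
  have nat: "?D (Ysig a 2 ?V i w' s) = Ysig a 2 ?V i (\<lambda>s. ?D (w' s)) s" for s
    by (rule Ysig_nat[where \<Theta>="Dsig c U" and U="Ysig c 2 U" and U'="Ysig c 2 U"])
      (use Dsig_additive[OF U] Dsig_Ysig[OF U ac'(2)] i ac' in auto)
  have e': "(if s = TI then - ?D (Ysig a 2 ?V i w' s) else ?D (Ysig a 2 ?V i w' s)) = Ysig a 2 ?V i e s"
    unfolding nat e_def by (cases s) (simp_all add: Ysig_def comm_opsD[OF V])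
  have "DSS a c U (YSS a c U i w) k = Dsig a ?V (Ysig a 2 ?V i w') s t +
      (if s = TI then - ?D (Ysig a 2 ?V i w' s) else ?D (Ysig a 2 ?V i w' s)) t"
    by (simp add: DSS_def YSS_def k w'_def)
  also have "\<dots> = (Ysig a 2 ?V i (Dsig a ?V w') s + Ysig a 2 ?V i e s) t"
    unfolding e' Dsig_Ysig[OF V ac'(1)] by simp
  also have "Ysig a 2 ?V i (Dsig a ?V w') s + Ysig a 2 ?V i e s = Ysig a 2 ?V i (Dsig a ?V w' + e) s"
    using comm_opsD(1)[OF comm_ops_Ysig[OF V ac'(1)], of i "Dsig a ?V w'" e] by (simp add: fun_eq_iff)
  also have "Dsig a ?V w' + e = (\<lambda>s t. DSS a c U w (s, t))"
    by (auto simp: fun_eq_iff DSS_def w'_def e_def)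
  also have "Ysig a 2 ?V i (\<lambda>s t. DSS a c U w (s, t)) s t = YSS a c U i (DSS a c U w) k"
    by (simp add: YSS_def k)
  finally show "DSS a c U (YSS a c U i w) k = YSS a c U i (DSS a c U w) k" .
qed

lemma YSS_additive: assumes "comm_ops U" "a \<noteq> 2" "c \<noteq> 2"
  shows "YSS a c U i (\<lambda>k. v k + w k) k = YSS a c U i v k + YSS a c U i w k"
proof -
  have "comm_ops (Ysig a 2 (Ysig c 2 U))" using assms by (intro comm_ops_Ysig)
  from comm_opsD(1)[OF this, of i "\<lambda>s t. v (s, t)" "\<lambda>s t. w (s, t)"] show ?thesis
    by (simp add: YSS_def plus_fun_def fun_eq_iff)
qed

lemma DSS_additive: assumes "comm_ops U" "c \<noteq> 2"
  shows "DSS a c U (\<lambda>k. v k + w k) k = DSS a c U v k + DSS a c U w k"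
proof -
  have "comm_ops (Ysig c 2 U)" using assms by (intro comm_ops_Ysig)
  from Dsig_additive[OF this, of a "\<lambda>s t. v (s, t)" "\<lambda>s t. w (s, t)"]
    Dsig_additive[OF assms(1), of c "\<lambda>t. v (_, t)" "\<lambda>t. w (_, t)"] show ?thesis
    by (simp add: DSS_def plus_fun_def fun_eq_iff)
qed

lemma Ysig_scale: "Ysig a b xmul i (\<lambda>k. r * v k) = (\<lambda>k. r * Ysig a b xmul i v k)"
  by (auto simp: Ysig_def fun_eq_iff algebra_simps split: trit.split)

section \<open>Models of the double and triple products\<close>

lemma ocomp_SS:
  assumes ac: "a = 1 \<or> a = 3" "c = 1 \<or> c = 3"
  shows "ocomp (sgm a) tpos 1 tqd (Phi3 a) (Ysig a 2 xmul) (Dsig a xmul) (sgm c) tpos 1 tqd (Phi3 c) (Ysig c 2 xmul) (Dsig c xmul)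
    (Ysig a 2 (Ysig c 2 xmul)) (Dsig a (Ysig c 2 xmul))"
proof (intro ocomp.intro ocomp_axioms.intro omodel_sgm[OF ac(1)] omodel_sgm[OF ac(2)])
  have a3: "a \<in> {1..3}" "2 \<in> {1..3::nat}" "a \<noteq> 2" "c \<noteq> 2" using ac by auto
  have V: "comm_ops (Ysig c 2 xmul)" using comm_ops_xmul a3 by (intro comm_ops_Ysig)
  fix \<Theta> :: "mpol \<Rightarrow> trit \<Rightarrow> mpol" and i w k
  assume T: "\<And>p q. \<Theta> (p + q) = \<Theta> p + \<Theta> q" "\<And>p j. j \<in> {1..3} \<Longrightarrow> \<Theta> (xv j * p) = Ysig c 2 xmul j (\<Theta> p)"
  show "\<Theta> (Ysig a 2 xmul i w k) = Ysig a 2 (Ysig c 2 xmul) i (\<lambda>k. \<Theta> (w k)) k" if "i \<in> {1..3}"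
    by (rule Ysig_nat[where \<Theta>=\<Theta> and U=xmul and U'="Ysig c 2 xmul", OF T that a3(1,2)])
  show "\<Theta> (Dsig a xmul w k) = Dsig a (Ysig c 2 xmul) (\<lambda>k. \<Theta> (w k)) k"
    by (rule Dsig_nat[where \<Theta>=\<Theta> and U=xmul and U'="Ysig c 2 xmul", OF T a3(1)])
next
  have a3: "a \<noteq> 2" "c \<noteq> 2" using ac by auto
  have V: "comm_ops (Ysig c 2 xmul)" using comm_ops_xmul a3 by (intro comm_ops_Ysig)
  fix i k and v w :: "trit \<Rightarrow> trit \<Rightarrow> mpol"
  show "Ysig a 2 (Ysig c 2 xmul) i (\<lambda>k. v k + w k) k = Ysig a 2 (Ysig c 2 xmul) i v k + Ysig a 2 (Ysig c 2 xmul) i w k"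
    using comm_opsD(1)[OF comm_ops_Ysig[OF V a3(1)], of i v w] by (simp add: plus_fun_def)
  show "Dsig a (Ysig c 2 xmul) (\<lambda>k. v k + w k) k = Dsig a (Ysig c 2 xmul) v k + Dsig a (Ysig c 2 xmul) w k"
    using Dsig_additive[OF V, of a v w] by (simp add: plus_fun_def)
qed (auto intro: Ysig_local Dsig_local)

lemma omodel_SS:
  assumes ac: "a = 1 \<or> a = 3" "c = 1 \<or> c = 3"
  shows "omodel 3 (ocx_comp 3 (sgm a) (sgm c)) pos2 2 qd2 (Phi4 a c) (YSS a c xmul) (DSS a c xmul)"
proof -
  interpret O: ocomp "sgm a" tpos 1 tqd "Phi3 a" "Ysig a 2 xmul" "Dsig a xmul" "sgm c" tpos 1 tqd "Phi3 c" "Ysig c 2 xmul" "Dsig c xmul"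
    "Ysig a 2 (Ysig c 2 xmul)" "Dsig a (Ysig c 2 xmul)" by (rule ocomp_SS[OF ac])
  have Y: "O.YCE = YSS a c xmul" by (intro ext) (simp add: O.YCE_def YSS_def)
  have D: "O.DCE = DSS a c xmul" by (intro ext) (auto simp: O.DCE_def DSS_def tpos_def)
  have p: "O.posCE = pos2" "O.qdCE = qd2" by (auto simp: O.posCE_def pos2_def O.qdCE_def qd2_def)
  have "omodel 3 (ocx_comp 3 (sgm a) (sgm c)) O.posCE (1 + 1) O.qdCE (Phi4 a c) O.YCE O.DCE"
    unfolding Phi4_def
  proof (rule O.omodel_CE)
    show "O.DCE (O.YCE i v) = O.YCE i (O.DCE v)" if "i \<in> {1..3}" for i v
      unfolding Y D using ac that by (intro DSS_YSS comm_ops_xmul) auto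
    show "Dsig a (Ysig c 2 xmul) (\<lambda>k l. r * v k l) k = (\<lambda>l. r * Dsig a (Ysig c 2 xmul) v k l)" for r v k
      by (cases k) (simp_all add: Dsig_def Ysig_scale fun_eq_iff distrib_left)
  qed
  then show ?thesis unfolding Y D p by simp
qed

lemma ocomp_SSS:
  assumes ac: "a = 1 \<or> a = 3" "c = 1 \<or> c = 3"
  shows "ocomp (ocx_comp 3 (sgm a) (sgm c)) pos2 2 qd2 (Phi4 a c) (YSS a c xmul) (DSS a c xmul)
    (sgm a) tpos 1 tqd (Phi3 a) (Ysig a 2 xmul) (Dsig a xmul) (YSS a c (Ysig a 2 xmul)) (DSS a c (Ysig a 2 xmul))"
proof (intro ocomp.intro ocomp_axioms.intro omodel_SS[OF ac] omodel_sgm[OF ac(1)])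
  have a3: "a \<in> {1..3}" "c \<in> {1..3}" using ac by auto
  fix \<Theta> :: "mpol \<Rightarrow> trit \<Rightarrow> mpol" and i w k
  assume T: "\<And>p q. \<Theta> (p + q) = \<Theta> p + \<Theta> q" "\<And>p j. j \<in> {1..3} \<Longrightarrow> \<Theta> (xv j * p) = Ysig a 2 xmul j (\<Theta> p)"
  show "\<Theta> (YSS a c xmul i w k) = YSS a c (Ysig a 2 xmul) i (\<lambda>k. \<Theta> (w k)) k" if "i \<in> {1..3}"
    by (rule YSS_nat[where \<Theta>=\<Theta> and U=xmul and U'="Ysig a 2 xmul", OF T that a3])
  show "\<Theta> (DSS a c xmul w k) = DSS a c (Ysig a 2 xmul) (\<lambda>k. \<Theta> (w k)) k"
    by (rule DSS_nat[where \<Theta>=\<Theta> and U=xmul and U'="Ysig a 2 xmul", OF T a3])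
next
  have a3: "a \<noteq> 2" "c \<noteq> 2" using ac by auto
  have V: "comm_ops (Ysig a 2 xmul)" using comm_ops_xmul a3 by (intro comm_ops_Ysig)
  fix i k and v w :: "trit \<times> trit \<Rightarrow> trit \<Rightarrow> mpol"
  show "YSS a c (Ysig a 2 xmul) i (\<lambda>k. v k + w k) k = YSS a c (Ysig a 2 xmul) i v k + YSS a c (Ysig a 2 xmul) i w k"
    by (rule YSS_additive[OF V a3])
  show "DSS a c (Ysig a 2 xmul) (\<lambda>k. v k + w k) k = DSS a c (Ysig a 2 xmul) v k + DSS a c (Ysig a 2 xmul) w k"
    by (rule DSS_additive[OF V a3(2)])
  show "YSS a c (Ysig a 2 xmul) i v k = YSS a c (Ysig a 2 xmul) i w k" if "\<And>k'. pos2 k' = pos2 k \<Longrightarrow> v k' = w k'"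
    using that a3 by (rule YSS_local)
  show "DSS a c (Ysig a 2 xmul) v k = DSS a c (Ysig a 2 xmul) w k" if "\<And>k'. pos2 k' = pos2 k + 2 \<Longrightarrow> v k' = w k'"
    using that by (rule DSS_local)
qed

lemma DSSS_YSSS:
  assumes ac: "a = 1 \<or> a = 3" "c = 1 \<or> c = 3" and i: "i \<in> {1..3}"
  shows "DSSS a c (YSSS a c i w) = YSSS a c i (DSSS a c w)"
proof
  fix k :: "(trit \<times> trit) \<times> trit" obtain s t where k: "k = (s, t)" by (cases k)
  have ac': "a \<noteq> 2" "c \<noteq> 2" "a \<in> {1..3}" "c \<in> {1..3}" "a \<in> {1,3}" "c \<in> {1,3}" using ac by auto
  let ?V = "Ysig a 2 xmul" let ?D = "\<lambda>f. Dsig a xmul f"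
  have V: "comm_ops ?V" using comm_ops_xmul ac' by (intro comm_ops_Ysig)
  define w' where "w' = (\<lambda>s t. w (s, t))"
  define od where "od s = ((fst s = TI) \<noteq> (snd s = TI))" for s :: "trit \<times> trit"
  define e where "e = (\<lambda>s. if od s then - ?D (w' s) else ?D (w' s))"
  have nat: "?D (YSS a c ?V i w' s) = YSS a c ?V i (\<lambda>s. ?D (w' s)) s" for s
    by (rule YSS_nat[where \<Theta>="Dsig a xmul" and U="Ysig a 2 xmul" and U'="Ysig a 2 xmul"])
      (use Dsig_additive[OF comm_ops_xmul] Dsig_Ysig[OF comm_ops_xmul ac'(1)] i ac' in auto)
  have neg: "YSS a c ?V i (\<lambda>s. - f s) s = - YSS a c ?V i f s" for f s
    using YSS_additive[OF V ac'(1,2), of i f "\<lambda>s. - f s" s] YSS_additive[OF V ac'(1,2), of i "\<lambda>_. 0" "\<lambda>_. 0" s]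
    by (simp add: eq_neg_iff_add_eq_0 add.commute)
  have e': "(if od s then - ?D (YSS a c ?V i w' s) else ?D (YSS a c ?V i w' s)) = YSS a c ?V i e s"
  proof -
    \<comment> \<open>\<open>YSS\<close> mixes only indices of equal \<open>pos2\<close>, and
      \<open>od\<close> depends on \<open>pos2\<close> alone: it holds exactly at position 0. So the
      sign can be frozen at its value for \<open>s\<close>.\<close>
    have "YSS a c ?V i e s = YSS a c ?V i (\<lambda>s'. if od s then - ?D (w' s') else ?D (w' s')) s"
    proof (rule YSS_local[OF _ ac'(1,2)])
      fix k' assume "pos2 k' = pos2 s"
      then have "od k' = od s" by (cases k'; cases s) (auto simp: od_def pos2_def tpos_def split: if_splits)
      then show "e k' = (if od s then - ?D (w' k') else ?D (w' k'))" by (simp add: e_def)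
    qed
    then show ?thesis unfolding nat by (simp add: neg)
  qed
  have "DSSS a c (YSSS a c i w) k = DSS a c ?V (YSS a c ?V i w') s t +
      (if od s then - ?D (YSS a c ?V i w' s) else ?D (YSS a c ?V i w' s)) t"
    by (simp add: DSSS_def YSSS_def k w'_def od_def)
  also have "\<dots> = (YSS a c ?V i (DSS a c ?V w') s + YSS a c ?V i e s) t"
    unfolding e' DSS_YSS[OF V ac'(5,6) i] by simp
  also have "YSS a c ?V i (DSS a c ?V w') s + YSS a c ?V i e s = YSS a c ?V i (\<lambda>s. DSS a c ?V w' s + e s) s"
    by (rule YSS_additive[OF V ac'(1,2), symmetric])
  also have "(\<lambda>s. DSS a c ?V w' s + e s) = (\<lambda>s t. DSSS a c w (s, t))"
    by (auto simp: fun_eq_iff DSSS_def w'_def e_def od_def)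
  also have "YSS a c ?V i (\<lambda>s t. DSSS a c w (s, t)) s t = YSSS a c i (DSSS a c w) k"
    by (simp add: YSSS_def k)
  finally show "DSSS a c (YSSS a c i w) k = YSSS a c i (DSSS a c w) k" .
qed

abbreviation triple where "triple a c \<equiv> ocx_comp 3 (ocx_comp 3 (sgm a) (sgm c)) (sgm a)"

lemma omodel_SSS:
  assumes ac: "a = 1 \<or> a = 3" "c = 1 \<or> c = 3"
  shows "omodel 3 (triple a c) pos3 3 qd3 (Phi5 a c) (YSSS a c) (DSSS a c)"
proof -
  interpret O: ocomp "ocx_comp 3 (sgm a) (sgm c)" pos2 2 qd2 "Phi4 a c" "YSS a c xmul" "DSS a c xmul"
    "sgm a" tpos 1 tqd "Phi3 a" "Ysig a 2 xmul" "Dsig a xmul" "YSS a c (Ysig a 2 xmul)" "DSS a c (Ysig a 2 xmul)"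
    by (rule ocomp_SSS[OF ac])
  have Y: "O.YCE = YSSS a c" by (intro ext) (simp add: O.YCE_def YSSS_def)
  have D: "O.DCE = DSSS a c"
  proof (intro ext)
    fix w k
    show "O.DCE w k = DSSS a c w k"
      by (cases k; cases "fst k") (auto simp: O.DCE_def DSSS_def pos2_def tpos_def)
  qed
  have p: "O.posCE = pos3" "O.qdCE = qd3" by (auto simp: O.posCE_def pos3_def O.qdCE_def qd3_def)
  have "omodel 3 (triple a c) O.posCE (2 + 1) O.qdCE (Phi5 a c) O.YCE O.DCE"
    unfolding Phi5_def
  proof (rule O.omodel_CE)
    show "O.DCE (O.YCE i v) = O.YCE i (O.DCE v)" if "i \<in> {1..3}" for i v
      unfolding Y D by (rule DSSS_YSSS[OF ac that])
    show "DSS a c (Ysig a 2 xmul) (\<lambda>k l. r * v k l) k = (\<lambda>l. r * DSS a c (Ysig a 2 xmul) v k l)" for r v k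
    proof -
      have "(\<lambda>t. r * DSS a c (Ysig a 2 xmul) v k t) = DSS a c (Ysig a 2 xmul) (\<lambda>k t. r * v k t) k"
        by (rule DSS_nat[where \<Theta>="\<lambda>f t. r * f t" and U="Ysig a 2 xmul" and U'="Ysig a 2 xmul"])
          (use ac in \<open>auto simp: Ysig_scale distrib_left fun_eq_iff\<close>)
      then show ?thesis by (rule sym)
    qed
  qed
  then show ?thesis unfolding Y D p by simp
qed

section \<open>The homotopy equivalence in coordinates\<close>

text \<open>The map goes from the word \<open>a, c, a\<close> to the word \<open>c, a, c\<close>. Write \<open>z\<close> for the left variable of strand
  \<open>a\<close> of the last blob of the source, so that \<open>((Bi, Bj), Bk)\<close> indexes \<open>y\<^sub>a\<^sup>i y\<^sub>c\<^sup>j z\<^sup>k\<close>. In the top position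
  the map is the morphism of bimodules which fixes 1 and sends \<open>z\<close> to \<open>x\<^sub>a + x\<^sub>2 - y\<^sub>c\<close>. It is the
  composition of the projection of the source to the bimodule \<open>R \<otimes>\<^bsub>R\<^sup>S\<^esub> R\<close> over the symmetric polynomials \<open>R\<^sup>S\<close>
  with the inclusion of the latter in the target. The remaining terms eliminate the two copies of
  the blob bimodule by which the products of two equal blobs and of three blobs differ from
  the terms of the minimal complex.\<close>

fun Fmap :: "nat \<Rightarrow> nat \<Rightarrow> ((trit \<times> trit) \<times> trit \<Rightarrow> mpol) \<Rightarrow> (trit \<times> trit) \<times> trit \<Rightarrow> mpol" where
  "Fmap a c w ((B0, B0), B0) = w ((B0, B0), B0) + (xv a + xv 2) * w ((B0, B0), B1) + xv 2 * xv c * w ((B0, B1), B1)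
     + xv a * xv 2 * xv c * w ((B1, B1), B1)"
| "Fmap a c w ((B1, B0), B0) = w ((B0, B1), B0) - w ((B0, B0), B1) - xv c * w ((B0, B1), B1) - xv a * (xv 2 + xv c) * w ((B1, B1), B1)"
| "Fmap a c w ((B0, B1), B0) = w ((B1, B0), B0) + (xv a + xv 2) * w ((B1, B0), B1)"
| "Fmap a c w ((B1, B1), B0) = w ((B1, B1), B0) - w ((B1, B0), B1) + w ((B0, B1), B1) + (xv a + xv 2) * w ((B1, B1), B1)"
| "Fmap a c w ((B0, B0), B1) = xv a * w ((B0, B1), B1)"
| "Fmap a c w ((B0, B1), B1) = - w ((B0, B1), B1)"
| "Fmap a c w ((B1, B0), B1) = xv a * w ((B1, B1), B1)"
| "Fmap a c w ((B1, B1), B1) = - w ((B1, B1), B1)"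
| "Fmap a c w ((B0, B0), TI) = w ((TI, B0), B0) + (xv a + xv 2) * w ((B0, TI), B1) + xv a * xv 2 * w ((B1, TI), B1)"
| "Fmap a c w ((B0, B1), TI) = w ((TI, B0), B1) - w ((B0, TI), B1)"
| "Fmap a c w ((B1, B0), TI) = w ((TI, B1), B0) - w ((B0, TI), B1)"
| "Fmap a c w ((B1, B1), TI) = w ((TI, B1), B1) - w ((B1, TI), B1)"
| "Fmap a c w ((TI, B0), B0) = w ((B0, B0), TI) + xv 2 * w ((B0, TI), B1)"
| "Fmap a c w ((TI, B1), B0) = w ((B1, B0), TI) + xv 2 * w ((B1, TI), B1)"
| "Fmap a c w ((TI, B0), B1) = w ((B0, B1), TI) - w ((B0, TI), B1)"
| "Fmap a c w ((TI, B1), B1) = w ((B1, B1), TI) - w ((B1, TI), B1)"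
| "Fmap a c w ((B0, TI), B0) = w ((B0, B0), TI) + xv 2 * w ((B0, TI), B1) + xv a * (w ((B1, B0), TI) + xv 2 * w ((B1, TI), B1))"
| "Fmap a c w ((B1, TI), B0) = w ((B0, B1), TI) - w ((B0, TI), B1) + xv a * (w ((B1, B1), TI) - w ((B1, TI), B1))"
| "Fmap a c w ((B0, TI), B1) = 0"
| "Fmap a c w ((B1, TI), B1) = 0"
| "Fmap a c w ((B0, TI), TI) = - w ((TI, B0), TI)"
| "Fmap a c w ((B1, TI), TI) = - w ((TI, B1), TI)"
| "Fmap a c w ((TI, B0), TI) = - w ((B0, TI), TI) - w ((TI, TI), B0)"
| "Fmap a c w ((TI, B1), TI) = - w ((B1, TI), TI) - w ((TI, TI), B1)"
| "Fmap a c w ((TI, TI), B0) = 0"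
| "Fmap a c w ((TI, TI), B1) = 0"
| "Fmap a c w ((TI, TI), TI) = w ((TI, TI), TI)"

text \<open>The first two clauses lift the term with a blob in the last place only to the term with
  blobs in the first and last places, along minus a section of the differential between them. The
  next six send the coefficient of y_a^i z in the latter term to the multiple of y_a^i (x_a + x_2 -
  z - y_c) in the top term, an element that the top component of \<open>Fmap\<close> kills.\<close>

fun Hmap :: "nat \<Rightarrow> ((trit \<times> trit) \<times> trit \<Rightarrow> mpol) \<Rightarrow> (trit \<times> trit) \<times> trit \<Rightarrow> mpol" where
  "Hmap a w ((B0, TI), B0) = - w ((TI, TI), B0)"
| "Hmap a w ((B1, TI), B0) = - w ((TI, TI), B1)"
| "Hmap a w ((B0, B0), B0) = (xv a + xv 2) * w ((B0, TI), B1)"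
| "Hmap a w ((B1, B0), B0) = (xv a + xv 2) * w ((B1, TI), B1)"
| "Hmap a w ((B0, B0), B1) = - w ((B0, TI), B1)"
| "Hmap a w ((B1, B0), B1) = - w ((B1, TI), B1)"
| "Hmap a w ((B0, B1), B0) = - w ((B0, TI), B1)"
| "Hmap a w ((B1, B1), B0) = - w ((B1, TI), B1)"
| "Hmap a w _ = 0"

text \<open>Reduces an identity of coordinate vectors to 27 polynomial identities, which are settled
  by expansion.\<close>

lemma trits3_cases:
  assumes "\<And>s t u. s \<in> {B0, B1, TI} \<Longrightarrow> t \<in> {B0, B1, TI} \<Longrightarrow> u \<in> {B0, B1, TI} \<Longrightarrow> P ((s, t), u)"
  shows "P k"
  using assms[of "fst (fst k)" "snd (fst k)" "snd k"] trit_UNIV by (metis UNIV_I prod.collapse)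

lemma Fmap_D: "a \<noteq> c \<Longrightarrow> a \<noteq> 2 \<Longrightarrow> c \<noteq> 2 \<Longrightarrow> DSSS c a (Fmap a c w) k = Fmap a c (DSSS a c w) k"
  by (rule trits3_cases[where k=k], elim insertE emptyE; simp add: DSSS_def DSS_def Dsig_def Ysig_def; simp add: algebra_simps)

text \<open>The homotopy for the composite in the other order is the same identity with
  \<open>a\<close> and \<open>c\<close> exchanged.\<close>

lemma Fmap_Hmap: "a \<noteq> c \<Longrightarrow> a \<noteq> 2 \<Longrightarrow> c \<noteq> 2 \<Longrightarrow>
    Fmap c a (Fmap a c w) k = w k + DSSS a c (Hmap a w) k + Hmap a (DSSS a c w) k"
  by (rule trits3_cases[where k=k], elim insertE emptyE; simp add: DSSS_def DSS_def Dsig_def Ysig_def; simp add: algebra_simps)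

lemma Fmap_Y: "a \<noteq> c \<Longrightarrow> a \<noteq> 2 \<Longrightarrow> c \<noteq> 2 \<Longrightarrow> i = a \<or> i = 2 \<or> i = c \<Longrightarrow> YSSS c a i (Fmap a c w) k = Fmap a c (YSSS a c i w) k"
  by (rule trits3_cases[where k=k], elim insertE emptyE disjE; simp add: YSSS_def YSS_def Ysig_def; simp add: algebra_simps)

lemma Hmap_Y: "a \<noteq> c \<Longrightarrow> a \<noteq> 2 \<Longrightarrow> c \<noteq> 2 \<Longrightarrow> i = a \<or> i = 2 \<or> i = c \<Longrightarrow> YSSS a c i (Hmap a w) k = Hmap a (YSSS a c i w) k"
  by (rule trits3_cases[where k=k], elim insertE emptyE disjE; simp add: YSSS_def YSS_def Ysig_def; simp add: algebra_simps)

section \<open>Filtrations\<close>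

text \<open>The conditions of \<open>fobj\<close> on the filtration apart from the differential,
  with both bounds named, as the estimates depend on their values.\<close>

definition ffilt :: "nat \<Rightarrow> 'm fcx \<Rightarrow> int \<Rightarrow> int \<Rightarrow> bool" where
  "ffilt n A lo hi \<longleftrightarrow> (\<forall>j. submodule (filt A j) (pol (XY n)) A) \<and>
     (\<forall>j. \<forall>m\<in>filt A j. \<exists>u. hom_dec A m u \<and> range u \<subseteq> filt A j) \<and>
     (\<forall>i j. i \<le> j \<longrightarrow> filt A j \<subseteq> filt A i) \<and> filt A lo = carrier A \<and> filt A hi = {\<zero>\<^bsub>A\<^esub>}"

text \<open>\<open>twist\<close>: the step \<open>j\<close> of the filtration is supported on the graph of the permutation \<open>s\<close>. \<open>neard\<close>: the quotient
  by the step \<open>j\<close> is supported on the diagonal.\<close>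

definition twist :: "nat \<Rightarrow> 'm fcx \<Rightarrow> (nat \<Rightarrow> nat) \<Rightarrow> int \<Rightarrow> bool" where
  "twist n A s j \<longleftrightarrow> (\<forall>i\<in>{1..n}. \<forall>m\<in>filt A j. yv i \<odot>\<^bsub>A\<^esub> m = xv (s i) \<odot>\<^bsub>A\<^esub> m)"

definition neard :: "nat \<Rightarrow> 'm fcx \<Rightarrow> int \<Rightarrow> bool" where
  "neard n A j \<longleftrightarrow> (\<forall>i\<in>{1..n}. \<forall>m\<in>carrier A. (yv i - xv i) \<odot>\<^bsub>A\<^esub> m \<in> filt A j)"

lemma ffiltD:
  assumes "ffilt n A lo hi"
  shows "submodule (filt A j) (pol (XY n)) A" "i \<le> j \<Longrightarrow> filt A j \<subseteq> filt A i" "filt A lo = carrier A" "filt A hi = {\<zero>\<^bsub>A\<^esub>}"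
    and "m \<in> filt A j \<Longrightarrow> \<exists>u. hom_dec A m u \<and> range u \<subseteq> filt A j"
  using assms by (auto simp: ffilt_def)

lemma ffilt_sub:
  assumes "ffilt n A lo hi"
  shows "filt A j \<subseteq> carrier A" "\<zero>\<^bsub>A\<^esub> \<in> filt A j" "x \<in> filt A j \<Longrightarrow> y \<in> filt A j \<Longrightarrow> x \<oplus>\<^bsub>A\<^esub> y \<in> filt A j"
    "x \<in> filt A j \<Longrightarrow> \<ominus>\<^bsub>A\<^esub> x \<in> filt A j" "p \<in> PR (XY n) \<Longrightarrow> x \<in> filt A j \<Longrightarrow> p \<odot>\<^bsub>A\<^esub> x \<in> filt A j"
proof -
  interpret submodule "filt A j" "pol (XY n)" A by (rule ffiltD(1)[OF assms])
  show "filt A j \<subseteq> carrier A" "\<zero>\<^bsub>A\<^esub> \<in> filt A j" "x \<in> filt A j \<Longrightarrow> y \<in> filt A j \<Longrightarrow> x \<oplus>\<^bsub>A\<^esub> y \<in> filt A j"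
    "p \<in> PR (XY n) \<Longrightarrow> x \<in> filt A j \<Longrightarrow> p \<odot>\<^bsub>A\<^esub> x \<in> filt A j"
    using subset one_closed m_closed[of x y] smult_closed[of p x] by auto
  show "x \<in> filt A j \<Longrightarrow> \<ominus>\<^bsub>A\<^esub> x \<in> filt A j" using m_inv_closed[of x] by (simp add: a_inv_def)
qed

context xfree
begin

lemma hom_dec_filt_iff:
  assumes x: "x \<in> carrier A" and z: "\<zero>\<^bsub>A\<^esub> \<in> F"
  shows "(\<exists>u. hom_dec A x u \<and> range u \<subseteq> F) \<longleftrightarrow> (\<forall>q. hproj q x \<in> F)"
proof
  assume "\<exists>u. hom_dec A x u \<and> range u \<subseteq> F"
  then obtain u where u: "hom_dec A x u" "range u \<subseteq> F" by blast
  then have u': "u = hdec x" using hom_dec_unique[OF x] by blast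
  have "hproj q x = hdec x (a, q)" for q by (simp add: hdec_def)
  then show "\<forall>q. hproj q x \<in> F" using u(2) u' by auto
next
  assume "\<forall>q. hproj q x \<in> F"
  then have "range (hdec x) \<subseteq> F" using z by (auto simp: hdec_def split: prod.split)
  then show "\<exists>u. hom_dec A x u \<and> range u \<subseteq> F" using hom_dec_hdec[OF x] by blast
qed

text \<open>\<open>x\<close> is the finite sum of its homogeneous components, and each partial sum
  stays in \<open>F\<close>.\<close>

lemma homog_induct_in:
  assumes x: "x \<in> carrier A" "\<And>q. hproj q x \<in> F"
    and F: "F \<subseteq> carrier A" "\<zero>\<^bsub>A\<^esub> \<in> F" "\<And>y z. y \<in> F \<Longrightarrow> z \<in> F \<Longrightarrow> y \<oplus>\<^bsub>A\<^esub> z \<in> F"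
    and hom: "\<And>d y. y \<in> cmp A a d \<Longrightarrow> y \<in> F \<Longrightarrow> P y"
    and add: "\<And>y z. y \<in> F \<Longrightarrow> z \<in> F \<Longrightarrow> P y \<Longrightarrow> P z \<Longrightarrow> P (y \<oplus>\<^bsub>A\<^esub> z)"
  shows "P x"
proof -
  have P0: "P \<zero>\<^bsub>A\<^esub>" using F(2) cmp_zero by (rule hom[rotated])
  have P: "P (hdec x i)" and inF: "hdec x i \<in> F" for i
    using hom[OF hproj_cmp[OF x(1)] x(2)] x(2) P0 F(2) by (auto simp: hdec_def split: prod.split)
  have "P (\<Oplus>\<^bsub>A\<^esub>i\<in>I. hdec x i) \<and> (\<Oplus>\<^bsub>A\<^esub>i\<in>I. hdec x i) \<in> F" if "finite I" for I
    using that
  proof (induction I)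
    case (insert i I)
    have "(\<Oplus>\<^bsub>A\<^esub>i\<in>insert i I. hdec x i) = hdec x i \<oplus>\<^bsub>A\<^esub> (\<Oplus>\<^bsub>A\<^esub>i\<in>I. hdec x i)"
      using subsetD[OF F(1) inF] insert by (subst finsum_insert) auto
    then show ?case using add[OF inF _ P] F(3)[OF inF] insert by simp
  qed (auto simp: P0 F(2))
  moreover have "finite {i. hdec x i \<noteq> \<zero>\<^bsub>A\<^esub>}" and e: "x = (\<Oplus>\<^bsub>A\<^esub>i\<in>{i. hdec x i \<noteq> \<zero>\<^bsub>A\<^esub>}. hdec x i)"
    using hom_dec_hdec[OF x(1)] by (auto simp only: hom_dec_def)
  ultimately show ?thesis by (subst e) blast
qed

lemma hproj_smult:
  assumes p: "p \<in> PR (XY n)" "p \<in> qhom d" and x: "x \<in> carrier A"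
  shows "hproj q (p \<odot>\<^bsub>A\<^esub> x) = p \<odot>\<^bsub>A\<^esub> hproj (q - d) x"
proof (rule homog_induct_in[where x=x and F="carrier A"])
  fix y e assume y: "y \<in> cmp A a e"
  show "hproj q (p \<odot>\<^bsub>A\<^esub> y) = p \<odot>\<^bsub>A\<^esub> hproj (q - d) y"
    using p by (auto simp: hproj_of_cmp[OF y] hproj_of_cmp[OF smult_hom[OF p y]] smult_r_null)
next
  fix y z assume "y \<in> carrier A" "z \<in> carrier A" "hproj q (p \<odot>\<^bsub>A\<^esub> y) = p \<odot>\<^bsub>A\<^esub> hproj (q - d) y" "hproj q (p \<odot>\<^bsub>A\<^esub> z) = p \<odot>\<^bsub>A\<^esub> hproj (q - d) z"
  then show "hproj q (p \<odot>\<^bsub>A\<^esub> (y \<oplus>\<^bsub>A\<^esub> z)) = p \<odot>\<^bsub>A\<^esub> hproj (q - d) (y \<oplus>\<^bsub>A\<^esub> z)"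
    using p by (simp add: hproj_add smult_r_distr smult_closed hproj_closed)
qed (use x hproj_closed in auto)

end

locale xfilt = xfree n A K \<Phi> a qd
  for n and A :: "'m fcx" and K :: "'k set" and \<Phi> :: "'m \<Rightarrow> 'k \<Rightarrow> mpol" and a qd
begin

lemma ffiltI:
  assumes "\<And>j. submodule (filt A j) (pol (XY n)) A" "\<And>i j. i \<le> j \<Longrightarrow> filt A j \<subseteq> filt A i"
    and "filt A lo = carrier A" "filt A hi = {\<zero>\<^bsub>A\<^esub>}" and h: "\<And>j x q. x \<in> filt A j \<Longrightarrow> hproj q x \<in> filt A j"
  shows "ffilt n A lo hi"
  unfolding ffilt_def
proof (intro conjI allI ballI impI)
  fix j x assume x: "x \<in> filt A j"
  interpret S: submodule "filt A j" "pol (XY n)" A by (rule assms)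
  show "\<exists>u. hom_dec A x u \<and> range u \<subseteq> filt A j"
    using x S.subset S.one_closed h by (subst hom_dec_filt_iff) auto
qed (use assms in auto)

lemma graded_induct:
  assumes f: "ffilt n A lo hi" and x: "x \<in> filt A j"
    and hom: "\<And>d y. y \<in> cmp A a d \<Longrightarrow> y \<in> filt A j \<Longrightarrow> P y"
    and add: "\<And>y z. y \<in> filt A j \<Longrightarrow> z \<in> filt A j \<Longrightarrow> P y \<Longrightarrow> P z \<Longrightarrow> P (y \<oplus>\<^bsub>A\<^esub> z)"
  shows "P x"
proof (rule homog_induct_in[where F="filt A j"])
  note S = ffilt_sub[OF f]
  show xc: "x \<in> carrier A" using x S(1) by blast
  show "hproj q x \<in> filt A j" for q
    using ffiltD(5)[OF f x] hom_dec_filt_iff[OF xc S(2)] by blast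
qed (use ffilt_sub[OF f] hom add in auto)

lemma ffilt_zero:
  assumes "carrier A = {\<zero>\<^bsub>A\<^esub>}" "\<And>j. filt A j = {\<zero>\<^bsub>A\<^esub>}"
  shows "ffilt n A lo hi" "(\<And>i. i \<in> {1..n} \<Longrightarrow> s i \<in> {1..n}) \<Longrightarrow> twist n A s j" "neard n A j"
proof -
  have s: "submodule {\<zero>\<^bsub>A\<^esub>} (pol (XY n)) A" by (rule submoduleI) auto
  show "ffilt n A lo hi"
  proof (rule ffiltI)
    show "hproj q x \<in> filt A j" if "x \<in> filt A j" for j x q
      using hproj_closed[of x q] assms that by auto
  qed (auto simp: assms s)
  have z: "v \<odot>\<^bsub>A\<^esub> \<zero>\<^bsub>A\<^esub> = \<zero>\<^bsub>A\<^esub>" if "v \<in> PR (XY n)" for v using smult_closed[OF that, of "\<zero>\<^bsub>A\<^esub>"] assms by auto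
  show "twist n A s j" if "\<And>i. i \<in> {1..n} \<Longrightarrow> s i \<in> {1..n}" using assms that z by (simp add: twist_def)
  have "yv i - xv i \<in> PR (XY n)" if "i \<in> {1..n}" for i using that by auto
  then show "neard n A j" using assms z by (simp add: neard_def)
qed

end

section \<open>Filtrations of tensor products and direct sums\<close>

lemma ffilt_zero_filt: "ffilt n A lo hi \<Longrightarrow> carrier A = {\<zero>\<^bsub>A\<^esub>} \<Longrightarrow> filt A j = {\<zero>\<^bsub>A\<^esub>}"
  using ffilt_sub(1,2)[of n A lo hi j] by auto

lemma ffilt_mono: "ffilt n A lo hi \<Longrightarrow> hi \<le> hi' \<Longrightarrow> ffilt n A lo hi'"
  using ffilt_sub(2)[of n A lo hi hi'] ffiltD(2,4)[of n A lo hi] unfolding ffilt_def by blast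

text \<open>If two indices add up to \<open>hiM + hiN - 1\<close>, one of them reaches its bound and
  the factor there is zero; hence the correction by 1. That the steps are graded is checked on pure
  tensors with homogeneous factors, to which graded induction in each factor leads.\<close>

lemma (in bitensor_act) ffilt_tens:
  assumes xM: "xfree nM M KM \<Phi>M aM qdM" and xN: "xfree nN N KN \<Phi>N aN qdN"
    and xT: "xfree n T J \<Phi> (aM + aN) qd"
    and VM: "VM = XY nM" and VN: "VN = XY nN" and V: "V = XY n"
    and fM: "ffilt nM M loM hiM" and fN: "ffilt nN N loN hiN"
  shows "ffilt n T (loM + loN) (hiM + hiN - 1)"
    and "m \<in> filt M i \<Longrightarrow> x \<in> filt N j \<Longrightarrow> pt m x \<in> filt T (i + j)"
proof -
  interpret xM: xfilt nM M KM \<Phi>M aM qdM by (rule xfilt.intro[OF xM])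
  interpret xN: xfilt nN N KN \<Phi>N aN qdN by (rule xfilt.intro[OF xN])
  interpret xT: xfilt n T J \<Phi> "aM + aN" qd by (rule xfilt.intro[OF xT])
  note sM = ffilt_sub[OF fM] and sN = ffilt_sub[OF fN]
  let ?S = "\<lambda>j. \<Union>i. filt M i \<times> filt N (j - i)"
  have filt: "filt T j = tens_span Mid M N (?S j)" for j by (simp add: tens_def)
  have S: "?S j \<subseteq> carrier M \<times> carrier N" for j using sM(1) sN(1) by blast
  have nS: "\<forall>m x. (m, x) \<in> ?S j \<longrightarrow> (\<ominus>\<^bsub>M\<^esub> m, x) \<in> ?S j" for j using sM(4) by blast
  have zS: "(\<zero>\<^bsub>M\<^esub>, \<zero>\<^bsub>N\<^esub>) \<in> ?S j" for j using sM(2) sN(2) by blast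
  note ind = tens_span_induct[where l=l and r=r, OF _ S nS zS, consumes 1, case_names pt add]
  have addT: "s \<in> filt T j \<Longrightarrow> t \<in> filt T j \<Longrightarrow> s \<oplus>\<^bsub>T\<^esub> t \<in> filt T j" for s t j
    unfolding filt by (rule tens_span_add)
  show ptT: "pt m x \<in> filt T (i + j)" if "m \<in> filt M i" "x \<in> filt N j" for m x i j
    unfolding filt using that by (intro tens_span_pt) (auto intro!: exI[of _ i])
  have zT: "\<zero>\<^bsub>T\<^esub> \<in> filt T j" for j unfolding filt by (rule tens_span_zero)
  have sub: "filt T j \<subseteq> carrier T" for j unfolding filt by (rule tens_span_closed[OF S])
  have pt0: "pt m x = \<zero>\<^bsub>T\<^esub>" if "m \<in> filt M i" "x \<in> filt N (hiM + hiN - 1 - i)" for m x i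
  proof (cases "i \<ge> hiM")
    case True
    then have "m = \<zero>\<^bsub>M\<^esub>" using that(1) ffiltD(2)[OF fM True] ffiltD(4)[OF fM] by auto
    moreover have "x \<in> carrier N" using that(2) sN(1) by blast
    ultimately show ?thesis using pt_zero1[where l=l and r=r] by simp
  next
    case False
    then have "hiN \<le> hiM + hiN - 1 - i" by simp
    then have "x = \<zero>\<^bsub>N\<^esub>" using that(2) ffiltD(2)[OF fN, of hiN] ffiltD(4)[OF fN] by blast
    moreover have "m \<in> carrier M" using that(1) sM(1) by blast
    ultimately show ?thesis using pt_zero2[where l=l and r=r] by simp
  qed
  have Vl: "p \<odot>\<^bsub>T\<^esub> pt m x \<in> filt T j" if p: "p \<in> PR V" and mx: "(m, x) \<in> ?S j" for p m x j
    using p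
  proof (induction p rule: PR_induct_single)
    case zero
    have "pt m x \<in> carrier T" using mx S pt_closed by blast
    then show ?case using TM.smult_l_null[of "pt m x"] zT by simp
  next
    case (add p q)
    have "pt m x \<in> carrier T" using mx S pt_closed by blast
    then show ?case using add by (simp add: smult_l_distr addT)
  next
    case (single e c)
    from mx obtain i where i: "m \<in> filt M i" "x \<in> filt N (j - i)" by auto
    have "(Cst c * monom_subst l e) \<odot>\<^bsub>M\<^esub> m \<in> filt M i" using sM(5) mon_cl[OF single] i VM by auto
    moreover have "monom_subst r e \<odot>\<^bsub>N\<^esub> x \<in> filt N (j - i)" using sN(5) mon_r[OF single] i VN by auto
    ultimately have "pt ((Cst c * monom_subst l e) \<odot>\<^bsub>M\<^esub> m) (monom_subst r e \<odot>\<^bsub>N\<^esub> x) \<in> filt T (i + (j - i))" by (rule ptT)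
    moreover have "m \<in> carrier M" "x \<in> carrier N" using i sM(1) sN(1) by blast+
    ultimately show ?case using smult_single[OF single] by simp
  qed
  show "ffilt n T (loM + loN) (hiM + hiN - 1)"
  proof (rule xT.ffiltI)
    fix j
    show "submodule (filt T j) (pol (XY n)) T"
    proof (rule xT.submoduleI)
      show "\<ominus>\<^bsub>T\<^esub> t \<in> filt T j" if "t \<in> filt T j" for t
        using that unfolding filt by (rule tens_span_neg[OF _ S])
      fix p t assume p: "p \<in> carrier (pol (XY n))" and "t \<in> filt T j"
      from \<open>t \<in> filt T j\<close>[unfolded filt] show "p \<odot>\<^bsub>T\<^esub> t \<in> filt T j"
      proof (induction rule: ind)
        case (pt m x) then show ?case using Vl p V by blast
      next
        case (add s t)
        then have "s \<in> carrier T" "t \<in> carrier T" using sub[of j] by (auto simp: filt)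
        then have "p \<odot>\<^bsub>T\<^esub> (s \<oplus>\<^bsub>T\<^esub> t) = p \<odot>\<^bsub>T\<^esub> s \<oplus>\<^bsub>T\<^esub> p \<odot>\<^bsub>T\<^esub> t" using p V by (intro smult_add_t) auto
        then show ?case using add(3,4) by (simp add: addT)
      qed
    qed (use sub zT addT in auto)
  next
    fix i j :: int assume ij: "i \<le> j"
    have "?S j \<subseteq> ?S i"
    proof clarify
      fix m x k assume "m \<in> filt M k" "x \<in> filt N (j - k)"
      moreover have "filt N (j - k) \<subseteq> filt N (i - k)" using ij by (intro ffiltD(2)[OF fN]) simp
      ultimately show "(m, x) \<in> ?S i" by blast
    qed
    then show "filt T j \<subseteq> filt T i" unfolding filt by (rule tens_span_mono)
  next
    have "t \<in> filt T (loM + loN)" if "t \<in> carrier T" for t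
      using that
    proof (induction t rule: tens_induct)
      case (pt m x)
      then show ?case using ptT ffiltD(3)[OF fM] ffiltD(3)[OF fN] by auto
    next
      case (add s t) then show ?case using addT by blast
    qed
    then show "filt T (loM + loN) = carrier T" using sub by auto
    have "t = \<zero>\<^bsub>T\<^esub>" if "t \<in> filt T (hiM + hiN - 1)" for t
      using that[unfolded filt]
    proof (induction rule: ind)
      case (pt m x) then show ?case using pt0 by blast
    qed auto
    then show "filt T (hiM + hiN - 1) = {\<zero>\<^bsub>T\<^esub>}" using zT by auto
  next
    fix j t q assume "t \<in> filt T j"
    from this[unfolded filt] show "xT.hproj q t \<in> filt T j"
    proof (induction rule: ind)
      case (add s t)
      then have "s \<in> carrier T" "t \<in> carrier T" using sub[of j] by (auto simp: filt)
      then show ?case using add(3,4) by (simp add: xT.hproj_add addT)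
    next
      case (pt m x)
      then obtain i where m: "m \<in> filt M i" and x: "x \<in> filt N (j - i)" by auto
      have cM: "z \<in> carrier M" if "z \<in> filt M k" for z k using that sM(1) by blast
      have cN: "z \<in> carrier N" if "z \<in> filt N k" for z k using that sN(1) by blast
      from fM m show ?case
      proof (rule xM.graded_induct)
        fix d y assume y: "y \<in> cmp M aM d" "y \<in> filt M i"
        from fN x show "xT.hproj q (pt y x) \<in> filt T j"
        proof (rule xN.graded_induct)
          fix d' z assume z: "z \<in> cmp N aN d'" "z \<in> filt N (j - i)"
          have "cmp T (aM + aN) (d + d') = tens_span Mid M N (\<Union>i d''. cmp M i d'' \<times> cmp N (aM + aN - i) (d + d' - d''))" by (simp add: tens_def)
          moreover have "(y, z) \<in> (\<Union>i d''. cmp M i d'' \<times> cmp N (aM + aN - i) (d + d' - d''))" 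
            by (rule UN_I[where a=aM, OF UNIV_I], rule UN_I[where a=d, OF UNIV_I]) (use y(1) z(1) in simp)
          ultimately have "pt y z \<in> cmp T (aM + aN) (d + d')" by (simp only: tens_span_pt)
          moreover have "pt y z \<in> filt T (i + (j - i))" using y z by (intro ptT)
          ultimately show "xT.hproj q (pt y z) \<in> filt T j" using zT by (simp add: xT.hproj_of_cmp)
        next
          fix z z' assume "z \<in> filt N (j - i)" "z' \<in> filt N (j - i)" and h: "xT.hproj q (pt y z) \<in> filt T j" "xT.hproj q (pt y z') \<in> filt T j"
          then have z: "z \<in> carrier N" "z' \<in> carrier N" using cN by auto
          have "pt y (z \<oplus>\<^bsub>N\<^esub> z') = pt y z \<oplus>\<^bsub>T\<^esub> pt y z'" by (rule pt_add2[OF cM[OF y(2)] z])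
          then show "xT.hproj q (pt y (z \<oplus>\<^bsub>N\<^esub> z')) \<in> filt T j"
            using h z cM[OF y(2)] by (simp add: xT.hproj_add pt_closed addT)
        qed
      next
        fix y y' assume "y \<in> filt M i" "y' \<in> filt M i" and h: "xT.hproj q (pt y x) \<in> filt T j" "xT.hproj q (pt y' x) \<in> filt T j"
        then have z: "y \<in> carrier M" "y' \<in> carrier M" using cM by auto
        have "pt (y \<oplus>\<^bsub>M\<^esub> y') x = pt y x \<oplus>\<^bsub>T\<^esub> pt y' x" by (rule pt_add1[OF z cN[OF x]])
        then show "xT.hproj q (pt (y \<oplus>\<^bsub>M\<^esub> y') x) \<in> filt T j"
          using h z cN[OF x] by (simp add: xT.hproj_add pt_closed addT)
      qed
    qed
  qed
qed

text \<open>In a nonzero pure tensor the steps of the factors stay below \<open>hiM\<close> and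
  \<open>hiN\<close>. The bounds on \<open>j\<close> therefore force the other factor up to
  \<open>jN\<close> or \<open>jM\<close>, and such tensors span the step \<open>j\<close>.\<close>

lemma (in bitensor_act) filt_tens_induct [consumes 5, case_names pt add]:
  assumes f: "ffilt nM M loM hiM" "ffilt nN N loN hiN" and t: "t \<in> filt T j"
    and j: "jM + hiN - 1 \<le> j" "hiM - 1 + jN \<le> j"
    and pt: "\<And>m x. m \<in> filt M jM \<Longrightarrow> x \<in> filt N jN \<Longrightarrow> P (pt m x)"
    and add: "\<And>s t. s \<in> carrier T \<Longrightarrow> t \<in> carrier T \<Longrightarrow> P s \<Longrightarrow> P t \<Longrightarrow> P (s \<oplus>\<^bsub>T\<^esub> t)"
  shows "P t"
proof -
  note sM = ffilt_sub[OF f(1)] and sN = ffilt_sub[OF f(2)]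
  let ?S = "\<Union>i. filt M i \<times> filt N (j - i)"
  have S: "?S \<subseteq> carrier M \<times> carrier N" using sM(1) sN(1) by blast
  have P0: "P \<zero>\<^bsub>T\<^esub>" using pt[OF sM(2) sN(2)] pt_zero1[where l=l and r=r, of "\<zero>\<^bsub>N\<^esub>"] by simp
  have t': "t \<in> tens_span Mid M N ?S" using t by (simp add: tens_def)
  have nS: "\<forall>m x. (m, x) \<in> ?S \<longrightarrow> (\<ominus>\<^bsub>M\<^esub> m, x) \<in> ?S" using sM(4) by blast
  have zS: "(\<zero>\<^bsub>M\<^esub>, \<zero>\<^bsub>N\<^esub>) \<in> ?S" using sM(2) sN(2) by blast
  from t' S nS zS show ?thesis
  proof (induction t rule: tens_span_induct[where l=l and r=r])
    show "P (s \<oplus>\<^bsub>T\<^esub> t)" if "s \<in> tens_span Mid M N ?S" "t \<in> tens_span Mid M N ?S" "P s" "P t" for s t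
      using that tens_span_closed[OF S, where l=l and r=r] by (intro add) auto
    fix m x assume "(m, x) \<in> ?S"
    then obtain i where mx: "m \<in> filt M i" "x \<in> filt N (j - i)" by auto
    then have c: "m \<in> carrier M" "x \<in> carrier N" using sM(1) sN(1) by blast+
    consider "jM \<le> i" "jN \<le> j - i" | "hiN \<le> j - i" | "hiM \<le> i" using j by linarith
    then show "P (pt m x)"
    proof cases
      case 1
      then show ?thesis using pt mx ffiltD(2)[OF f(1), of jM i] ffiltD(2)[OF f(2), of jN "j - i"] by blast
    next
      case 2
      then have "x = \<zero>\<^bsub>N\<^esub>" using mx(2) ffiltD(2)[OF f(2), of hiN] ffiltD(4)[OF f(2)] by blast
      then show ?thesis using P0 pt_zero2[where l=l and r=r] c by simp
    next
      case 3
      then have "m = \<zero>\<^bsub>M\<^esub>" using mx(1) ffiltD(2)[OF f(1), of hiM] ffiltD(4)[OF f(1)] by blast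
      then show ?thesis using P0 pt_zero1[where l=l and r=r] c by simp
    qed
  qed
qed

context xcomp
begin

lemma comp_ffilt:
  assumes "ffilt n M loM hiM" "ffilt n N loN hiN"
  shows "ffilt n (bim_comp n M N) (loM + loN) (hiM + hiN - 1)"
    and "m \<in> filt M i \<Longrightarrow> x \<in> filt N j \<Longrightarrow> bt.pt m x \<in> filt (bim_comp n M N) (i + j)"
  using bt.ffilt_tens[OF xM.xfree_axioms xN.xfree_axioms xfree_comp[unfolded bim_comp_eq] refl refl refl assms]
  unfolding bim_comp_eq by blast+

lemma act_pt:
  assumes i: "i \<in> {1..n}" and mx: "m \<in> carrier M" "x \<in> carrier N"
  shows "yv i \<odot>\<^bsub>bt.T\<^esub> bt.pt m x = bt.pt (yv i \<odot>\<^bsub>M\<^esub> m) x" "xv i \<odot>\<^bsub>bt.T\<^esub> bt.pt m x = bt.pt m (xv i \<odot>\<^bsub>N\<^esub> x)"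
    "bt.pt (xv i \<odot>\<^bsub>M\<^esub> m) x = bt.pt m (yv i \<odot>\<^bsub>N\<^esub> x)"
proof -
  show "yv i \<odot>\<^bsub>bt.T\<^esub> bt.pt m x = bt.pt (yv i \<odot>\<^bsub>M\<^esub> m) x" "xv i \<odot>\<^bsub>bt.T\<^esub> bt.pt m x = bt.pt m (xv i \<odot>\<^bsub>N\<^esub> x)"
    using bt.smult_pt_Var[of "vY i" m x] bt.smult_pt_Var[of "vX i" m x] i mx xM.smult_one xN.smult_one
    by (auto simp: comp_l_def comp_r_def)
  have "(xv i, xtoy n (xv i)) \<in> comp_mid n" using i by (auto simp: comp_mid_eq)
  then show "bt.pt (xv i \<odot>\<^bsub>M\<^esub> m) x = bt.pt m (yv i \<odot>\<^bsub>N\<^esub> x)"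
    using bt.pt_balanced[of "xv i" "yv i" m x] i mx by (simp add: xtoy_xv)
qed

text \<open>On the first factor y_i acts as its right variable x_(sM i). In the tensor product this
  is the left variable with number \<open>sM i\<close> of the second factor, which acts as x_(sN (sM
  i)).\<close>

lemma comp_twist:
  assumes f: "ffilt n M loM hiM" "ffilt n N loN hiN" and tw: "twist n M sM jM" "twist n N sN jN"
    and s: "\<And>i. i \<in> {1..n} \<Longrightarrow> sM i \<in> {1..n}" "\<And>i. i \<in> {1..n} \<Longrightarrow> sN i \<in> {1..n}"
    and j: "jM + hiN - 1 \<le> j" "hiM - 1 + jN \<le> j"
  shows "twist n (bim_comp n M N) (\<lambda>i. sN (sM i)) j"
  unfolding twist_def bim_comp_eq
proof (intro ballI)
  fix i t assume i: "i \<in> {1..n}" and t: "t \<in> filt bt.T j"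
  have v: "yv i \<in> PR (XY n)" "xv (sN (sM i)) \<in> PR (XY n)" using i s(2)[OF s(1)[OF i]] by auto
  from f t j show "yv i \<odot>\<^bsub>bt.T\<^esub> t = xv (sN (sM i)) \<odot>\<^bsub>bt.T\<^esub> t"
  proof (induction t rule: bt.filt_tens_induct)
    case (pt m x)
    then have c: "m \<in> carrier M" "x \<in> carrier N" using ffilt_sub(1)[OF f(1)] ffilt_sub(1)[OF f(2)] by blast+
    have "yv i \<odot>\<^bsub>M\<^esub> m = xv (sM i) \<odot>\<^bsub>M\<^esub> m" "yv (sM i) \<odot>\<^bsub>N\<^esub> x = xv (sN (sM i)) \<odot>\<^bsub>N\<^esub> x"
      using tw pt i s(1)[OF i] by (auto simp: twist_def)
    then show ?case using act_pt[OF i c] act_pt[OF s(1)[OF i] c] act_pt[OF s(2)[OF s(1)[OF i]] c] by simp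
  next
    case (add s t)
    then show ?case using v by (simp add: bt.smult_add_t)
  qed
qed

end

lemma (in abelian_group) eq_add_cancel: "x \<in> carrier G \<Longrightarrow> d \<in> carrier G \<Longrightarrow> s \<in> carrier G \<Longrightarrow> d \<oplus> x = s \<oplus> x \<Longrightarrow> d = s"
  using a_comm add.right_cancel by simp

text \<open>A Leibniz rule: y_i - x_i acts as y_i - x_i on the first factor plus the same on the
  second, because the middle variables cancel. In each summand one factor lies in its step
  \<open>hM\<close> or \<open>hN\<close> and the other in the lowest step.\<close>

lemma (in xcomp) comp_neard:
  assumes f: "ffilt n M loM hiM" "ffilt n N loN hiN" and nd: "neard n M hM" "neard n N hN"
    and h: "h \<le> hM + loN" "h \<le> loM + hN"
  shows "neard n (bim_comp n M N) h"
  unfolding neard_def bim_comp_eq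
proof (intro ballI)
  fix i t assume i: "i \<in> {1..n}" and t: "t \<in> carrier bt.T"
  note F = comp_ffilt(1)[OF f, unfolded bim_comp_eq]
  have v: "yv i \<in> PR (XY n)" "xv i \<in> PR (XY n)" "yv i - xv i \<in> PR (XY n)" using i by auto
  from t show "(yv i - xv i) \<odot>\<^bsub>bt.T\<^esub> t \<in> filt bt.T h"
  proof (induction t rule: bt.tens_induct)
    case (pt m x)
    note ac = act_pt[OF i pt]
    let ?d = "(yv i - xv i) \<odot>\<^bsub>M\<^esub> m" and ?e = "(yv i - xv i) \<odot>\<^bsub>N\<^esub> x"
    have c: "xv i \<odot>\<^bsub>M\<^esub> m \<in> carrier M" "?d \<in> carrier M" "xv i \<odot>\<^bsub>N\<^esub> x \<in> carrier N" "?e \<in> carrier N"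
      using v pt xM.smult_closed xN.smult_closed by auto
    have ym: "yv i \<odot>\<^bsub>M\<^esub> m = ?d \<oplus>\<^bsub>M\<^esub> xv i \<odot>\<^bsub>M\<^esub> m" using xM.smult_l_distr[of "yv i - xv i" "xv i" m] v pt by simp
    have yx: "yv i \<odot>\<^bsub>N\<^esub> x = ?e \<oplus>\<^bsub>N\<^esub> xv i \<odot>\<^bsub>N\<^esub> x" using xN.smult_l_distr[of "yv i - xv i" "xv i" x] v pt by simp
    have p: "bt.pt ?d x \<in> carrier bt.T" "bt.pt m ?e \<in> carrier bt.T" "bt.pt m (xv i \<odot>\<^bsub>N\<^esub> x) \<in> carrier bt.T"
      "bt.pt m x \<in> carrier bt.T" using c pt bt.pt_closed by auto
    have "(yv i - xv i) \<odot>\<^bsub>bt.T\<^esub> bt.pt m x = bt.pt ?d x \<oplus>\<^bsub>bt.T\<^esub> bt.pt m ?e"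
    proof (rule bt.T.eq_add_cancel[of "xv i \<odot>\<^bsub>bt.T\<^esub> bt.pt m x"])
      have "(yv i - xv i) \<odot>\<^bsub>bt.T\<^esub> bt.pt m x \<oplus>\<^bsub>bt.T\<^esub> xv i \<odot>\<^bsub>bt.T\<^esub> bt.pt m x = yv i \<odot>\<^bsub>bt.T\<^esub> bt.pt m x"
        using bt.smult_l_distr[of "yv i - xv i" "xv i" "bt.pt m x"] v p by simp
      also have "\<dots> = bt.pt (?d \<oplus>\<^bsub>M\<^esub> xv i \<odot>\<^bsub>M\<^esub> m) x" unfolding ac ym ..
      also have "\<dots> = bt.pt ?d x \<oplus>\<^bsub>bt.T\<^esub> bt.pt m (?e \<oplus>\<^bsub>N\<^esub> xv i \<odot>\<^bsub>N\<^esub> x)"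
        by (subst bt.pt_add1[OF c(2,1) pt(2), where l=comp_l and r=comp_r]) (simp add: ac yx)
      also have "bt.pt m (?e \<oplus>\<^bsub>N\<^esub> xv i \<odot>\<^bsub>N\<^esub> x) = bt.pt m ?e \<oplus>\<^bsub>bt.T\<^esub> bt.pt m (xv i \<odot>\<^bsub>N\<^esub> x)"
        by (rule bt.pt_add2[OF pt(1) c(4,3)])
      finally show "(yv i - xv i) \<odot>\<^bsub>bt.T\<^esub> bt.pt m x \<oplus>\<^bsub>bt.T\<^esub> xv i \<odot>\<^bsub>bt.T\<^esub> bt.pt m x =
          bt.pt ?d x \<oplus>\<^bsub>bt.T\<^esub> bt.pt m ?e \<oplus>\<^bsub>bt.T\<^esub> xv i \<odot>\<^bsub>bt.T\<^esub> bt.pt m x"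
        using p by (simp add: ac bt.T.a_assoc)
    qed (use p v bt.smult_closed in \<open>auto simp: bt.T.a_closed\<close>)
    moreover have "bt.pt ?d x \<in> filt bt.T h"
      using comp_ffilt(2)[OF f, unfolded bim_comp_eq, of ?d hM x loN] nd(1) i pt ffiltD(3)[OF f(2)] ffiltD(2)[OF F h(1)]
      by (auto simp: neard_def)
    moreover have "bt.pt m ?e \<in> filt bt.T h"
      using comp_ffilt(2)[OF f, unfolded bim_comp_eq, of m loM ?e hN] nd(2) i pt ffiltD(3)[OF f(1)] ffiltD(2)[OF F h(2)]
      by (auto simp: neard_def)
    ultimately show ?case using ffilt_sub(3)[OF F] by simp
  next
    case (add s t)
    then show ?case using v ffilt_sub(3)[OF F] by (simp add: bt.smult_add_t)
  qed
qed

context xunion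
begin

lemma union_ffilt:
  assumes "ffilt nM M loM hiM" "ffilt nN N loN hiN"
  shows "ffilt (nM + nN) (bim_union nM M N) (loM + loN) (hiM + hiN - 1)"
    and "m \<in> filt M i \<Longrightarrow> x \<in> filt N j \<Longrightarrow> bt.pt m x \<in> filt (bim_union nM M N) (i + j)"
  using bt.ffilt_tens[OF xM.xfree_axioms xN.xfree_axioms xfree_union[unfolded bim_union_eq] refl refl refl assms]
  unfolding bim_union_eq by blast+

lemma act_pt:
  assumes mx: "m \<in> carrier M" "x \<in> carrier N"
  shows "i \<in> {1..nM} \<Longrightarrow> yv i \<odot>\<^bsub>bt.T\<^esub> bt.pt m x = bt.pt (yv i \<odot>\<^bsub>M\<^esub> m) x"
    "i \<in> {1..nM} \<Longrightarrow> xv i \<odot>\<^bsub>bt.T\<^esub> bt.pt m x = bt.pt (xv i \<odot>\<^bsub>M\<^esub> m) x"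
    "i \<in> {1..nN} \<Longrightarrow> yv (nM + i) \<odot>\<^bsub>bt.T\<^esub> bt.pt m x = bt.pt m (yv i \<odot>\<^bsub>N\<^esub> x)"
    "i \<in> {1..nN} \<Longrightarrow> xv (nM + i) \<odot>\<^bsub>bt.T\<^esub> bt.pt m x = bt.pt m (xv i \<odot>\<^bsub>N\<^esub> x)"
  using bt.smult_pt_Var[of "vY i" m x] bt.smult_pt_Var[of "vX i" m x] bt.smult_pt_Var[of "vY (nM + i)" m x]
    bt.smult_pt_Var[of "vX (nM + i)" m x] mx xM.smult_one xN.smult_one
  by (auto simp: union_l_def union_r_def)

lemma union_twist:
  assumes f: "ffilt nM M loM hiM" "ffilt nN N loN hiN" and tw: "twist nM M sM jM" "twist nN N sN jN"
    and s: "\<And>i. i \<in> {1..nM} \<Longrightarrow> sM i \<in> {1..nM} \<and> s i = sM i" "\<And>i. i \<in> {1..nN} \<Longrightarrow> sN i \<in> {1..nN} \<and> s (nM + i) = nM + sN i"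
    and j: "jM + hiN - 1 \<le> j" "hiM - 1 + jN \<le> j"
  shows "twist (nM + nN) (bim_union nM M N) s j"
  unfolding twist_def bim_union_eq
proof (intro ballI)
  fix i t assume i: "i \<in> {1..nM + nN}" and t: "t \<in> filt bt.T j"
  have i': "i \<in> {1..nM} \<or> (\<exists>k\<in>{1..nN}. i = nM + k)"
  proof (cases "i \<le> nM")
    case False
    then have "i - nM \<in> {1..nN}" "i = nM + (i - nM)" using i by auto
    then show ?thesis by blast
  qed (use i in auto)
  then have "s i \<in> {1..nM + nN}" using s by fastforce
  then have v: "yv i \<in> PR (XY (nM + nN))" "xv (s i) \<in> PR (XY (nM + nN))" using i by auto
  from f t j show "yv i \<odot>\<^bsub>bt.T\<^esub> t = xv (s i) \<odot>\<^bsub>bt.T\<^esub> t"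
  proof (induction t rule: bt.filt_tens_induct)
    case (pt m x)
    then have c: "m \<in> carrier M" "x \<in> carrier N" using ffilt_sub(1)[OF f(1)] ffilt_sub(1)[OF f(2)] by blast+
    from i' show ?case
    proof (elim disjE bexE)
      assume "i \<in> {1..nM}"
      then show ?thesis using s(1)[of i] act_pt(1,2)[OF c] tw(1) pt(1) by (simp add: twist_def)
    next
      fix k assume "k \<in> {1..nN}" "i = nM + k"
      then show ?thesis using s(2)[of k] act_pt(3,4)[OF c] tw(2) pt(2) by (simp add: twist_def)
    qed
  next
    case (add s' t)
    then show ?case using v by (simp add: bt.smult_add_t)
  qed
qed

lemma union_neard:
  assumes f: "ffilt nM M loM hiM" "ffilt nN N loN hiN" and nd: "neard nM M hM" "neard nN N hN"
    and h: "h \<le> hM + loN" "h \<le> loM + hN"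
  shows "neard (nM + nN) (bim_union nM M N) h"
  unfolding neard_def bim_union_eq
proof (intro ballI)
  fix i t assume i: "i \<in> {1..nM + nN}" and t: "t \<in> carrier bt.T"
  note F = union_ffilt(1)[OF f, unfolded bim_union_eq]
  have v: "yv i \<in> PR (XY (nM + nN))" "xv i \<in> PR (XY (nM + nN))" "yv i - xv i \<in> PR (XY (nM + nN))" using i by auto
  from t show "(yv i - xv i) \<odot>\<^bsub>bt.T\<^esub> t \<in> filt bt.T h"
  proof (induction t rule: bt.tens_induct)
    case (pt m x)
    have p: "bt.pt m x \<in> carrier bt.T" using pt by (rule bt.pt_closed)
    have d: "(yv i - xv i) \<odot>\<^bsub>bt.T\<^esub> bt.pt m x \<oplus>\<^bsub>bt.T\<^esub> xv i \<odot>\<^bsub>bt.T\<^esub> bt.pt m x = yv i \<odot>\<^bsub>bt.T\<^esub> bt.pt m x"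
      using bt.smult_l_distr[of "yv i - xv i" "xv i" "bt.pt m x"] v p by simp
    show ?case
    proof (cases "i \<le> nM")
      case True
      then have i1: "i \<in> {1..nM}" using i by auto
      let ?d = "(yv i - xv i) \<odot>\<^bsub>M\<^esub> m"
      have v': "yv i - xv i \<in> PR (XY nM)" "xv i \<in> PR (XY nM)" using i1 by auto
      then have c: "?d \<in> carrier M" "xv i \<odot>\<^bsub>M\<^esub> m \<in> carrier M" using pt xM.smult_closed by auto
      have "yv i \<odot>\<^bsub>M\<^esub> m = ?d \<oplus>\<^bsub>M\<^esub> xv i \<odot>\<^bsub>M\<^esub> m" using xM.smult_l_distr[of "yv i - xv i" "xv i" m] v' pt by simp
      then have "yv i \<odot>\<^bsub>bt.T\<^esub> bt.pt m x = bt.pt ?d x \<oplus>\<^bsub>bt.T\<^esub> xv i \<odot>\<^bsub>bt.T\<^esub> bt.pt m x"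
        using act_pt(1,2)[OF pt i1] bt.pt_add1[OF c pt(2)] by simp
      then have "(yv i - xv i) \<odot>\<^bsub>bt.T\<^esub> bt.pt m x \<oplus>\<^bsub>bt.T\<^esub> xv i \<odot>\<^bsub>bt.T\<^esub> bt.pt m x = bt.pt ?d x \<oplus>\<^bsub>bt.T\<^esub> xv i \<odot>\<^bsub>bt.T\<^esub> bt.pt m x"
        by (simp only: d)
      then have "(yv i - xv i) \<odot>\<^bsub>bt.T\<^esub> bt.pt m x = bt.pt ?d x"
        by (rule bt.T.eq_add_cancel[OF bt.smult_closed[OF v(2) p] bt.smult_closed[OF v(3) p] bt.pt_closed[OF c(1) pt(2)]])
      then show ?thesis
        using union_ffilt(2)[OF f, unfolded bim_union_eq, of ?d hM x loN] nd(1) i1 pt ffiltD(3)[OF f(2)] ffiltD(2)[OF F h(1)]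
        by (auto simp: neard_def)
    next
      case False
      define k where "k = i - nM"
      have i1: "k \<in> {1..nN}" and ik: "i = nM + k" using i False by (auto simp: k_def)
      let ?d = "(yv k - xv k) \<odot>\<^bsub>N\<^esub> x"
      have v': "yv k - xv k \<in> PR (XY nN)" "xv k \<in> PR (XY nN)" using i1 by auto
      then have c: "?d \<in> carrier N" "xv k \<odot>\<^bsub>N\<^esub> x \<in> carrier N" using pt xN.smult_closed by auto
      have "yv k \<odot>\<^bsub>N\<^esub> x = ?d \<oplus>\<^bsub>N\<^esub> xv k \<odot>\<^bsub>N\<^esub> x" using xN.smult_l_distr[of "yv k - xv k" "xv k" x] v' pt by simp
      then have "yv i \<odot>\<^bsub>bt.T\<^esub> bt.pt m x = bt.pt m ?d \<oplus>\<^bsub>bt.T\<^esub> xv i \<odot>\<^bsub>bt.T\<^esub> bt.pt m x"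
        using act_pt(3,4)[OF pt i1] bt.pt_add2[OF pt(1) c] by (simp add: ik)
      then have "(yv i - xv i) \<odot>\<^bsub>bt.T\<^esub> bt.pt m x \<oplus>\<^bsub>bt.T\<^esub> xv i \<odot>\<^bsub>bt.T\<^esub> bt.pt m x = bt.pt m ?d \<oplus>\<^bsub>bt.T\<^esub> xv i \<odot>\<^bsub>bt.T\<^esub> bt.pt m x"
        by (simp only: d)
      then have "(yv i - xv i) \<odot>\<^bsub>bt.T\<^esub> bt.pt m x = bt.pt m ?d"
        by (rule bt.T.eq_add_cancel[OF bt.smult_closed[OF v(2) p] bt.smult_closed[OF v(3) p] bt.pt_closed[OF pt(1) c(1)]])
      then show ?thesis
        using union_ffilt(2)[OF f, unfolded bim_union_eq, of m loM ?d hN] nd(2) i1 pt ffiltD(3)[OF f(1)] ffiltD(2)[OF F h(2)]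
        by (auto simp: neard_def)
    qed
  next
    case (add s t)
    then show ?case using v ffilt_sub(3)[OF F] by (simp add: bt.smult_add_t)
  qed
qed

end

text \<open>Homogeneity of \<open>p\<close> makes its multiples a graded submodule. The case
  \<open>j1 = j2\<close>, without a middle step, serves the identity term of a crossing and the
  strand \<open>J\<close>.\<close>

lemma (in xfilt) ffilt_two_steps:
  assumes filt: "filt A = (\<lambda>j. if j < j1 then carrier A else if j < j2 then (\<lambda>m. p \<odot>\<^bsub>A\<^esub> m) ` carrier A else {\<zero>\<^bsub>A\<^esub>})"
    and p: "p \<in> PR (XY n)" "p \<in> qhom d" and j: "lo < j1" "j1 \<le> j2" "j2 \<le> hi"
  shows "ffilt n A lo hi"
proof (rule ffiltI)
  let ?F = "(\<lambda>m. p \<odot>\<^bsub>A\<^esub> m) ` carrier A"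
  have sub: "?F \<subseteq> carrier A" using p smult_closed by auto
  have zero: "\<zero>\<^bsub>A\<^esub> \<in> ?F" using p smult_r_null by (intro image_eqI[of _ _ "\<zero>\<^bsub>A\<^esub>"]) auto
  show "submodule (filt A j) (pol (XY n)) A" for j
  proof -
    have "submodule ?F (pol (XY n)) A"
    proof (rule submoduleI)
      fix x y assume "x \<in> ?F" "y \<in> ?F"
      then obtain m m' where m: "m \<in> carrier A" "m' \<in> carrier A" "x = p \<odot>\<^bsub>A\<^esub> m" "y = p \<odot>\<^bsub>A\<^esub> m'" by auto
      then show "x \<oplus>\<^bsub>A\<^esub> y \<in> ?F" using p smult_r_distr[of p m m'] by (intro image_eqI[of _ _ "m \<oplus>\<^bsub>A\<^esub> m'"]) auto
    next
      fix x assume "x \<in> ?F"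
      then obtain m where m: "m \<in> carrier A" "x = p \<odot>\<^bsub>A\<^esub> m" by auto
      then show "\<ominus>\<^bsub>A\<^esub> x \<in> ?F" using p smult_r_minus[of p m] by (intro image_eqI[of _ _ "\<ominus>\<^bsub>A\<^esub> m"]) auto
      fix r assume r: "r \<in> carrier (pol (XY n))"
      then show "r \<odot>\<^bsub>A\<^esub> x \<in> ?F" using p m smult_assoc1[of r p m] smult_assoc1[of p r m]
        by (intro image_eqI[of _ _ "r \<odot>\<^bsub>A\<^esub> m"]) (auto simp: mult.commute)
    qed (use sub zero in auto)
    moreover have "submodule {\<zero>\<^bsub>A\<^esub>} (pol (XY n)) A" by (rule submoduleI) (auto simp: smult_r_null)
    moreover have "submodule (carrier A) (pol (XY n)) A" by (rule submoduleI) auto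
    ultimately show ?thesis by (simp add: filt)
  qed
  show "i \<le> j \<Longrightarrow> filt A j \<subseteq> filt A i" for i j using sub zero by (auto simp: filt)
  show "hproj q x \<in> filt A j" if "x \<in> filt A j" for j x q
  proof -
    have "hproj q (p \<odot>\<^bsub>A\<^esub> m) \<in> ?F" if "m \<in> carrier A" for m
      using that hproj_closed by (simp add: hproj_smult[OF p])
    moreover have "hproj q \<zero>\<^bsub>A\<^esub> = \<zero>\<^bsub>A\<^esub>" using hproj_of_cmp[OF cmp_zero] by simp
    ultimately show ?thesis using that hproj_closed by (auto simp: filt split: if_splits)
  qed
qed (use j in \<open>auto simp: filt\<close>)

lemma dir_sum_sel: "zero (dir_sum A) = (\<lambda>i. \<zero>\<^bsub>A i\<^esub>)" "add (dir_sum A) = (\<lambda>u v i. u i \<oplus>\<^bsub>A i\<^esub> v i)"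
  "smult (dir_sum A) = (\<lambda>r u i. r \<odot>\<^bsub>A i\<^esub> u i)"
  "filt (dir_sum A) j = {u\<in>carrier (dir_sum A). \<forall>i. u i \<in> filt (A i) j}"
  "u \<in> carrier (dir_sum A) \<Longrightarrow> u i \<in> carrier (A i)"
  by (auto simp: dir_sum_def Let_def)

lemma ffilt_dir_sum:
  fixes f :: "'k \<Rightarrow> int"
  assumes A: "\<And>i. xfree n (A i) {k\<in>K. f k = i} (\<Phi> i) a qd" and K: "finite K" and ff: "\<And>i. ffilt n (A i) lo hi"
    and c: "\<And>u. u \<in> carrier (dir_sum A) \<longleftrightarrow> (\<forall>i. u i \<in> carrier (A i))"
  shows "ffilt n (dir_sum A) lo hi"
proof -
  let ?S = "dir_sum A"
  interpret A: xfilt n "A i" "{k\<in>K. f k = i}" "\<Phi> i" a qd for i by (rule xfilt.intro[OF A])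
  interpret S: xfilt n ?S K "\<lambda>u k. \<Phi> (f k) (u (f k)) k" a qd
    by (rule xfilt.intro[OF xfree_dir_sum[OF A K]])
  note s = ffilt_sub[OF ff]
  have sub: "u \<in> filt ?S j \<longleftrightarrow> (\<forall>i. u i \<in> filt (A i) j)" for u j
    using s(1) by (auto simp: dir_sum_sel(4) c)
  have neg: "(\<ominus>\<^bsub>?S\<^esub> u) i = \<ominus>\<^bsub>A i\<^esub> u i" if "u \<in> carrier ?S" for u i
  proof -
    have "(\<ominus>\<^bsub>?S\<^esub> u) \<oplus>\<^bsub>?S\<^esub> u = \<zero>\<^bsub>?S\<^esub>" using that by (rule S.l_neg)
    then have "(\<ominus>\<^bsub>?S\<^esub> u) i \<oplus>\<^bsub>A i\<^esub> u i = \<zero>\<^bsub>A i\<^esub>" by (simp add: dir_sum_sel fun_eq_iff)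
    then show ?thesis using A.minus_equality that S.a_inv_closed[OF that] by (metis c)
  qed
  have hp: "S.hproj q u i = A.hproj i q (u i)" if u: "u \<in> carrier ?S" for u q i
  proof -
    have "S.hproj q u = (\<lambda>i. A.hproj i q (u i))"
    proof (rule S.Phi_inject)
      show "(\<lambda>k. \<Phi> (f k) (S.hproj q u (f k)) k) = (\<lambda>k. \<Phi> (f k) (A.hproj (f k) q (u (f k))) k)"
        using u S.Phi_hproj[OF u, of q] by (simp add: A.Phi_hproj c)
    qed (use u S.hproj_closed A.hproj_closed in \<open>auto simp: c\<close>)
    then show ?thesis by simp
  qed
  show ?thesis
  proof (rule S.ffiltI)
    fix j
    show "submodule (filt ?S j) (pol (XY n)) ?S"
    proof (rule S.submoduleI)
      show "filt ?S j \<subseteq> carrier ?S" by (auto simp: dir_sum_sel(4))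
      then show "\<ominus>\<^bsub>?S\<^esub> u \<in> filt ?S j" if "u \<in> filt ?S j" for u
        using that s(4) by (auto simp: sub neg subset_eq)
    qed (use s in \<open>auto simp: sub dir_sum_sel(1-3)\<close>)
    show "filt ?S j \<subseteq> filt ?S i" if "i \<le> j" for i using ffiltD(2)[OF ff that] by (auto simp: sub subset_eq)
    show "S.hproj q u \<in> filt ?S j" if "u \<in> filt ?S j" for u q
    proof -
      have "u \<in> carrier ?S" using that by (auto simp: dir_sum_sel(4))
      moreover have "A.hproj i q (u i) \<in> filt (A i) j" for i
      proof -
        have ui: "u i \<in> filt (A i) j" using that by (simp add: sub)
        then have "u i \<in> carrier (A i)" using s(1) by blast
        from A.hom_dec_filt_iff[OF this s(2)] ffiltD(5)[OF ff ui] show ?thesis by blast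
      qed
      ultimately show ?thesis by (simp add: sub hp)
    qed
  next
    show "filt ?S lo = carrier ?S" using ffiltD(3)[OF ff] by (auto simp: sub c)
    show "filt ?S hi = {\<zero>\<^bsub>?S\<^esub>}" using ffiltD(4)[OF ff] by (auto simp: sub dir_sum_sel(1) fun_eq_iff)
  qed
qed

context ocomp
begin

lemma ffilt_TT:
  assumes "\<And>i. ffilt 3 (opos C i) loC (hC i)" "\<And>j. ffilt 3 (opos E j) loE (hE j)"
  shows "ffilt 3 (TT i j) (loC + loE) (hC i + hE j - 1)"
  by (rule T.comp_ffilt(1)[OF assms])

lemma ffilt_CE:
  assumes f: "\<And>i. ffilt 3 (opos C i) loC (hC i)" "\<And>j. ffilt 3 (opos E j) loE (hE j)"
    and h: "\<And>i. hC i + hE (p - i) - 1 \<le> h"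
  shows "ffilt 3 (opos CE p) (loC + loE) h"
proof -
  have *: "xfree 3 (TT i (p - i)) {k\<in>{k. posCE k = p}. posC (fst k) = i} (tlift (gg i (p - i))) ((p - (mC + mE)) div 2) qdCE" for i
    using xfree_TT[of i p] by simp
  show ?thesis
    unfolding opos_CE
  proof (rule ffilt_dir_sum[OF *])
    show "ffilt 3 (TT i (p - i)) (loC + loE) h" for i by (rule ffilt_mono[OF ffilt_TT[OF f] h])
    show "u \<in> carrier (dir_sum (\<lambda>i. TT i (p - i))) \<longleftrightarrow> (\<forall>i. u i \<in> carrier (TT i (p - i)))" for u
      using CE_carrier[of u p] by (simp add: opos_CE)
  qed simp
qed

lemma TT_trivial:
  assumes "\<And>k. posCE k = p \<Longrightarrow> posC (fst k) \<noteq> i"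
  shows "carrier (TT i (p - i)) = {\<zero>\<^bsub>TT i (p - i)\<^esub>}"
proof -
  have e: "{k. posCE k = p \<and> posC (fst k) = i} = {}" using assms by auto
  from xfree_TT[of i p] show ?thesis unfolding e by (rule xfree_empty(1))
qed

text \<open>By \<open>one\<close>, all summands at position \<open>p\<close> except that of
  \<open>i0\<close> vanish. This is the situation in the top position, where each factor must be in
  its own top position.\<close>

lemma twist_neard_CE:
  assumes f: "\<And>i. ffilt 3 (opos C i) loC (hC i)" "\<And>j. ffilt 3 (opos E j) loE (hE j)"
    and one: "\<And>k. posCE k = p \<Longrightarrow> posC (fst k) = i0"
  shows "twist 3 (opos C i0) sC jC \<Longrightarrow> twist 3 (opos E (p - i0)) sE jE \<Longrightarrow>
      (\<And>i. i \<in> {1..3} \<Longrightarrow> sC i \<in> {1..3}) \<Longrightarrow> (\<And>i. i \<in> {1..3} \<Longrightarrow> sE i \<in> {1..3}) \<Longrightarrow>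
      jC + hE (p - i0) - 1 \<le> j \<Longrightarrow> hC i0 - 1 + jE \<le> j \<Longrightarrow> twist 3 (opos CE p) (\<lambda>i. sE (sC i)) j"
    and "neard 3 (opos C i0) lC \<Longrightarrow> neard 3 (opos E (p - i0)) lE \<Longrightarrow> l \<le> lC + loE \<Longrightarrow> l \<le> loC + lE \<Longrightarrow> neard 3 (opos CE p) l"
proof -
  have zero: "carrier (TT i (p - i)) = {\<zero>\<^bsub>TT i (p - i)\<^esub>}" if "i \<noteq> i0" for i
    using that one by (intro TT_trivial) auto
  have zf: "filt (TT i (p - i)) j = {\<zero>\<^bsub>TT i (p - i)\<^esub>}" if "i \<noteq> i0" for i j
    by (rule ffilt_zero_filt[OF ffilt_TT[OF f] zero[OF that]])
  interpret Z: xfilt 3 "TT i (p - i)" "{k. posCE k = p \<and> posC (fst k) = i}" "tlift (gg i (p - i))" "(p - (mC + mE)) div 2" qdCE for i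
    by (rule xfilt.intro[OF xfree_TT])
  show "twist 3 (opos CE p) (\<lambda>i. sE (sC i)) j"
    if tw: "twist 3 (opos C i0) sC jC" "twist 3 (opos E (p - i0)) sE jE"
      and s: "\<And>i. i \<in> {1..3} \<Longrightarrow> sC i \<in> {1..3}" "\<And>i. i \<in> {1..3} \<Longrightarrow> sE i \<in> {1..3}"
      and j: "jC + hE (p - i0) - 1 \<le> j" "hC i0 - 1 + jE \<le> j"
  proof -
    have "twist 3 (TT i (p - i)) (\<lambda>i. sE (sC i)) j" for i
    proof (cases "i = i0")
      case True
      show ?thesis unfolding True by (rule T.comp_twist[OF f tw s j])
    next
      case False
      show ?thesis by (rule Z.ffilt_zero(2)[OF zero[OF False] zf[OF False]]) (use s in auto)
    qed
    then show ?thesis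
      unfolding twist_def opos_CE dir_sum_sel by (auto simp: fun_eq_iff)
  qed
  assume nd: "neard 3 (opos C i0) lC" "neard 3 (opos E (p - i0)) lE" and l: "l \<le> lC + loE" "l \<le> loC + lE"
  have N: "neard 3 (TT i (p - i)) l" for i
  proof (cases "i = i0")
    case True
    show ?thesis unfolding True by (rule T.comp_neard[OF f nd l])
  next
    case False
    show ?thesis by (rule Z.ffilt_zero(3)[OF zero[OF False] zf[OF False]])
  qed
  show "neard 3 (opos CE p) l"
    unfolding neard_def
  proof (intro ballI)
    fix i :: nat and u assume i: "i \<in> {1..3}" and u: "u \<in> carrier (opos CE p)"
    have "yv i - xv i \<in> PR (XY 3)" using i by auto
    then have v: "(yv i - xv i) \<odot>\<^bsub>opos CE p\<^esub> u \<in> carrier (opos CE p)"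
      using u module.smult_closed[OF xfree.module_A[OF xfree_CE]] by simp
    show "(yv i - xv i) \<odot>\<^bsub>opos CE p\<^esub> u \<in> filt (opos CE p) l"
    proof -
      have "(yv i - xv i) \<odot>\<^bsub>TT j (p - j)\<^esub> u j \<in> filt (TT j (p - j)) l" for j
        using N[of j] i u by (simp add: neard_def CE_carrier)
      then show ?thesis using v unfolding opos_CE by (simp add: dir_sum_sel)
    qed
  qed
qed

end

subsection \<open>Filtrations of the crossings and their products\<close>

definition swp :: "nat \<Rightarrow> nat \<Rightarrow> nat" where
  "swp a i = (if i = a then 2 else if i = 2 then a else i)"

text \<open>The shift s^(-1/2) lowers the doubled indices of the jumps by one, so that the steps 0
  and 1 of the top term are the multiples of y_- - x_-.\<close>

lemma filt_sigma:
  "filt (opos sigma_minus 1) = (\<lambda>j. if j < 0 then carrier (opos sigma_minus 1)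
     else if j < 2 then (\<lambda>m. (ym - xm) \<odot>\<^bsub>opos sigma_minus 1\<^esub> m) ` carrier (opos sigma_minus 1) else {\<zero>\<^bsub>opos sigma_minus 1\<^esub>})"
  "filt (opos sigma_minus (- 1)) = (\<lambda>j. if j < 0 then carrier (opos sigma_minus (- 1)) else {\<zero>\<^bsub>opos sigma_minus (- 1)\<^esub>})"
  "p \<noteq> 1 \<Longrightarrow> p \<noteq> - 1 \<Longrightarrow> filt (opos sigma_minus p) j = {\<zero>\<^bsub>opos sigma_minus p\<^esub>} \<and> carrier (opos sigma_minus p) = {\<zero>\<^bsub>opos sigma_minus p\<^esub>}"
  by (auto simp: opos_sigma shalf_def ashift_def qshift_def bim_B_def bim_I_def cyc_bim_def Let_def zero_fcx_def fun_eq_iff)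

lemma xfilt_sigma: "xfilt 2 (opos sigma_minus p) {t. tpos t = p} (Phi2 1 p) ((p - 1) div 2) tqd"
  by (rule xfilt.intro[OF xfree_sigma]) simp

lemma ffilt_sigma: "ffilt 2 (opos sigma_minus p) (- 1) (if p = 1 then 2 else 0)"
proof -
  interpret X: xfilt 2 "opos sigma_minus p" "{t. tpos t = p}" "Phi2 1 p" "(p - 1) div 2" tqd by (rule xfilt_sigma)
  have d: "ym - xm \<in> PR (XY 2)" "ym - xm \<in> qhom 2" by (auto simp: ym_def xm_def intro!: qhom_diff)
  consider "p = 1" | "p = - 1" | "p \<noteq> 1" "p \<noteq> - 1" by blast
  then show ?thesis
  proof cases
    case 1
    then show ?thesis using xfilt.ffilt_two_steps[OF xfilt_sigma filt_sigma(1) d, of "- 1" 2] by simp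
  next
    case 2
    have "filt (opos sigma_minus (- 1)) = (\<lambda>j. if j < 0 then carrier (opos sigma_minus (- 1))
      else if j < 0 then (\<lambda>m. (ym - xm) \<odot>\<^bsub>opos sigma_minus (- 1)\<^esub> m) ` carrier (opos sigma_minus (- 1)) else {\<zero>\<^bsub>opos sigma_minus (- 1)\<^esub>})"
      by (simp add: filt_sigma(2) fun_eq_iff)
    from xfilt.ffilt_two_steps[OF xfilt_sigma this d, of "- 1" 0] 2 show ?thesis by simp
  next
    case 3
    then show ?thesis using X.ffilt_zero(1) filt_sigma(3)[OF 3] by auto
  qed
qed

text \<open>Modulo the relations, y_- - x_- is annihilated by y_1 - x_2 and y_2 - x_1, while y_i -
  x_i is plus or minus half of it. So the deeper step lies on the graph of the transposition, and
  y_i - x_i maps everything into it.\<close>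

lemma twist_neard_sigma: "twist 2 (opos sigma_minus 1) (swp 1) 0" "neard 2 (opos sigma_minus 1) 1"
proof -
  have "((1::nat), (2::nat)) \<in> {(1, 2), (2, 1)}" by simp
  note R = M_rels_ideal[OF this]
  interpret CM: cyc 2 M_rels "{B0, B1}" "Mbasis 1" Mdeg by (rule cyc_M) simp
  have M: "bim_M = CM.A" by (simp add: bim_M_def M_rels_def)
  have d: "ym - xm \<in> PR (XY 2)" by (auto simp: ym_def xm_def)
  have H: "Cst (1/2) * 2 = (1::mpol)" by (simp flip: Cst_numeral Cst_mult)
  have two: "(2::mpol) \<in> PR V" for V using PR_Cst[of 2 V] by (simp only: Cst_numeral)
  have i2: "i = 1 \<or> i = 2" if "i \<in> {1..2}" for i :: nat using that by auto
  show "twist 2 (opos sigma_minus 1) (swp 1) 0"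
    unfolding twist_def
  proof (intro ballI)
    fix i m assume i: "i \<in> {1..2::nat}" and m: "m \<in> filt (opos sigma_minus 1) 0"
    then obtain p where p: "p \<in> PR (XY 2)" "m = (ym - xm) \<odot>\<^bsub>CM.A\<^esub> CM.co p" by (auto simp: filt_sigma M CM.A_carrier)
    have s: "swp 1 i \<in> {1..2}" using i by (auto simp: swp_def)
    have q: "(ym - xm) * p \<in> PR (XY 2)" using p d by simp
    have "(yv i - xv (swp 1 i)) * (ym - xm) \<in> CM.I"
    proof -
      \<comment> \<open>Up to the sum relation, y_- - x_- is 2 (y_2 - x_2), and also -2 (y_1 - x_1).
        The product with y_2 - x_1, or y_1 - x_2, is then a multiple of the quadratic
        relation.\<close>
      have 2: "(yv 2 - xv 1) * (ym - xm) = 2 * (yv 2 * yv 2 + xv 2 * xv 1 - (xv 2 + xv 1) * yv 2) - (yv 2 - xv 1) * (yv 1 + yv 2 - xv 1 - xv 2)"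
        and 1: "(yv 1 - xv 2) * (ym - xm) = (yv 1 - xv 2) * (yv 1 + yv 2 - xv 1 - xv 2) - 2 * (yv 1 * yv 1 + xv 1 * xv 2 - (xv 1 + xv 2) * yv 1)"
        by (simp_all add: ym_def xm_def algebra_simps)
      have "(yv 2 - xv 1) * (ym - xm) \<in> CM.I"
        unfolding 2 by (intro CM.I_diff CM.I_mult[OF R(1)] CM.I_mult[OF M_rels_ideal(3)]) (auto simp: two)
      moreover have "(yv 1 - xv 2) * (ym - xm) \<in> CM.I"
        unfolding 1 by (intro CM.I_diff CM.I_mult[OF R(1)] CM.I_mult[OF R(3)]) (auto simp: two)
      ultimately show ?thesis using i2[OF i] by (auto simp: swp_def)
    qed
    then have "yv i * ((ym - xm) * p) - xv (swp 1 i) * ((ym - xm) * p) \<in> CM.I"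
      using CM.I_mult[OF _ p(1), of "(yv i - xv (swp 1 i)) * (ym - xm)"] by (simp add: algebra_simps)
    then show "yv i \<odot>\<^bsub>opos sigma_minus 1\<^esub> m = xv (swp 1 i) \<odot>\<^bsub>opos sigma_minus 1\<^esub> m"
      using p q d i s by (simp add: M CM.A_smult CM.co_eq_iff)
  qed
  show "neard 2 (opos sigma_minus 1) 1"
    unfolding neard_def
  proof (intro ballI)
    fix i m assume i: "i \<in> {1..2::nat}" and m: "m \<in> carrier (opos sigma_minus 1)"
    then obtain p where p: "p \<in> PR (XY 2)" "m = CM.co p" by (auto simp: M CM.A_carrier)
    define h where "h = (if i = 2 then Cst (1/2) else - Cst (1/2))"
    have h: "h \<in> PR (XY 2)" by (simp add: h_def)
    have "(yv i - xv i) - (ym - xm) * h = Cst (1/2) * (yv 1 + yv 2 - xv 1 - xv 2)"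
    proof -
      have "yv i - xv i = (Cst (1/2) * 2) * (yv i - xv i)" by (simp only: H) simp
      also have "\<dots> - (ym - xm) * h = Cst (1/2) * (yv 1 + yv 2 - xv 1 - xv 2)"
        using i2[OF i] by (auto simp: h_def ym_def xm_def algebra_simps)
      finally show ?thesis .
    qed
    then have "(yv i - xv i) - (ym - xm) * h \<in> CM.I" using CM.I_mult[OF R(1), of "Cst (1/2)"] by simp
    then have "(yv i - xv i) * p - (ym - xm) * (h * p) \<in> CM.I"
      using CM.I_mult[OF _ p(1), of "(yv i - xv i) - (ym - xm) * h"] by (simp add: algebra_simps)
    then have "(yv i - xv i) \<odot>\<^bsub>CM.A\<^esub> m = (ym - xm) \<odot>\<^bsub>CM.A\<^esub> CM.co (h * p)"
      using p h d i by (simp add: CM.A_smult CM.co_eq_iff)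
    then show "(yv i - xv i) \<odot>\<^bsub>opos sigma_minus 1\<^esub> m \<in> filt (opos sigma_minus 1) 1"
      using p h by (auto simp: filt_sigma M CM.A_carrier)
  qed
qed

text \<open>On \<open>J\<close> the two variables agree, so both properties hold for every index;
  the free \<open>j\<close> is set to whatever the estimates for the disjoint union demand.\<close>

lemma filt_J: "ffilt 1 bim_J 0 1" "twist 1 bim_J (\<lambda>i. i) j" "neard 1 bim_J j"
proof -
  interpret X: xfilt 1 bim_J "{()}" PhiJ 0 "\<lambda>_. 0" by (rule xfilt.intro[OF xfree_J])
  interpret J: cyc 1 "{yv 1 - xv 1}" "{()}" "\<lambda>_. 1" "\<lambda>_. 0" by (rule cyc_J)
  have "filt bim_J = (\<lambda>j. if j < 1 then carrier bim_J else if j < 1 then (\<lambda>m. 1 \<odot>\<^bsub>bim_J\<^esub> m) ` carrier bim_J else {\<zero>\<^bsub>bim_J\<^esub>})"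
    by (auto simp: bim_J_def cyc_bim_def Let_def fun_eq_iff)
  from X.ffilt_two_steps[OF this, of 0] show f: "ffilt 1 bim_J 0 1" by simp
  have y: "yv i \<odot>\<^bsub>bim_J\<^esub> m = xv i \<odot>\<^bsub>bim_J\<^esub> m" if "i \<in> {1..1}" "m \<in> carrier bim_J" for i m
  proof (rule X.Phi_inject)
    have "i = 1" using that by simp
    then show "PhiJ (yv i \<odot>\<^bsub>bim_J\<^esub> m) = PhiJ (xv i \<odot>\<^bsub>bim_J\<^esub> m)"
      using PhiJ_yv[OF that(2)] X.Phi_smult[of "xv 1" m] that by (simp del: One_nat_def)
  qed (use that X.smult_closed[of "yv i" m] X.smult_closed[of "xv i" m] in auto)
  then show "twist 1 bim_J (\<lambda>i. i) j" using ffilt_sub(1)[OF f] by (auto simp: twist_def subset_eq)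
  show "neard 1 bim_J j"
    unfolding neard_def
  proof (intro ballI)
    fix i m assume im: "i \<in> {1..1::nat}" "m \<in> carrier bim_J"
    have v: "yv i - xv i \<in> PR (XY 1)" "xv i \<in> PR (XY 1)" using im by auto
    have c: "(yv i - xv i) \<odot>\<^bsub>bim_J\<^esub> m \<in> carrier bim_J" "xv i \<odot>\<^bsub>bim_J\<^esub> m \<in> carrier bim_J"
      using v im X.smult_closed by auto
    have "(yv i - xv i) \<odot>\<^bsub>bim_J\<^esub> m \<oplus>\<^bsub>bim_J\<^esub> xv i \<odot>\<^bsub>bim_J\<^esub> m = \<zero>\<^bsub>bim_J\<^esub> \<oplus>\<^bsub>bim_J\<^esub> xv i \<odot>\<^bsub>bim_J\<^esub> m"
      using X.smult_l_distr[of "yv i - xv i" "xv i" m] y[OF im] v im c by simp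
    from X.eq_add_cancel[OF c(2) c(1) X.zero_closed this] show "(yv i - xv i) \<odot>\<^bsub>bim_J\<^esub> m \<in> filt bim_J j"
      using ffilt_sub(2)[OF f] by simp
  qed
qed

lemma filt_sgm:
  assumes a: "a = 1 \<or> a = 3"
  shows "ffilt 3 (opos (sgm a) p) (- 1) (if p = 1 then 2 else 0)"
    and "twist 3 (opos (sgm a) 1) (swp a) 0" "neard 3 (opos (sgm a) 1) 1"
proof -
  interpret R: xunion 2 "opos sigma_minus p" "{t. tpos t = p}" "Phi2 1 p" "(p - 1) div 2" tqd 1 bim_J "{()}" PhiJ 0 "\<lambda>_. 0" for p
    by (rule xunion.intro[OF xfree_sigma xfree_J]) simp
  interpret L: xunion 1 bim_J "{()}" PhiJ 0 "\<lambda>_. 0" 2 "opos sigma_minus p" "{t. tpos t = p}" "Phi2 1 p" "(p - 1) div 2" tqd for p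
    by (rule xunion.intro[OF xfree_J xfree_sigma]) simp
  have three: "2 + 1 = (3::nat)" "1 + 2 = (3::nat)" by simp_all
  have op: "opos sigma1_minus p = bim_union 2 (opos sigma_minus p) bim_J" "opos sigma2_minus p = bim_union 1 bim_J (opos sigma_minus p)" for p
    by (simp_all add: sigma1_minus_def ocx_union_right_def sigma2_minus_def ocx_union_left_def)
  note fs = ffilt_sigma[of p] and f1 = ffilt_sigma[of 1] and J = filt_J(1)
  have R: "ffilt 3 (opos sigma1_minus p) (- 1) (if p = 1 then 2 else 0)"
    using R.union_ffilt(1)[OF fs J] by (simp add: op three del: One_nat_def)
  have L: "ffilt 3 (opos sigma2_minus p) (- 1) (if p = 1 then 2 else 0)"
    using L.union_ffilt(1)[OF J fs] by (simp add: op three del: One_nat_def)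
  \<comment> \<open>The top term of the crossing is zero from index 2 on, so \<open>J\<close> must
    enter with an index at most -1. For \<open>neard\<close> the lower bound -1 requires an index of
    at least 2.\<close>
  have "twist (2 + 1) (bim_union 2 (opos sigma_minus 1) bim_J) (swp 1) 0"
    by (rule R.union_twist[OF f1 J twist_neard_sigma(1) filt_J(2)[of "- 1"]]) (auto simp: swp_def)
  moreover have "twist (1 + 2) (bim_union 1 bim_J (opos sigma_minus 1)) (swp 3) 0"
    by (rule L.union_twist[OF J f1 filt_J(2)[of "- 1"] twist_neard_sigma(1)]) (auto simp: swp_def)
  moreover have "neard (2 + 1) (bim_union 2 (opos sigma_minus 1) bim_J) 1"
    by (rule R.union_neard[OF f1 J twist_neard_sigma(2) filt_J(3)[of 2]]) auto
  moreover have "neard (1 + 2) (bim_union 1 bim_J (opos sigma_minus 1)) 1"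
    by (rule L.union_neard[OF J f1 filt_J(3)[of 2] twist_neard_sigma(2)]) auto
  ultimately show "ffilt 3 (opos (sgm a) p) (- 1) (if p = 1 then 2 else 0)"
    "twist 3 (opos (sgm a) 1) (swp a) 0" "neard 3 (opos (sgm a) 1) 1"
    using a R L by (auto simp: sgm_def op three simp del: One_nat_def)
qed

lemma swp_range: "a = 1 \<or> a = 3 \<Longrightarrow> i \<in> {1..3} \<Longrightarrow> swp a i \<in> {1..3}"
  by (auto simp: swp_def)

text \<open>In doubled indices: zero is reached at 2 + 2 - 1 = 3 in the top position and by 2 + 0 -
  1 = 1 in the others; the graph condition starts at 0 + 2 - 1 = 1, and the differences land in 1 -
  1 = 0.\<close>

lemma filt_SS:
  assumes ac: "a = 1 \<or> a = 3" "c = 1 \<or> c = 3"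
  shows "ffilt 3 (opos (ocx_comp 3 (sgm a) (sgm c)) p) (- 2) (if p = 2 then 3 else 1)"
    and "twist 3 (opos (ocx_comp 3 (sgm a) (sgm c)) 2) (\<lambda>i. swp c (swp a i)) 1"
    and "neard 3 (opos (ocx_comp 3 (sgm a) (sgm c)) 2) 0"
proof -
  interpret O: ocomp "sgm a" tpos 1 tqd "Phi3 a" "Ysig a 2 xmul" "Dsig a xmul"
    "sgm c" tpos 1 tqd "Phi3 c" "Ysig c 2 xmul" "Dsig c xmul" "Ysig a 2 (Ysig c 2 xmul)" "Dsig a (Ysig c 2 xmul)"
    by (rule ocomp_SS[OF ac])
  note fa = filt_sgm[OF ac(1)] and fc = filt_sgm[OF ac(2)]
  show "ffilt 3 (opos (ocx_comp 3 (sgm a) (sgm c)) p) (- 2) (if p = 2 then 3 else 1)"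
    using O.ffilt_CE[OF fa(1) fc(1), of p "if p = 2 then 3 else 1"] by simp
  have one: "tpos (fst k) = 1" if "O.posCE k = 2" for k using that by (auto simp: O.posCE_def tpos_def split: if_splits)
  note tn = O.twist_neard_CE[OF fa(1) fc(1) one]
  show "twist 3 (opos (ocx_comp 3 (sgm a) (sgm c)) 2) (\<lambda>i. swp c (swp a i)) 1"
    by (rule tn(1)[OF _ fa(2)]) (use fc(2) swp_range[OF ac(1)] swp_range[OF ac(2)] in auto)
  show "neard 3 (opos (ocx_comp 3 (sgm a) (sgm c)) 2) 0"
    by (rule tn(2)[OF _ fa(3)]) (use fc(3) in auto)
qed

text \<open>Another crossing gives 3 + 2 - 1 = 4 in the top position and at most 2 in the others,
  the graph condition from 1 + 2 - 1 = 2 on, and the differences in 0 - 1 = -1.\<close>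

lemma filt_SSS:
  assumes ac: "a = 1 \<or> a = 3" "c = 1 \<or> c = 3"
  shows "ffilt 3 (opos (triple a c) p) (- 3) (if p = 3 then 4 else 2)"
    and "twist 3 (opos (triple a c) 3) (\<lambda>i. swp a (swp c (swp a i))) 2"
    and "neard 3 (opos (triple a c) 3) (- 1)"
proof -
  interpret O: ocomp "ocx_comp 3 (sgm a) (sgm c)" pos2 2 qd2 "Phi4 a c" "YSS a c xmul" "DSS a c xmul"
    "sgm a" tpos 1 tqd "Phi3 a" "Ysig a 2 xmul" "Dsig a xmul" "YSS a c (Ysig a 2 xmul)" "DSS a c (Ysig a 2 xmul)"
    by (rule ocomp_SSS[OF ac])
  note fa = filt_sgm[OF ac(1)] and fac = filt_SS[OF ac]
  show "ffilt 3 (opos (triple a c) p) (- 3) (if p = 3 then 4 else 2)"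
    using O.ffilt_CE[OF fac(1) fa(1), of p "if p = 3 then 4 else 2"] by simp
  have one: "pos2 (fst k) = 2" if "O.posCE k = 3" for k using that by (auto simp: O.posCE_def pos2_def tpos_def split: if_splits)
  note tn = O.twist_neard_CE[OF fac(1) fa(1) one]
  show "twist 3 (opos (triple a c) 3) (\<lambda>i. swp a (swp c (swp a i))) 2"
    by (rule tn(1)[OF _ fac(2)]) (use fa(2) swp_range[OF ac(1)] swp_range[OF ac(2)] in auto)
  show "neard 3 (opos (triple a c) 3) (- 1)"
    by (rule tn(2)[OF _ fac(3)]) (use fa(3) in auto)
qed

text \<open>An element annihilated by all \<open>vY i - vX (s i)\<close>, where \<open>s\<close> is the longest permutation, is in the top position
  a multiple by some \<open>g\<close> of the product over the three blobs of the differences of the left and the right variable of the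
  same strand. This product is divisible by \<open>vY a - vX a\<close>, and \<open>wdiv\<close> is the quotient.\<close>

definition wdiv :: "nat \<Rightarrow> nat \<Rightarrow> mpol \<Rightarrow> (trit \<times> trit) \<times> trit \<Rightarrow> mpol" where
  "wdiv a c g k = (if k = ((B0, B0), B0) then - (xv a * xv 2 - xv 2 * xv 2 - xv 2 * xv c) * g
     else if k = ((B0, B0), B1) then - xv c * g else if k = ((B0, B1), B1) then g
     else if k = ((B1, B0), B0) then (xv a - xv 2) * g else if k = ((B0, B1), B0) then - xv 2 * g else 0)"

text \<open>The eigenvector equations determine all coordinates from the one with three indices
  \<open>B1\<close>. The equation for y_c leaves the first index alone and solves for the other two;
  that for y_a then relates the two values of the first index.\<close>

lemma wdiv:
  assumes ac: "a \<noteq> c" "a \<noteq> 2" "c \<noteq> 2" and ya: "YSSS a c a v = (\<lambda>k. xv c * v k)" and yc: "YSSS a c c v = (\<lambda>k. xv a * v k)"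
    and v: "\<And>k. pos3 k \<noteq> 3 \<Longrightarrow> v k = 0"
  shows "YSSS a c a (wdiv a c (v ((B1, B1), B1))) k - xv a * wdiv a c (v ((B1, B1), B1)) k = v k"
proof -
  let ?g = "v ((B1, B1), B1)"
  have ne: "xv c - xv a \<noteq> 0" using ac(1) by (simp add: Var_inject)
  have y: "YSSS a c c v ((i, j), k) = xv a * v ((i, j), k)" for i j k using yc by (simp add: fun_eq_iff)
  have c1: "v ((i, B0), B1) = v ((i, B1), B0) + (xv a - xv c) * v ((i, B1), B1)" if "i = B0 \<or> i = B1" for i
    using y[of i B1 B1] that ac by (auto simp: YSSS_def YSS_def Ysig_def algebra_simps)
  have c2: "v ((i, B1), B0) = - xv a * v ((i, B1), B1)" if i: "i = B0 \<or> i = B1" for i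
  proof -
    have "xv c * v ((i, B1), B0) = xv a * v ((i, B0), B1)"
      using y[of i B0 B1] i ac by (auto simp: YSSS_def YSS_def Ysig_def algebra_simps)
    \<comment> \<open>After substitution of \<open>c1\<close> the equation acquires the factor x_c -
      x_a, which can be cancelled.\<close>
    then have "(xv c - xv a) * (v ((i, B1), B0) + xv a * v ((i, B1), B1)) = 0"
      unfolding c1[OF i] by (simp add: algebra_simps)
    then show ?thesis using ne by (simp add: eq_neg_iff_add_eq_0)
  qed
  have c3: "v ((i, B0), B1) = - xv c * v ((i, B1), B1)" if "i = B0 \<or> i = B1" for i
    using c1[OF that] c2[OF that] by (simp add: algebra_simps)
  have c4: "v ((i, B0), B0) = xv a * xv c * v ((i, B1), B1)" if i: "i = B0 \<or> i = B1" for i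
    using y[of i B1 B0] i ac c2[OF i] by (auto simp: YSSS_def YSS_def Ysig_def algebra_simps)
  have c5: "v ((B0, B1), B1) = - xv 2 * ?g"
    using fun_cong[OF ya, of "((B1, B1), B1)"] ac c2[of B1] c3[of B1] by (simp add: YSSS_def YSS_def Ysig_def algebra_simps eq_neg_iff_add_eq_0)
  note cs = c2[of B0, simplified] c2[of B1, simplified] c3[of B0, simplified] c3[of B1, simplified]
    c4[of B0, simplified] c4[of B1, simplified] c5
  have vT: "v ((TI, j), l) = 0" "v ((i, TI), l) = 0" "v ((i, j), TI) = 0" for i j l
    by (rule v, simp add: pos3_def pos2_def tpos_def)+
  show ?thesis
    by (rule trits3_cases[where k=k], elim insertE emptyE; hypsubst?;
      simp add: YSSS_def YSS_def Ysig_def wdiv_def ac ac(1)[symmetric] vT; simp only: cs vT; simp add: algebra_simps)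
qed

section \<open>Morphisms in coordinates\<close>

text \<open>What a map of coordinate vectors needs in order to come from a morphism. One function
  \<open>qd\<close> serves source and target, because the two words share their basis indices and
  degrees.\<close>

definition cmor :: "nat \<Rightarrow> 'k set \<Rightarrow> 'k set \<Rightarrow> ('k \<Rightarrow> int) \<Rightarrow> (nat \<Rightarrow> ('k \<Rightarrow> mpol) \<Rightarrow> 'k \<Rightarrow> mpol) \<Rightarrow>
    (nat \<Rightarrow> ('k \<Rightarrow> mpol) \<Rightarrow> 'k \<Rightarrow> mpol) \<Rightarrow> (('k \<Rightarrow> mpol) \<Rightarrow> 'k \<Rightarrow> mpol) \<Rightarrow> bool" where
  "cmor n K L qd Y Z G \<longleftrightarrow> (\<forall>v w. G (v + w) = G v + G w) \<and> (\<forall>r v. G (\<lambda>k. r * v k) = (\<lambda>k. r * G v k)) \<and>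
     (\<forall>i\<in>{1..n}. \<forall>v. G (Y i v) = Z i (G v)) \<and> (\<forall>v\<in>vecs n K. G v \<in> vecs n L) \<and>
     (\<forall>v q. (\<forall>k. v k \<in> qhom (q - qd k)) \<longrightarrow> (\<forall>k. G v k \<in> qhom (q - qd k)))"

text \<open>Scaling gives linearity over the right variables and intertwining of \<open>Y\<close>
  and \<open>Z\<close> over the left ones. Compatibility with the inner differentials is automatic,
  as these vanish.\<close>

lemma gmor_coord:
  assumes xA: "xfree n A K \<Phi> a qd" and xB: "xfree n B L \<Psi> a qd"
    and YA: "\<And>i x. i \<in> {1..n} \<Longrightarrow> x \<in> carrier A \<Longrightarrow> \<Phi> (yv i \<odot>\<^bsub>A\<^esub> x) = Y i (\<Phi> x)"
    and YB: "\<And>i x. i \<in> {1..n} \<Longrightarrow> x \<in> carrier B \<Longrightarrow> \<Psi> (yv i \<odot>\<^bsub>B\<^esub> x) = Z i (\<Psi> x)"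
    and G: "cmor n K L qd Y Z G"
    and f: "\<And>x. x \<in> carrier A \<Longrightarrow> f x \<in> carrier B \<and> \<Psi> (f x) = G (\<Phi> x)"
  shows "gmor n A B f"
proof -
  interpret A: xfree n A K \<Phi> a qd by (rule xA)
  interpret B: xfree n B L \<Psi> a qd by (rule xB)
  have add: "f (x \<oplus>\<^bsub>A\<^esub> y) = f x \<oplus>\<^bsub>B\<^esub> f y" if "x \<in> carrier A" "y \<in> carrier A" for x y
    using that f G by (intro B.Phi_inject) (auto simp: A.Phi_add B.Phi_add cmor_def)
  have zero: "f \<zero>\<^bsub>A\<^esub> = \<zero>\<^bsub>B\<^esub>"
    using add[of "\<zero>\<^bsub>A\<^esub>" "\<zero>\<^bsub>A\<^esub>"] f[of "\<zero>\<^bsub>A\<^esub>"] B.add.l_cancel_one[of "f \<zero>\<^bsub>A\<^esub>" "f \<zero>\<^bsub>A\<^esub>"] by auto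
  have smult: "f (r \<odot>\<^bsub>A\<^esub> x) = r \<odot>\<^bsub>B\<^esub> f x" if "r \<in> PR (XY n)" "x \<in> carrier A" for r x
    using that
  proof (induction r arbitrary: x rule: PR_induct)
    case (Cst c)
    have "Cst c \<in> RX n" "Cst c \<in> PR (XY n)" by simp_all
    then show ?case using Cst f G A.smult_closed[of "Cst c" x] B.smult_closed[of "Cst c" "f x"]
      by (intro B.Phi_inject) (auto simp: A.Phi_smult B.Phi_smult cmor_def)
  next
    case (add p q)
    then show ?case using f[OF add(5)] by (simp add: A.smult_l_distr[simplified] B.smult_l_distr[simplified] \<open>\<And>x y. x \<in> carrier A \<Longrightarrow> y \<in> carrier A \<Longrightarrow> f (x \<oplus>\<^bsub>A\<^esub> y) = f x \<oplus>\<^bsub>B\<^esub> f y\<close> A.smult_closed[simplified])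
  next
    case (Var v q)
    have v: "Var v \<in> PR (XY n)" using Var(1) by simp
    have V: "f (Var v \<odot>\<^bsub>A\<^esub> x) = Var v \<odot>\<^bsub>B\<^esub> f x" if x: "x \<in> carrier A" for x
    proof (rule B.Phi_inject)
      show "f (Var v \<odot>\<^bsub>A\<^esub> x) \<in> carrier B" "Var v \<odot>\<^bsub>B\<^esub> f x \<in> carrier B"
        using x v f A.smult_closed[of "Var v" x] B.smult_closed[of "Var v" "f x"] by auto
      have c: "Var v \<odot>\<^bsub>A\<^esub> x \<in> carrier A" using x v A.smult_closed by simp
      show "\<Psi> (f (Var v \<odot>\<^bsub>A\<^esub> x)) = \<Psi> (Var v \<odot>\<^bsub>B\<^esub> f x)"
      proof (cases v)
        case (vX i)
        then have "Var v \<in> RX n" using Var(1) by simp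
        then show ?thesis using x f[OF c] f[OF x] G by (simp add: A.Phi_smult B.Phi_smult cmor_def)
      next
        case (vY i)
        then have "i \<in> {1..n}" using Var(1) by simp
        then show ?thesis using x vY f[OF c] f[OF x] G YA YB by (simp add: cmor_def del: atLeastAtMost_iff)
      qed
    qed
    have "(Var v * q) \<odot>\<^bsub>A\<^esub> x = Var v \<odot>\<^bsub>A\<^esub> (q \<odot>\<^bsub>A\<^esub> x)"
      using A.smult_assoc1[of "Var v" q x] Var v by simp
    moreover have "(Var v * q) \<odot>\<^bsub>B\<^esub> f x = Var v \<odot>\<^bsub>B\<^esub> (q \<odot>\<^bsub>B\<^esub> f x)"
      using B.smult_assoc1[of "Var v" q "f x"] Var v f by simp
    moreover have "q \<odot>\<^bsub>A\<^esub> x \<in> carrier A" using A.smult_closed[of q x] Var by simp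
    ultimately show ?case using Var V by simp
  qed
  show ?thesis
    unfolding gmor_def
  proof (intro conjI allI ballI)
    show "gobj n A" "gobj n B" by (rule A.gobj B.gobj)+
    show "lin_map n A B f" using add smult f by (auto simp: lin_map_def hom_def xyring_eq)
    show "f ` cmp A i q \<subseteq> cmp B i q" for i q
    proof (cases "i = a")
      case True
      then show ?thesis using f G by (auto simp: A.cmp_eq B.cmp_eq cmor_def)
    next
      case False
      then show ?thesis using zero by (simp add: A.cmp_eq B.cmp_eq)
    qed
    show "f (bd A x) = bd B (f x)" if "x \<in> carrier A" for x
      using that f zero by (simp add: A.bd_zero B.bd_zero)
  qed
qed

section \<open>Equality of morphisms in the localization\<close>

lemma gobj_module: "gobj n A \<Longrightarrow> module (xyring n) A" by (simp add: gobj_def)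

lemma gobj_cmp: assumes "gobj n A" shows "cmp A k q \<subseteq> carrier A" "x \<in> cmp A k q \<Longrightarrow> y \<in> cmp A k q \<Longrightarrow> x \<oplus>\<^bsub>A\<^esub> y \<in> cmp A k q"
    "\<zero>\<^bsub>A\<^esub> \<in> cmp A k q"
proof -
  interpret submodule "cmp A k q" "pol {}" A using assms by (simp add: gobj_def)
  show "cmp A k q \<subseteq> carrier A" "x \<in> cmp A k q \<Longrightarrow> y \<in> cmp A k q \<Longrightarrow> x \<oplus>\<^bsub>A\<^esub> y \<in> cmp A k q" "\<zero>\<^bsub>A\<^esub> \<in> cmp A k q"
    using subset m_closed[of x y] one_closed by auto
qed

lemma gobj_bd: "gobj n A \<Longrightarrow> x \<in> carrier A \<Longrightarrow> bd A x \<in> carrier A"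
  by (auto simp: gobj_def lin_map_def hom_def)

lemma gmor_closed: "gmor n A B f \<Longrightarrow> x \<in> carrier A \<Longrightarrow> f x \<in> carrier B"
  by (auto simp: gmor_def lin_map_def hom_def)

lemma gmor_ext:
  assumes f: "gmor n A B f" and eq: "\<And>x. x \<in> carrier A \<Longrightarrow> g x = f x"
  shows "gmor n A B g"
proof -
  have A: "gobj n A" using f by (simp add: gmor_def)
  interpret module "xyring n" A by (rule gobj_module[OF A])
  have "g ` cmp A k q = f ` cmp A k q" for k q using eq gobj_cmp(1)[OF A, of k q] by (auto simp: subset_eq image_iff)
  then show ?thesis using f eq gobj_bd[OF A] by (auto simp: gmor_def lin_map_def hom_def)
qed

lemma gmor_add:
  assumes f: "gmor n A B f" and g: "gmor n A B g"
  shows "gmor n A B (\<lambda>x. f x \<oplus>\<^bsub>B\<^esub> g x)"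
proof -
  have A: "gobj n A" and B: "gobj n B" using f by (simp_all add: gmor_def)
  interpret A: module "xyring n" A by (rule gobj_module[OF A])
  interpret B: module "xyring n" B by (rule gobj_module[OF B])
  have l: "lin_map n A B f" "lin_map n A B g" "lin_map n B B (bd B)" using f g B by (simp_all add: gmor_def gobj_def)
  have h: "f x \<in> carrier B" "g x \<in> carrier B" if "x \<in> carrier A" for x by (rule gmor_closed[OF f that], rule gmor_closed[OF g that])
  show ?thesis
    unfolding gmor_def
  proof (intro conjI allI ballI)
    show "lin_map n A B (\<lambda>x. f x \<oplus>\<^bsub>B\<^esub> g x)"
      unfolding lin_map_def
    proof (intro conjI ballI)
      show "(\<lambda>x. f x \<oplus>\<^bsub>B\<^esub> g x) \<in> hom (add_monoid A) (add_monoid B)"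
      proof (rule homI)
        fix x y assume xy: "x \<in> carrier (add_monoid A)" "y \<in> carrier (add_monoid A)"
        then have e: "f (x \<oplus>\<^bsub>A\<^esub> y) = f x \<oplus>\<^bsub>B\<^esub> f y" "g (x \<oplus>\<^bsub>A\<^esub> y) = g x \<oplus>\<^bsub>B\<^esub> g y"
          using l(1,2) by (simp_all add: lin_map_def hom_def)
        have c: "f x \<in> carrier B" "f y \<in> carrier B" "g x \<in> carrier B" "g y \<in> carrier B" using xy h by simp_all
        show "f (x \<otimes>\<^bsub>add_monoid A\<^esub> y) \<oplus>\<^bsub>B\<^esub> g (x \<otimes>\<^bsub>add_monoid A\<^esub> y) = (f x \<oplus>\<^bsub>B\<^esub> g x) \<otimes>\<^bsub>add_monoid B\<^esub> (f y \<oplus>\<^bsub>B\<^esub> g y)"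
          using c by (simp add: e B.a_ac)
      qed (use h in simp)
      fix r m assume r: "r \<in> carrier (xyring n)" and m: "m \<in> carrier A"
      then have "f (r \<odot>\<^bsub>A\<^esub> m) = r \<odot>\<^bsub>B\<^esub> f m" "g (r \<odot>\<^bsub>A\<^esub> m) = r \<odot>\<^bsub>B\<^esub> g m" using l(1,2) by (simp_all add: lin_map_def)
      then show "f (r \<odot>\<^bsub>A\<^esub> m) \<oplus>\<^bsub>B\<^esub> g (r \<odot>\<^bsub>A\<^esub> m) = r \<odot>\<^bsub>B\<^esub> (f m \<oplus>\<^bsub>B\<^esub> g m)"
        using B.smult_r_distr[OF r h[OF m]] by simp
    qed
    show "(\<lambda>x. f x \<oplus>\<^bsub>B\<^esub> g x) ` cmp A k q \<subseteq> cmp B k q" for k q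
      proof clarify
      fix x assume "x \<in> cmp A k q"
      moreover have "f ` cmp A k q \<subseteq> cmp B k q" "g ` cmp A k q \<subseteq> cmp B k q" using f g unfolding gmor_def by blast+
      ultimately have "f x \<in> cmp B k q" "g x \<in> cmp B k q" by blast+
      then show "f x \<oplus>\<^bsub>B\<^esub> g x \<in> cmp B k q" by (rule gobj_cmp(2)[OF B])
    qed
    show "f (bd A m) \<oplus>\<^bsub>B\<^esub> g (bd A m) = bd B (f m \<oplus>\<^bsub>B\<^esub> g m)" if "m \<in> carrier A" for m
      using that f g l(3) h by (simp add: gmor_def lin_map_def hom_def)
  qed (use A B in auto)
qed

lemma gmor_id: "gobj n A \<Longrightarrow> gmor n A A (\<lambda>x. x)"
  by (auto simp: gmor_def lin_map_def hom_def)

lemma D_unfilt_sel [simp]: "mor (D_unfilt n) = gmor n" "ob (D_unfilt n) = gobj n"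
  by (simp_all add: D_unfilt_def)

lemma gen_hom: "gmor n A B f \<Longrightarrow> loc_hom (D_unfilt n) A B (Gen A f B)"
  by (rule loc_hom.intros) simp

lemma gmor_comp:
  assumes f: "gmor n A B f" and g: "gmor n B C g"
  shows "gmor n A C (\<lambda>x. g (f x))"
proof -
  have cl: "f x \<in> carrier B" if "x \<in> carrier A" for x by (rule gmor_closed[OF f that])
  have i: "f ` cmp A k q \<subseteq> cmp B k q" "g ` cmp B k q \<subseteq> cmp C k q" for k q using f g unfolding gmor_def by blast+
  have l: "lin_map n A B f" "lin_map n B C g" using f g by (simp_all add: gmor_def)
  show ?thesis
    unfolding gmor_def
  proof (intro conjI allI ballI)
    show "lin_map n A C (\<lambda>x. g (f x))"
      unfolding lin_map_def
    proof (intro conjI ballI)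
      show "(\<lambda>x. g (f x)) \<in> hom (add_monoid A) (add_monoid C)"
        using l cl gmor_closed[OF g] by (simp add: lin_map_def hom_def)
      show "g (f (r \<odot>\<^bsub>A\<^esub> m)) = r \<odot>\<^bsub>C\<^esub> g (f m)" if "r \<in> carrier (xyring n)" "m \<in> carrier A" for r m
        using l cl that by (simp add: lin_map_def)
    qed
    show "(\<lambda>x. g (f x)) ` cmp A k q \<subseteq> cmp C k q" for k q using i[of k q] by blast
    show "g (f (bd A m)) = bd C (g (f m))" if "m \<in> carrier A" for m using f g cl that by (simp add: gmor_def)
  qed (use f g in \<open>simp_all add: gmor_def\<close>)
qed

lemma gen_cmp:
  assumes f: "gmor n A B f" and g: "gmor n B C g" and eq: "\<And>x. x \<in> carrier A \<Longrightarrow> h x = g (f x)"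
  shows "loc_eq (D_unfilt n) A C (Cmp (Gen B g C) (Gen A f B)) (Gen A h C)"
proof (rule le_trans)
  show "loc_eq (D_unfilt n) A C (Cmp (Gen B g C) (Gen A f B)) (Gen A (\<lambda>x. g (f x)) C)"
    using f g by (intro le_gen_comp) auto
  show "loc_eq (D_unfilt n) A C (Gen A (\<lambda>x. g (f x)) C) (Gen A h C)"
    using eq gmor_comp[OF f g] gmor_ext[OF gmor_comp[OF f g] eq] by (intro le_gen_ext) auto
qed

text \<open>The relations of the localization do not list this identity. But f + f agrees with f
  pointwise, so the generator equals its own double and is zero by cancellation in the group of
  morphisms.\<close>

lemma gen_zero:
  assumes f: "gmor n A B f" and z: "\<And>x. x \<in> carrier A \<Longrightarrow> f x = \<zero>\<^bsub>B\<^esub>"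
  shows "loc_eq (D_unfilt n) A B (Gen A f B) (Zero A B)"
proof -
  let ?U = "D_unfilt n" let ?f = "Gen A f B"
  have A: "ob ?U A" and B: "ob ?U B" using f by (simp_all add: gmor_def)
  interpret B: module "xyring n" B using B by (simp add: gobj_module)
  note h = gen_hom[OF f]
  have ff: "loc_eq ?U A B (Add ?f ?f) ?f"
  proof (rule le_trans)
    show "loc_eq ?U A B (Add ?f ?f) (Gen A (\<lambda>x. f x \<oplus>\<^bsub>B\<^esub> f x) B)" using f by (intro le_gen_add) auto
    show "loc_eq ?U A B (Gen A (\<lambda>x. f x \<oplus>\<^bsub>B\<^esub> f x) B) ?f"
      using f gmor_ext[OF f, of "\<lambda>x. f x \<oplus>\<^bsub>B\<^esub> f x"] z by (intro le_gen_ext) auto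
  qed
  have n: "loc_hom ?U A B (Neg ?f)" using h by (rule loc_hom.intros)
  have 1: "loc_eq ?U A B ?f (Add ?f (Zero A B))" by (rule le_sym[OF le_zero[OF A B h]])
  have 2: "loc_eq ?U A B (Add ?f (Zero A B)) (Add ?f (Add ?f (Neg ?f)))"
    by (rule le_Add[OF le_refl[OF h] le_sym[OF le_neg[OF A B h]]])
  have 3: "loc_eq ?U A B (Add ?f (Add ?f (Neg ?f))) (Add (Add ?f ?f) (Neg ?f))" by (rule le_add_assoc[OF h h n])
  have 4: "loc_eq ?U A B (Add (Add ?f ?f) (Neg ?f)) (Add ?f (Neg ?f))" by (rule le_Add[OF ff le_refl[OF n]])
  show ?thesis by (rule le_trans[OF 1 le_trans[OF 2 le_trans[OF 3 le_trans[OF 4 le_neg[OF A B h]]]]])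
qed

text \<open>The homotopy relation asks for a difference of formal terms. Deriving it from a
  pointwise sum makes it unnecessary to form the negative of a map.\<close>

lemma gen_diff:
  assumes P: "gmor n A B P" and I: "gmor n A B I" and Q: "gmor n A B Q" "gmor n A B Q'"
    and eq: "\<And>x. x \<in> carrier A \<Longrightarrow> P x = (Q x \<oplus>\<^bsub>B\<^esub> Q' x) \<oplus>\<^bsub>B\<^esub> I x"
  shows "loc_eq (D_unfilt n) A B (Add (Gen A P B) (Neg (Gen A I B))) (Add (Gen A Q B) (Gen A Q' B))"
proof -
  let ?U = "D_unfilt n" let ?q = "\<lambda>x. Q x \<oplus>\<^bsub>B\<^esub> Q' x"
  let ?I = "Gen A I B" and ?q' = "Gen A ?q B"
  have A: "ob ?U A" and B: "ob ?U B" using P by (simp_all add: gmor_def)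
  note q = gmor_add[OF Q]
  have i: "loc_hom ?U A B ?I" "loc_hom ?U A B (Neg ?I)" "loc_hom ?U A B ?q'"
    using gen_hom[OF I] gen_hom[OF q] by (auto intro: loc_hom.intros)
  have 1: "loc_eq ?U A B (Gen A P B) (Add ?q' ?I)"
  proof (rule le_trans)
    show "loc_eq ?U A B (Gen A P B) (Gen A (\<lambda>x. ?q x \<oplus>\<^bsub>B\<^esub> I x) B)"
      using P gmor_add[OF q I] eq by (intro le_gen_ext) auto
    show "loc_eq ?U A B (Gen A (\<lambda>x. ?q x \<oplus>\<^bsub>B\<^esub> I x) B) (Add ?q' ?I)"
      using q I by (intro le_sym[OF le_gen_add]) auto
  qed
  have 2: "loc_eq ?U A B (Add (Add ?q' ?I) (Neg ?I)) (Add ?q' (Add ?I (Neg ?I)))"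
    by (rule le_sym[OF le_add_assoc[OF i(3,1,2)]])
  have 3: "loc_eq ?U A B (Add ?q' (Add ?I (Neg ?I))) (Add ?q' (Zero A B))"
    by (rule le_Add[OF le_refl[OF i(3)] le_neg[OF A B i(1)]])
  have 4: "loc_eq ?U A B ?q' (Add (Gen A Q B) (Gen A Q' B))"
    using Q by (intro le_sym[OF le_gen_add]) auto
  show ?thesis
    by (rule le_trans[OF le_Add[OF 1 le_refl[OF i(2)]] le_trans[OF 2 le_trans[OF 3 le_trans[OF le_zero[OF A B i(3)] 4]]]])
qed

subsection \<open>The maps as morphisms in coordinates\<close>

lemma DSSS_DSSS: "a \<noteq> c \<Longrightarrow> a \<noteq> 2 \<Longrightarrow> c \<noteq> 2 \<Longrightarrow> DSSS a c (DSSS a c w) k = 0"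
  by (rule trits3_cases[where k=k], elim insertE emptyE; simp add: DSSS_def DSS_def Dsig_def Ysig_def; simp add: algebra_simps)

lemma qhom_xv_mult: "p \<in> qhom (d - 2) \<Longrightarrow> xv i * p \<in> qhom d"
  by (rule qhom_mult[of _ 2 _ "d - 2"]) auto

lemma qhom_xv_mult2: "p \<in> qhom (d - 2) \<Longrightarrow> (xv i + xv j) * p \<in> qhom d"
  by (simp add: distrib_right qhom_add qhom_xv_mult)

lemma vecs_off: "v \<in> vecs n {k. P k} \<Longrightarrow> \<not> P k \<Longrightarrow> v k = 0" and vecs_RX: "v \<in> vecs n K \<Longrightarrow> v k \<in> RX n"
  by (auto simp: vecs_def)

lemma cmor_F:
  assumes ac: "a \<noteq> c" "a = 1 \<or> a = 3" "c = 1 \<or> c = 3"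
  shows "cmor 3 {k. pos3 k = p} {k. pos3 k = p} qd3 (YSSS a c) (YSSS c a) (Fmap a c)"
  unfolding cmor_def
proof (intro conjI allI ballI impI)
  have ac2: "a \<noteq> 2" "c \<noteq> 2" "a \<in> {1..3}" "c \<in> {1..3}" using ac by auto
  show "Fmap a c (v + w) = Fmap a c v + Fmap a c w" for v w
  proof
    show "Fmap a c (v + w) k = (Fmap a c v + Fmap a c w) k" for k
      by (rule trits3_cases[where k=k], elim insertE emptyE; simp; simp add: algebra_simps)
  qed
  show "Fmap a c (\<lambda>k. r * v k) = (\<lambda>k. r * Fmap a c v k)" for r v
  proof
    show "Fmap a c (\<lambda>k. r * v k) k = r * Fmap a c v k" for k
      by (rule trits3_cases[where k=k], elim insertE emptyE; simp; simp add: algebra_simps)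
  qed
  show "Fmap a c (YSSS a c i v) = YSSS c a i (Fmap a c v)" if "i \<in> {1..3}" for i v
  proof
    have "i = a \<or> i = 2 \<or> i = c" using that ac by auto
    then show "Fmap a c (YSSS a c i v) k = YSSS c a i (Fmap a c v) k" for k using Fmap_Y[OF ac(1) ac2(1,2)] by simp
  qed
  show "Fmap a c v \<in> vecs 3 {k. pos3 k = p}" if v: "v \<in> vecs 3 {k. pos3 k = p}" for v
  proof -
    have RX: "xv a \<in> RX 3" "xv c \<in> RX 3" "xv 2 \<in> RX 3" using ac2 by auto
    have "Fmap a c v k \<in> RX 3" for k
      by (rule trits3_cases[where k=k], elim insertE emptyE; simp add: vecs_RX[OF v] RX del: PR_Var)
    moreover have "pos3 k \<noteq> p \<longrightarrow> Fmap a c v k = 0" for k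
      by (rule trits3_cases[where k=k], elim insertE emptyE; simp add: vecs_off[OF v] pos3_def pos2_def tpos_def)
    ultimately show ?thesis by (auto simp: vecs_def)
  qed
  show "Fmap a c v k \<in> qhom (q - qd3 k)" if v: "\<forall>k. v k \<in> qhom (q - qd3 k)" for v q k
  proof -
    have v': "v k \<in> qhom d" if "d = q - qd3 k" for k d unfolding that using v by blast
    show ?thesis
      by (rule trits3_cases[where k=k], elim insertE emptyE; simp only: Fmap.simps mult.assoc;
        intro qhom_0 qhom_add qhom_diff qhom_uminus qhom_xv_mult2 qhom_xv_mult v'; simp add: qd3_def qd2_def tqd_def)
  qed
qed

lemma cmor_H:
  assumes ac: "a \<noteq> c" "a = 1 \<or> a = 3" "c = 1 \<or> c = 3" and p': "p' = p + 2"
  shows "cmor 3 {k. pos3 k = p} {k. pos3 k = p'} qd3 (YSSS a c) (YSSS a c) (Hmap a)"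
  unfolding cmor_def
proof (intro conjI allI ballI impI)
  have ac2: "a \<noteq> 2" "c \<noteq> 2" "a \<in> {1..3}" "c \<in> {1..3}" using ac by auto
  show "Hmap a (v + w) = Hmap a v + Hmap a w" for v w
  proof
    show "Hmap a (v + w) k = (Hmap a v + Hmap a w) k" for k
      by (rule trits3_cases[where k=k], elim insertE emptyE; simp; simp add: algebra_simps)
  qed
  show "Hmap a (\<lambda>k. r * v k) = (\<lambda>k. r * Hmap a v k)" for r v
  proof
    show "Hmap a (\<lambda>k. r * v k) k = r * Hmap a v k" for k
      by (rule trits3_cases[where k=k], elim insertE emptyE; simp; simp add: algebra_simps)
  qed
  show "Hmap a (YSSS a c i v) = YSSS a c i (Hmap a v)" if "i \<in> {1..3}" for i v
  proof
    have "i = a \<or> i = 2 \<or> i = c" using that ac by auto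
    then show "Hmap a (YSSS a c i v) k = YSSS a c i (Hmap a v) k" for k using Hmap_Y[OF ac(1) ac2(1,2)] by simp
  qed
  show "Hmap a v \<in> vecs 3 {k. pos3 k = p'}" if v: "v \<in> vecs 3 {k. pos3 k = p}" for v
  proof -
    have RX: "xv a \<in> RX 3" "xv c \<in> RX 3" "xv 2 \<in> RX 3" using ac2 by auto
    have "Hmap a v k \<in> RX 3" for k
      by (rule trits3_cases[where k=k], elim insertE emptyE; simp add: vecs_RX[OF v] RX del: PR_Var)
    moreover have "pos3 k \<noteq> p' \<longrightarrow> Hmap a v k = 0" for k
      by (rule trits3_cases[where k=k], elim insertE emptyE; simp add: vecs_off[OF v] p' pos3_def pos2_def tpos_def)
    ultimately show ?thesis by (auto simp: vecs_def)
  qed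
  show "Hmap a v k \<in> qhom (q - qd3 k)" if v: "\<forall>k. v k \<in> qhom (q - qd3 k)" for v q k
  proof -
    have v': "v k \<in> qhom d" if "d = q - qd3 k" for k d unfolding that using v by blast
    show ?thesis
      by (rule trits3_cases[where k=k], elim insertE emptyE; simp only: Hmap.simps mult.assoc;
        intro qhom_0 qhom_add qhom_diff qhom_uminus qhom_xv_mult2 qhom_xv_mult v'; simp add: qd3_def qd2_def tqd_def)
  qed
qed

lemma cmor_D:
  assumes ac: "a \<noteq> c" "a = 1 \<or> a = 3" "c = 1 \<or> c = 3" and p': "p' = p - 2"
  shows "cmor 3 {k. pos3 k = p} {k. pos3 k = p'} qd3 (YSSS a c) (YSSS a c) (DSSS a c)"
  unfolding cmor_def
proof (intro conjI allI ballI impI)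
  interpret O: omodel 3 "triple a c" pos3 3 qd3 "Phi5 a c" "YSSS a c" "DSSS a c" by (rule omodel_SSS[OF ac(2,3)])
  have ac2: "a \<noteq> 2" "c \<noteq> 2" "a \<in> {1..3}" "c \<in> {1..3}" using ac by auto
  show "DSSS a c (v + w) = DSSS a c v + DSSS a c w" for v w by (rule O.D_add)
  show "DSSS a c (\<lambda>k. r * v k) = (\<lambda>k. r * DSSS a c v k)" for r v by (rule O.D_scale)
  show "DSSS a c (YSSS a c i v) = YSSS a c i (DSSS a c v)" if "i \<in> {1..3}" for i v by (rule O.D_Y[OF that])
  \<comment> \<open>\<open>v\<close> is the coordinate vector of an element at position
    \<open>p\<close>, and the differential sends that element to position
    \<open>p - 2\<close>.\<close>
  show "DSSS a c v \<in> vecs 3 {k. pos3 k = p'}" if v: "v \<in> vecs 3 {k. pos3 k = p}" for v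
    using O.Phi_d[of "O.X.\<Psi> p v" p] O.X.Phi_Psi[OF v] O.X.Psi_closed[OF v] O.d_closed[of "O.X.\<Psi> p v" p]
      O.X.Phi_vecs[of "odiff (triple a c) p (O.X.\<Psi> p v)" p'] by (simp add: p')
  show "DSSS a c v k \<in> qhom (q - qd3 k)" if v: "\<forall>k. v k \<in> qhom (q - qd3 k)" for v q k
  proof -
    have v': "v k \<in> qhom d" if "d = q - qd3 k" for k d unfolding that using v by blast
    show ?thesis
      by (rule trits3_cases[where k=k], elim insertE emptyE; simp add: DSSS_def DSS_def Dsig_def Ysig_def ac ac(1)[symmetric] ac2 del: qhom_add qhom_diff qhom_uminus qhom_uminus_iff;
        intro qhom_0 qhom_add qhom_diff qhom_uminus qhom_xv_mult2 qhom_xv_mult v'; simp add: qd3_def qd2_def tqd_def)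
  qed
qed

section \<open>The homotopy equivalence\<close>

text \<open>The negation inside \<open>ashift\<close> is determined by the carrier, sum and zero,
  which truncation keeps. So forgetting the filtration commutes with the shift.\<close>

lemma truncate_ashift [simp]: "gcx.truncate (ashift k A) = ashift k (gcx.truncate A)"
  by (auto simp: gcx.truncate_def ashift_def a_inv_def m_inv_def fun_eq_iff)

lemma ashift_sel [simp]: "carrier (ashift k A) = carrier A" "smult (ashift k A) = smult A"
  and truncate_sel [simp]: "carrier (gcx.truncate A) = carrier A" "smult (gcx.truncate A) = smult A"
  by (simp_all add: ashift_def gcx.truncate_def)

lemma truncate_shalf [simp]: "gcx.truncate (shalf j A) = gcx.truncate A"
  by (simp add: gcx.truncate_def shalf_def)

section \<open>Objects that share the coordinates of a position\<close>

context omodel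
begin

text \<open>Shifted, truncated and refiltered versions of one position have the same elements and
  coordinates; only the \<open>a\<close>-degree \<open>b\<close> is recorded. A map given in
  coordinates is then a morphism between any two such versions of equal \<open>b\<close>.\<close>

definition obj :: "int \<Rightarrow> int \<Rightarrow> ('a, 'e) gcx_scheme \<Rightarrow> bool" where
  "obj p b A \<longleftrightarrow> xfree n A {k. pos k = p} (\<Phi> p) b qd \<and> carrier A = carrier (opos C p) \<and> smult A = smult (opos C p)"

lemma obj_opos: "obj p ((p - m) div 2) (opos C p)"
  by (simp add: obj_def xfree)

lemma obj_shalf: "obj p b (A :: 'a fcx) \<Longrightarrow> obj p b (shalf j A)"
  using xfree_shalf by (auto simp: obj_def) (simp_all add: shalf_def)

lemma obj_truncate: "obj p b A \<Longrightarrow> obj p b (gcx.truncate A)"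
  by (simp add: obj_def xfree_truncate)

lemma obj_ashift: "obj p b A \<Longrightarrow> obj p (b + k) (ashift k A)"
  by (simp add: obj_def xfree_ashift)

lemma obj_xfree: "obj p b A \<Longrightarrow> xfree n A {k. pos k = p} (\<Phi> p) b qd"
  by (simp add: obj_def)

lemma obj_trivial:
  assumes "obj p b A" "\<And>k. pos k \<noteq> p" shows "carrier A = {\<zero>\<^bsub>A\<^esub>}"
proof -
  have e: "{k. pos k = p} = {}" using assms(2) by auto
  from obj_xfree[OF assms(1)] show ?thesis unfolding e by (rule xfree_empty(1))
qed

end

lemma gmor_obj:
  assumes C: "omodel n C pos m qd \<Phi> Y D" and E: "omodel n E pos m qd \<Psi> Z D'"
    and A: "omodel.obj n C pos qd \<Phi> p b A" and B: "omodel.obj n E pos qd \<Psi> p' b B"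
    and G: "cmor n {k. pos k = p} {k. pos k = p'} qd Y Z G"
    and f: "\<And>x. x \<in> carrier (opos C p) \<Longrightarrow> f x \<in> carrier (opos E p') \<and> \<Psi> p' (f x) = G (\<Phi> p x)"
  shows "gmor n A B f"
proof -
  interpret C: omodel n C pos m qd \<Phi> Y D by (rule C)
  interpret E: omodel n E pos m qd \<Psi> Z D' by (rule E)
  show ?thesis
    by (rule gmor_coord[OF C.obj_xfree[OF A] E.obj_xfree[OF B] _ _ G])
      (use A B f C.Phi_Y E.Phi_Y in \<open>simp_all add: C.obj_def E.obj_def del: atLeastAtMost_iff\<close>)
qed

definition fmap where
  "fmap a c p x = xfree.\<Psi> (opos (triple c a) p) (Phi5 c a p) (Fmap a c (Phi5 a c p x))"

definition hmap where
  "hmap a c p x = xfree.\<Psi> (opos (triple a c) (p + 2)) (Phi5 a c (p + 2)) (Hmap a (Phi5 a c p x))"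

locale word =
  fixes a c :: nat
  assumes ac: "a \<noteq> c" "a = 1 \<or> a = 3" "c = 1 \<or> c = 3"
begin

sublocale L: omodel 3 "triple a c" pos3 3 qd3 "Phi5 a c" "YSSS a c" "DSSS a c" by (rule omodel_SSS[OF ac(2,3)])
sublocale R: omodel 3 "triple c a" pos3 3 qd3 "Phi5 c a" "YSSS c a" "DSSS c a" by (rule omodel_SSS[OF ac(3,2)])

lemma ac2: "a \<noteq> 2" "c \<noteq> 2" "a \<in> {1..3}" "c \<in> {1..3}" using ac by auto

lemma fmap:
  assumes "x \<in> carrier (opos (triple a c) p)"
  shows "fmap a c p x \<in> carrier (opos (triple c a) p)" "Phi5 c a p (fmap a c p x) = Fmap a c (Phi5 a c p x)"
proof -
  have "Fmap a c (Phi5 a c p x) \<in> vecs 3 {k. pos3 k = p}"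
    using cmor_F[OF ac] L.X.Phi_vecs[OF assms] by (simp add: cmor_def)
  then show "fmap a c p x \<in> carrier (opos (triple c a) p)" "Phi5 c a p (fmap a c p x) = Fmap a c (Phi5 a c p x)"
    unfolding fmap_def by (rule R.X.Psi_closed, rule R.X.Phi_Psi)
qed

lemma hmap:
  assumes "x \<in> carrier (opos (triple a c) p)"
  shows "hmap a c p x \<in> carrier (opos (triple a c) (p + 2))" "Phi5 a c (p + 2) (hmap a c p x) = Hmap a (Phi5 a c p x)"
proof -
  have "Hmap a (Phi5 a c p x) \<in> vecs 3 {k. pos3 k = p + 2}"
    using cmor_H[OF ac refl] L.X.Phi_vecs[OF assms] by (simp add: cmor_def)
  then show "hmap a c p x \<in> carrier (opos (triple a c) (p + 2))" "Phi5 a c (p + 2) (hmap a c p x) = Hmap a (Phi5 a c p x)"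
    unfolding hmap_def by (rule L.X.Psi_closed, rule L.X.Phi_Psi)
qed

lemma gmor_f: "L.obj p b A \<Longrightarrow> R.obj p b B \<Longrightarrow> gmor 3 A B (fmap a c p)"
  by (rule gmor_obj[OF L.omodel_axioms R.omodel_axioms _ _ cmor_F[OF ac]]) (auto simp: fmap)

lemma gmor_d: "L.obj p b A \<Longrightarrow> L.obj (p - 2) b B \<Longrightarrow> gmor 3 A B (odiff (triple a c) p)"
  by (rule gmor_obj[OF L.omodel_axioms L.omodel_axioms _ _ cmor_D[OF ac refl]]) (auto simp: L.Phi_d L.d_closed)

lemma gmor_h: "L.obj p b A \<Longrightarrow> L.obj (p + 2) b B \<Longrightarrow> gmor 3 A B (hmap a c p)"
  by (rule gmor_obj[OF L.omodel_axioms L.omodel_axioms _ _ cmor_H[OF ac refl]]) (auto simp: hmap)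

abbreviation T where "T p \<equiv> gcx.truncate (opos (triple a c) p)"
abbreviation T' where "T' p \<equiv> gcx.truncate (opos (triple c a) p)"

text \<open>The sources and targets that occur in chain maps and homotopies. Lowering the position
  by 2 lowers the \<open>a\<close>-degree by 1, which one application of \<open>ashift 1\<close>
  makes up for.\<close>

lemma objs:
  "L.obj p ((p - 3) div 2) (T p)" "L.obj p ((p - 3) div 2 + 1) (ashift 1 (T p))"
  "L.obj (p - 2) ((p - 3) div 2) (ashift 1 (T (p - 2)))"
  "L.obj (p - 2) ((p - 3) div 2 + 1) (ashift 1 (ashift 1 (T (p - 2))))"
  "L.obj (p - 4) ((p - 3) div 2) (ashift 1 (ashift 1 (T (p - 4))))"
  "L.obj (p + 2) ((p - 3) div 2 + 1) (T (p + 2))"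
proof -
  have b: "(p - 2 - 3) div 2 + 1 = (p - 3) div 2" "(p - 4 - 3) div 2 + 1 + 1 = (p - 3) div 2" "(p + 2 - 3) div 2 = (p - 3) div 2 + 1"
    by presburger+
  show T: "L.obj p ((p - 3) div 2) (T p)" for p by (rule L.obj_truncate[OF L.obj_opos])
  then show "L.obj p ((p - 3) div 2 + 1) (ashift 1 (T p))" by (rule L.obj_ashift)
  show A: "L.obj (p - 2) ((p - 3) div 2) (ashift 1 (T (p - 2)))" using L.obj_ashift[OF T[of "p - 2"], of 1] unfolding b .
  then show "L.obj (p - 2) ((p - 3) div 2 + 1) (ashift 1 (ashift 1 (T (p - 2))))" by (rule L.obj_ashift)
  show "L.obj (p - 4) ((p - 3) div 2) (ashift 1 (ashift 1 (T (p - 4))))"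
    using L.obj_ashift[OF L.obj_ashift[OF T[of "p - 4"]], of 1 1] unfolding b .
  show "L.obj (p + 2) ((p - 3) div 2 + 1) (T (p + 2))" using T[of "p + 2"] unfolding b .
qed

lemma forget_triple: "dobj (forget_dcx (dcx_of (triple a c))) = T"
  "ddiff (forget_dcx (dcx_of (triple a c))) = (\<lambda>p. Gen (T p) (odiff (triple a c) p) (ashift 1 (T (p - 2))))"
  by (simp_all add: forget_dcx_def dcx_of_def forget_mor_def fun_eq_iff)

lemma is_dcx: "is_dcx (D_unfilt 3) (forget_dcx (dcx_of (triple a c)))"
  unfolding is_dcx_def forget_triple
proof (intro conjI allI)
  fix p
  show "ob (D_unfilt 3) (T p)" using xfree.gobj[OF L.obj_xfree[OF objs(1)]] by simp
  show "loc_hom (D_unfilt 3) (T p) (ashift 1 (T (p - 2))) (Gen (T p) (odiff (triple a c) p) (ashift 1 (T (p - 2))))"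
    by (rule gen_hom[OF gmor_d[OF objs(1,3)]])
  let ?d = "odiff (triple a c)" let ?B = "ashift 1 (T (p - 2))" let ?C = "ashift 1 (ashift 1 (T (p - 4)))"
  have d1: "gmor 3 (T p) ?B (?d p)" by (rule gmor_d[OF objs(1,3)])
  have "p - 2 - 2 = p - 4" by simp
  then have d2: "gmor 3 ?B ?C (?d (p - 2))" using gmor_d[OF objs(3), where B="?C"] objs(5) by simp
  interpret X: xfree 3 ?C "{k. pos3 k = p - 4}" "Phi5 a c (p - 4)" "(p - 3) div 2" qd3 by (rule L.obj_xfree[OF objs(5)])
  have z: "?d (p - 2) (?d p x) = \<zero>\<^bsub>?C\<^esub>" if "x \<in> carrier (T p)" for x
  proof (rule X.Phi_inject)
    have x: "x \<in> carrier (opos (triple a c) p)" using that by simp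
    show "Phi5 a c (p - 4) (?d (p - 2) (?d p x)) = Phi5 a c (p - 4) \<zero>\<^bsub>?C\<^esub>"
      using L.Phi_d[OF L.d_closed[OF x]] L.Phi_d[OF x] DSSS_DSSS[OF ac(1) ac2(1,2)] by (simp add: fun_eq_iff)
    show "?d (p - 2) (?d p x) \<in> carrier ?C" using L.d_closed[OF L.d_closed[OF x]] by simp
  qed (rule X.zero_closed)
  have c: "gmor 3 (T p) ?C (\<lambda>x. ?d (p - 2) (?d p x))" by (rule gmor_comp[OF d1 d2])
  have "loc_eq (D_unfilt 3) (T p) ?C (Cmp (Gen ?B (?d (p - 2)) ?C) (Gen (T p) (?d p) ?B)) (Zero (T p) ?C)"
    by (rule le_trans[OF gen_cmp[OF d1 d2 refl] gen_zero[OF c z]])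
  then show "loc_eq (D_unfilt 3) (T p) ?C
      (Cmp (ashift_mor (Gen (T (p - 2)) (?d (p - 2)) (ashift 1 (T (p - 2 - 2))))) (Gen (T p) (?d p) ?B)) (Zero (T p) ?C)"
    by (simp add: ashift_mor_def)
next
  show "\<exists>N. \<forall>p. \<bar>p\<bar> > N \<longrightarrow> loc_eq (D_unfilt 3) (T p) (T p) (id_mor (T p)) (Zero (T p) (T p))"
  \<comment> \<open>Positions with basis elements lie between -3 and 3. Beyond them the objects are
    zero, and the identity is a zero map.\<close>
  proof (intro exI[of _ 3] allI impI)
    fix p :: int assume p: "3 < \<bar>p\<bar>"
    have "\<bar>pos3 k\<bar> \<le> 3" for k by (auto simp: pos3_def pos2_def tpos_def)
    then have "pos3 k \<noteq> p" for k using p by (metis not_less)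
    then have "x = \<zero>\<^bsub>T p\<^esub>" if "x \<in> carrier (T p)" for x using that L.obj_trivial[OF objs(1)] by blast
    then show "loc_eq (D_unfilt 3) (T p) (T p) (id_mor (T p)) (Zero (T p) (T p))"
      unfolding id_mor_def by (intro gen_zero gmor_id xfree.gobj[OF L.obj_xfree[OF objs(1)]])
  qed
qed

end

text \<open>The hypotheses on \<open>a\<close> and \<open>c\<close> are symmetric, so every result
  about one word has a counterpart for the other; the primed names below are these
  counterparts.\<close>

lemma word_swap: "word a c \<Longrightarrow> word c a"
  by (auto simp: word_def)

context word
begin

lemmas objs' = word.objs[OF word_swap[OF word_axioms]]
lemmas gmor_d' = word.gmor_d[OF word_swap[OF word_axioms]]
lemmas forget_triple' = word.forget_triple[OF word_swap[OF word_axioms]]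
lemmas fmap' = word.fmap[OF word_swap[OF word_axioms]]
lemmas gmor_f' = word.gmor_f[OF word_swap[OF word_axioms]]

abbreviation floc where "floc p \<equiv> Gen (T p) (fmap a c p) (T' p)"
abbreviation gloc where "gloc p \<equiv> Gen (T' p) (fmap c a p) (T p)"

lemma chain_map_floc: "chain_map (D_unfilt 3) (forget_dcx (dcx_of (triple a c))) (forget_dcx (dcx_of (triple c a))) floc"
  unfolding chain_map_def forget_triple forget_triple'
proof (intro conjI allI)
  fix p
  have f: "gmor 3 (T p) (T' p) (fmap a c p)" by (rule gmor_f[OF objs(1) objs'(1)])
  have f1: "gmor 3 (ashift 1 (T (p - 2))) (ashift 1 (T' (p - 2))) (fmap a c (p - 2))" by (rule gmor_f[OF objs(3) objs'(3)])
  have d: "gmor 3 (T p) (ashift 1 (T (p - 2))) (odiff (triple a c) p)" by (rule gmor_d[OF objs(1,3)])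
  have d': "gmor 3 (T' p) (ashift 1 (T' (p - 2))) (odiff (triple c a) p)" by (rule gmor_d'[OF objs'(1,3)])
  show "loc_hom (D_unfilt 3) (T p) (T' p) (floc p)" by (rule gen_hom[OF f])
  have eq: "odiff (triple c a) p (fmap a c p x) = fmap a c (p - 2) (odiff (triple a c) p x)" if "x \<in> carrier (T p)" for x
  proof (rule R.X.Phi_inject[where p="p - 2"])
    have x: "x \<in> carrier (opos (triple a c) p)" using that by simp
    note cl = fmap[OF x] L.d_closed[OF x] R.d_closed[OF fmap(1)[OF x]] fmap[OF L.d_closed[OF x]]
    show "odiff (triple c a) p (fmap a c p x) \<in> carrier (opos (triple c a) (p - 2))"
      "fmap a c (p - 2) (odiff (triple a c) p x) \<in> carrier (opos (triple c a) (p - 2))" by (rule cl)+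
    show "Phi5 c a (p - 2) (odiff (triple c a) p (fmap a c p x)) = Phi5 c a (p - 2) (fmap a c (p - 2) (odiff (triple a c) p x))"
      unfolding R.Phi_d[OF cl(1)] cl(2,6) L.Phi_d[OF x] by (rule ext) (rule Fmap_D[OF ac(1) ac2(1,2)])
  qed
  have "loc_eq (D_unfilt 3) (T p) (ashift 1 (T' (p - 2)))
      (Cmp (Gen (T' p) (odiff (triple c a) p) (ashift 1 (T' (p - 2)))) (floc p))
      (Cmp (Gen (ashift 1 (T (p - 2))) (fmap a c (p - 2)) (ashift 1 (T' (p - 2)))) (Gen (T p) (odiff (triple a c) p) (ashift 1 (T (p - 2)))))"
    by (rule le_trans[OF gen_cmp[OF f d'] le_sym[OF gen_cmp[OF d f1]]]) (rule refl, erule eq)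
  then show "loc_eq (D_unfilt 3) (T p) (ashift 1 (T' (p - 2)))
      (Cmp (Gen (T' p) (odiff (triple c a) p) (ashift 1 (T' (p - 2)))) (floc p))
      (Cmp (ashift_mor (floc (p - 2))) (Gen (T p) (odiff (triple a c) p) (ashift 1 (T (p - 2)))))"
    by (simp add: ashift_mor_def)
qed

text \<open>In coordinates this is \<open>Fmap_Hmap\<close>, in the form g f = (d h + h d) + 1. All
  maps are regarded as maps between objects shifted once more by \<open>ashift 1\<close>, since the
  homotopy relation is stated after that shift.\<close>

lemma homotopic_gf: "homotopic (D_unfilt 3) (forget_dcx (dcx_of (triple a c))) (forget_dcx (dcx_of (triple a c)))
    (\<lambda>p. Cmp (gloc p) (floc p)) (\<lambda>p. id_mor (dobj (forget_dcx (dcx_of (triple a c))) p))"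
  unfolding homotopic_def forget_triple
proof (rule exI[of _ "\<lambda>p. Gen (ashift 1 (T p)) (hmap a c p) (T (p + 2))"], intro conjI allI)
  fix p
  let ?d = "odiff (triple a c)" let ?A = "ashift 1 (T p)" let ?B = "ashift 1 (T' p)" let ?E = "ashift 1 (ashift 1 (T (p - 2)))"
  have h: "gmor 3 ?A (T (p + 2)) (hmap a c p)" by (rule gmor_h[OF objs(2,6)])
  show "loc_hom (D_unfilt 3) ?A (T (p + 2)) (Gen ?A (hmap a c p) (T (p + 2)))" by (rule gen_hom[OF h])
  have p2: "p + 2 - 2 = p" "p - 2 + 2 = p" by simp_all
  have d: "gmor 3 (T (p + 2)) ?A (?d (p + 2))" using gmor_d[OF objs(6)[of p], where B="?A"] objs(2)[of p] by (simp only: p2)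
  have d2: "gmor 3 ?A ?E (?d p)" by (rule gmor_d[OF objs(2,4)])
  have h2: "gmor 3 ?E ?A (hmap a c (p - 2))" using gmor_h[OF objs(4)[of p], where B="?A"] objs(2)[of p] by (simp only: p2)
  have f: "gmor 3 ?A ?B (fmap a c p)" by (rule gmor_f[OF objs(2) objs'(2)])
  have g: "gmor 3 ?B ?A (fmap c a p)" by (rule gmor_f'[OF objs'(2) objs(2)])
  have i: "gmor 3 ?A ?A (\<lambda>x. x)" by (rule gmor_id[OF xfree.gobj[OF L.obj_xfree[OF objs(2)]]])
  interpret X: xfree 3 ?A "{k. pos3 k = p}" "Phi5 a c p" "(p - 3) div 2 + 1" qd3 by (rule L.obj_xfree[OF objs(2)])
  have eq: "fmap c a p (fmap a c p x) = (?d (p + 2) (hmap a c p x) \<oplus>\<^bsub>?A\<^esub> hmap a c (p - 2) (?d p x)) \<oplus>\<^bsub>?A\<^esub> x"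
    if "x \<in> carrier ?A" for x
  proof (rule X.Phi_inject)
    have x: "x \<in> carrier (opos (triple a c) p)" using that by simp
    note F = fmap[OF x] and G = fmap'[OF fmap(1)[OF x]]
    note DH = L.d_closed[OF hmap(1)[OF x], unfolded p2] L.Phi_d[OF hmap(1)[OF x], unfolded p2]
    note HD = hmap[OF L.d_closed[OF x], unfolded p2]
    have c: "?d (p + 2) (hmap a c p x) \<in> carrier ?A" "hmap a c (p - 2) (?d p x) \<in> carrier ?A" "x \<in> carrier ?A"
      using DH(1) HD(1) x by simp_all
    then show "(?d (p + 2) (hmap a c p x) \<oplus>\<^bsub>?A\<^esub> hmap a c (p - 2) (?d p x)) \<oplus>\<^bsub>?A\<^esub> x \<in> carrier ?A"
      by (intro X.a_closed)
    show "fmap c a p (fmap a c p x) \<in> carrier ?A" using G(1) by simp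
    show "Phi5 a c p (fmap c a p (fmap a c p x)) = Phi5 a c p ((?d (p + 2) (hmap a c p x) \<oplus>\<^bsub>?A\<^esub> hmap a c (p - 2) (?d p x)) \<oplus>\<^bsub>?A\<^esub> x)"
      unfolding X.Phi_add[OF X.a_closed[OF c(1,2)] c(3)] X.Phi_add[OF c(1,2)] G(2) F(2) DH(2) hmap(2)[OF x] HD(2) L.Phi_d[OF x]
      by (rule ext) (simp add: Fmap_Hmap[OF ac(1) ac2(1,2)])
  qed
  have 1: "loc_eq (D_unfilt 3) ?A ?A (Cmp (Gen ?B (fmap c a p) ?A) (Gen ?A (fmap a c p) ?B)) (Gen ?A (\<lambda>x. fmap c a p (fmap a c p x)) ?A)"
    by (rule gen_cmp[OF f g refl])
  have 2: "loc_eq (D_unfilt 3) ?A ?A (Cmp (Gen (T (p + 2)) (?d (p + 2)) ?A) (Gen ?A (hmap a c p) (T (p + 2)))) (Gen ?A (\<lambda>x. ?d (p + 2) (hmap a c p x)) ?A)"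
    by (rule gen_cmp[OF h d refl])
  have 3: "loc_eq (D_unfilt 3) ?A ?A (Cmp (Gen ?E (hmap a c (p - 2)) ?A) (Gen ?A (?d p) ?E)) (Gen ?A (\<lambda>x. hmap a c (p - 2) (?d p x)) ?A)"
    by (rule gen_cmp[OF d2 h2 refl])
  have n: "loc_eq (D_unfilt 3) ?A ?A (Neg (Gen ?A (\<lambda>x. x) ?A)) (Neg (Gen ?A (\<lambda>x. x) ?A))"
    by (rule le_Neg[OF le_refl[OF gen_hom[OF i]]])
  have 4: "loc_eq (D_unfilt 3) ?A ?A
      (Add (Gen ?A (\<lambda>x. fmap c a p (fmap a c p x)) ?A) (Neg (Gen ?A (\<lambda>x. x) ?A)))
      (Add (Gen ?A (\<lambda>x. ?d (p + 2) (hmap a c p x)) ?A) (Gen ?A (\<lambda>x. hmap a c (p - 2) (?d p x)) ?A))"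
    by (rule gen_diff[OF gmor_comp[OF f g] i gmor_comp[OF h d] gmor_comp[OF d2 h2] eq])
  have "loc_eq (D_unfilt 3) ?A ?A
      (Add (Cmp (Gen ?B (fmap c a p) ?A) (Gen ?A (fmap a c p) ?B)) (Neg (Gen ?A (\<lambda>x. x) ?A)))
      (Add (Cmp (Gen (T (p + 2)) (?d (p + 2)) ?A) (Gen ?A (hmap a c p) (T (p + 2)))) (Cmp (Gen ?E (hmap a c (p - 2)) ?A) (Gen ?A (?d p) ?E)))"
    by (rule le_trans[OF le_Add[OF 1 n] le_trans[OF 4 le_sym[OF le_Add[OF 2 3]]]])
  then show "loc_eq (D_unfilt 3) ?A ?A
      (Add (ashift_mor (Cmp (gloc p) (floc p))) (Neg (ashift_mor (id_mor (T p)))))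
      (Add (Cmp (Gen (T (p + 2)) (?d (p + 2)) (ashift 1 (T (p + 2 - 2)))) (Gen ?A (hmap a c p) (T (p + 2))))
        (Cmp (ashift_mor (Gen (ashift 1 (T (p - 2))) (hmap a c (p - 2)) (T (p - 2 + 2)))) (ashift_mor (Gen (T p) (?d p) (ashift 1 (T (p - 2)))))))"
    by (simp add: ashift_mor_def id_mor_def)
qed

section \<open>Effect of the map on the filtration\<close>

lemma filt_fmap:
  assumes x: "x \<in> filt (opos (triple a c) p) j"
  shows "fmap a c p x \<in> filt (opos (triple c a) p) (j - 4)"
proof -
  note fL = filt_SSS[OF ac(2,3)] and fR = filt_SSS[OF ac(3,2)]
  have xc: "x \<in> carrier (opos (triple a c) p)" using x ffilt_sub(1)[OF fL(1)] by blast
  note F = fmap[OF xc]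
  have zero: "fmap a c p \<zero>\<^bsub>opos (triple a c) p\<^esub> \<in> filt (opos (triple c a) p) (j - 4)"
  proof -
    have "fmap a c p \<zero>\<^bsub>opos (triple a c) p\<^esub> = \<zero>\<^bsub>opos (triple c a) p\<^esub>"
    proof (rule R.X.Phi_inject)
      have "Fmap a c 0 = 0"
      proof
        show "Fmap a c 0 k = 0 k" for k by (rule trits3_cases[where k=k], elim insertE emptyE; simp)
      qed
      then show "Phi5 c a p (fmap a c p \<zero>\<^bsub>opos (triple a c) p\<^esub>) = Phi5 c a p \<zero>\<^bsub>opos (triple c a) p\<^esub>"
        by (simp add: fmap)
    qed (auto simp: fmap)
    then show ?thesis using ffilt_sub(2)[OF fR(1)] by simp
  qed
  \<comment> \<open>Indices are doubled, so two units are 4. For \<open>j \<le> 1\<close> the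
    required target step is everything; from 2 on, or from 4 on in the top position, the source step
    is zero. There remain the indices 2 and 3 in the top position.\<close>
  consider "j \<le> 1" | "j \<ge> 2" "p \<noteq> 3" | "j \<ge> 4" "p = 3" | "2 \<le> j" "j \<le> 3" "p = 3" by linarith
  then show ?thesis
  proof cases
    case 1
    then have "filt (opos (triple c a) p) (- 3) \<subseteq> filt (opos (triple c a) p) (j - 4)" by (intro ffiltD(2)[OF fR(1)]) simp
    then show ?thesis using F(1) ffiltD(3)[OF fR(1)] by blast
  next
    case 2
    then have "x = \<zero>\<^bsub>opos (triple a c) p\<^esub>" using x ffiltD(2)[OF fL(1), of 2 j p] ffiltD(4)[OF fL(1), of p] by auto
    then show ?thesis using zero by simp
  next
    case 3
    then have "x = \<zero>\<^bsub>opos (triple a c) p\<^esub>" using x ffiltD(2)[OF fL(1), of 4 j p] ffiltD(4)[OF fL(1), of p] by auto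
    then show ?thesis using zero by simp
  next
    case 4
    have x2: "x \<in> filt (opos (triple a c) 3) 2" using x 4 ffiltD(2)[OF fL(1), of 2 j p] by auto
    have xc3: "x \<in> carrier (opos (triple a c) 3)" using xc 4 by simp
    define v where "v = Phi5 a c 3 x" define w where "w = Fmap a c v"
    have Yv: "YSSS a c i v = (\<lambda>k. xv (swp a (swp c (swp a i))) * v k)" if i: "i \<in> {1..3}" for i
    proof -
      have s: "swp a (swp c (swp a i)) \<in> {1..3}" using i by (intro swp_range ac)
      have "yv i \<odot>\<^bsub>opos (triple a c) 3\<^esub> x = xv (swp a (swp c (swp a i))) \<odot>\<^bsub>opos (triple a c) 3\<^esub> x"
        using fL(2) x2 i by (simp add: twist_def)
      then show ?thesis using L.Phi_Y[OF i xc3] L.X.Phi_smult[OF _ xc3, of "xv (swp a (swp c (swp a i)))"] s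
        by (simp add: v_def)
    qed
    have Yw: "YSSS c a i w = (\<lambda>k. xv (swp a (swp c (swp a i))) * w k)" if i: "i \<in> {1..3}" for i
      using cmor_F[OF ac, of 3] i Yv[OF i] unfolding cmor_def w_def by (metis (no_types))
    \<comment> \<open>The longest permutation exchanges the outer strands, so y_a acts on
      \<open>w\<close> as x_c and y_c as x_a.\<close>
    have sw: "swp a (swp c (swp a a)) = c" "swp a (swp c (swp a c)) = a" using ac by (auto simp: swp_def)
    have w: "w \<in> vecs 3 {k. pos3 k = 3}"
      using cmor_F[OF ac, of 3] L.X.Phi_vecs[OF xc3] by (simp add: cmor_def w_def v_def)
    \<comment> \<open>The division takes place in the target, where the first crossing has outer
      strand \<open>c\<close>. So \<open>a\<close> and \<open>c\<close> trade places in
      \<open>wdiv\<close>, and the divisor is y_c - x_c.\<close>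
    define u where "u = wdiv c a (w ((B1, B1), B1))"
    have u: "u \<in> vecs 3 {k. pos3 k = 3}"
      using vecs_RX[OF w, of "((B1, B1), B1)"] ac2 by (auto simp: vecs_def u_def wdiv_def pos3_def pos2_def tpos_def)
    let ?y = "R.X.\<Psi> 3 u"
    have y: "?y \<in> carrier (opos (triple c a) 3)" by (rule R.X.Psi_closed[OF u])
    have e: "(yv c - xv c) \<in> PR (XY 3)" "xv c \<in> PR (XY 3)" "yv c \<in> PR (XY 3)" "xv c \<in> RX 3" using ac2 by auto
    have ye: "(yv c - xv c) \<odot>\<^bsub>opos (triple c a) 3\<^esub> ?y \<in> carrier (opos (triple c a) 3)" using e y R.X.smult_closed by simp
    have "fmap a c 3 x = (yv c - xv c) \<odot>\<^bsub>opos (triple c a) 3\<^esub> ?y"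
    proof (rule R.X.Phi_inject[OF fmap(1)[OF xc3] ye])
      have "yv c \<odot>\<^bsub>opos (triple c a) 3\<^esub> ?y = (yv c - xv c) \<odot>\<^bsub>opos (triple c a) 3\<^esub> ?y \<oplus>\<^bsub>opos (triple c a) 3\<^esub> xv c \<odot>\<^bsub>opos (triple c a) 3\<^esub> ?y"
        using R.X.smult_l_distr[of "yv c - xv c" "xv c" ?y 3] e y by simp
      then have E1: "YSSS c a c u = Phi5 c a 3 ((yv c - xv c) \<odot>\<^bsub>opos (triple c a) 3\<^esub> ?y) + (\<lambda>k. xv c * u k)"
        using R.Phi_Y[OF ac2(4) y] R.X.Phi_add[OF ye R.X.smult_closed[of "xv c" ?y 3]] R.X.Phi_smult[OF e(4) y] e y R.X.Phi_Psi[OF u] by simp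
      have E2: "YSSS c a c u k - xv c * u k = w k" for k
        unfolding u_def
        by (rule wdiv) (use ac ac2 Yw[OF ac2(4)] Yw[OF ac2(3)] sw vecs_off[OF w] in auto)
      have "Phi5 c a 3 ((yv c - xv c) \<odot>\<^bsub>opos (triple c a) 3\<^esub> ?y) k = w k" for k
        using E2[of k] unfolding E1 by simp
      then show "Phi5 c a 3 (fmap a c 3 x) = Phi5 c a 3 ((yv c - xv c) \<odot>\<^bsub>opos (triple c a) 3\<^esub> ?y)"
        unfolding fmap(2)[OF xc3] v_def[symmetric] w_def[symmetric] by auto
    qed
    moreover have "(yv c - xv c) \<odot>\<^bsub>opos (triple c a) 3\<^esub> ?y \<in> filt (opos (triple c a) 3) (- 1)"
      using fR(3) y ac2 by (simp add: neard_def)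
    moreover have "filt (opos (triple c a) 3) (- 1) \<subseteq> filt (opos (triple c a) 3) (j - 4)"
      using 4 by (intro ffiltD(2)[OF fR(1)]) simp
    ultimately show ?thesis using 4 by auto
  qed
qed


end

lemma shalf_sel: "filt (shalf j A) = (\<lambda>i. filt A (i - j))" "carrier (shalf j A) = carrier A" "zero (shalf j A) = zero A"
    "bd (shalf j A) = bd A" "add (shalf j A) = add A" "smult (shalf j A) = smult A"
  by (simp_all add: shalf_def)

lemma hom_dec_shalf: "hom_dec (shalf j A) = hom_dec A"
  by (simp add: fun_eq_iff hom_dec_def shalf_def finsum_def)

lemma submodule_shalf: "submodule H R (shalf j A) = submodule H R A"
  by (simp add: submodule_def submodule_axioms_def shalf_def)

lemma ffilt_shalf: "ffilt n A lo hi \<Longrightarrow> ffilt n (shalf j A) (lo + j) (hi + j)"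
  by (simp add: ffilt_def shalf_sel hom_dec_shalf submodule_shalf)

lemma (in xfilt) fobj:
  assumes f: "ffilt n A lo hi" shows "fobj n A"
proof -
  have "bd A x \<in> filt A j" if x: "x \<in> filt A j" for x j
  proof -
    have "x \<in> carrier A" using x ffilt_sub(1)[OF f] by blast
    then show ?thesis using ffilt_sub(2)[OF f] by (simp add: bd_zero)
  qed
  then show ?thesis
    unfolding fobj_def xyring_eq using f gobj by (auto simp only: ffilt_def)
qed

text \<open>The underlying map itself is a filtered morphism into the target with its filtration
  shifted by two units, which is \<open>shalf 4\<close>; truncation removes the shift and returns
  \<open>floc\<close>.\<close>

lemma (in word) violates_floc: "chain_map_violates_filt_by 3 2 (dcx_of (triple a c)) (dcx_of (triple c a)) floc"
  unfolding chain_map_violates_filt_by_def violates_filt_by_def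
proof (intro allI exI conjI)
  fix p
  let ?A = "opos (triple a c) p" and ?B = "shalf 4 (opos (triple c a) p)"
  have "gmor 3 ?A ?B (fmap a c p)"
    by (rule gmor_f[OF L.obj_opos R.obj_shalf[OF R.obj_opos]])
  then have "fmor 3 ?A ?B (fmap a c p)"
    using xfilt.fobj[OF xfilt.intro[OF L.xfree] filt_SSS(1)[OF ac(2,3)]]
      xfilt.fobj[OF xfilt.intro[OF xfree_shalf[OF R.xfree]] ffilt_shalf[OF filt_SSS(1)[OF ac(3,2)]]] filt_fmap
    by (auto simp: fmor_def shalf_sel)
  then show "loc_hom (D_filt 3) (dobj (dcx_of (triple a c)) p) (shalf (2 * 2) (dobj (dcx_of (triple c a)) p)) (Gen ?A (fmap a c p) ?B)"
    by (auto simp: dcx_of_def D_filt_def intro!: loc_hom.intros(1))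
  show "loc_eq (D_unfilt 3) (gcx.truncate (dobj (dcx_of (triple a c)) p)) (gcx.truncate (dobj (dcx_of (triple c a)) p))
      (forget_mor (Gen ?A (fmap a c p) ?B)) (floc p)"
    using le_refl[OF gen_hom[OF gmor_f[OF objs(1) objs'(1)]]] by (simp add: dcx_of_def forget_mor_def)
qed

theorem theorem5p1:
  fixes L R :: "(int \<Rightarrow>
    ((int \<Rightarrow> ((mpol set \<times> mpol set \<Rightarrow>\<^sub>0 int) set \<times> (mpol set \<times> mpol set \<Rightarrow>\<^sub>0 int) set \<Rightarrow>\<^sub>0 int) set)
      \<times> (mpol set \<times> mpol set \<Rightarrow>\<^sub>0 int) set \<Rightarrow>\<^sub>0 int) set) ocx"
  defines "L \<equiv> ocx_comp 3 (ocx_comp 3 sigma1_minus sigma2_minus) sigma1_minus"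
    and "R \<equiv> ocx_comp 3 (ocx_comp 3 sigma2_minus sigma1_minus) sigma2_minus"
  shows "\<exists>f_lr f_rl.
    homotopy_equiv (D_unfilt 3) (forget_dcx (dcx_of L)) (forget_dcx (dcx_of R)) f_lr f_rl \<and>
    chain_map_violates_filt_by 3 2 (dcx_of L) (dcx_of R) f_lr \<and>
    chain_map_violates_filt_by 3 2 (dcx_of R) (dcx_of L) f_rl"
proof -
  have LR: "L = triple 1 3" "R = triple 3 1" by (simp_all add: L_def R_def sgm_def)
  \<comment> \<open>The word with the two outer strands exchanged supplies the homotopy
    inverse.\<close>
  interpret A: word 1 3 by (rule word.intro) simp_all
  interpret B: word 3 1 by (rule word.intro) simp_all
  have "homotopy_equiv (D_unfilt 3) (forget_dcx (dcx_of L)) (forget_dcx (dcx_of R)) A.floc B.floc"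
    unfolding homotopy_equiv_def LR
    by (intro conjI A.is_dcx B.is_dcx A.chain_map_floc B.chain_map_floc A.homotopic_gf B.homotopic_gf)
  then show ?thesis unfolding LR using A.violates_floc B.violates_floc by blast
qed

end
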